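(* A finite multitensor category $\mathcal C$ is symmetric Frobenius if and only if it is unimodular and the double dual functor on $\mathcal C$ is naturally isomorphic, as a linear functor, to the identity functor.
   Context: $\Bbbk$ is an algebraically closed field; all categories and functors are $\Bbbk$-linear. A finite linear category is one equivalent to the category of finite-dimensional modules over a finite-dimensional $\Bbbk$-algebra. A finite multitensor category is a finite linear category that is rigid monoidal with bilinear tensor product (no condition $\mathrm{End}(\mathbf 1)\cong\Bbbk$ is imposed). The double dual functor is $c\mapsto c^{\vee\vee}$, with $c^\vee$ the right dual (coming with $c^\vee\otimes c\to\mathbf 1$ and $\mathbf 1\to c\otimes c^\vee$). A finite linear category is called symmetric Frobenius if it is equivalent as a linear category to the category of finite-dimensional modules over a finite-dimensional symmetric Frobenius $\Bbbk$-algebra. $\mathcal C$ is called unimodular if its distinguished object $D_{\mathcal C}=\int_{c\in\mathcal C}\mathrm{Hom}_{\mathcal C}(c,\mathbf 1)\otimes c$ (an end in $\mathcal C$, where $v\otimes c$ is the canonical action of finite-dimensional vector spaces on $\mathcal C$) is isomorphic to the monoidal unit $\mathbf 1$. *)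

theory Defs
  imports
    "Jordan_Normal_Form.VS_Connect"
begin

section \<open>Linear categories\<close>

text \<open>
  The ground field is a type \<open>'k\<close>, and \<open>class_ring :: 'k ring\<close> is that field as a record; vector
  spaces over it are \<open>('k, 'v) module\<close> records satisfying \<open>vectorspace class_ring\<close>.
  In a \<open>linear_cat\<close>, \<open>g \<cdot> f\<close> means \<open>g\<close> after \<open>f\<close>; addition, zero and scalars of morphisms are
  those of the hom-spaces.
\<close>

record ('k, 'o, 'm) linear_cat =
  Obj :: "'o set"
  Arr :: "'m set"
  Dom :: "'m \<Rightarrow> 'o"
  Cod :: "'m \<Rightarrow> 'o"
  Id :: "'o \<Rightarrow> 'm"
  Comp :: "'m \<Rightarrow> 'm \<Rightarrow> 'm"  (infixl \<open>\<cdot>\<index>\<close> 55)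
  ZeroArr :: "'o \<Rightarrow> 'o \<Rightarrow> 'm"
  AddArr :: "'m \<Rightarrow> 'm \<Rightarrow> 'm"
  ScaleArr :: "'k \<Rightarrow> 'm \<Rightarrow> 'm"

definition Hom :: "('k, 'o, 'm, 'x) linear_cat_scheme \<Rightarrow> 'o \<Rightarrow> 'o \<Rightarrow> 'm set" where
  "Hom C a b = {f \<in> Arr C. Dom C f = a \<and> Cod C f = b}"

text \<open>The ring operations \<open>mult\<close> and \<open>one\<close> of the record are irrelevant for a vector space.\<close>

definition hom_space :: "('k, 'o, 'm, 'x) linear_cat_scheme \<Rightarrow> 'o \<Rightarrow> 'o \<Rightarrow> ('k, 'm) module" where
  "hom_space C a b =
     \<lparr>carrier = Hom C a b, mult = undefined, one = undefined,
      zero = ZeroArr C a b, add = AddArr C, smult = ScaleArr C\<rparr>"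

locale linear_category =
  fixes C :: "('k::field, 'o, 'm, 'x) linear_cat_scheme" (structure)
  assumes dom_closed: "f \<in> Arr C \<Longrightarrow> Dom C f \<in> Obj C"
    and cod_closed: "f \<in> Arr C \<Longrightarrow> Cod C f \<in> Obj C"
    and id_in_hom: "a \<in> Obj C \<Longrightarrow> Id C a \<in> Hom C a a"
    and comp_in_hom: "\<lbrakk>f \<in> Hom C a b; g \<in> Hom C b c\<rbrakk> \<Longrightarrow> g \<cdot> f \<in> Hom C a c"
    and comp_id_right: "f \<in> Hom C a b \<Longrightarrow> f \<cdot> Id C a = f"
    and comp_id_left: "f \<in> Hom C a b \<Longrightarrow> Id C b \<cdot> f = f"
    and comp_assoc:
      "\<lbrakk>f \<in> Hom C a b; g \<in> Hom C b c; h \<in> Hom C c d\<rbrakk> \<Longrightarrow> (h \<cdot> g) \<cdot> f = h \<cdot> (g \<cdot> f)"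
    and hom_vectorspace:
      "\<lbrakk>a \<in> Obj C; b \<in> Obj C\<rbrakk> \<Longrightarrow> vectorspace (class_ring :: 'k ring) (hom_space C a b)"
    and comp_linear_left:
      "\<lbrakk>f \<in> Hom C a b; c \<in> Obj C\<rbrakk> \<Longrightarrow>
         linear_map (class_ring :: 'k ring) (hom_space C b c) (hom_space C a c) (\<lambda>g. g \<cdot> f)"
    and comp_linear_right:
      "\<lbrakk>g \<in> Hom C b c; a \<in> Obj C\<rbrakk> \<Longrightarrow>
         linear_map (class_ring :: 'k ring) (hom_space C a b) (hom_space C a c) (\<lambda>f. g \<cdot> f)"

definition inverse_arrows :: "('k, 'o, 'm, 'x) linear_cat_scheme \<Rightarrow> 'm \<Rightarrow> 'm \<Rightarrow> bool" where
  "inverse_arrows C f g \<longleftrightarrow>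
     f \<in> Arr C \<and> g \<in> Hom C (Cod C f) (Dom C f) \<and>
     g \<cdot>\<^bsub>C\<^esub> f = Id C (Dom C f) \<and> f \<cdot>\<^bsub>C\<^esub> g = Id C (Cod C f)"

definition iso_arr :: "('k, 'o, 'm, 'x) linear_cat_scheme \<Rightarrow> 'm \<Rightarrow> bool" where
  "iso_arr C f \<longleftrightarrow> (\<exists>g. inverse_arrows C f g)"

definition inv_arr :: "('k, 'o, 'm, 'x) linear_cat_scheme \<Rightarrow> 'm \<Rightarrow> 'm" where
  "inv_arr C f = (THE g. inverse_arrows C f g)"

definition isomorphic :: "('k, 'o, 'm, 'x) linear_cat_scheme \<Rightarrow> 'o \<Rightarrow> 'o \<Rightarrow> bool" where
  "isomorphic C a b \<longleftrightarrow> (\<exists>f \<in> Hom C a b. iso_arr C f)"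


section \<open>Linear functors and equivalences\<close>

record ('o, 'm, 'p, 'n) functor_data =
  FObj :: "'o \<Rightarrow> 'p"
  FArr :: "'m \<Rightarrow> 'n"

locale linear_functor =
  C: linear_category C + D: linear_category D
  for C :: "('k::field, 'o, 'm, 'x) linear_cat_scheme"
    and D :: "('k, 'p, 'n, 'y) linear_cat_scheme"
    and F :: "('o, 'm, 'p, 'n) functor_data" +
  assumes obj_closed: "a \<in> Obj C \<Longrightarrow> FObj F a \<in> Obj D"
    and preserves_id: "a \<in> Obj C \<Longrightarrow> FArr F (Id C a) = Id D (FObj F a)"
    and preserves_comp:
      "\<lbrakk>f \<in> Hom C a b; g \<in> Hom C b c\<rbrakk> \<Longrightarrow>
         FArr F (g \<cdot>\<^bsub>C\<^esub> f) = FArr F g \<cdot>\<^bsub>D\<^esub> FArr F f"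
    and linear_on_homs:
      "\<lbrakk>a \<in> Obj C; b \<in> Obj C\<rbrakk> \<Longrightarrow>
         linear_map (class_ring :: 'k ring) (hom_space C a b) (hom_space D (FObj F a) (FObj F b))
           (FArr F)"

definition id_functor :: "('o, 'm, 'o, 'm) functor_data" where
  "id_functor = \<lparr>FObj = (\<lambda>a. a), FArr = (\<lambda>f. f)\<rparr>"

definition comp_functor ::
  "('p, 'n, 'q, 'l) functor_data \<Rightarrow> ('o, 'm, 'p, 'n) functor_data \<Rightarrow> ('o, 'm, 'q, 'l) functor_data"
where
  "comp_functor G F = \<lparr>FObj = FObj G \<circ> FObj F, FArr = FArr G \<circ> FArr F\<rparr>"

definition naturally_isomorphic ::
  "('k, 'o, 'm, 'x) linear_cat_scheme \<Rightarrow> ('k, 'p, 'n, 'y) linear_cat_scheme \<Rightarrow>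
   ('o, 'm, 'p, 'n) functor_data \<Rightarrow> ('o, 'm, 'p, 'n) functor_data \<Rightarrow> bool"
where
  "naturally_isomorphic C D F G \<longleftrightarrow>
     (\<exists>\<eta>. (\<forall>a \<in> Obj C. \<eta> a \<in> Hom D (FObj F a) (FObj G a) \<and> iso_arr D (\<eta> a)) \<and>
          (\<forall>a \<in> Obj C. \<forall>b \<in> Obj C. \<forall>f \<in> Hom C a b.
             FArr G f \<cdot>\<^bsub>D\<^esub> \<eta> a = \<eta> b \<cdot>\<^bsub>D\<^esub> FArr F f))"

definition linearly_equivalent ::
  "('k::field, 'o, 'm, 'x) linear_cat_scheme \<Rightarrow> ('k, 'p, 'n, 'y) linear_cat_scheme \<Rightarrow> bool"
where
  "linearly_equivalent C D \<longleftrightarrow>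
     (\<exists>F G. linear_functor C D F \<and> linear_functor D C G \<and>
            naturally_isomorphic C C (comp_functor G F) id_functor \<and>
            naturally_isomorphic D D (comp_functor F G) id_functor)"


section \<open>Finite-dimensional algebras and their modules\<close>

text \<open>
  A \<open>('k, 'a) module\<close> record carries both a ring structure and a scalar multiplication, i.e. the
  data of a \<open>'k\<close>-algebra.  (The library locale \<open>algebra\<close> is for commutative algebras
  only, and its \<open>module\<close> is for commutative base rings only.)
\<close>

definition fd_algebra :: "('k::field, 'a) module \<Rightarrow> bool" where
  "fd_algebra A \<longleftrightarrow>
     ring A \<and> vectorspace (class_ring :: 'k ring) A \<and>
     vectorspace.fin_dim (class_ring :: 'k ring) A \<and>
     (\<forall>c. \<forall>x \<in> carrier A. \<forall>y \<in> carrier A.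
        (c \<odot>\<^bsub>A\<^esub> x) \<otimes>\<^bsub>A\<^esub> y = c \<odot>\<^bsub>A\<^esub> (x \<otimes>\<^bsub>A\<^esub> y) \<and>
        x \<otimes>\<^bsub>A\<^esub> (c \<odot>\<^bsub>A\<^esub> y) = c \<odot>\<^bsub>A\<^esub> (x \<otimes>\<^bsub>A\<^esub> y))"

definition symmetric_frobenius_algebra :: "('k::field, 'a) module \<Rightarrow> bool" where
  "symmetric_frobenius_algebra A \<longleftrightarrow>
     fd_algebra A \<and>
     (\<exists>t :: 'a \<Rightarrow> 'k.
        (\<forall>x \<in> carrier A. \<forall>y \<in> carrier A. t (x \<oplus>\<^bsub>A\<^esub> y) = t x + t y) \<and>
        (\<forall>c. \<forall>x \<in> carrier A. t (c \<odot>\<^bsub>A\<^esub> x) = c * t x) \<and>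
        (\<forall>x \<in> carrier A. \<forall>y \<in> carrier A. t (x \<otimes>\<^bsub>A\<^esub> y) = t (y \<otimes>\<^bsub>A\<^esub> x)) \<and>
        (\<forall>x \<in> carrier A. (\<forall>y \<in> carrier A. t (x \<otimes>\<^bsub>A\<^esub> y) = 0) \<longrightarrow> x = \<zero>\<^bsub>A\<^esub>))"

locale left_module = R?: ring R + M?: abelian_group M
  for R :: "('a, 'r) ring_scheme" (structure) and M :: "('a, 'v, 'm) module_scheme" (structure) +
  assumes smult_closed: "\<lbrakk>r \<in> carrier R; x \<in> carrier M\<rbrakk> \<Longrightarrow> r \<odot>\<^bsub>M\<^esub> x \<in> carrier M"
    and smult_l_distr:
      "\<lbrakk>r \<in> carrier R; s \<in> carrier R; x \<in> carrier M\<rbrakk> \<Longrightarrow>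
         (r \<oplus> s) \<odot>\<^bsub>M\<^esub> x = r \<odot>\<^bsub>M\<^esub> x \<oplus>\<^bsub>M\<^esub> s \<odot>\<^bsub>M\<^esub> x"
    and smult_r_distr:
      "\<lbrakk>r \<in> carrier R; x \<in> carrier M; y \<in> carrier M\<rbrakk> \<Longrightarrow>
         r \<odot>\<^bsub>M\<^esub> (x \<oplus>\<^bsub>M\<^esub> y) = r \<odot>\<^bsub>M\<^esub> x \<oplus>\<^bsub>M\<^esub> r \<odot>\<^bsub>M\<^esub> y"
    and smult_assoc:
      "\<lbrakk>r \<in> carrier R; s \<in> carrier R; x \<in> carrier M\<rbrakk> \<Longrightarrow>
         (r \<otimes> s) \<odot>\<^bsub>M\<^esub> x = r \<odot>\<^bsub>M\<^esub> (s \<odot>\<^bsub>M\<^esub> x)"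
    and smult_one: "x \<in> carrier M \<Longrightarrow> \<one> \<odot>\<^bsub>M\<^esub> x = x"

text \<open>The vector space underlying an \<open>A\<close>-module: scalars act through \<open>c \<mapsto> c 1\<^sub>A\<close>.\<close>

definition underlying_space :: "('k, 'a) module \<Rightarrow> ('a, 'v) module \<Rightarrow> ('k, 'v) module" where
  "underlying_space A M =
     \<lparr>carrier = carrier M, mult = mult M, one = one M, zero = zero M, add = add M,
      smult = (\<lambda>c x. (c \<odot>\<^bsub>A\<^esub> \<one>\<^bsub>A\<^esub>) \<odot>\<^bsub>M\<^esub> x)\<rparr>"

text \<open>
  The linear category of finite-dimensional left \<open>A\<close>-modules whose elements lie in \<open>'v\<close>.  A morphism
  is a triple of source, \<open>A\<close>-linear map (made \<open>undefined\<close> outside the source) and target.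
\<close>

definition fd_module_cat ::
  "('k::field, 'a) module \<Rightarrow>
   ('k, ('a, 'v) module, ('a, 'v) module \<times> ('v \<Rightarrow> 'v) \<times> ('a, 'v) module) linear_cat"
where
  "fd_module_cat A =
     (let Ob = {M. left_module A M \<and>
                   vectorspace.fin_dim (class_ring :: 'k ring) (underlying_space A M)}
      in \<lparr>Obj = Ob,
          Arr = {(M, f, N). M \<in> Ob \<and> N \<in> Ob \<and>
                   f \<in> LinearCombinations.module_hom A M N \<and> f \<in> extensional (carrier M)},
          Dom = (\<lambda>(M, f, N). M),
          Cod = (\<lambda>(M, f, N). N),
          Id = (\<lambda>M. (M, \<lambda>x \<in> carrier M. x, M)),
          Comp = (\<lambda>(M', g, N) (L, f, M). (L, compose (carrier L) g f, N)),
          ZeroArr = (\<lambda>M N. (M, \<lambda>x \<in> carrier M. \<zero>\<^bsub>N\<^esub>, N)),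
          AddArr = (\<lambda>(M, f, N) (M', g, N'). (M, \<lambda>x \<in> carrier M. f x \<oplus>\<^bsub>N\<^esub> g x, N)),
          ScaleArr =
            (\<lambda>c (M, f, N). (M, \<lambda>x \<in> carrier M. c \<odot>\<^bsub>underlying_space A N\<^esub> f x, N))\<rparr>)"

text \<open>
  \<open>'k vec\<close>, the type of vectors of all finite lengths, serves as a universe for the elements of
  algebras and modules.  Carriers and operations are otherwise arbitrary, and as every
  finite-dimensional vector space is isomorphic to some \<open>carrier_vec n\<close>, every finite-dimensional
  algebra and every finite-dimensional module has an isomorphic copy in this universe.
\<close>

abbreviation fd_modules ::
  "('k::field, 'k vec) module \<Rightarrow>
   ('k, ('k vec, 'k vec) module,
    ('k vec, 'k vec) module \<times> ('k vec \<Rightarrow> 'k vec) \<times> ('k vec, 'k vec) module) linear_cat"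
where
  "fd_modules \<equiv> fd_module_cat"

definition finite_linear_category :: "('k::field, 'o, 'm, 'x) linear_cat_scheme \<Rightarrow> bool" where
  "finite_linear_category C \<longleftrightarrow>
     linear_category C \<and> (\<exists>A. fd_algebra A \<and> linearly_equivalent C (fd_modules A))"

definition symmetric_frobenius_category :: "('k::field, 'o, 'm, 'x) linear_cat_scheme \<Rightarrow> bool"
where
  "symmetric_frobenius_category C \<longleftrightarrow>
     linear_category C \<and>
     (\<exists>A. symmetric_frobenius_algebra A \<and> linearly_equivalent C (fd_modules A))"


section \<open>Linear monoidal categories and duals\<close>

record ('k, 'o, 'm) monoidal_cat = "('k, 'o, 'm) linear_cat" +
  TObj :: "'o \<Rightarrow> 'o \<Rightarrow> 'o"  (infixr \<open>\<otimes>\<^sub>o\<index>\<close> 70)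
  TArr :: "'m \<Rightarrow> 'm \<Rightarrow> 'm"  (infixr \<open>\<otimes>\<^sub>a\<index>\<close> 70)
  Unit :: 'o
  Assoc :: "'o \<Rightarrow> 'o \<Rightarrow> 'o \<Rightarrow> 'm"
  LUnit :: "'o \<Rightarrow> 'm"
  RUnit :: "'o \<Rightarrow> 'm"

locale linear_monoidal_category = linear_category C
  for C :: "('k::field, 'o, 'm, 'x) monoidal_cat_scheme" (structure) +
  assumes tensor_obj: "\<lbrakk>a \<in> Obj C; b \<in> Obj C\<rbrakk> \<Longrightarrow> a \<otimes>\<^sub>o b \<in> Obj C"
    and unit_obj: "Unit C \<in> Obj C"
    and tensor_arr:
      "\<lbrakk>f \<in> Hom C a b; g \<in> Hom C c d\<rbrakk> \<Longrightarrow> f \<otimes>\<^sub>a g \<in> Hom C (a \<otimes>\<^sub>o c) (b \<otimes>\<^sub>o d)"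
    and tensor_id: "\<lbrakk>a \<in> Obj C; b \<in> Obj C\<rbrakk> \<Longrightarrow> Id C a \<otimes>\<^sub>a Id C b = Id C (a \<otimes>\<^sub>o b)"
    and tensor_comp:
      "\<lbrakk>f \<in> Hom C a b; f' \<in> Hom C b c; g \<in> Hom C a' b'; g' \<in> Hom C b' c'\<rbrakk> \<Longrightarrow>
         (f' \<cdot> f) \<otimes>\<^sub>a (g' \<cdot> g) = (f' \<otimes>\<^sub>a g') \<cdot> (f \<otimes>\<^sub>a g)"
    and tensor_linear_left:
      "\<lbrakk>a \<in> Obj C; b \<in> Obj C; g \<in> Hom C c d\<rbrakk> \<Longrightarrow>
         linear_map (class_ring :: 'k ring) (hom_space C a b)
           (hom_space C (a \<otimes>\<^sub>o c) (b \<otimes>\<^sub>o d)) (\<lambda>f. f \<otimes>\<^sub>a g)"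
    and tensor_linear_right:
      "\<lbrakk>f \<in> Hom C a b; c \<in> Obj C; d \<in> Obj C\<rbrakk> \<Longrightarrow>
         linear_map (class_ring :: 'k ring) (hom_space C c d)
           (hom_space C (a \<otimes>\<^sub>o c) (b \<otimes>\<^sub>o d)) (\<lambda>g. f \<otimes>\<^sub>a g)"
    and assoc_iso:
      "\<lbrakk>a \<in> Obj C; b \<in> Obj C; c \<in> Obj C\<rbrakk> \<Longrightarrow>
         Assoc C a b c \<in> Hom C ((a \<otimes>\<^sub>o b) \<otimes>\<^sub>o c) (a \<otimes>\<^sub>o (b \<otimes>\<^sub>o c)) \<and> iso_arr C (Assoc C a b c)"
    and assoc_natural:
      "\<lbrakk>f \<in> Hom C a a'; g \<in> Hom C b b'; h \<in> Hom C c c'\<rbrakk> \<Longrightarrow>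
         Assoc C a' b' c' \<cdot> ((f \<otimes>\<^sub>a g) \<otimes>\<^sub>a h) = (f \<otimes>\<^sub>a (g \<otimes>\<^sub>a h)) \<cdot> Assoc C a b c"
    and lunit_iso:
      "a \<in> Obj C \<Longrightarrow> LUnit C a \<in> Hom C (Unit C \<otimes>\<^sub>o a) a \<and> iso_arr C (LUnit C a)"
    and lunit_natural:
      "f \<in> Hom C a b \<Longrightarrow> LUnit C b \<cdot> (Id C (Unit C) \<otimes>\<^sub>a f) = f \<cdot> LUnit C a"
    and runit_iso:
      "a \<in> Obj C \<Longrightarrow> RUnit C a \<in> Hom C (a \<otimes>\<^sub>o Unit C) a \<and> iso_arr C (RUnit C a)"
    and runit_natural:
      "f \<in> Hom C a b \<Longrightarrow> RUnit C b \<cdot> (f \<otimes>\<^sub>a Id C (Unit C)) = f \<cdot> RUnit C a"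
    and pentagon:
      "\<lbrakk>a \<in> Obj C; b \<in> Obj C; c \<in> Obj C; d \<in> Obj C\<rbrakk> \<Longrightarrow>
         (Id C a \<otimes>\<^sub>a Assoc C b c d) \<cdot> Assoc C a (b \<otimes>\<^sub>o c) d \<cdot> (Assoc C a b c \<otimes>\<^sub>a Id C d) =
         Assoc C a b (c \<otimes>\<^sub>o d) \<cdot> Assoc C (a \<otimes>\<^sub>o b) c d"
    and triangle:
      "\<lbrakk>a \<in> Obj C; b \<in> Obj C\<rbrakk> \<Longrightarrow>
         (Id C a \<otimes>\<^sub>a LUnit C b) \<cdot> Assoc C a (Unit C) b = RUnit C a \<otimes>\<^sub>a Id C b"

text \<open>
  \<open>d\<close> is a right dual of \<open>c\<close> via \<open>e : d \<otimes> c \<rightarrow> 1\<close> and \<open>k : 1 \<rightarrow> c \<otimes> d\<close>; equivalently, \<open>c\<close> is a left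
  dual of \<open>d\<close> via the same morphisms.  In the two snake identities the unit constraint at the source
  is moved to the right-hand side.
\<close>

definition is_right_dual ::
  "('k, 'o, 'm, 'x) monoidal_cat_scheme \<Rightarrow> 'o \<Rightarrow> 'o \<Rightarrow> 'm \<Rightarrow> 'm \<Rightarrow> bool"
where
  "is_right_dual C c d e k \<longleftrightarrow>
     c \<in> Obj C \<and> d \<in> Obj C \<and>
     e \<in> Hom C (d \<otimes>\<^sub>o\<^bsub>C\<^esub> c) (Unit C) \<and> k \<in> Hom C (Unit C) (c \<otimes>\<^sub>o\<^bsub>C\<^esub> d) \<and>
     RUnit C c \<cdot>\<^bsub>C\<^esub> (Id C c \<otimes>\<^sub>a\<^bsub>C\<^esub> e) \<cdot>\<^bsub>C\<^esub> Assoc C c d c \<cdot>\<^bsub>C\<^esub> (k \<otimes>\<^sub>a\<^bsub>C\<^esub> Id C c)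
       = LUnit C c \<and>
     LUnit C d \<cdot>\<^bsub>C\<^esub> (e \<otimes>\<^sub>a\<^bsub>C\<^esub> Id C d) \<cdot>\<^bsub>C\<^esub> inv_arr C (Assoc C d c d) \<cdot>\<^bsub>C\<^esub> (Id C d \<otimes>\<^sub>a\<^bsub>C\<^esub> k)
       = RUnit C d"

locale finite_multitensor_category = linear_monoidal_category C
  for C :: "('k::field, 'o, 'm, 'x) monoidal_cat_scheme" (structure) +
  assumes finite_linear: "finite_linear_category C"
    and has_right_duals: "c \<in> Obj C \<Longrightarrow> \<exists>d e k. is_right_dual C c d e k"
    and has_left_duals: "c \<in> Obj C \<Longrightarrow> \<exists>d e k. is_right_dual C d c e k"

text \<open>A choice of a right dual for every object, which makes \<open>c \<mapsto> c\<^sup>\<or>\<close> a (contravariant) functor.\<close>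

record ('o, 'm) duality =
  Dual :: "'o \<Rightarrow> 'o"
  Ev :: "'o \<Rightarrow> 'm"
  Coev :: "'o \<Rightarrow> 'm"

definition right_duality ::
  "('k, 'o, 'm, 'x) monoidal_cat_scheme \<Rightarrow> ('o, 'm) duality \<Rightarrow> bool"
where
  "right_duality C R \<longleftrightarrow> (\<forall>c \<in> Obj C. is_right_dual C c (Dual R c) (Ev R c) (Coev R c))"

text \<open>
  For \<open>f : c \<rightarrow> d\<close>, the composite \<open>d\<^sup>\<or> \<rightarrow> d\<^sup>\<or> 1 \<rightarrow> d\<^sup>\<or>(c c\<^sup>\<or>) \<rightarrow> d\<^sup>\<or>(d c\<^sup>\<or>) \<rightarrow> (d\<^sup>\<or> d) c\<^sup>\<or> \<rightarrow> 1 c\<^sup>\<or> \<rightarrow> c\<^sup>\<or>\<close>.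
\<close>

definition dual_arr ::
  "('k, 'o, 'm, 'x) monoidal_cat_scheme \<Rightarrow> ('o, 'm) duality \<Rightarrow> 'm \<Rightarrow> 'm"
where
  "dual_arr C R f =
     (let c = Dom C f; d = Cod C f; c' = Dual R c; d' = Dual R d in
        LUnit C c' \<cdot>\<^bsub>C\<^esub>
        (Ev R d \<otimes>\<^sub>a\<^bsub>C\<^esub> Id C c') \<cdot>\<^bsub>C\<^esub>
        inv_arr C (Assoc C d' d c') \<cdot>\<^bsub>C\<^esub>
        (Id C d' \<otimes>\<^sub>a\<^bsub>C\<^esub> (f \<otimes>\<^sub>a\<^bsub>C\<^esub> Id C c')) \<cdot>\<^bsub>C\<^esub>
        (Id C d' \<otimes>\<^sub>a\<^bsub>C\<^esub> Coev R c) \<cdot>\<^bsub>C\<^esub>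
        inv_arr C (RUnit C d'))"

definition double_dual ::
  "('k, 'o, 'm, 'x) monoidal_cat_scheme \<Rightarrow> ('o, 'm) duality \<Rightarrow> ('o, 'm, 'o, 'm) functor_data"
where
  "double_dual C R =
     \<lparr>FObj = (\<lambda>c. Dual R (Dual R c)), FArr = (\<lambda>f. dual_arr C R (dual_arr C R f))\<rparr>"


section \<open>The action of vector spaces, ends, and the distinguished object\<close>

text \<open>
  \<open>P\<close> together with the linear map \<open>\<iota> : V \<rightarrow> Hom(d, P)\<close> is the object \<open>V \<otimes> d\<close>, characterised by
  \<open>Hom(V \<otimes> d, x) \<cong> Hom(V, Hom(d, x))\<close>, naturally in \<open>x\<close>.
\<close>

definition is_vect_tensor ::
  "('k::field, 'o, 'm, 'x) linear_cat_scheme \<Rightarrow> ('k, 'v) module \<Rightarrow> 'o \<Rightarrow> 'o \<Rightarrow> ('v \<Rightarrow> 'm) \<Rightarrow> bool"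
where
  "is_vect_tensor C V d P \<iota> \<longleftrightarrow>
     P \<in> Obj C \<and> linear_map (class_ring :: 'k ring) V (hom_space C d P) \<iota> \<and>
     (\<forall>x \<in> Obj C. \<forall>\<phi>. linear_map (class_ring :: 'k ring) V (hom_space C d x) \<phi> \<longrightarrow>
        (\<exists>!h. h \<in> Hom C P x \<and> (\<forall>v \<in> carrier V. h \<cdot>\<^bsub>C\<^esub> \<iota> v = \<phi> v)))"

text \<open>
  The morphism \<open>\<phi> \<otimes> g : V \<otimes> d \<rightarrow> V' \<otimes> d'\<close> induced by a linear map \<open>\<phi> : V \<rightarrow> V'\<close> and
  \<open>g : d \<rightarrow> d'\<close>, where \<open>(P, \<iota>)\<close> is \<open>V \<otimes> d\<close> and \<open>(P', \<iota>')\<close> is \<open>V' \<otimes> d'\<close>.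
\<close>

definition vect_tensor_arr ::
  "('k, 'o, 'm, 'x) linear_cat_scheme \<Rightarrow> ('k, 'v) module \<Rightarrow>
   'o \<Rightarrow> ('v \<Rightarrow> 'm) \<Rightarrow> 'o \<Rightarrow> ('w \<Rightarrow> 'm) \<Rightarrow> ('v \<Rightarrow> 'w) \<Rightarrow> 'm \<Rightarrow> 'm"
where
  "vect_tensor_arr C V P \<iota> P' \<iota>' \<phi> g =
     (THE h. h \<in> Hom C P P' \<and> (\<forall>v \<in> carrier V. h \<cdot>\<^bsub>C\<^esub> \<iota> v = \<iota>' (\<phi> v) \<cdot>\<^bsub>C\<^esub> g))"

text \<open>
  Wedges and ends of a functor \<open>T : C\<^sup>o\<^sup>p \<times> C \<rightarrow> E\<close> with object part \<open>TO\<close> and morphism part \<open>TA\<close>.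
\<close>

definition is_wedge ::
  "('k, 'o, 'm, 'x) linear_cat_scheme \<Rightarrow> ('k, 'p, 'n, 'y) linear_cat_scheme \<Rightarrow>
   ('o \<Rightarrow> 'o \<Rightarrow> 'p) \<Rightarrow> ('m \<Rightarrow> 'm \<Rightarrow> 'n) \<Rightarrow> 'p \<Rightarrow> ('o \<Rightarrow> 'n) \<Rightarrow> bool"
where
  "is_wedge C E TO TA X \<pi> \<longleftrightarrow>
     X \<in> Obj E \<and> (\<forall>c \<in> Obj C. \<pi> c \<in> Hom E X (TO c c)) \<and>
     (\<forall>c \<in> Obj C. \<forall>d \<in> Obj C. \<forall>f \<in> Hom C c d.
        TA (Id C c) f \<cdot>\<^bsub>E\<^esub> \<pi> c = TA f (Id C d) \<cdot>\<^bsub>E\<^esub> \<pi> d)"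

definition is_end ::
  "('k, 'o, 'm, 'x) linear_cat_scheme \<Rightarrow> ('k, 'p, 'n, 'y) linear_cat_scheme \<Rightarrow>
   ('o \<Rightarrow> 'o \<Rightarrow> 'p) \<Rightarrow> ('m \<Rightarrow> 'm \<Rightarrow> 'n) \<Rightarrow> 'p \<Rightarrow> ('o \<Rightarrow> 'n) \<Rightarrow> bool"
where
  "is_end C E TO TA D \<pi> \<longleftrightarrow>
     is_wedge C E TO TA D \<pi> \<and>
     (\<forall>X \<rho>. is_wedge C E TO TA X \<rho> \<longrightarrow>
        (\<exists>!h. h \<in> Hom E X D \<and> (\<forall>c \<in> Obj C. \<pi> c \<cdot>\<^bsub>E\<^esub> h = \<rho> c)))"

text \<open>
  \<open>TO c d\<close> with \<open>\<iota> c d\<close> is a chosen \<open>Hom(c, 1) \<otimes> d\<close>; \<open>hom_unit_tensor_arr\<close> is the morphism part of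
  the functor \<open>(c, d) \<mapsto> Hom(c, 1) \<otimes> d\<close>, sending \<open>f : c' \<rightarrow> c\<close> and \<open>g : d \<rightarrow> d'\<close> to
  \<open>Hom(f, 1) \<otimes> g : Hom(c, 1) \<otimes> d \<rightarrow> Hom(c', 1) \<otimes> d'\<close>.
\<close>

definition hom_unit_tensor_arr ::
  "('k, 'o, 'm, 'x) monoidal_cat_scheme \<Rightarrow> ('o \<Rightarrow> 'o \<Rightarrow> 'o) \<Rightarrow> ('o \<Rightarrow> 'o \<Rightarrow> 'm \<Rightarrow> 'm) \<Rightarrow>
   'm \<Rightarrow> 'm \<Rightarrow> 'm"
where
  "hom_unit_tensor_arr C TO \<iota> f g =
     (let c = Cod C f; c' = Dom C f; d = Dom C g; d' = Cod C g in
        vect_tensor_arr C (hom_space C c (Unit C)) (TO c d) (\<iota> c d) (TO c' d') (\<iota> c' d')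
          (\<lambda>v. v \<cdot>\<^bsub>C\<^esub> f) g)"

definition is_distinguished_object ::
  "('k::field, 'o, 'm, 'x) monoidal_cat_scheme \<Rightarrow> 'o \<Rightarrow> bool"
where
  "is_distinguished_object C D \<longleftrightarrow>
     (\<exists>TO \<iota> \<pi>.
        (\<forall>c \<in> Obj C. \<forall>d \<in> Obj C.
           is_vect_tensor C (hom_space C c (Unit C)) d (TO c d) (\<iota> c d)) \<and>
        is_end C C TO (hom_unit_tensor_arr C TO \<iota>) D \<pi>)"

definition unimodular :: "('k::field, 'o, 'm, 'x) monoidal_cat_scheme \<Rightarrow> bool" where
  "unimodular C \<longleftrightarrow> (\<exists>D. is_distinguished_object C D \<and> isomorphic C D (Unit C))"

end

theory Submission
  imports Defs
begin

text \<open>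
  A morphism \<open>X \<rightarrow> V \<otimes> d\<close> is a linear map \<open>V\<^sup>* \<rightarrow> Hom(X, d)\<close>, so a wedge from \<open>X\<close> to \<open>Hom(c, x) \<otimes> c\<close> is a
  natural family of linear maps \<open>Hom(c, x)\<^sup>* \<rightarrow> Hom(X, c)\<close>, and an end is an object with a universal
  such family.  Duality turns a universal family for \<open>x = 1\<close> on \<open>D\<close> into one for \<open>x = z\<^sup>\<or>\<^sup>\<or>\<close> on
  \<open>D \<otimes> z\<close>, naturally in \<open>z\<close>.

  If \<open>t\<close> is a trace form on a symmetric algebra \<open>A\<close> and \<open>P\<close> is the regular module, then every functional
  on \<open>Hom(c, x)\<close> is a sum of functionals \<open>f \<mapsto> t (g f p)\<close> with \<open>p : P \<rightarrow> c\<close> and \<open>g : x \<rightarrow> P\<close>, and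
  sending these to \<open>p g\<close> is a well-defined universal family on \<open>x\<close> itself.  Hence \<open>D = 1\<close>, and since
  \<open>z\<close> and \<open>z\<^sup>\<or>\<^sup>\<or>\<close> both carry a universal family for \<open>z\<^sup>\<or>\<^sup>\<or>\<close>, they are naturally isomorphic.

  Conversely, \<open>D = 1\<close> and \<open>z\<^sup>\<or>\<^sup>\<or> = z\<close> give every object a universal family for itself.  For the
  injective module \<open>I = A\<^sup>*\<close>, factoring the isomorphism \<open>Hom(c, I)\<^sup>* = Hom(P, c)\<close> through it gives a
  map \<open>P \<rightarrow> I\<close>, which is a symmetric nondegenerate form on \<open>A\<close>.
\<close>

section \<open>Functionals on finite-dimensional spaces\<close>

text \<open>Behind the overview stands the left exact Nakayama functor N: an object with a universal
  family for x is N(x), and for A-modules N(x) = Hom_A(A^*, x). It sends I = A^* to P = A, which is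
  why I is the object at which the converse is tested. An isomorphism of P with I as modules makes A
  only a Frobenius algebra; symmetry of the form comes from compatibility with endomorphisms of I.
  Hence naturality in x is carried through the constructions, and not just the existence of
  universal families.

  The obstacle is that V \<otimes> d is given by the arrows out of it, whereas an end concerns
  arrows into it. A finite basis of V with its coordinate functionals makes V \<otimes> d a
  biproduct of copies of d and so controls both. Once ends are rewritten as universal families,
  these objects disappear and only composition and functionals remain. Modules serve to supply the
  objects P, I and V \<otimes> d and the properties by which they are used.\<close>

definition functional :: "('k::field, 'v) module \<Rightarrow> ('v \<Rightarrow> 'k) \<Rightarrow> bool" where
  "functional V \<phi> \<longleftrightarrow>
     (\<forall>x \<in> carrier V. \<forall>y \<in> carrier V. \<phi> (x \<oplus>\<^bsub>V\<^esub> y) = \<phi> x + \<phi> y) \<and>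
     (\<forall>c. \<forall>x \<in> carrier V. \<phi> (c \<odot>\<^bsub>V\<^esub> x) = c * \<phi> x)"

text \<open>Sums are recursive and indexed by numbers, so that pushing an arrow or a functional
  through one is an induction on its length.\<close>

primrec vsum :: "('k, 'v) module \<Rightarrow> (nat \<Rightarrow> 'v) \<Rightarrow> nat \<Rightarrow> 'v" where
  "vsum V f 0 = \<zero>\<^bsub>V\<^esub>"
| "vsum V f (Suc n) = vsum V f n \<oplus>\<^bsub>V\<^esub> f n"

text \<open>The \<phi> i are at the same time a basis of the dual space, so that both spaces are
  handled without forming the latter.\<close>

definition dual_basis ::
  "('k::field, 'v) module \<Rightarrow> nat \<Rightarrow> (nat \<Rightarrow> 'v) \<Rightarrow> (nat \<Rightarrow> 'v \<Rightarrow> 'k) \<Rightarrow> bool" where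
  "dual_basis V n v \<phi> \<longleftrightarrow>
     (\<forall>i<n. v i \<in> carrier V) \<and> (\<forall>i<n. functional V (\<phi> i)) \<and>
     (\<forall>i<n. \<forall>j<n. \<phi> i (v j) = (if i = j then 1 else 0)) \<and>
     (\<forall>x \<in> carrier V. vsum V (\<lambda>i. \<phi> i x \<odot>\<^bsub>V\<^esub> v i) n = x)"

text \<open>A finite separating set amounts to finite dimension. Finiteness is passed on in this
  form, since a separating set for a space of arrows, functionals or families can be written down at
  once, whereas a basis would have to be computed.\<close>

definition separating :: "('k::field, 'v) module \<Rightarrow> ('v \<Rightarrow> 'k) set \<Rightarrow> bool" where
  "separating V \<Xi> \<longleftrightarrow>
     (\<forall>\<phi> \<in> \<Xi>. functional V \<phi>) \<and> (\<forall>x \<in> carrier V. (\<forall>\<phi> \<in> \<Xi>. \<phi> x = 0) \<longrightarrow> x = \<zero>\<^bsub>V\<^esub>)"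

lemma functional_add: "functional V \<phi> \<Longrightarrow> x \<in> carrier V \<Longrightarrow> y \<in> carrier V \<Longrightarrow> \<phi> (x \<oplus>\<^bsub>V\<^esub> y) = \<phi> x + \<phi> y"
  and functional_smult: "functional V \<phi> \<Longrightarrow> x \<in> carrier V \<Longrightarrow> \<phi> (c \<odot>\<^bsub>V\<^esub> x) = c * \<phi> x"
  by (simp_all add: functional_def)

locale kspace = vectorspace "class_ring :: 'k ring" V for V :: "('k::field, 'v) module"
begin

lemma smult_in [simp]: "x \<in> carrier V \<Longrightarrow> c \<odot>\<^bsub>V\<^esub> x \<in> carrier V"
  using smult_closed by simp

lemma zero_smult [simp]: "x \<in> carrier V \<Longrightarrow> 0 \<odot>\<^bsub>V\<^esub> x = \<zero>\<^bsub>V\<^esub>"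
  using smult_l_null by simp

lemma one_smult [simp]: "x \<in> carrier V \<Longrightarrow> 1 \<odot>\<^bsub>V\<^esub> x = x"
  using smult_one by simp

lemma smult_smult: "x \<in> carrier V \<Longrightarrow> a \<odot>\<^bsub>V\<^esub> (b \<odot>\<^bsub>V\<^esub> x) = (a * b) \<odot>\<^bsub>V\<^esub> x"
  using smult_assoc1[of a b x] by simp

lemma add_smult: "x \<in> carrier V \<Longrightarrow> (a + b) \<odot>\<^bsub>V\<^esub> x = a \<odot>\<^bsub>V\<^esub> x \<oplus>\<^bsub>V\<^esub> b \<odot>\<^bsub>V\<^esub> x"
  using smult_l_distr[of a b x] by simp

lemma smult_zero [simp]: "c \<odot>\<^bsub>V\<^esub> \<zero>\<^bsub>V\<^esub> = \<zero>\<^bsub>V\<^esub>"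
  using smult_r_null[of c] by simp

lemma functional_zero: "functional V \<phi> \<Longrightarrow> \<phi> \<zero>\<^bsub>V\<^esub> = 0"
  using functional_smult[of V \<phi> "\<zero>\<^bsub>V\<^esub>" 0] by simp

lemma eq_if_diff_zero:
  assumes "x \<in> carrier V" "y \<in> carrier V" "x \<oplus>\<^bsub>V\<^esub> (-1) \<odot>\<^bsub>V\<^esub> y = \<zero>\<^bsub>V\<^esub>"
  shows "x = y"
proof -
  have "y \<oplus>\<^bsub>V\<^esub> (-1) \<odot>\<^bsub>V\<^esub> y = \<zero>\<^bsub>V\<^esub>"
    using add_smult[of y 1 "-1"] assms by simp
  then show ?thesis
    using assms M.add.right_cancel[of "(-1) \<odot>\<^bsub>V\<^esub> y" x y] by fastforce
qed

lemma vsum_in [simp]: "(\<And>i. i < n \<Longrightarrow> f i \<in> carrier V) \<Longrightarrow> vsum V f n \<in> carrier V"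
  by (induction n) auto

lemma vsum_cong: "(\<And>i. i < n \<Longrightarrow> f i = g i) \<Longrightarrow> vsum V f n = vsum V g n"
  by (induction n) auto

lemma functional_vsum:
  "functional V \<phi> \<Longrightarrow> (\<And>i. i < n \<Longrightarrow> f i \<in> carrier V) \<Longrightarrow> \<phi> (vsum V f n) = (\<Sum>i<n. \<phi> (f i))"
  by (induction n) (auto simp: functional_zero functional_add)

lemma separating_eq:
  assumes "separating V \<Xi>" "x \<in> carrier V" "y \<in> carrier V" "\<And>\<phi>. \<phi> \<in> \<Xi> \<Longrightarrow> \<phi> x = \<phi> y"
  shows "x = y"
proof (rule eq_if_diff_zero)
  have "\<phi> (x \<oplus>\<^bsub>V\<^esub> (-1) \<odot>\<^bsub>V\<^esub> y) = 0" if "\<phi> \<in> \<Xi>" for \<phi>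
    using that assms by (simp add: separating_def functional_add functional_smult)
  then show "x \<oplus>\<^bsub>V\<^esub> (-1) \<odot>\<^bsub>V\<^esub> y = \<zero>\<^bsub>V\<^esub>"
    using assms by (simp add: separating_def)
qed (use assms in auto)

text \<open>Induction on \<Xi>: a functional \<xi> that is nonzero on S splits off one vector u, and
  the rest of \<Xi> still separates the kernel of \<xi> in S. The subspace S varies while the
  functionals stay defined on V, because the coordinates found on the kernel must make sense at u as
  well.\<close>

lemma dual_basis_subspace:
  assumes "finite \<Xi>"
    and "\<forall>\<phi> \<in> \<Xi>. functional V \<phi>"
    and "S \<subseteq> carrier V" "\<zero>\<^bsub>V\<^esub> \<in> S" "\<And>x y. x \<in> S \<Longrightarrow> y \<in> S \<Longrightarrow> x \<oplus>\<^bsub>V\<^esub> y \<in> S"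
      "\<And>c x. x \<in> S \<Longrightarrow> c \<odot>\<^bsub>V\<^esub> x \<in> S"
    and "\<And>x. x \<in> S \<Longrightarrow> \<forall>\<phi> \<in> \<Xi>. \<phi> x = 0 \<Longrightarrow> x = \<zero>\<^bsub>V\<^esub>"
  shows "\<exists>n v \<psi>. (\<forall>i<n. v i \<in> S \<and> functional V (\<psi> i)) \<and>
           (\<forall>i<n. \<forall>j<n. \<psi> i (v j) = (if i = j then 1 else 0)) \<and>
           (\<forall>x \<in> S. vsum V (\<lambda>i. \<psi> i x \<odot>\<^bsub>V\<^esub> v i) n = x)"
  using assms
proof (induction \<Xi> arbitrary: S rule: finite_induct)
  case empty
  then show ?case
    by (intro exI[of _ 0]) auto
next
  case (insert \<xi> \<Xi>)
  note fs = insert.prems(1) and S = insert.prems(2-5) and sep = insert.prems(6)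
  have fs': "\<forall>\<phi> \<in> \<Xi>. functional V \<phi>" and \<xi>: "functional V \<xi>"
    using fs by auto
  show ?case
  proof (cases "\<forall>x \<in> S. \<xi> x = 0")
    case True
    show ?thesis
    proof (rule insert.IH[OF fs' S])
      show "x = \<zero>\<^bsub>V\<^esub>" if "x \<in> S" "\<forall>\<phi> \<in> \<Xi>. \<phi> x = 0" for x
        using sep[of x] True that by blast
    qed
  next
    case False
    then obtain w where w: "w \<in> S" "\<xi> w \<noteq> 0"
      by blast
    define u where "u = (1 / \<xi> w) \<odot>\<^bsub>V\<^esub> w"
    have wc: "w \<in> carrier V"
      using w S(1) by blast
    have u: "u \<in> S" "u \<in> carrier V" "\<xi> u = 1"
      using w wc S(4)[OF w(1)] functional_smult[OF \<xi> wc] by (simp_all add: u_def)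
    define S' where "S' = {x \<in> S. \<xi> x = 0}"
    have "\<exists>n v \<psi>. (\<forall>i<n. v i \<in> S' \<and> functional V (\<psi> i)) \<and>
           (\<forall>i<n. \<forall>j<n. \<psi> i (v j) = (if i = j then 1 else 0)) \<and>
           (\<forall>x \<in> S'. vsum V (\<lambda>i. \<psi> i x \<odot>\<^bsub>V\<^esub> v i) n = x)"
    proof (rule insert.IH[OF fs'])
      show "S' \<subseteq> carrier V" "\<zero>\<^bsub>V\<^esub> \<in> S'"
        using S(1,2) functional_zero[OF \<xi>] by (auto simp: S'_def)
      show "x \<oplus>\<^bsub>V\<^esub> y \<in> S'" if "x \<in> S'" "y \<in> S'" for x y
        using that S(1) S(3)[of x y] functional_add[OF \<xi>, of x y] by (auto simp: S'_def)
      show "c \<odot>\<^bsub>V\<^esub> x \<in> S'" if "x \<in> S'" for c x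
        using that S(1) S(4)[of x c] functional_smult[OF \<xi>, of x c] by (auto simp: S'_def)
      show "x = \<zero>\<^bsub>V\<^esub>" if "x \<in> S'" "\<forall>\<phi> \<in> \<Xi>. \<phi> x = 0" for x
        using sep[of x] that by (simp add: S'_def)
    qed
    then obtain n v \<psi> where
      v: "\<And>i. i < n \<Longrightarrow> v i \<in> S'" and \<psi>: "\<And>i. i < n \<Longrightarrow> functional V (\<psi> i)"
      and \<delta>: "\<And>i j. i < n \<Longrightarrow> j < n \<Longrightarrow> \<psi> i (v j) = (if i = j then 1 else 0)"
      and sum: "\<And>x. x \<in> S' \<Longrightarrow> vsum V (\<lambda>i. \<psi> i x \<odot>\<^bsub>V\<^esub> v i) n = x"
      by blast
    have v': "v i \<in> carrier V" "\<xi> (v i) = 0" if "i < n" for i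
      using v[OF that] S(1) by (auto simp: S'_def)
    define v1 where "v1 = v(n := u)"
    \<comment> \<open>Subtracting \<psi> i u times \<xi> makes the old coordinates vanish at u and
      leaves them unchanged on the kernel of \<xi>. The new coordinate is \<xi> itself, as \<xi> u =
      1.\<close>
    define \<psi>1 where "\<psi>1 = (\<lambda>i x. \<psi> i x - \<psi> i u * \<xi> x)(n := \<xi>)"
    have f: "functional V (\<psi>1 i)" if "i < Suc n" for i
      using \<psi>[of i] \<xi> that by (auto simp: functional_def \<psi>1_def algebra_simps)
    have d: "\<psi>1 i (v1 j) = (if i = j then 1 else 0)" if "i < Suc n" "j < Suc n" for i j
      using that u v' \<delta> by (auto simp: \<psi>1_def v1_def less_Suc_eq)
    have s: "vsum V (\<lambda>i. \<psi>1 i x \<odot>\<^bsub>V\<^esub> v1 i) (Suc n) = x" if x: "x \<in> S" for x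
    proof -
      have xc: "x \<in> carrier V"
        using x S(1) by blast
      define x' where "x' = x \<oplus>\<^bsub>V\<^esub> (- \<xi> x) \<odot>\<^bsub>V\<^esub> u"
      have "x' \<in> S'"
        using S(3)[OF x S(4)[OF u(1)]] u xc functional_add[OF \<xi>, of x "(- \<xi> x) \<odot>\<^bsub>V\<^esub> u"]
          functional_smult[OF \<xi>, of u "- \<xi> x"]
        by (simp add: S'_def x'_def)
      have "vsum V (\<lambda>i. \<psi>1 i x \<odot>\<^bsub>V\<^esub> v1 i) n = vsum V (\<lambda>i. \<psi> i x' \<odot>\<^bsub>V\<^esub> v i) n"
      proof (rule vsum_cong)
        fix i assume i: "i < n"
        have "\<psi> i x' = \<psi>1 i x"
          using functional_add[OF \<psi>[OF i], of x "(- \<xi> x) \<odot>\<^bsub>V\<^esub> u"] functional_smult[OF \<psi>[OF i], of u "- \<xi> x"]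
            xc u i by (simp add: \<psi>1_def x'_def)
        then show "\<psi>1 i x \<odot>\<^bsub>V\<^esub> v1 i = \<psi> i x' \<odot>\<^bsub>V\<^esub> v i"
          using i by (simp add: v1_def)
      qed
      also have "\<dots> = x'"
        using sum \<open>x' \<in> S'\<close> by blast
      finally have "vsum V (\<lambda>i. \<psi>1 i x \<odot>\<^bsub>V\<^esub> v1 i) (Suc n) = x' \<oplus>\<^bsub>V\<^esub> \<xi> x \<odot>\<^bsub>V\<^esub> u"
        by (simp add: \<psi>1_def v1_def)
      also have "\<dots> = x \<oplus>\<^bsub>V\<^esub> ((- \<xi> x) \<odot>\<^bsub>V\<^esub> u \<oplus>\<^bsub>V\<^esub> \<xi> x \<odot>\<^bsub>V\<^esub> u)"
        using xc u by (simp add: x'_def M.add.m_assoc)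
      also have "\<dots> = x"
        using xc u add_smult[of u "- \<xi> x" "\<xi> x"] by simp
      finally show ?thesis .
    qed
    have m: "v1 i \<in> S" if "i < Suc n" for i
      using that v u by (auto simp: v1_def S'_def less_Suc_eq)
    show ?thesis
      using f d s m by (intro exI[of _ "Suc n"] exI[of _ v1] exI[of _ \<psi>1]) blast
  qed
qed

lemma dual_basis_exists:
  assumes "finite \<Xi>" "separating V \<Xi>"
  shows "\<exists>n v \<phi>. dual_basis V n v \<phi>"
proof -
  have "\<exists>n v \<psi>. (\<forall>i<n. v i \<in> carrier V \<and> functional V (\<psi> i)) \<and>
           (\<forall>i<n. \<forall>j<n. \<psi> i (v j) = (if i = j then 1 else 0)) \<and>
           (\<forall>x \<in> carrier V. vsum V (\<lambda>i. \<psi> i x \<odot>\<^bsub>V\<^esub> v i) n = x)"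
    by (rule dual_basis_subspace[OF assms(1)]) (use assms(2) in \<open>simp_all add: separating_def\<close>)
  then show ?thesis
    unfolding dual_basis_def by blast
qed

lemma fin_dim_if_separating:
  assumes "finite \<Xi>" "separating V \<Xi>"
  shows "fin_dim"
proof -
  obtain n v \<phi> where d: "dual_basis V n v \<phi>"
    using dual_basis_exists assms by blast
  let ?S = "v ` {..<n}"
  have S: "?S \<subseteq> carrier V"
    using d by (auto simp: dual_basis_def)
  have sub: "submodule class_ring (span ?S) V"
    using span_is_submodule[OF S] .
  have "vsum V (\<lambda>i. \<phi> i x \<odot>\<^bsub>V\<^esub> v i) m \<in> span ?S" if "m \<le> n" for x m
    using that
  proof (induction m)
    case 0
    then show ?case
      using sub by (simp add: submodule_def)
  next
    case (Suc m)
    have "v m \<in> span ?S"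
      using in_own_span[OF S] Suc.prems by auto
    then show ?case
      using sub Suc by (simp add: submodule_def)
  qed
  then have "vsum V (\<lambda>i. \<phi> i x \<odot>\<^bsub>V\<^esub> v i) n \<in> span ?S" for x
    by blast
  moreover have "vsum V (\<lambda>i. \<phi> i x \<odot>\<^bsub>V\<^esub> v i) n = x" if "x \<in> carrier V" for x
    using d that by (simp add: dual_basis_def)
  ultimately have "carrier V \<subseteq> span ?S"
    by (metis subsetI)
  then have "gen_set ?S"
    using span_is_subset2[OF S] by blast
  then show ?thesis
    unfolding fin_dim_def using S by (intro exI[of _ ?S]) simp
qed

lemma separating_if_fin_dim:
  assumes "fin_dim"
  shows "\<exists>\<Xi>. finite \<Xi> \<and> separating V \<Xi>"
proof -
  obtain B where B: "finite B" "basis B"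
    using finite_basis_exists[OF assms] by blast
  have Bc: "B \<subseteq> carrier V"
    using B by (simp add: basis_def)
  have ex: "\<exists>!a. a \<in> B \<rightarrow>\<^sub>E UNIV \<and> lincomb a B = x" if "x \<in> carrier V" for x
    using basis_criterion[OF B(1) Bc] B(2) that by simp
  define co where "co x = (THE a. a \<in> B \<rightarrow>\<^sub>E UNIV \<and> lincomb a B = x)" for x
  have co: "lincomb (co x) B = x" if "x \<in> carrier V" for x
    using theI'[OF ex[OF that]] by (simp add: co_def)
  have co_eq: "co x b = a b" if "x \<in> carrier V" "lincomb a B = x" "b \<in> B" for x a b
  proof -
    \<comment> \<open>Coordinates are unique only as functions that are extensional on B, so an
      arbitrary coefficient function is first cut down to B.\<close>
    have "lincomb (restrict a B) B = lincomb a B"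
      unfolding lincomb_def using Bc by (intro M.finsum_cong') auto
    then have "co x = restrict a B"
      unfolding co_def using that by (intro the1_equality[OF ex]) auto
    then show ?thesis
      using that by simp
  qed
  have fin: "functional V (\<lambda>x. co x b)" if "b \<in> B" for b
    unfolding functional_def
  proof (intro conjI ballI allI)
    fix x y assume xy: "x \<in> carrier V" "y \<in> carrier V"
    have "lincomb (\<lambda>b. co x b + co y b) B = lincomb (co x) B \<oplus>\<^bsub>V\<^esub> lincomb (co y) B"
      using lincomb_sum[OF B(1) Bc, of "co x" "co y"] by simp
    then show "co (x \<oplus>\<^bsub>V\<^esub> y) b = co x b + co y b"
      using xy that co by (intro co_eq) auto
  next
    fix c x assume x: "x \<in> carrier V"
    have "lincomb (\<lambda>b. c * co x b) B = c \<odot>\<^bsub>V\<^esub> lincomb (co x) B"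
      using lincomb_smult[OF Bc, of "co x" c] by simp
    then show "co (c \<odot>\<^bsub>V\<^esub> x) b = c * co x b"
      using x that co by (intro co_eq) auto
  qed
  have "x = \<zero>\<^bsub>V\<^esub>" if "x \<in> carrier V" "\<forall>b \<in> B. co x b = 0" for x
  proof -
    have "x = lincomb (co x) B"
      using co that by simp
    also have "\<dots> = (\<Oplus>\<^bsub>V\<^esub>b\<in>B. \<zero>\<^bsub>V\<^esub>)"
      unfolding lincomb_def using Bc that by (intro M.finsum_cong') auto
    finally show ?thesis by simp
  qed
  then show ?thesis
    using B(1) fin by (intro exI[of _ "(\<lambda>b x. co x b) ` B"]) (auto simp: separating_def)
qed

lemma functional_expand:
  assumes d: "dual_basis V n v \<phi>" and f: "functional V f" and x: "x \<in> carrier V"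
  shows "f x = (\<Sum>i<n. f (v i) * \<phi> i x)"
proof -
  have "f x = f (vsum V (\<lambda>i. \<phi> i x \<odot>\<^bsub>V\<^esub> v i) n)"
    using d x by (simp add: dual_basis_def)
  also have "\<dots> = (\<Sum>i<n. f (v i) * \<phi> i x)"
    using f d by (subst functional_vsum) (auto simp: functional_smult dual_basis_def mult.commute)
  finally show ?thesis .
qed

text \<open>In finite dimension a subspace of the dual with zero annihilator is everything. The
  proof interpolates: by induction on k it finds a member of T with prescribed values on the first k
  basis vectors.\<close>

lemma separating_subspace_spans:
  assumes d: "dual_basis V n v \<phi>"
    and sep: "separating V T"
    and T0: "(\<lambda>x. 0) \<in> T"
    and Tadd: "\<And>s t. s \<in> T \<Longrightarrow> t \<in> T \<Longrightarrow> (\<lambda>x. s x + t x) \<in> T"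
    and Tscale: "\<And>c s. s \<in> T \<Longrightarrow> (\<lambda>x. c * s x) \<in> T"
    and \<theta>: "functional V \<theta>"
  shows "\<exists>t \<in> T. \<forall>x \<in> carrier V. t x = \<theta> x"
proof -
  have vc: "v i \<in> carrier V" if "i < n" for i
    using d that by (simp add: dual_basis_def)
  have Tsum: "(\<lambda>x. \<Sum>i<m. c i * s i x) \<in> T" if "\<And>i. i < m \<Longrightarrow> s i \<in> T" for m :: nat and c s
    using that by (induction m) (auto intro!: T0 Tadd Tscale)
  have ind: "\<exists>t \<in> T. \<forall>i<k. t (v i) = \<theta> (v i)" if "k \<le> n" "functional V \<theta>" for k \<theta>
    using that
  proof (induction k arbitrary: \<theta>)
    case 0
    then show ?case using T0 by auto
  next
    case (Suc k)
    have kn: "k < n" using Suc.prems by simp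
    obtain t0 where t0: "t0 \<in> T" "\<forall>i<k. t0 (v i) = \<theta> (v i)"
      using Suc by auto
    have "\<forall>j<k. \<exists>t \<in> T. \<forall>i<k. t (v i) = \<phi> j (v i)"
    proof (intro allI impI)
      fix j assume "j < k"
      then have "functional V (\<phi> j)"
        using d kn by (simp add: dual_basis_def)
      then show "\<exists>t \<in> T. \<forall>i<k. t (v i) = \<phi> j (v i)"
        using Suc.IH kn by simp
    qed
    then obtain s where s: "\<And>j. j < k \<Longrightarrow> s j \<in> T" "\<And>i j. j < k \<Longrightarrow> i < k \<Longrightarrow> s j (v i) = \<phi> j (v i)"
      by metis
    define z where "z = vsum V (\<lambda>i. s i (v k) \<odot>\<^bsub>V\<^esub> v i) k"
    \<comment> \<open>A functional takes at y the value that it would take at v k after being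
      corrected by the s i to vanish on the earlier basis vectors. Some r in T is nonzero at y, and
      r' below is r so corrected.\<close>
    define y where "y = v k \<oplus>\<^bsub>V\<^esub> (-1) \<odot>\<^bsub>V\<^esub> z"
    have z: "z \<in> carrier V"
      unfolding z_def using vc kn by (intro vsum_in) auto
    have y: "y \<in> carrier V"
      unfolding y_def using z vc kn by simp
    have fz: "f z = (\<Sum>i<k. s i (v k) * f (v i))" if "functional V f" for f
      unfolding z_def using that vc kn by (subst functional_vsum) (auto simp: functional_smult)
    have fy: "f y = f (v k) - (\<Sum>i<k. s i (v k) * f (v i))" if "functional V f" for f
      unfolding y_def using that vc kn z by (simp add: functional_add functional_smult fz)
    have "\<phi> k y = 1"
      using d kn by (subst fy) (auto simp: dual_basis_def)
    then have "y \<noteq> \<zero>\<^bsub>V\<^esub>"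
      using functional_zero[of "\<phi> k"] d kn by (auto simp: dual_basis_def)
    then obtain r where r: "r \<in> T" "r y \<noteq> 0"
      using sep y by (auto simp: separating_def)
    define r' where "r' = (\<lambda>x. r x + (\<Sum>i<k. (- r (v i)) * s i x))"
    have r'T: "r' \<in> T"
      unfolding r'_def using r s by (intro Tadd Tsum) auto
    have "r y = r (v k) - (\<Sum>i<k. s i (v k) * r (v i))"
      using r sep by (intro fy) (auto simp: separating_def)
    then have r'k: "r' (v k) \<noteq> 0"
      using r by (simp add: r'_def sum_negf mult.commute)
    have r'i: "r' (v i) = 0" if i: "i < k" for i
    proof -
      have "(\<Sum>j<k. (- r (v j)) * s j (v i)) = (\<Sum>j<k. if j = i then - r (v i) else 0)"
        using s i kn d by (intro sum.cong) (auto simp: dual_basis_def)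
      then show ?thesis using i by (simp add: r'_def)
    qed
    define t where "t = (\<lambda>x. t0 x + ((\<theta> (v k) - t0 (v k)) / r' (v k)) * r' x)"
    have "t \<in> T"
      unfolding t_def using t0 r'T by (intro Tadd Tscale)
    moreover have "t (v i) = \<theta> (v i)" if "i < Suc k" for i
      using that t0 r'k r'i by (auto simp: t_def less_Suc_eq)
    ultimately show ?case by blast
  qed
  then obtain t where t: "t \<in> T" "\<And>i. i < n \<Longrightarrow> t (v i) = \<theta> (v i)"
    using ind[OF le_refl \<theta>] by blast
  have "t x = \<theta> x" if x: "x \<in> carrier V" for x
  proof -
    have "functional V t"
      using t sep by (simp add: separating_def)
    then have "t x = (\<Sum>i<n. t (v i) * \<phi> i x)"
      by (rule functional_expand[OF d _ x])
    also have "\<dots> = (\<Sum>i<n. \<theta> (v i) * \<phi> i x)"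
      using t(2) by (intro sum.cong) auto
    also have "\<dots> = \<theta> x"
      by (rule functional_expand[OF d \<theta> x, symmetric])
    finally show ?thesis .
  qed
  then show ?thesis using t by blast
qed

text \<open>If only the zero vector of V pairs to zero with all of W, the functionals B w form a
  separating subspace, so every functional on V is one of them.\<close>

lemma pairing_represents:
  fixes W :: "('k, 'w) module"
  assumes db: "dual_basis V n v \<phi>" and W: "kspace W"
    and left: "\<And>w. w \<in> carrier W \<Longrightarrow> functional V (B w)"
    and right: "\<And>x. x \<in> carrier V \<Longrightarrow> functional W (\<lambda>w. B w x)"
    and nondeg: "\<And>x. x \<in> carrier V \<Longrightarrow> (\<And>w. w \<in> carrier W \<Longrightarrow> B w x = 0) \<Longrightarrow> x = \<zero>\<^bsub>V\<^esub>"
    and \<psi>: "functional V \<psi>"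
  shows "\<exists>w \<in> carrier W. \<forall>x \<in> carrier V. B w x = \<psi> x"
proof -
  interpret W: kspace W by (rule W)
  \<comment> \<open>Functionals are total functions, and B w is one of many that agree on the
    carrier. Closing the set under this agreement makes it a subspace on the nose.\<close>
  let ?T = "{\<tau>. functional V \<tau> \<and> (\<exists>w \<in> carrier W. \<forall>x \<in> carrier V. B w x = \<tau> x)}"
  have mem: "B w \<in> ?T" if "w \<in> carrier W" for w
    using left[OF that] that by blast
  have "\<exists>\<tau> \<in> ?T. \<forall>x \<in> carrier V. \<tau> x = \<psi> x"
  proof (rule separating_subspace_spans[OF db _ _ _ _ \<psi>])
    show "separating V ?T"
      unfolding separating_def
    proof (intro conjI ballI impI)
      fix x assume x: "x \<in> carrier V" and z: "\<forall>\<tau> \<in> ?T. \<tau> x = 0"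
      show "x = \<zero>\<^bsub>V\<^esub>"
        by (rule nondeg[OF x]) (rule bspec[OF z mem])
    qed blast
    show "(\<lambda>x. 0) \<in> ?T"
      using W.functional_zero[OF right] by (intro CollectI conjI bexI[of _ "\<zero>\<^bsub>W\<^esub>"]) (simp_all add: functional_def)
    show "(\<lambda>x. s x + t x) \<in> ?T" if st: "s \<in> ?T" "t \<in> ?T" for s t
    proof -
      obtain p q where p: "p \<in> carrier W" "\<forall>x \<in> carrier V. B p x = s x"
        and q: "q \<in> carrier W" "\<forall>x \<in> carrier V. B q x = t x"
        using st by blast
      have "B (p \<oplus>\<^bsub>W\<^esub> q) x = s x + t x" if x: "x \<in> carrier V" for x
        using functional_add[OF right[OF x] p(1) q(1)] p(2) q(2) x by simp
      moreover have "functional V (\<lambda>x. s x + t x)"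
        using st by (simp add: functional_def algebra_simps)
      ultimately show ?thesis
        using W.M.a_closed[OF p(1) q(1)] by blast
    qed
    show "(\<lambda>x. c * s x) \<in> ?T" if st: "s \<in> ?T" for c s
    proof -
      obtain p where p: "p \<in> carrier W" "\<forall>x \<in> carrier V. B p x = s x"
        using st by blast
      have "B (c \<odot>\<^bsub>W\<^esub> p) x = c * s x" if x: "x \<in> carrier V" for x
        using functional_smult[OF right[OF x] p(1)] p(2) x by simp
      moreover have "functional V (\<lambda>x. c * s x)"
        using st by (simp add: functional_def algebra_simps)
      ultimately show ?thesis
        using W.smult_in[OF p(1)] by blast
    qed
  qed
  then obtain \<tau> w where "\<forall>x \<in> carrier V. \<tau> x = \<psi> x" "w \<in> carrier W" "\<forall>x \<in> carrier V. B w x = \<tau> x"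
    by auto
  then show ?thesis
    by (intro bexI[of _ w]) simp_all
qed

end

lemma linear_map_iff:
  fixes V :: "('k::field, 'v) module" and W :: "('k, 'w) module"
  shows "linear_map (class_ring :: 'k ring) V W T \<longleftrightarrow>
    vectorspace (class_ring :: 'k ring) V \<and> vectorspace (class_ring :: 'k ring) W \<and>
    (\<forall>x \<in> carrier V. T x \<in> carrier W) \<and>
    (\<forall>x \<in> carrier V. \<forall>y \<in> carrier V. T (x \<oplus>\<^bsub>V\<^esub> y) = T x \<oplus>\<^bsub>W\<^esub> T y) \<and>
    (\<forall>c. \<forall>x \<in> carrier V. T (c \<odot>\<^bsub>V\<^esub> x) = c \<odot>\<^bsub>W\<^esub> T x)"
proof -
  have *: "linear_map (class_ring :: 'k ring) V W T \<longleftrightarrow>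
    vectorspace (class_ring :: 'k ring) V \<and> vectorspace (class_ring :: 'k ring) W \<and>
    T \<in> LinearCombinations.module_hom (class_ring :: 'k ring) V W"
    unfolding linear_map_def mod_hom_def mod_hom_axioms_def by (auto simp: vectorspace_def)
  show ?thesis
    unfolding * LinearCombinations.module_hom_def by (simp add: Pi_iff) (blast | auto)
qed

section \<open>Natural families\<close>

lemma hom_space_simps [simp]:
  "carrier (hom_space C a b) = Hom C a b" "zero (hom_space C a b) = ZeroArr C a b"
  "add (hom_space C a b) = AddArr C" "smult (hom_space C a b) = ScaleArr C"
  by (simp_all add: hom_space_def)

context linear_category
begin

abbreviation add_arr (infixl \<open>\<boxplus>\<close> 60) where "f \<boxplus> g \<equiv> AddArr C f g"
abbreviation scale_arr (infixr \<open>\<star>\<close> 65) where "k \<star> f \<equiv> ScaleArr C k f"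
abbreviation hom where "hom \<equiv> Hom C"
abbreviation hsum where "hsum a b \<equiv> vsum (hom_space C a b)"
abbreviation Fn where "Fn a b \<equiv> {\<phi>. functional (hom_space C a b) \<phi>}"

lemma hom_obj: "f \<in> hom a b \<Longrightarrow> a \<in> Obj C" "f \<in> hom a b \<Longrightarrow> b \<in> Obj C"
  using dom_closed cod_closed by (auto simp: Hom_def)

lemma hom_dom_cod: "f \<in> hom a b \<Longrightarrow> Dom C f = a" "f \<in> hom a b \<Longrightarrow> Cod C f = b"
  by (simp_all add: Hom_def)

lemma hom_kspace: "a \<in> Obj C \<Longrightarrow> b \<in> Obj C \<Longrightarrow> kspace (hom_space C a b)"
  using hom_vectorspace by (simp add: kspace_def)

lemma zero_in: "a \<in> Obj C \<Longrightarrow> b \<in> Obj C \<Longrightarrow> ZeroArr C a b \<in> hom a b"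
  using kspace.vsum_in[OF hom_kspace, of a b 0] by simp

lemma add_in: "f \<in> hom a b \<Longrightarrow> g \<in> hom a b \<Longrightarrow> f \<boxplus> g \<in> hom a b"
proof -
  assume fg: "f \<in> hom a b" "g \<in> hom a b"
  then interpret kspace "hom_space C a b" using hom_kspace hom_obj by blast
  show ?thesis using M.a_closed fg by simp
qed

lemma scale_in: "f \<in> hom a b \<Longrightarrow> k \<star> f \<in> hom a b"
  using kspace.smult_in[OF hom_kspace, of a b f k] hom_obj by simp

lemma comp_add_left:
  "f \<in> hom a b \<Longrightarrow> g \<in> hom b c \<Longrightarrow> g' \<in> hom b c \<Longrightarrow> (g \<boxplus> g') \<cdot> f = (g \<cdot> f) \<boxplus> (g' \<cdot> f)"
  using comp_linear_left[of f a b c] hom_obj by (simp add: linear_map_iff)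

lemma comp_scale_left: "f \<in> hom a b \<Longrightarrow> g \<in> hom b c \<Longrightarrow> (k \<star> g) \<cdot> f = k \<star> (g \<cdot> f)"
  using comp_linear_left[of f a b c] hom_obj by (simp add: linear_map_iff)

lemma comp_add_right:
  "f \<in> hom a b \<Longrightarrow> f' \<in> hom a b \<Longrightarrow> g \<in> hom b c \<Longrightarrow> g \<cdot> (f \<boxplus> f') = (g \<cdot> f) \<boxplus> (g \<cdot> f')"
  using comp_linear_right[of g b c a] hom_obj by (simp add: linear_map_iff)

lemma comp_scale_right: "f \<in> hom a b \<Longrightarrow> g \<in> hom b c \<Longrightarrow> g \<cdot> (k \<star> f) = k \<star> (g \<cdot> f)"
  using comp_linear_right[of g b c a] hom_obj by (simp add: linear_map_iff)

lemma scale_zero: "f \<in> hom a b \<Longrightarrow> 0 \<star> f = ZeroArr C a b"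
  using kspace.zero_smult[OF hom_kspace, of a b f] hom_obj by simp

lemma comp_zero_left: "f \<in> hom a b \<Longrightarrow> c \<in> Obj C \<Longrightarrow> ZeroArr C b c \<cdot> f = ZeroArr C a c"
  using comp_scale_left[of f a b "ZeroArr C b c" c 0] zero_in[of b c] hom_obj comp_in_hom scale_zero
  by metis

lemma comp_zero_right: "g \<in> hom b c \<Longrightarrow> a \<in> Obj C \<Longrightarrow> g \<cdot> ZeroArr C a b = ZeroArr C a c"
  using comp_scale_right[of "ZeroArr C a b" a b g c 0] zero_in[of a b] hom_obj comp_in_hom scale_zero
  by metis

lemma hsum_in:
  "a \<in> Obj C \<Longrightarrow> b \<in> Obj C \<Longrightarrow> (\<And>i. i < n \<Longrightarrow> f i \<in> hom a b) \<Longrightarrow> hsum a b f n \<in> hom a b"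
  using kspace.vsum_in[OF hom_kspace, of a b n f] by simp

lemma hsum_cong: "(\<And>i. i < n \<Longrightarrow> f i = g i) \<Longrightarrow> hsum a b f n = hsum a b g n"
  by (induction n) auto

lemma hsum_comp:
  assumes "g \<in> hom a b" "c \<in> Obj C" "\<And>i. i < n \<Longrightarrow> f i \<in> hom b c"
  shows "hsum b c f n \<cdot> g = hsum a c (\<lambda>i. f i \<cdot> g) n"
  using assms(3)
proof (induction n)
  case 0
  then show ?case using comp_zero_left assms by simp
next
  case (Suc n)
  then show ?case using comp_add_left[of g a b "hsum b c f n" c "f n"] assms hsum_in hom_obj
    by simp
qed

lemma comp_hsum:
  assumes "g \<in> hom b c" "a \<in> Obj C" "\<And>i. i < n \<Longrightarrow> f i \<in> hom a b"
  shows "g \<cdot> hsum a b f n = hsum a c (\<lambda>i. g \<cdot> f i) n"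
  using assms(3)
proof (induction n)
  case 0
  then show ?case using comp_zero_right assms by simp
next
  case (Suc n)
  then show ?case using comp_add_right[of "hsum a b f n" a b "f n" g c] assms hsum_in hom_obj
    by simp
qed

lemma hsum_delta:
  assumes "a \<in> Obj C" "b \<in> Obj C" "i < n" "\<And>j. j < n \<Longrightarrow> f j \<in> hom a b"
    and "\<And>j. j < n \<Longrightarrow> j \<noteq> i \<Longrightarrow> f j = ZeroArr C a b"
  shows "hsum a b f n = f i"
proof -
  interpret kspace "hom_space C a b" using hom_kspace assms by blast
  have z: "hsum a b f m = ZeroArr C a b" if "\<And>j. j < m \<Longrightarrow> f j = ZeroArr C a b" for m
    using that by (induction m) (use M.r_zero M.zero_closed in auto)
  have "hsum a b f n = f i" if "i < n" "\<And>j. j < n \<Longrightarrow> f j \<in> hom a b"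
    "\<And>j. j < n \<Longrightarrow> j \<noteq> i \<Longrightarrow> f j = ZeroArr C a b" for n
    using that
  proof (induction n)
    case (Suc n)
    show ?case
    proof (cases "i = n")
      case True
      then show ?thesis using z[of n] M.l_zero Suc by simp
    next
      case False
      then show ?thesis using M.r_zero Suc by simp
    qed
  qed simp
  then show ?thesis using assms by blast
qed

lemma functional_hom_iff:
  "functional (hom_space C a b) \<phi> \<longleftrightarrow>
     (\<forall>f \<in> hom a b. \<forall>g \<in> hom a b. \<phi> (f \<boxplus> g) = \<phi> f + \<phi> g) \<and> (\<forall>k. \<forall>f \<in> hom a b. \<phi> (k \<star> f) = k * \<phi> f)"
  by (simp add: functional_def)

lemma Fn_add: "\<phi> \<in> Fn a b \<Longrightarrow> \<psi> \<in> Fn a b \<Longrightarrow> (\<lambda>f. \<phi> f + \<psi> f) \<in> Fn a b"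
  by (simp add: functional_hom_iff algebra_simps)

lemma Fn_scale: "\<phi> \<in> Fn a b \<Longrightarrow> (\<lambda>f. k * \<phi> f) \<in> Fn a b"
  by (simp add: functional_hom_iff algebra_simps)

lemma Fn_zero: "(\<lambda>f. 0) \<in> Fn a b"
  by (simp add: functional_hom_iff)

lemma Fn_precomp: "\<phi> \<in> Fn a c \<Longrightarrow> u \<in> hom a b \<Longrightarrow> (\<lambda>f. \<phi> (f \<cdot> u)) \<in> Fn b c"
  by (simp add: functional_hom_iff comp_add_left comp_scale_left comp_in_hom)

lemma Fn_postcomp: "\<phi> \<in> Fn a c \<Longrightarrow> w \<in> hom b c \<Longrightarrow> (\<lambda>f. \<phi> (w \<cdot> f)) \<in> Fn a b"
  by (simp add: functional_hom_iff comp_add_right comp_scale_right comp_in_hom)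

lemma Fn_zero_arr: "\<phi> \<in> Fn a b \<Longrightarrow> a \<in> Obj C \<Longrightarrow> b \<in> Obj C \<Longrightarrow> \<phi> (ZeroArr C a b) = 0"
  using kspace.functional_zero[OF hom_kspace, of a b \<phi>] by simp

text \<open>
  A natural family \<open>Hom(c, x)\<^sup>* \<rightarrow> Hom(X, c)\<close>.  Functionals are total functions, of which only the
  values on \<open>Hom(c, x)\<close> matter.
\<close>

definition natfam :: "'o \<Rightarrow> 'o \<Rightarrow> ('o \<Rightarrow> ('m \<Rightarrow> 'k) \<Rightarrow> 'm) \<Rightarrow> bool" where
  "natfam x X \<alpha> \<longleftrightarrow> x \<in> Obj C \<and> X \<in> Obj C \<and>
     (\<forall>c \<in> Obj C. \<forall>\<phi> \<in> Fn c x. \<alpha> c \<phi> \<in> hom X c) \<and>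
     (\<forall>c \<in> Obj C. \<forall>\<phi> \<in> Fn c x. \<forall>\<psi> \<in> Fn c x. \<alpha> c (\<lambda>f. \<phi> f + \<psi> f) = \<alpha> c \<phi> \<boxplus> \<alpha> c \<psi>) \<and>
     (\<forall>c \<in> Obj C. \<forall>\<phi> \<in> Fn c x. \<forall>\<psi> \<in> Fn c x. (\<forall>f \<in> hom c x. \<phi> f = \<psi> f) \<longrightarrow> \<alpha> c \<phi> = \<alpha> c \<psi>) \<and>
     (\<forall>c \<in> Obj C. \<forall>d \<in> Obj C. \<forall>u \<in> hom c d. \<forall>\<phi> \<in> Fn c x. u \<cdot> \<alpha> c \<phi> = \<alpha> d (\<lambda>f. \<phi> (f \<cdot> u)))"

text \<open>The end of Hom(c, x) \<otimes> c over c. The case x = 1 is the distinguished object;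
  other x are needed because duality moves x to a double dual and because x = I is the case that
  yields the trace.\<close>

definition univ :: "'o \<Rightarrow> 'o \<Rightarrow> ('o \<Rightarrow> ('m \<Rightarrow> 'k) \<Rightarrow> 'm) \<Rightarrow> bool" where
  "univ x N \<Phi> \<longleftrightarrow> natfam x N \<Phi> \<and>
     (\<forall>X \<alpha>. natfam x X \<alpha> \<longrightarrow>
        (\<exists>!h. h \<in> hom X N \<and> (\<forall>c \<in> Obj C. \<forall>\<phi> \<in> Fn c x. \<Phi> c \<phi> \<cdot> h = \<alpha> c \<phi>)))"

lemma natfamI:
  assumes "x \<in> Obj C" "X \<in> Obj C"
    and "\<And>c \<phi>. c \<in> Obj C \<Longrightarrow> \<phi> \<in> Fn c x \<Longrightarrow> \<alpha> c \<phi> \<in> hom X c"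
    and "\<And>c \<phi> \<psi>. c \<in> Obj C \<Longrightarrow> \<phi> \<in> Fn c x \<Longrightarrow> \<psi> \<in> Fn c x \<Longrightarrow>
           \<alpha> c (\<lambda>f. \<phi> f + \<psi> f) = \<alpha> c \<phi> \<boxplus> \<alpha> c \<psi>"
    and "\<And>c \<phi> \<psi>. c \<in> Obj C \<Longrightarrow> \<phi> \<in> Fn c x \<Longrightarrow> \<psi> \<in> Fn c x \<Longrightarrow>
           (\<And>f. f \<in> hom c x \<Longrightarrow> \<phi> f = \<psi> f) \<Longrightarrow> \<alpha> c \<phi> = \<alpha> c \<psi>"
    and "\<And>c d u \<phi>. u \<in> hom c d \<Longrightarrow> \<phi> \<in> Fn c x \<Longrightarrow> u \<cdot> \<alpha> c \<phi> = \<alpha> d (\<lambda>f. \<phi> (f \<cdot> u))"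
  shows "natfam x X \<alpha>"
  using assms unfolding natfam_def by (intro conjI ballI allI impI) blast+

lemma natfamD:
  assumes "natfam x X \<alpha>"
  shows natfam_obj: "x \<in> Obj C" "X \<in> Obj C"
    and natfam_in: "\<And>c \<phi>. c \<in> Obj C \<Longrightarrow> \<phi> \<in> Fn c x \<Longrightarrow> \<alpha> c \<phi> \<in> hom X c"
    and natfam_add: "\<And>c \<phi> \<psi>. c \<in> Obj C \<Longrightarrow> \<phi> \<in> Fn c x \<Longrightarrow> \<psi> \<in> Fn c x \<Longrightarrow>
           \<alpha> c (\<lambda>f. \<phi> f + \<psi> f) = \<alpha> c \<phi> \<boxplus> \<alpha> c \<psi>"
    and natfam_cong: "\<And>c \<phi> \<psi>. c \<in> Obj C \<Longrightarrow> \<phi> \<in> Fn c x \<Longrightarrow> \<psi> \<in> Fn c x \<Longrightarrow>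
           (\<And>f. f \<in> hom c x \<Longrightarrow> \<phi> f = \<psi> f) \<Longrightarrow> \<alpha> c \<phi> = \<alpha> c \<psi>"
    and natfam_nat: "\<And>c d u \<phi>. u \<in> hom c d \<Longrightarrow> \<phi> \<in> Fn c x \<Longrightarrow> u \<cdot> \<alpha> c \<phi> = \<alpha> d (\<lambda>f. \<phi> (f \<cdot> u))"
  using assms hom_obj unfolding natfam_def by blast+

text \<open>Homogeneity is not a clause of \<open>natfam\<close>: it is naturality at the
  endomorphism k times the identity of c.\<close>

lemma natfam_scale:
  assumes a: "natfam x X \<alpha>" and c: "c \<in> Obj C" and \<phi>: "\<phi> \<in> Fn c x"
  shows "\<alpha> c (\<lambda>f. k * \<phi> f) = k \<star> \<alpha> c \<phi>"
proof -
  note i = id_in_hom[OF c]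
  note ki = scale_in[OF i]
  have "\<alpha> c (\<lambda>f. k * \<phi> f) = \<alpha> c (\<lambda>f. \<phi> (f \<cdot> (k \<star> Id C c)))"
  proof (rule natfam_cong[OF a c Fn_scale[OF \<phi>] Fn_precomp[OF \<phi> ki]])
    fix f assume f: "f \<in> hom c x"
    show "k * \<phi> f = \<phi> (f \<cdot> (k \<star> Id C c))"
      using \<phi> f comp_scale_right[OF i f] comp_id_right[OF f] by (simp add: functional_hom_iff)
  qed
  also have "\<dots> = (k \<star> Id C c) \<cdot> \<alpha> c \<phi>"
    by (rule natfam_nat[OF a ki \<phi>, symmetric])
  also have "\<dots> = k \<star> \<alpha> c \<phi>"
    using comp_scale_left[OF natfam_in[OF a c \<phi>] i] comp_id_left[OF natfam_in[OF a c \<phi>]] by simp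
  finally show ?thesis .
qed

lemma univ_natfam: "univ x N \<Phi> \<Longrightarrow> natfam x N \<Phi>"
  by (simp add: univ_def)

lemma univ_ex:
  assumes "univ x N \<Phi>" "natfam x X \<alpha>"
  obtains h where "h \<in> hom X N" "\<And>c \<phi>. c \<in> Obj C \<Longrightarrow> \<phi> \<in> Fn c x \<Longrightarrow> \<Phi> c \<phi> \<cdot> h = \<alpha> c \<phi>"
  using assms unfolding univ_def by (metis (no_types, lifting))

lemma natfam_comp:
  assumes "natfam x N \<Phi>" and h: "h \<in> hom X N"
  shows "natfam x X (\<lambda>c \<phi>. \<Phi> c \<phi> \<cdot> h)"
proof (rule natfamI)
  note [simp] = natfamD[OF assms(1)]
  show "\<Phi> c \<phi> \<cdot> h \<in> hom X c" if "c \<in> Obj C" "\<phi> \<in> Fn c x" for c \<phi>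
    using natfam_in[OF assms(1) that] h comp_in_hom by blast
  show "\<Phi> c (\<lambda>f. \<phi> f + \<psi> f) \<cdot> h = (\<Phi> c \<phi> \<cdot> h) \<boxplus> (\<Phi> c \<psi> \<cdot> h)"
    if "c \<in> Obj C" "\<phi> \<in> Fn c x" "\<psi> \<in> Fn c x" for c \<phi> \<psi>
    using that natfam_add[OF assms(1) that] natfam_in[OF assms(1)] h comp_add_left by metis
  show "\<Phi> c \<phi> \<cdot> h = \<Phi> c \<psi> \<cdot> h" if "c \<in> Obj C" "\<phi> \<in> Fn c x" "\<psi> \<in> Fn c x"
    "\<And>f. f \<in> hom c x \<Longrightarrow> \<phi> f = \<psi> f" for c \<phi> \<psi>
    using natfam_cong[OF assms(1) that] by simp
  show "u \<cdot> (\<Phi> c \<phi> \<cdot> h) = \<Phi> d (\<lambda>f. \<phi> (f \<cdot> u)) \<cdot> h" if "u \<in> hom c d" "\<phi> \<in> Fn c x" for c d u \<phi>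
    using that natfam_nat[OF assms(1) that] natfam_in[OF assms(1)] h comp_assoc hom_obj by metis
qed (use natfam_obj[OF assms(1)] hom_obj(1)[OF h] in auto)

lemma univ_unique:
  assumes "univ x N \<Phi>" "h \<in> hom X N" "h' \<in> hom X N"
    and "\<And>c \<phi>. c \<in> Obj C \<Longrightarrow> \<phi> \<in> Fn c x \<Longrightarrow> \<Phi> c \<phi> \<cdot> h = \<Phi> c \<phi> \<cdot> h'"
  shows "h = h'"
proof -
  have "natfam x X (\<lambda>c \<phi>. \<Phi> c \<phi> \<cdot> h)"
    using natfam_comp univ_natfam assms by blast
  then have "\<exists>!g. g \<in> hom X N \<and> (\<forall>c \<in> Obj C. \<forall>\<phi> \<in> Fn c x. \<Phi> c \<phi> \<cdot> g = \<Phi> c \<phi> \<cdot> h)"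
    using assms(1) unfolding univ_def by blast
  then show ?thesis using assms by (metis (no_types, lifting))
qed

lemma natfam_sum:
  assumes "natfam x X \<alpha>" "c \<in> Obj C" "\<And>i. i < n \<Longrightarrow> \<phi> i \<in> Fn c x"
  shows "(\<lambda>f. \<Sum>i<n. k i * \<phi> i f) \<in> Fn c x \<and>
         \<alpha> c (\<lambda>f. \<Sum>i<n. k i * \<phi> i f) = hsum X c (\<lambda>i. k i \<star> \<alpha> c (\<phi> i)) n"
  using assms(3)
proof (induction n)
  case 0
  \<comment> \<open>The empty sum: the zero functional is read as 0 times itself, so that
    homogeneity yields the zero arrow.\<close>
  have "\<alpha> c (\<lambda>f. 0 * 0) = 0 \<star> \<alpha> c (\<lambda>f. 0)"
    using natfam_scale[OF assms(1,2) Fn_zero] .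
  also have "\<dots> = ZeroArr C X c"
    using scale_zero natfam_in[OF assms(1,2) Fn_zero] by blast
  finally show ?case using Fn_zero by simp
next
  case (Suc n)
  then have IH: "(\<lambda>f. \<Sum>i<n. k i * \<phi> i f) \<in> Fn c x"
    "\<alpha> c (\<lambda>f. \<Sum>i<n. k i * \<phi> i f) = hsum X c (\<lambda>i. k i \<star> \<alpha> c (\<phi> i)) n" and n: "\<phi> n \<in> Fn c x"
    by auto
  have n': "(\<lambda>f. k n * \<phi> n f) \<in> Fn c x"
    using Fn_scale[OF n] .
  show ?case
    using natfam_add[OF assms(1,2) IH(1) n'] natfam_scale[OF assms(1,2) n, of "k n"] IH
      Fn_add[OF IH(1) n'] by simp
qed

end

section \<open>Ends as universal families\<close>

context linear_category
begin

text \<open>The arrow \<phi> \<otimes> d from V \<otimes> d to the ground field tensored with d,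
  which is d.\<close>

definition vt_ev where
  "vt_ev V P \<iota> d \<phi> = (THE h. h \<in> hom P d \<and> (\<forall>v \<in> carrier V. h \<cdot> \<iota> v = \<phi> v \<star> Id C d))"

context
  fixes V :: "('k, 'v) module" and d P :: 'o and \<iota> :: "'v \<Rightarrow> 'm"
  assumes vt: "is_vect_tensor C V d P \<iota>" and d: "d \<in> Obj C"
begin

lemma
  shows vt_obj: "P \<in> Obj C" and vt_vs: "kspace V" and vt_in: "v \<in> carrier V \<Longrightarrow> \<iota> v \<in> hom d P"
    and vt_add: "v \<in> carrier V \<Longrightarrow> w \<in> carrier V \<Longrightarrow> \<iota> (v \<oplus>\<^bsub>V\<^esub> w) = \<iota> v \<boxplus> \<iota> w"
    and vt_scale: "v \<in> carrier V \<Longrightarrow> \<iota> (k \<odot>\<^bsub>V\<^esub> v) = k \<star> \<iota> v"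
  using vt by (simp_all add: is_vect_tensor_def linear_map_iff kspace_def)

lemma vt_ex1:
  assumes "x \<in> Obj C" "\<And>v. v \<in> carrier V \<Longrightarrow> g v \<in> hom d x"
    and "\<And>v w. v \<in> carrier V \<Longrightarrow> w \<in> carrier V \<Longrightarrow> g (v \<oplus>\<^bsub>V\<^esub> w) = g v \<boxplus> g w"
    and "\<And>k v. v \<in> carrier V \<Longrightarrow> g (k \<odot>\<^bsub>V\<^esub> v) = k \<star> g v"
  shows "\<exists>!h. h \<in> hom P x \<and> (\<forall>v \<in> carrier V. h \<cdot> \<iota> v = g v)"
proof -
  have "linear_map (class_ring :: 'k ring) V (hom_space C d x) g"
    using assms vt_vs hom_vectorspace[OF d assms(1)] by (simp add: linear_map_iff kspace_def)
  then show ?thesis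
    using vt assms(1) unfolding is_vect_tensor_def by blast
qed

lemma vt_eq:
  assumes "h \<in> hom P x" "h' \<in> hom P x" "\<And>v. v \<in> carrier V \<Longrightarrow> h \<cdot> \<iota> v = h' \<cdot> \<iota> v"
  shows "h = h'"
proof -
  have x: "x \<in> Obj C"
    using hom_obj assms(1) by blast
  have "\<exists>!g. g \<in> hom P x \<and> (\<forall>v \<in> carrier V. g \<cdot> \<iota> v = h \<cdot> \<iota> v)"
    by (rule vt_ex1[OF x])
      (use assms(1) vt_in vt_add vt_scale comp_in_hom comp_add_right comp_scale_right in \<open>metis+\<close>)
  then show ?thesis using assms by (metis (no_types, lifting))
qed

lemma vt_ev:
  assumes "functional V \<phi>"
  shows vt_ev_in: "vt_ev V P \<iota> d \<phi> \<in> hom P d"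
    and vt_ev_comp: "v \<in> carrier V \<Longrightarrow> vt_ev V P \<iota> d \<phi> \<cdot> \<iota> v = \<phi> v \<star> Id C d"
proof -
  interpret D: kspace "hom_space C d d" using hom_kspace d by blast
  have "\<exists>!h. h \<in> hom P d \<and> (\<forall>v \<in> carrier V. h \<cdot> \<iota> v = \<phi> v \<star> Id C d)"
    by (rule vt_ex1[OF d])
      (use assms d id_in_hom scale_in D.add_smult D.smult_smult in \<open>auto simp: functional_def\<close>)
  from theI'[OF this]
  show "vt_ev V P \<iota> d \<phi> \<in> hom P d"
    and "v \<in> carrier V \<Longrightarrow> vt_ev V P \<iota> d \<phi> \<cdot> \<iota> v = \<phi> v \<star> Id C d"
    unfolding vt_ev_def by blast+
qed

lemma vt_ev_eqI:
  assumes "functional V \<phi>" "h \<in> hom P d" "\<And>v. v \<in> carrier V \<Longrightarrow> h \<cdot> \<iota> v = \<phi> v \<star> Id C d"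
  shows "vt_ev V P \<iota> d \<phi> = h"
  using vt_eq[OF vt_ev_in[OF assms(1)] assms(2)] vt_ev_comp[OF assms(1)] assms(3) by simp

lemma vt_ev_cong:
  assumes "functional V \<phi>" "functional V \<psi>" "\<And>v. v \<in> carrier V \<Longrightarrow> \<phi> v = \<psi> v"
  shows "vt_ev V P \<iota> d \<phi> = vt_ev V P \<iota> d \<psi>"
  using assms by (intro vt_ev_eqI) (simp_all add: vt_ev_in vt_ev_comp)

lemma vt_ev_add:
  assumes "functional V \<phi>" "functional V \<psi>"
  shows "vt_ev V P \<iota> d (\<lambda>v. \<phi> v + \<psi> v) = vt_ev V P \<iota> d \<phi> \<boxplus> vt_ev V P \<iota> d \<psi>"
proof (rule vt_ev_eqI)
  interpret D: kspace "hom_space C d d" using hom_kspace d by blast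
  show "functional V (\<lambda>v. \<phi> v + \<psi> v)"
    using assms by (simp add: functional_def algebra_simps)
  show "vt_ev V P \<iota> d \<phi> \<boxplus> vt_ev V P \<iota> d \<psi> \<in> hom P d"
    using assms vt_ev_in add_in by blast
  show "(vt_ev V P \<iota> d \<phi> \<boxplus> vt_ev V P \<iota> d \<psi>) \<cdot> \<iota> v = (\<phi> v + \<psi> v) \<star> Id C d" if "v \<in> carrier V" for v
    using that assms comp_add_left[OF vt_in[OF that] vt_ev_in[OF assms(1)] vt_ev_in[OF assms(2)]]
      vt_ev_comp D.add_smult id_in_hom[OF d] by simp
qed

lemma vt_vsum:
  "(\<And>i. i < n \<Longrightarrow> v i \<in> carrier V) \<Longrightarrow> \<iota> (vsum V v n) = hsum d P (\<lambda>i. \<iota> (v i)) n"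
proof (induction n)
  case 0
  interpret kspace V by (rule vt_vs)
  have "\<iota> (0 \<odot>\<^bsub>V\<^esub> \<zero>\<^bsub>V\<^esub>) = 0 \<star> \<iota> \<zero>\<^bsub>V\<^esub>"
    using vt_scale M.zero_closed by blast
  then show ?case using scale_zero[OF vt_in[OF M.zero_closed]] by simp
next
  case (Suc n)
  then show ?case using kspace.vsum_in[OF vt_vs] by (simp add: vt_add)
qed

text \<open>The arrows \<iota> (v i) and the evaluations at \<phi> i are the injections and
  projections of a biproduct of n copies of d. The universal property speaks of arrows out of P, and
  this decomposition gives a hold on arrows into P.\<close>

lemma vt_id:
  assumes db: "dual_basis V n v \<phi>"
  shows "Id C P = hsum P P (\<lambda>i. \<iota> (v i) \<cdot> vt_ev V P \<iota> d (\<phi> i)) n"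
proof (rule vt_eq)
  interpret kspace V by (rule vt_vs)
  have v: "v i \<in> carrier V" and f: "functional V (\<phi> i)" if "i < n" for i
    using db that by (simp_all add: dual_basis_def)
  have in': "\<iota> (v i) \<cdot> vt_ev V P \<iota> d (\<phi> i) \<in> hom P P" if "i < n" for i
    using comp_in_hom[OF vt_ev_in[OF f] vt_in[OF v]] that by blast
  show "Id C P \<in> hom P P"
    by (rule id_in_hom[OF vt_obj])
  show "hsum P P (\<lambda>i. \<iota> (v i) \<cdot> vt_ev V P \<iota> d (\<phi> i)) n \<in> hom P P"
    by (rule hsum_in[OF vt_obj vt_obj in'])
  show "Id C P \<cdot> \<iota> w = hsum P P (\<lambda>i. \<iota> (v i) \<cdot> vt_ev V P \<iota> d (\<phi> i)) n \<cdot> \<iota> w" if w: "w \<in> carrier V" for w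
  proof -
    have "hsum P P (\<lambda>i. \<iota> (v i) \<cdot> vt_ev V P \<iota> d (\<phi> i)) n \<cdot> \<iota> w
        = hsum d P (\<lambda>i. (\<iota> (v i) \<cdot> vt_ev V P \<iota> d (\<phi> i)) \<cdot> \<iota> w) n"
      by (rule hsum_comp[OF vt_in[OF w] vt_obj in'])
    also have "\<dots> = hsum d P (\<lambda>i. \<iota> (\<phi> i w \<odot>\<^bsub>V\<^esub> v i)) n"
    proof (rule hsum_cong)
      fix i assume i: "i < n"
      have "(\<iota> (v i) \<cdot> vt_ev V P \<iota> d (\<phi> i)) \<cdot> \<iota> w = \<iota> (v i) \<cdot> (\<phi> i w \<star> Id C d)"
        using comp_assoc[OF vt_in[OF w] vt_ev_in[OF f[OF i]] vt_in[OF v[OF i]]]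
          vt_ev_comp[OF f[OF i] w] by simp
      also have "\<dots> = \<iota> (\<phi> i w \<odot>\<^bsub>V\<^esub> v i)"
        using comp_scale_right[OF id_in_hom[OF d] vt_in[OF v[OF i]]] comp_id_right[OF vt_in[OF v[OF i]]]
          vt_scale[OF v[OF i]] by simp
      finally show "(\<iota> (v i) \<cdot> vt_ev V P \<iota> d (\<phi> i)) \<cdot> \<iota> w = \<iota> (\<phi> i w \<odot>\<^bsub>V\<^esub> v i)" .
    qed
    also have "\<dots> = \<iota> (vsum V (\<lambda>i. \<phi> i w \<odot>\<^bsub>V\<^esub> v i) n)"
      using v by (intro vt_vsum[symmetric]) simp
    also have "\<dots> = \<iota> w"
      using db w by (simp add: dual_basis_def)
    finally show ?thesis
      using comp_id_left[OF vt_in[OF w]] by simp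
  qed
qed

lemma vt_ext:
  assumes db: "dual_basis V n v \<phi>" and f: "f \<in> hom X P" and g: "g \<in> hom X P"
    and eq: "\<And>\<psi>. functional V \<psi> \<Longrightarrow> vt_ev V P \<iota> d \<psi> \<cdot> f = vt_ev V P \<iota> d \<psi> \<cdot> g"
  shows "f = g"
proof -
  have v: "v i \<in> carrier V" and fn: "functional V (\<phi> i)" if "i < n" for i
    using db that by (simp_all add: dual_basis_def)
  have "h = hsum X P (\<lambda>i. \<iota> (v i) \<cdot> (vt_ev V P \<iota> d (\<phi> i) \<cdot> h)) n" if h: "h \<in> hom X P" for h
  proof -
    have "h = hsum P P (\<lambda>i. \<iota> (v i) \<cdot> vt_ev V P \<iota> d (\<phi> i)) n \<cdot> h"
      using vt_id[OF db] comp_id_left[OF h] by simp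
    also have "\<dots> = hsum X P (\<lambda>i. (\<iota> (v i) \<cdot> vt_ev V P \<iota> d (\<phi> i)) \<cdot> h) n"
      using comp_in_hom[OF vt_ev_in[OF fn] vt_in[OF v]] by (intro hsum_comp[OF h vt_obj])
    also have "\<dots> = hsum X P (\<lambda>i. \<iota> (v i) \<cdot> (vt_ev V P \<iota> d (\<phi> i) \<cdot> h)) n"
      using comp_assoc[OF h vt_ev_in[OF fn] vt_in[OF v]] by (intro hsum_cong)
    finally show ?thesis .
  qed
  from this[OF f] this[OF g] show ?thesis
    using eq[OF fn] hsum_cong[of n "\<lambda>i. \<iota> (v i) \<cdot> (vt_ev V P \<iota> d (\<phi> i) \<cdot> f)"
        "\<lambda>i. \<iota> (v i) \<cdot> (vt_ev V P \<iota> d (\<phi> i) \<cdot> g)" X P] by simp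
qed

text \<open>By \<open>vt_id\<close> an arrow into P with the prescribed evaluations must be the sum
  of the \<iota> (v i) after \<alpha> (\<phi> i). The expansion hypothesis expresses linearity of
  \<alpha> in coordinates.\<close>

lemma vt_lift:
  assumes db: "dual_basis V n v \<phi>" and X: "X \<in> Obj C"
    and \<alpha>: "\<And>\<psi>. functional V \<psi> \<Longrightarrow> \<alpha> \<psi> \<in> hom X d"
    and exp: "\<And>\<psi>. functional V \<psi> \<Longrightarrow> \<alpha> \<psi> = hsum X d (\<lambda>i. \<psi> (v i) \<star> \<alpha> (\<phi> i)) n"
  shows "\<exists>f \<in> hom X P. \<forall>\<psi>. functional V \<psi> \<longrightarrow> vt_ev V P \<iota> d \<psi> \<cdot> f = \<alpha> \<psi>"
proof (intro bexI allI impI)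
  have v: "v i \<in> carrier V" and fn: "functional V (\<phi> i)" if "i < n" for i
    using db that by (simp_all add: dual_basis_def)
  let ?f = "hsum X P (\<lambda>i. \<iota> (v i) \<cdot> \<alpha> (\<phi> i)) n"
  have t: "\<iota> (v i) \<cdot> \<alpha> (\<phi> i) \<in> hom X P" if "i < n" for i
    by (rule comp_in_hom[OF \<alpha>[OF fn[OF that]] vt_in[OF v[OF that]]])
  show "?f \<in> hom X P"
    using X vt_obj t by (intro hsum_in)
  fix \<psi> assume \<psi>: "functional V \<psi>"
  have "vt_ev V P \<iota> d \<psi> \<cdot> ?f = hsum X d (\<lambda>i. vt_ev V P \<iota> d \<psi> \<cdot> (\<iota> (v i) \<cdot> \<alpha> (\<phi> i))) n"
    using t by (intro comp_hsum[OF vt_ev_in[OF \<psi>] X])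
  also have "\<dots> = hsum X d (\<lambda>i. \<psi> (v i) \<star> \<alpha> (\<phi> i)) n"
  proof (rule hsum_cong)
    fix i assume i: "i < n"
    have "vt_ev V P \<iota> d \<psi> \<cdot> (\<iota> (v i) \<cdot> \<alpha> (\<phi> i)) = (vt_ev V P \<iota> d \<psi> \<cdot> \<iota> (v i)) \<cdot> \<alpha> (\<phi> i)"
      using comp_assoc[OF \<alpha>[OF fn[OF i]] vt_in[OF v[OF i]] vt_ev_in[OF \<psi>]] by simp
    also have "\<dots> = \<psi> (v i) \<star> \<alpha> (\<phi> i)"
      using vt_ev_comp[OF \<psi> v[OF i]] comp_scale_left[OF \<alpha>[OF fn[OF i]] id_in_hom[OF d]]
        comp_id_left[OF \<alpha>[OF fn[OF i]]] by simp
    finally show "vt_ev V P \<iota> d \<psi> \<cdot> (\<iota> (v i) \<cdot> \<alpha> (\<phi> i)) = \<psi> (v i) \<star> \<alpha> (\<phi> i)" .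
  qed
  finally show "vt_ev V P \<iota> d \<psi> \<cdot> ?f = \<alpha> \<psi>"
    using exp[OF \<psi>] by simp
qed

lemma vt_arr:
  fixes V' :: "('k, 'w) module"
  assumes vt': "is_vect_tensor C V' d' P' \<iota>'" and g: "g \<in> hom d d'"
    and l: "\<And>v. v \<in> carrier V \<Longrightarrow> \<theta> v \<in> carrier V'"
      "\<And>v w. v \<in> carrier V \<Longrightarrow> w \<in> carrier V \<Longrightarrow> \<theta> (v \<oplus>\<^bsub>V\<^esub> w) = \<theta> v \<oplus>\<^bsub>V'\<^esub> \<theta> w"
      "\<And>k v. v \<in> carrier V \<Longrightarrow> \<theta> (k \<odot>\<^bsub>V\<^esub> v) = k \<odot>\<^bsub>V'\<^esub> \<theta> v"
  shows vt_arr_in: "vect_tensor_arr C V P \<iota> P' \<iota>' \<theta> g \<in> hom P P'"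
    and vt_arr_comp: "v \<in> carrier V \<Longrightarrow> vect_tensor_arr C V P \<iota> P' \<iota>' \<theta> g \<cdot> \<iota> v = \<iota>' (\<theta> v) \<cdot> g"
proof -
  have vb: "P' \<in> Obj C" "\<And>v. v \<in> carrier V' \<Longrightarrow> \<iota>' v \<in> hom d' P'"
    "\<And>v w. v \<in> carrier V' \<Longrightarrow> w \<in> carrier V' \<Longrightarrow> \<iota>' (v \<oplus>\<^bsub>V'\<^esub> w) = \<iota>' v \<boxplus> \<iota>' w"
    "\<And>k v. v \<in> carrier V' \<Longrightarrow> \<iota>' (k \<odot>\<^bsub>V'\<^esub> v) = k \<star> \<iota>' v"
    using vt' by (simp_all add: is_vect_tensor_def linear_map_iff)
  have "\<exists>!h. h \<in> hom P P' \<and> (\<forall>v \<in> carrier V. h \<cdot> \<iota> v = \<iota>' (\<theta> v) \<cdot> g)"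
  proof (rule vt_ex1[OF vb(1)])
    show "\<iota>' (\<theta> v) \<cdot> g \<in> hom d P'" if "v \<in> carrier V" for v
      using comp_in_hom[OF g vb(2)[OF l(1)[OF that]]] .
    show "\<iota>' (\<theta> (v \<oplus>\<^bsub>V\<^esub> w)) \<cdot> g = (\<iota>' (\<theta> v) \<cdot> g) \<boxplus> (\<iota>' (\<theta> w) \<cdot> g)"
      if "v \<in> carrier V" "w \<in> carrier V" for v w
      using that by (simp add: l vb comp_add_left[OF g vb(2)[OF l(1)] vb(2)[OF l(1)]])
    show "\<iota>' (\<theta> (k \<odot>\<^bsub>V\<^esub> v)) \<cdot> g = k \<star> (\<iota>' (\<theta> v) \<cdot> g)" if "v \<in> carrier V" for k v
      using that by (simp add: l vb comp_scale_left[OF g vb(2)[OF l(1)]])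
  qed
  from theI'[OF this] show "vect_tensor_arr C V P \<iota> P' \<iota>' \<theta> g \<in> hom P P'"
    and "v \<in> carrier V \<Longrightarrow> vect_tensor_arr C V P \<iota> P' \<iota>' \<theta> g \<cdot> \<iota> v = \<iota>' (\<theta> v) \<cdot> g"
    unfolding vect_tensor_arr_def by blast+
qed

end

text \<open>Both sides are the arrow (\<psi> \<theta>) \<otimes> g, with the functional applied
  after or before g.\<close>

lemma vt_ev_arr:
  fixes V :: "('k, 'v) module" and V' :: "('k, 'w) module"
  assumes vt: "is_vect_tensor C V d P \<iota>" and d: "d \<in> Obj C"
    and vt': "is_vect_tensor C V' d' P' \<iota>'" and d': "d' \<in> Obj C" and g: "g \<in> hom d d'"
    and l: "\<And>v. v \<in> carrier V \<Longrightarrow> \<theta> v \<in> carrier V'"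
      "\<And>v w. v \<in> carrier V \<Longrightarrow> w \<in> carrier V \<Longrightarrow> \<theta> (v \<oplus>\<^bsub>V\<^esub> w) = \<theta> v \<oplus>\<^bsub>V'\<^esub> \<theta> w"
      "\<And>k v. v \<in> carrier V \<Longrightarrow> \<theta> (k \<odot>\<^bsub>V\<^esub> v) = k \<odot>\<^bsub>V'\<^esub> \<theta> v"
    and \<psi>: "functional V' \<psi>"
  shows "vt_ev V' P' \<iota>' d' \<psi> \<cdot> vect_tensor_arr C V P \<iota> P' \<iota>' \<theta> g = g \<cdot> vt_ev V P \<iota> d (\<lambda>v. \<psi> (\<theta> v))"
proof (rule vt_eq[OF vt d])
  let ?T = "vect_tensor_arr C V P \<iota> P' \<iota>' \<theta> g"
  have T: "?T \<in> hom P P'" "\<And>v. v \<in> carrier V \<Longrightarrow> ?T \<cdot> \<iota> v = \<iota>' (\<theta> v) \<cdot> g"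
    using vt_arr[OF vt d vt' g, of \<theta>] l by blast+
  have f: "functional V (\<lambda>v. \<psi> (\<theta> v))"
    using \<psi> l by (simp add: functional_def)
  note e' = vt_ev_in[OF vt' d' \<psi>] and e = vt_ev_in[OF vt d f]
  show "vt_ev V' P' \<iota>' d' \<psi> \<cdot> ?T \<in> hom P d'" "g \<cdot> vt_ev V P \<iota> d (\<lambda>v. \<psi> (\<theta> v)) \<in> hom P d'"
    using comp_in_hom[OF T(1) e'] comp_in_hom[OF e g] .
  fix v assume v: "v \<in> carrier V"
  note \<iota> = vt_in[OF vt d v] and \<iota>' = vt_in[OF vt' d' l(1)[OF v]]
  have "(vt_ev V' P' \<iota>' d' \<psi> \<cdot> ?T) \<cdot> \<iota> v = vt_ev V' P' \<iota>' d' \<psi> \<cdot> (\<iota>' (\<theta> v) \<cdot> g)"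
    using comp_assoc[OF \<iota> T(1) e'] T(2)[OF v] by simp
  also have "\<dots> = (vt_ev V' P' \<iota>' d' \<psi> \<cdot> \<iota>' (\<theta> v)) \<cdot> g"
    using comp_assoc[OF g \<iota>' e'] by simp
  also have "\<dots> = \<psi> (\<theta> v) \<star> g"
    using vt_ev_comp[OF vt' d' \<psi> l(1)[OF v]] comp_scale_left[OF g id_in_hom[OF d']] comp_id_left[OF g] by simp
  also have "\<dots> = g \<cdot> (vt_ev V P \<iota> d (\<lambda>v. \<psi> (\<theta> v)) \<cdot> \<iota> v)"
    using vt_ev_comp[OF vt d f v] comp_scale_right[OF id_in_hom[OF d] g] comp_id_right[OF g] by simp
  also have "\<dots> = (g \<cdot> vt_ev V P \<iota> d (\<lambda>v. \<psi> (\<theta> v))) \<cdot> \<iota> v"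
    using comp_assoc[OF \<iota> e g] by simp
  finally show "(vt_ev V' P' \<iota>' d' \<psi> \<cdot> ?T) \<cdot> \<iota> v = (g \<cdot> vt_ev V P \<iota> d (\<lambda>v. \<psi> (\<theta> v))) \<cdot> \<iota> v" .
qed

end

context linear_monoidal_category
begin

section \<open>Wedges of Hom(c, 1) \<otimes> d as natural families\<close>

context
  fixes TO :: "'o \<Rightarrow> 'o \<Rightarrow> 'o" and \<iota> :: "'o \<Rightarrow> 'o \<Rightarrow> 'm \<Rightarrow> 'm"
  assumes TO: "\<And>c d. c \<in> Obj C \<Longrightarrow> d \<in> Obj C \<Longrightarrow>
      is_vect_tensor C (hom_space C c (Unit C)) d (TO c d) (\<iota> c d)"
    and fin: "\<And>c. c \<in> Obj C \<Longrightarrow> \<exists>n v \<phi>. dual_basis (hom_space C c (Unit C)) n v \<phi>"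
begin

abbreviation tev where "tev c d \<equiv> vt_ev (hom_space C c (Unit C)) (TO c d) (\<iota> c d) d"

lemma tev_arr:
  assumes f: "f \<in> hom c' c" and g: "g \<in> hom d d'" and \<psi>: "\<psi> \<in> Fn c' (Unit C)"
  shows "hom_unit_tensor_arr C TO \<iota> f g \<in> hom (TO c d) (TO c' d')"
    and "tev c' d' \<psi> \<cdot> hom_unit_tensor_arr C TO \<iota> f g = g \<cdot> tev c d (\<lambda>v. \<psi> (v \<cdot> f))"
proof -
  have o: "c \<in> Obj C" "c' \<in> Obj C" "d \<in> Obj C" "d' \<in> Obj C"
    using f g hom_obj by blast+
  have l: "\<And>v. v \<in> carrier (hom_space C c (Unit C)) \<Longrightarrow> v \<cdot> f \<in> carrier (hom_space C c' (Unit C))"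
    "\<And>v w. v \<in> carrier (hom_space C c (Unit C)) \<Longrightarrow> w \<in> carrier (hom_space C c (Unit C)) \<Longrightarrow>
      (v \<oplus>\<^bsub>hom_space C c (Unit C)\<^esub> w) \<cdot> f = (v \<cdot> f) \<oplus>\<^bsub>hom_space C c' (Unit C)\<^esub> (w \<cdot> f)"
    "\<And>k v. v \<in> carrier (hom_space C c (Unit C)) \<Longrightarrow>
      (k \<odot>\<^bsub>hom_space C c (Unit C)\<^esub> v) \<cdot> f = k \<odot>\<^bsub>hom_space C c' (Unit C)\<^esub> (v \<cdot> f)"
    using f comp_in_hom comp_add_left comp_scale_left by auto
  have h: "hom_unit_tensor_arr C TO \<iota> f g = vect_tensor_arr C (hom_space C c (Unit C)) (TO c d)
      (\<iota> c d) (TO c' d') (\<iota> c' d') (\<lambda>v. v \<cdot> f) g"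
    unfolding hom_unit_tensor_arr_def Let_def using hom_dom_cod[OF f] hom_dom_cod[OF g] by simp
  show "hom_unit_tensor_arr C TO \<iota> f g \<in> hom (TO c d) (TO c' d')"
    unfolding h by (rule vt_arr_in[OF TO[OF o(1,3)] o(3) TO[OF o(2,4)] g l])
  show "tev c' d' \<psi> \<cdot> hom_unit_tensor_arr C TO \<iota> f g = g \<cdot> tev c d (\<lambda>v. \<psi> (v \<cdot> f))"
    unfolding h by (rule vt_ev_arr[OF TO[OF o(1,3)] o(3) TO[OF o(2,4)] o(4) g l \<psi>[unfolded mem_Collect_eq]])
qed

lemma tev_ext:
  assumes "c \<in> Obj C" "d \<in> Obj C" "f \<in> hom X (TO c d)" "g \<in> hom X (TO c d)"
    and "\<And>\<psi>. \<psi> \<in> Fn c (Unit C) \<Longrightarrow> tev c d \<psi> \<cdot> f = tev c d \<psi> \<cdot> g"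
  shows "f = g"
  using vt_ext[OF TO[OF assms(1,2)] assms(2) _ assms(3,4)] fin[OF assms(1)] assms(5) by blast

lemma tev_in: "c \<in> Obj C \<Longrightarrow> d \<in> Obj C \<Longrightarrow> \<psi> \<in> Fn c (Unit C) \<Longrightarrow> tev c d \<psi> \<in> hom (TO c d) d"
  using vt_ev_in[OF TO] by blast

text \<open>The functor acts on Hom(c, 1) by composition with \<open>Id C c\<close>, which may
  change \<phi> off the hom-space although not on it; the evaluation only sees the latter.\<close>

lemma tev_comp_id:
  assumes c: "c \<in> Obj C" and \<phi>: "\<phi> \<in> Fn c (Unit C)"
  shows "tev c c (\<lambda>f. \<phi> (f \<cdot> Id C c)) = tev c c \<phi>"
proof (rule vt_ev_cong[OF TO[OF c c] c])
  show "functional (hom_space C c (Unit C)) (\<lambda>f. \<phi> (f \<cdot> Id C c))"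
    using Fn_precomp[OF \<phi> id_in_hom[OF c]] by simp
  show "functional (hom_space C c (Unit C)) \<phi>"
    using \<phi> by simp
  show "\<phi> (v \<cdot> Id C c) = \<phi> v" if "v \<in> carrier (hom_space C c (Unit C))" for v
    using that comp_id_right[of v c "Unit C"] by simp
qed

text \<open>Evaluating the wedge condition for u at \<phi> gives naturality at u: one side
  contributes u after the evaluation at \<phi>, the other the evaluation at \<phi> precomposed with
  u.\<close>

lemma wedge_natfam:
  assumes w: "is_wedge C C TO (hom_unit_tensor_arr C TO \<iota>) X \<pi>"
  shows "natfam (Unit C) X (\<lambda>c \<phi>. tev c c \<phi> \<cdot> \<pi> c)"
proof (rule natfamI)
  have X: "X \<in> Obj C" and \<pi>: "\<And>c. c \<in> Obj C \<Longrightarrow> \<pi> c \<in> hom X (TO c c)"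
    and eq: "\<And>c d f. f \<in> hom c d \<Longrightarrow> hom_unit_tensor_arr C TO \<iota> (Id C c) f \<cdot> \<pi> c =
      hom_unit_tensor_arr C TO \<iota> f (Id C d) \<cdot> \<pi> d"
    using w hom_obj unfolding is_wedge_def by blast+
  show "Unit C \<in> Obj C" "X \<in> Obj C"
    using unit_obj X by auto
  show "tev c c \<phi> \<cdot> \<pi> c \<in> hom X c" if "c \<in> Obj C" "\<phi> \<in> Fn c (Unit C)" for c \<phi>
    using comp_in_hom[OF \<pi> tev_in] that by blast
  show "tev c c (\<lambda>f. \<phi> f + \<psi> f) \<cdot> \<pi> c = (tev c c \<phi> \<cdot> \<pi> c) \<boxplus> (tev c c \<psi> \<cdot> \<pi> c)"
    if "c \<in> Obj C" "\<phi> \<in> Fn c (Unit C)" "\<psi> \<in> Fn c (Unit C)" for c \<phi> \<psi>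
    using that vt_ev_add[OF TO] comp_add_left[OF \<pi> tev_in tev_in] by simp
  show "tev c c \<phi> \<cdot> \<pi> c = tev c c \<psi> \<cdot> \<pi> c"
    if "c \<in> Obj C" "\<phi> \<in> Fn c (Unit C)" "\<psi> \<in> Fn c (Unit C)" "\<And>f. f \<in> hom c (Unit C) \<Longrightarrow> \<phi> f = \<psi> f" for c \<phi> \<psi>
  proof -
    have "tev c c \<phi> = tev c c \<psi>"
      by (rule vt_ev_cong[OF TO[OF that(1,1)] that(1)]) (use that in simp_all)
    then show ?thesis by (simp only:)
  qed
  show "u \<cdot> (tev c c \<phi> \<cdot> \<pi> c) = tev d d (\<lambda>f. \<phi> (f \<cdot> u)) \<cdot> \<pi> d"
    if u: "u \<in> hom c d" and \<phi>: "\<phi> \<in> Fn c (Unit C)" for c d u \<phi>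
  proof -
    have o: "c \<in> Obj C" "d \<in> Obj C"
      using u hom_obj by blast+
    have \<phi>u: "(\<lambda>f. \<phi> (f \<cdot> u)) \<in> Fn d (Unit C)"
      by (rule Fn_precomp[OF \<phi> u])
    note 1 = tev_comp_id[OF o(1) \<phi>]
    note T1 = tev_arr[OF id_in_hom[OF o(1)] u \<phi>] and T2 = tev_arr[OF u id_in_hom[OF o(2)] \<phi>]
    have "u \<cdot> (tev c c \<phi> \<cdot> \<pi> c) = (u \<cdot> tev c c \<phi>) \<cdot> \<pi> c"
      by (simp only: comp_assoc[OF \<pi>[OF o(1)] tev_in[OF o(1,1) \<phi>] u])
    also have "\<dots> = (tev c d \<phi> \<cdot> hom_unit_tensor_arr C TO \<iota> (Id C c) u) \<cdot> \<pi> c"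
      by (simp only: T1(2) 1)
    also have "\<dots> = tev c d \<phi> \<cdot> (hom_unit_tensor_arr C TO \<iota> u (Id C d) \<cdot> \<pi> d)"
      by (simp only: comp_assoc[OF \<pi>[OF o(1)] T1(1) tev_in[OF o \<phi>]] eq[OF u])
    also have "\<dots> = (Id C d \<cdot> tev d d (\<lambda>v. \<phi> (v \<cdot> u))) \<cdot> \<pi> d"
      by (simp only: comp_assoc[OF \<pi>[OF o(2)] T2(1) tev_in[OF o \<phi>], symmetric] T2(2))
    finally show ?thesis
      by (simp only: comp_id_left[OF tev_in[OF o(2,2) \<phi>u]])
  qed
qed

text \<open>Finite dimension enters here: the components are built by \<open>vt_lift\<close> from a
  basis of Hom(c, 1), and the wedge condition holds because evaluations separate arrows into Hom(c,
  1) \<otimes> d.\<close>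

lemma natfam_wedge:
  assumes n: "natfam (Unit C) X \<alpha>"
  shows "\<exists>\<pi>. is_wedge C C TO (hom_unit_tensor_arr C TO \<iota>) X \<pi> \<and>
           (\<forall>c \<in> Obj C. \<forall>\<phi> \<in> Fn c (Unit C). tev c c \<phi> \<cdot> \<pi> c = \<alpha> c \<phi>)"
proof -
  have X: "X \<in> Obj C"
    using natfam_obj[OF n] by simp
  have "\<exists>p \<in> hom X (TO c c). \<forall>\<phi>. functional (hom_space C c (Unit C)) \<phi> \<longrightarrow> tev c c \<phi> \<cdot> p = \<alpha> c \<phi>"
    if c: "c \<in> Obj C" for c
  proof -
    obtain m v \<phi> where db: "dual_basis (hom_space C c (Unit C)) m v \<phi>"
      using fin[OF c] by blast
    interpret V: kspace "hom_space C c (Unit C)"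
      using hom_kspace c unit_obj by blast
    show ?thesis
    proof (rule vt_lift[OF TO[OF c c] c db X])
      fix \<psi> assume \<psi>: "functional (hom_space C c (Unit C)) \<psi>"
      then show "\<alpha> c \<psi> \<in> hom X c"
        using natfam_in[OF n c] by blast
      have \<phi>: "\<phi> i \<in> Fn c (Unit C)" if "i < m" for i
        using db that by (simp add: dual_basis_def)
      note s = natfam_sum[OF n c \<phi>, where n = m and k = "\<lambda>i. \<psi> (v i)", simplified]
      have "\<alpha> c \<psi> = \<alpha> c (\<lambda>f. \<Sum>i<m. \<psi> (v i) * \<phi> i f)"
        using natfam_cong[OF n c, of \<psi> "\<lambda>f. \<Sum>i<m. \<psi> (v i) * \<phi> i f"] \<psi> s
          V.functional_expand[OF db \<psi>] by simp
      then show "\<alpha> c \<psi> = hsum X c (\<lambda>i. \<psi> (v i) \<star> \<alpha> c (\<phi> i)) m"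
        using s by simp
    qed
  qed
  then obtain \<pi> where \<pi>: "\<And>c. c \<in> Obj C \<Longrightarrow> \<pi> c \<in> hom X (TO c c)"
    and \<pi>\<alpha>: "\<And>c \<phi>. c \<in> Obj C \<Longrightarrow> \<phi> \<in> Fn c (Unit C) \<Longrightarrow> tev c c \<phi> \<cdot> \<pi> c = \<alpha> c \<phi>"
    by (metis mem_Collect_eq)
  have "hom_unit_tensor_arr C TO \<iota> (Id C c) u \<cdot> \<pi> c = hom_unit_tensor_arr C TO \<iota> u (Id C d) \<cdot> \<pi> d"
    if u: "u \<in> hom c d" for c d u
  proof -
    have o: "c \<in> Obj C" "d \<in> Obj C"
      using u hom_obj by blast+
    note T1 = tev_arr[OF id_in_hom[OF o(1)] u] and T2 = tev_arr[OF u id_in_hom[OF o(2)]]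
    \<comment> \<open>\<open>tev_arr\<close> states the typing together with a functional; the zero
      functional is supplied to obtain the typing alone.\<close>
    note T1i = T1(1)[OF Fn_zero] and T2i = T2(1)[OF Fn_zero]
    show ?thesis
    proof (rule tev_ext[OF o])
      show "hom_unit_tensor_arr C TO \<iota> (Id C c) u \<cdot> \<pi> c \<in> hom X (TO c d)"
        "hom_unit_tensor_arr C TO \<iota> u (Id C d) \<cdot> \<pi> d \<in> hom X (TO c d)"
        using comp_in_hom[OF \<pi>[OF o(1)] T1i] comp_in_hom[OF \<pi>[OF o(2)] T2i] .
      fix \<phi> assume \<phi>: "\<phi> \<in> Fn c (Unit C)"
      have \<phi>u: "(\<lambda>f. \<phi> (f \<cdot> u)) \<in> Fn d (Unit C)"
        by (rule Fn_precomp[OF \<phi> u])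
      note 1 = tev_comp_id[OF o(1) \<phi>]
      have "tev c d \<phi> \<cdot> (hom_unit_tensor_arr C TO \<iota> (Id C c) u \<cdot> \<pi> c) = (u \<cdot> tev c c \<phi>) \<cdot> \<pi> c"
        by (simp only: comp_assoc[OF \<pi>[OF o(1)] T1i tev_in[OF o \<phi>], symmetric] T1(2)[OF \<phi>] 1)
      also have "\<dots> = u \<cdot> \<alpha> c \<phi>"
        by (simp only: comp_assoc[OF \<pi>[OF o(1)] tev_in[OF o(1,1) \<phi>] u] \<pi>\<alpha>[OF o(1) \<phi>])
      also have "\<dots> = tev d d (\<lambda>f. \<phi> (f \<cdot> u)) \<cdot> \<pi> d"
        by (simp only: natfam_nat[OF n u \<phi>] \<pi>\<alpha>[OF o(2) \<phi>u])
      also have "\<dots> = tev c d \<phi> \<cdot> (hom_unit_tensor_arr C TO \<iota> u (Id C d) \<cdot> \<pi> d)"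
        by (simp only: comp_assoc[OF \<pi>[OF o(2)] T2i tev_in[OF o \<phi>], symmetric] T2(2)[OF \<phi>]
          comp_id_left[OF tev_in[OF o(2,2) \<phi>u]])
      finally show "tev c d \<phi> \<cdot> (hom_unit_tensor_arr C TO \<iota> (Id C c) u \<cdot> \<pi> c) =
          tev c d \<phi> \<cdot> (hom_unit_tensor_arr C TO \<iota> u (Id C d) \<cdot> \<pi> d)" .
    qed
  qed
  then show ?thesis
    using \<pi> \<pi>\<alpha> X unfolding is_wedge_def by (intro exI[of _ \<pi>]) blast
qed

lemma wedge_factor_iff:
  assumes w: "is_wedge C C TO (hom_unit_tensor_arr C TO \<iota>) D \<pi>"
    and r: "is_wedge C C TO (hom_unit_tensor_arr C TO \<iota>) X \<rho>" and h: "h \<in> hom X D"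
  shows "(\<forall>c \<in> Obj C. \<pi> c \<cdot> h = \<rho> c) \<longleftrightarrow>
         (\<forall>c \<in> Obj C. \<forall>\<phi> \<in> Fn c (Unit C). (tev c c \<phi> \<cdot> \<pi> c) \<cdot> h = tev c c \<phi> \<cdot> \<rho> c)"
proof -
  have \<pi>: "\<pi> c \<in> hom D (TO c c)" and \<rho>: "\<rho> c \<in> hom X (TO c c)" if "c \<in> Obj C" for c
    using w r that by (simp_all add: is_wedge_def)
  have a: "(tev c c \<phi> \<cdot> \<pi> c) \<cdot> h = tev c c \<phi> \<cdot> (\<pi> c \<cdot> h)" if "c \<in> Obj C" "\<phi> \<in> Fn c (Unit C)" for c \<phi>
    using comp_assoc[OF h \<pi> tev_in] that by blast
  show ?thesis
  proof (intro iffI ballI)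
    fix c assume H: "\<forall>c \<in> Obj C. \<forall>\<phi> \<in> Fn c (Unit C). (tev c c \<phi> \<cdot> \<pi> c) \<cdot> h = tev c c \<phi> \<cdot> \<rho> c"
      and c: "c \<in> Obj C"
    show "\<pi> c \<cdot> h = \<rho> c"
      using tev_ext[OF c c comp_in_hom[OF h \<pi>[OF c]] \<rho>[OF c]] H c a[OF c] by simp
  qed (use a in simp)
qed

text \<open>Wedges and natural families with the same source correspond to each other compatibly
  with precomposition, so a wedge is universal exactly when its family is.\<close>

lemma is_end_iff_univ:
  assumes w: "is_wedge C C TO (hom_unit_tensor_arr C TO \<iota>) D \<pi>"
  shows "is_end C C TO (hom_unit_tensor_arr C TO \<iota>) D \<pi> \<longleftrightarrow>
         univ (Unit C) D (\<lambda>c \<phi>. tev c c \<phi> \<cdot> \<pi> c)"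
proof
  assume E: "is_end C C TO (hom_unit_tensor_arr C TO \<iota>) D \<pi>"
  show "univ (Unit C) D (\<lambda>c \<phi>. tev c c \<phi> \<cdot> \<pi> c)"
    unfolding univ_def
  proof (intro conjI allI impI)
    show "natfam (Unit C) D (\<lambda>c \<phi>. tev c c \<phi> \<cdot> \<pi> c)"
      by (rule wedge_natfam[OF w])
    fix X \<alpha> assume "natfam (Unit C) X \<alpha>"
    then obtain \<rho> where r: "is_wedge C C TO (hom_unit_tensor_arr C TO \<iota>) X \<rho>"
      and \<rho>: "\<forall>c \<in> Obj C. \<forall>\<phi> \<in> Fn c (Unit C). tev c c \<phi> \<cdot> \<rho> c = \<alpha> c \<phi>"
      using natfam_wedge by blast
    have "\<exists>!h. h \<in> hom X D \<and> (\<forall>c \<in> Obj C. \<pi> c \<cdot> h = \<rho> c)"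
      using E r unfolding is_end_def by blast
    moreover have "(h \<in> hom X D \<and> (\<forall>c \<in> Obj C. \<pi> c \<cdot> h = \<rho> c)) \<longleftrightarrow>
      (h \<in> hom X D \<and> (\<forall>c \<in> Obj C. \<forall>\<phi> \<in> Fn c (Unit C). (tev c c \<phi> \<cdot> \<pi> c) \<cdot> h = \<alpha> c \<phi>))" for h
      using wedge_factor_iff[OF w r, of h] \<rho> by auto
    ultimately show "\<exists>!h. h \<in> hom X D \<and>
        (\<forall>c \<in> Obj C. \<forall>\<phi> \<in> Fn c (Unit C). (tev c c \<phi> \<cdot> \<pi> c) \<cdot> h = \<alpha> c \<phi>)"
      by simp
  qed
next
  assume U: "univ (Unit C) D (\<lambda>c \<phi>. tev c c \<phi> \<cdot> \<pi> c)"
  show "is_end C C TO (hom_unit_tensor_arr C TO \<iota>) D \<pi>"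
    unfolding is_end_def
  proof (intro conjI allI impI)
    show "is_wedge C C TO (hom_unit_tensor_arr C TO \<iota>) D \<pi>"
      by (rule w)
    fix X \<rho> assume r: "is_wedge C C TO (hom_unit_tensor_arr C TO \<iota>) X \<rho>"
    have "\<exists>!h. h \<in> hom X D \<and>
        (\<forall>c \<in> Obj C. \<forall>\<phi> \<in> Fn c (Unit C). (tev c c \<phi> \<cdot> \<pi> c) \<cdot> h = tev c c \<phi> \<cdot> \<rho> c)"
      using U wedge_natfam[OF r] unfolding univ_def by blast
    moreover have "(h \<in> hom X D \<and> (\<forall>c \<in> Obj C. \<pi> c \<cdot> h = \<rho> c)) \<longleftrightarrow> (h \<in> hom X D \<and>
      (\<forall>c \<in> Obj C. \<forall>\<phi> \<in> Fn c (Unit C). (tev c c \<phi> \<cdot> \<pi> c) \<cdot> h = tev c c \<phi> \<cdot> \<rho> c))" for h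
      using wedge_factor_iff[OF w r, of h] by auto
    ultimately show "\<exists>!h. h \<in> hom X D \<and> (\<forall>c \<in> Obj C. \<pi> c \<cdot> h = \<rho> c)"
      by simp
  qed
qed

end

lemma distinguished_univ:
  assumes "\<And>c. c \<in> Obj C \<Longrightarrow> \<exists>n v \<phi>. dual_basis (hom_space C c (Unit C)) n v \<phi>"
    and "is_distinguished_object C D"
  shows "\<exists>\<Phi>. univ (Unit C) D \<Phi>"
proof -
  obtain TO \<iota> \<pi> where TO: "\<And>c d. c \<in> Obj C \<Longrightarrow> d \<in> Obj C \<Longrightarrow>
      is_vect_tensor C (hom_space C c (Unit C)) d (TO c d) (\<iota> c d)"
    and e: "is_end C C TO (hom_unit_tensor_arr C TO \<iota>) D \<pi>"
    using assms(2) unfolding is_distinguished_object_def by blast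
  then show ?thesis
    using is_end_iff_univ[OF TO assms(1), of D \<pi>] unfolding is_end_def by blast
qed

lemma univ_distinguished:
  assumes "\<And>c. c \<in> Obj C \<Longrightarrow> \<exists>n v \<phi>. dual_basis (hom_space C c (Unit C)) n v \<phi>"
    and "\<And>c d. c \<in> Obj C \<Longrightarrow> d \<in> Obj C \<Longrightarrow> \<exists>P \<iota>. is_vect_tensor C (hom_space C c (Unit C)) d P \<iota>"
    and U: "univ (Unit C) D \<Phi>"
  shows "is_distinguished_object C D"
proof -
  obtain TO \<iota> where TO: "\<And>c d. c \<in> Obj C \<Longrightarrow> d \<in> Obj C \<Longrightarrow>
      is_vect_tensor C (hom_space C c (Unit C)) d (TO c d) (\<iota> c d)"
    using assms(2) by metis
  obtain \<pi> where w: "is_wedge C C TO (hom_unit_tensor_arr C TO \<iota>) D \<pi>"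
    and \<pi>: "\<forall>c \<in> Obj C. \<forall>\<phi> \<in> Fn c (Unit C).
      vt_ev (hom_space C c (Unit C)) (TO c c) (\<iota> c c) c \<phi> \<cdot> \<pi> c = \<Phi> c \<phi>"
    using natfam_wedge[OF TO assms(1) univ_natfam[OF U]] by blast
  have n: "natfam (Unit C) D (\<lambda>c \<phi>. vt_ev (hom_space C c (Unit C)) (TO c c) (\<iota> c c) c \<phi> \<cdot> \<pi> c)"
    by (rule wedge_natfam[OF TO assms(1) w])
  have "univ (Unit C) D (\<lambda>c \<phi>. vt_ev (hom_space C c (Unit C)) (TO c c) (\<iota> c c) c \<phi> \<cdot> \<pi> c)"
    using U n \<pi> unfolding univ_def by simp
  then show ?thesis
    using is_end_iff_univ[OF TO assms(1) w] TO unfolding is_distinguished_object_def by blast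
qed

end

section \<open>Adjunctions from duals\<close>

context linear_category
begin

lemma hom_iff: "f \<in> hom a b \<longleftrightarrow> f \<in> Arr C \<and> Dom C f = a \<and> Cod C f = b"
  by (simp add: Hom_def)

text \<open>Composability is phrased with \<open>Dom\<close> and \<open>Cod\<close> rather than
  \<open>hom\<close>, so that rewriting decides the typing of a long composite without guessing its
  intermediate objects.\<close>

lemma comp_arr:
  assumes "f \<in> Arr C" "g \<in> Arr C" "Dom C g = Cod C f"
  shows "g \<cdot> f \<in> Arr C" "Dom C (g \<cdot> f) = Dom C f" "Cod C (g \<cdot> f) = Cod C g"
  using comp_in_hom[of f "Dom C f" "Cod C f" g "Cod C g"] assms by (simp_all add: hom_iff)

lemma id_arr:
  assumes "a \<in> Obj C"
  shows "Id C a \<in> Arr C" "Dom C (Id C a) = a" "Cod C (Id C a) = a"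
  using id_in_hom[OF assms] by (simp_all add: hom_iff)

lemma comp_assoc_arr:
  assumes "f \<in> Arr C" "g \<in> Arr C" "h \<in> Arr C" "Dom C g = Cod C f" "Dom C h = Cod C g"
  shows "(h \<cdot> g) \<cdot> f = h \<cdot> (g \<cdot> f)"
  by (rule comp_assoc[of f "Dom C f" "Cod C f" g "Cod C g" h "Cod C h"]) (simp_all add: hom_iff assms)

lemma comp_id_arr:
  assumes "f \<in> Arr C"
  shows "Dom C f = a \<Longrightarrow> f \<cdot> Id C a = f" "Cod C f = a \<Longrightarrow> Id C a \<cdot> f = f"
  using comp_id_right[of f "Dom C f" "Cod C f"] comp_id_left[of f "Dom C f" "Cod C f"] assms
  by (auto simp: hom_iff)

lemmas arrs = comp_arr id_arr comp_id_arr dom_closed cod_closed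

lemma comp_extend:
  assumes "x \<cdot> y = z" "x \<in> Arr C" "y \<in> Arr C" "Dom C x = Cod C y" "t \<in> Arr C" "Cod C t = Dom C y"
  shows "x \<cdot> (y \<cdot> t) = z \<cdot> t"
  using comp_assoc_arr[of t y x] assms by simp

lemma inverse_arrows_unique:
  assumes "inverse_arrows C f g" "inverse_arrows C f g'"
  shows "g = g'"
proof -
  have f: "f \<in> Arr C" and g: "g \<in> Arr C" "Dom C g = Cod C f" "Cod C g = Dom C f"
    "g \<cdot> f = Id C (Dom C f)" and g': "g' \<in> Arr C" "Dom C g' = Cod C f" "Cod C g' = Dom C f"
    "f \<cdot> g' = Id C (Cod C f)"
    using assms by (simp_all add: inverse_arrows_def hom_iff)
  have "g = g \<cdot> (f \<cdot> g')"
    using f g g' by (simp add: arrs)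
  also have "\<dots> = (g \<cdot> f) \<cdot> g'"
    using comp_assoc_arr[of g' f g] f g g' by simp
  also have "\<dots> = g'"
    using g g' by (simp add: arrs)
  finally show ?thesis .
qed

lemma inv_arr_inverse:
  assumes "iso_arr C f"
  shows "inverse_arrows C f (inv_arr C f)"
  using assms inverse_arrows_unique unfolding iso_arr_def inv_arr_def by (metis (full_types) theI)

lemma inv_arr:
  assumes "iso_arr C f"
  shows "f \<in> Arr C" "inv_arr C f \<in> Arr C" "Dom C (inv_arr C f) = Cod C f" "Cod C (inv_arr C f) = Dom C f"
    "inv_arr C f \<cdot> f = Id C (Dom C f)" "f \<cdot> inv_arr C f = Id C (Cod C f)"
  using inv_arr_inverse[OF assms] by (simp_all add: inverse_arrows_def hom_iff)

lemma iso_cancel_left: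
  assumes "iso_arr C x" "f \<in> Arr C" "g \<in> Arr C" "Cod C f = Dom C x" "Cod C g = Dom C x" "x \<cdot> f = x \<cdot> g"
  shows "f = g"
proof -
  note x = inv_arr[OF assms(1)]
  have "f = inv_arr C x \<cdot> (x \<cdot> f)"
    using comp_assoc_arr[of f x "inv_arr C x"] x assms by (simp add: arrs)
  also have "\<dots> = g"
    using comp_assoc_arr[of g x "inv_arr C x"] x assms by (simp add: arrs)
  finally show ?thesis .
qed

lemma iso_cancel_right:
  assumes "iso_arr C x" "f \<in> Arr C" "g \<in> Arr C" "Dom C f = Cod C x" "Dom C g = Cod C x" "f \<cdot> x = g \<cdot> x"
  shows "f = g"
proof -
  note x = inv_arr[OF assms(1)]
  have "f = (f \<cdot> x) \<cdot> inv_arr C x"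
    using comp_assoc_arr[of "inv_arr C x" x f] x assms(2-5) by (simp add: arrs)
  also have "\<dots> = g"
    using comp_assoc_arr[of "inv_arr C x" x g] x assms by (simp add: arrs)
  finally show ?thesis .
qed

text \<open>Used to read naturality squares of constraints as squares of their inverses, and to
  solve the pentagon and the triangle for an inverse associator or unitor.\<close>

lemma iso_swap:
  assumes "iso_arr C x" "iso_arr C w" "y \<in> Arr C" "z \<in> Arr C" "Dom C x = Cod C y" "Dom C z = Cod C w"
    and "x \<cdot> y = z \<cdot> w"
  shows "y \<cdot> inv_arr C w = inv_arr C x \<cdot> z"
proof -
  note x = inv_arr[OF assms(1)] and w = inv_arr[OF assms(2)]
  have d: "Dom C y = Dom C w" "Cod C z = Cod C x"
    using comp_arr[OF assms(3) x(1) assms(5)] comp_arr[OF w(1) assms(4,6)] assms(7) by simp_all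
  have "y \<cdot> inv_arr C w = (inv_arr C x \<cdot> x) \<cdot> (y \<cdot> inv_arr C w)"
    using x w assms d by (simp add: arrs)
  also have "\<dots> = inv_arr C x \<cdot> ((x \<cdot> y) \<cdot> inv_arr C w)"
    using x(1-4) w(1-4) assms(3-6) d by (simp add: arrs comp_assoc_arr)
  also have "\<dots> = inv_arr C x \<cdot> (z \<cdot> (w \<cdot> inv_arr C w))"
    unfolding assms(7) using x(1-4) w(1-4) assms(3-6) d by (simp add: arrs comp_assoc_arr)
  also have "\<dots> = inv_arr C x \<cdot> z"
    using x w assms d by (simp add: arrs)
  finally show ?thesis .
qed

end

section \<open>Coherence of associators and unit constraints\<close>

context linear_monoidal_category
begin

lemma tensor_arrs:
  assumes "f \<in> Arr C" "g \<in> Arr C"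
  shows "f \<otimes>\<^sub>a g \<in> Arr C" "Dom C (f \<otimes>\<^sub>a g) = Dom C f \<otimes>\<^sub>o Dom C g" "Cod C (f \<otimes>\<^sub>a g) = Cod C f \<otimes>\<^sub>o Cod C g"
  using tensor_arr[of f "Dom C f" "Cod C f" g "Dom C g" "Cod C g"] assms by (simp_all add: hom_iff)

lemma interchange:
  assumes "f \<in> Arr C" "f' \<in> Arr C" "g \<in> Arr C" "g' \<in> Arr C" "Dom C f' = Cod C f" "Dom C g' = Cod C g"
  shows "(f' \<otimes>\<^sub>a g') \<cdot> (f \<otimes>\<^sub>a g) = (f' \<cdot> f) \<otimes>\<^sub>a (g' \<cdot> g)"
  using tensor_comp[of f "Dom C f" "Cod C f" f' "Cod C f'" g "Dom C g" "Cod C g" g' "Cod C g'"] assms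
  by (simp add: hom_iff)

lemma whisker_right:
  assumes "f \<in> Arr C" "g \<in> Arr C" "Dom C g = Cod C f" "c \<in> Obj C"
  shows "(g \<cdot> f) \<otimes>\<^sub>a Id C c = (g \<otimes>\<^sub>a Id C c) \<cdot> (f \<otimes>\<^sub>a Id C c)"
  using assms by (simp add: interchange arrs)

lemma whisker_left:
  assumes "f \<in> Arr C" "g \<in> Arr C" "Dom C g = Cod C f" "c \<in> Obj C"
  shows "Id C c \<otimes>\<^sub>a (g \<cdot> f) = (Id C c \<otimes>\<^sub>a g) \<cdot> (Id C c \<otimes>\<^sub>a f)"
  using assms by (simp add: interchange arrs)

lemma whisker_exchange:
  assumes "f \<in> Arr C" "g \<in> Arr C"
  shows "(Id C (Cod C f) \<otimes>\<^sub>a g) \<cdot> (f \<otimes>\<^sub>a Id C (Dom C g)) = (f \<otimes>\<^sub>a Id C (Cod C g)) \<cdot> (Id C (Dom C f) \<otimes>\<^sub>a g)"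
  using assms by (simp add: interchange arrs)

lemma assoc_arr:
  assumes "a \<in> Obj C" "b \<in> Obj C" "c \<in> Obj C"
  shows "iso_arr C (Assoc C a b c)" "Assoc C a b c \<in> Arr C"
    "Dom C (Assoc C a b c) = (a \<otimes>\<^sub>o b) \<otimes>\<^sub>o c" "Cod C (Assoc C a b c) = a \<otimes>\<^sub>o b \<otimes>\<^sub>o c"
  using assoc_iso[OF assms] by (simp_all add: hom_iff)

lemma assoc_inv_arr:
  assumes "a \<in> Obj C" "b \<in> Obj C" "c \<in> Obj C"
  shows "inv_arr C (Assoc C a b c) \<in> Arr C" "Dom C (inv_arr C (Assoc C a b c)) = a \<otimes>\<^sub>o b \<otimes>\<^sub>o c"
    "Cod C (inv_arr C (Assoc C a b c)) = (a \<otimes>\<^sub>o b) \<otimes>\<^sub>o c"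
  using inv_arr[OF assoc_arr(1)[OF assms]] assoc_arr[OF assms] by simp_all

lemma lunit_arr:
  assumes "a \<in> Obj C"
  shows "iso_arr C (LUnit C a)" "LUnit C a \<in> Arr C" "Dom C (LUnit C a) = Unit C \<otimes>\<^sub>o a" "Cod C (LUnit C a) = a"
  using lunit_iso[OF assms] by (simp_all add: hom_iff)

lemma lunit_inv_arr:
  assumes "a \<in> Obj C"
  shows "inv_arr C (LUnit C a) \<in> Arr C" "Dom C (inv_arr C (LUnit C a)) = a"
    "Cod C (inv_arr C (LUnit C a)) = Unit C \<otimes>\<^sub>o a"
  using inv_arr[OF lunit_arr(1)[OF assms]] lunit_arr[OF assms] by simp_all

lemma runit_arr:
  assumes "a \<in> Obj C"
  shows "iso_arr C (RUnit C a)" "RUnit C a \<in> Arr C" "Dom C (RUnit C a) = a \<otimes>\<^sub>o Unit C" "Cod C (RUnit C a) = a"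
  using runit_iso[OF assms] by (simp_all add: hom_iff)

lemma runit_inv_arr:
  assumes "a \<in> Obj C"
  shows "inv_arr C (RUnit C a) \<in> Arr C" "Dom C (inv_arr C (RUnit C a)) = a"
    "Cod C (inv_arr C (RUnit C a)) = a \<otimes>\<^sub>o Unit C"
  using inv_arr[OF runit_arr(1)[OF assms]] runit_arr[OF assms] by simp_all

lemmas marrs = arrs tensor_arrs tensor_obj unit_obj assoc_arr assoc_inv_arr lunit_arr lunit_inv_arr
  runit_arr runit_inv_arr tensor_id

lemma iso_tensor:
  assumes "iso_arr C f" "iso_arr C g"
  shows "iso_arr C (f \<otimes>\<^sub>a g)" "inv_arr C (f \<otimes>\<^sub>a g) = inv_arr C f \<otimes>\<^sub>a inv_arr C g"
proof -
  note f = inv_arr[OF assms(1)] and g = inv_arr[OF assms(2)]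
  have *: "inverse_arrows C (f \<otimes>\<^sub>a g) (inv_arr C f \<otimes>\<^sub>a inv_arr C g)"
    unfolding inverse_arrows_def using f g by (simp add: hom_iff marrs interchange)
  then show i: "iso_arr C (f \<otimes>\<^sub>a g)"
    unfolding iso_arr_def by blast
  show "inv_arr C (f \<otimes>\<^sub>a g) = inv_arr C f \<otimes>\<^sub>a inv_arr C g"
    by (rule inverse_arrows_unique[OF inv_arr_inverse[OF i] *])
qed

lemma iso_id:
  assumes "a \<in> Obj C"
  shows "iso_arr C (Id C a)" "inv_arr C (Id C a) = Id C a"
proof -
  have *: "inverse_arrows C (Id C a) (Id C a)"
    unfolding inverse_arrows_def using assms by (simp add: hom_iff arrs)
  then show i: "iso_arr C (Id C a)"
    unfolding iso_arr_def by blast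
  show "inv_arr C (Id C a) = Id C a"
    by (rule inverse_arrows_unique[OF inv_arr_inverse[OF i] *])
qed

lemma assoc_nat:
  assumes "f \<in> Arr C" "g \<in> Arr C" "h \<in> Arr C"
  shows "Assoc C (Cod C f) (Cod C g) (Cod C h) \<cdot> ((f \<otimes>\<^sub>a g) \<otimes>\<^sub>a h) =
         (f \<otimes>\<^sub>a g \<otimes>\<^sub>a h) \<cdot> Assoc C (Dom C f) (Dom C g) (Dom C h)"
  by (rule assoc_natural) (simp_all add: hom_iff assms)

lemma assoc_inv_nat:
  assumes "f \<in> Arr C" "g \<in> Arr C" "h \<in> Arr C"
  shows "((f \<otimes>\<^sub>a g) \<otimes>\<^sub>a h) \<cdot> inv_arr C (Assoc C (Dom C f) (Dom C g) (Dom C h)) =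
         inv_arr C (Assoc C (Cod C f) (Cod C g) (Cod C h)) \<cdot> (f \<otimes>\<^sub>a g \<otimes>\<^sub>a h)"
  by (rule iso_swap) (simp_all add: marrs assms assoc_nat)

lemma runit_nat: "f \<in> Arr C \<Longrightarrow> RUnit C (Cod C f) \<cdot> (f \<otimes>\<^sub>a Id C (Unit C)) = f \<cdot> RUnit C (Dom C f)"
  by (rule runit_natural) (simp add: hom_iff)

lemma runit_inv_nat:
  "f \<in> Arr C \<Longrightarrow> (f \<otimes>\<^sub>a Id C (Unit C)) \<cdot> inv_arr C (RUnit C (Dom C f)) = inv_arr C (RUnit C (Cod C f)) \<cdot> f"
  by (rule iso_swap) (simp_all add: marrs runit_nat)

lemma lunit_nat: "f \<in> Arr C \<Longrightarrow> LUnit C (Cod C f) \<cdot> (Id C (Unit C) \<otimes>\<^sub>a f) = f \<cdot> LUnit C (Dom C f)"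
  by (rule lunit_natural) (simp add: hom_iff)

lemma lunit_inv_nat:
  "f \<in> Arr C \<Longrightarrow> (Id C (Unit C) \<otimes>\<^sub>a f) \<cdot> inv_arr C (LUnit C (Dom C f)) = inv_arr C (LUnit C (Cod C f)) \<cdot> f"
  by (rule iso_swap) (simp_all add: marrs lunit_nat)

text \<open>A consequence of pentagon and triangle: both sides agree after tensoring with the unit
  and composing with an associator, and tensoring with the unit is faithful. It removes the unit
  constraint at a tensor product from the triangle identities of duals.\<close>

lemma runit_tensor:
  assumes a: "a \<in> Obj C" and b: "b \<in> Obj C"
  shows "RUnit C (a \<otimes>\<^sub>o b) = (Id C a \<otimes>\<^sub>a RUnit C b) \<cdot> Assoc C a b (Unit C)"
proof -
  let ?u = "Unit C"
  let ?r = "(Id C a \<otimes>\<^sub>a RUnit C b) \<cdot> Assoc C a b ?u"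
  have "RUnit C (a \<otimes>\<^sub>o b) \<otimes>\<^sub>a Id C ?u = ?r \<otimes>\<^sub>a Id C ?u"
  proof (rule iso_cancel_left[OF assoc_arr(1)[OF a b unit_obj]])
    have t1: "(Id C (a \<otimes>\<^sub>o b) \<otimes>\<^sub>a LUnit C ?u) \<cdot> Assoc C (a \<otimes>\<^sub>o b) ?u ?u = RUnit C (a \<otimes>\<^sub>o b) \<otimes>\<^sub>a Id C ?u"
      using triangle[of "a \<otimes>\<^sub>o b" ?u] a b unit_obj tensor_obj by simp
    have t2: "(Id C b \<otimes>\<^sub>a LUnit C ?u) \<cdot> Assoc C b ?u ?u = RUnit C b \<otimes>\<^sub>a Id C ?u"
      using triangle[of b ?u] b unit_obj by simp
    have n1: "Assoc C a b ?u \<cdot> (Id C (a \<otimes>\<^sub>o b) \<otimes>\<^sub>a LUnit C ?u) =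
        (Id C a \<otimes>\<^sub>a Id C b \<otimes>\<^sub>a LUnit C ?u) \<cdot> Assoc C a b (?u \<otimes>\<^sub>o ?u)"
      using assoc_nat[of "Id C a" "Id C b" "LUnit C ?u"] a b unit_obj by (simp add: marrs)
    have n2: "Assoc C a b ?u \<cdot> ((Id C a \<otimes>\<^sub>a RUnit C b) \<otimes>\<^sub>a Id C ?u) =
        (Id C a \<otimes>\<^sub>a RUnit C b \<otimes>\<^sub>a Id C ?u) \<cdot> Assoc C a (b \<otimes>\<^sub>o ?u) ?u"
      using assoc_nat[of "Id C a" "RUnit C b" "Id C ?u"] a b unit_obj by (simp add: marrs)
    have p: "Assoc C a b (?u \<otimes>\<^sub>o ?u) \<cdot> Assoc C (a \<otimes>\<^sub>o b) ?u ?u =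
        (Id C a \<otimes>\<^sub>a Assoc C b ?u ?u) \<cdot> (Assoc C a (b \<otimes>\<^sub>o ?u) ?u \<cdot> (Assoc C a b ?u \<otimes>\<^sub>a Id C ?u))"
      using pentagon[OF a b unit_obj unit_obj] a b by (simp add: marrs comp_assoc_arr)
    have "Assoc C a b ?u \<cdot> (RUnit C (a \<otimes>\<^sub>o b) \<otimes>\<^sub>a Id C ?u) =
        (Assoc C a b ?u \<cdot> (Id C (a \<otimes>\<^sub>o b) \<otimes>\<^sub>a LUnit C ?u)) \<cdot> Assoc C (a \<otimes>\<^sub>o b) ?u ?u"
      unfolding t1[symmetric] using a b by (simp add: marrs comp_assoc_arr)
    also have "\<dots> = (Id C a \<otimes>\<^sub>a Id C b \<otimes>\<^sub>a LUnit C ?u) \<cdot> (Assoc C a b (?u \<otimes>\<^sub>o ?u) \<cdot> Assoc C (a \<otimes>\<^sub>o b) ?u ?u)"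
      unfolding n1 using a b by (simp add: marrs comp_assoc_arr)
    also have "\<dots> = (Id C a \<otimes>\<^sub>a ((Id C b \<otimes>\<^sub>a LUnit C ?u) \<cdot> Assoc C b ?u ?u)) \<cdot>
        (Assoc C a (b \<otimes>\<^sub>o ?u) ?u \<cdot> (Assoc C a b ?u \<otimes>\<^sub>a Id C ?u))"
      unfolding p using a b by (simp add: marrs comp_assoc_arr whisker_left)
    also have "\<dots> = ((Id C a \<otimes>\<^sub>a RUnit C b \<otimes>\<^sub>a Id C ?u) \<cdot> Assoc C a (b \<otimes>\<^sub>o ?u) ?u) \<cdot> (Assoc C a b ?u \<otimes>\<^sub>a Id C ?u)"
      unfolding t2 using a b by (simp add: marrs comp_assoc_arr)
    also have "\<dots> = Assoc C a b ?u \<cdot> (?r \<otimes>\<^sub>a Id C ?u)"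
      unfolding n2[symmetric] using a b by (simp add: marrs comp_assoc_arr whisker_right)
    finally show "Assoc C a b ?u \<cdot> (RUnit C (a \<otimes>\<^sub>o b) \<otimes>\<^sub>a Id C ?u) = Assoc C a b ?u \<cdot> (?r \<otimes>\<^sub>a Id C ?u)" .
  qed (use a b in \<open>simp_all add: marrs\<close>)
  \<comment> \<open>Cancelling the unit factor: by naturality of \<open>RUnit\<close>, f \<otimes>
    id followed by the unitor is the unitor followed by f, and the unitor is invertible.\<close>
  then have "RUnit C (a \<otimes>\<^sub>o b) \<cdot> RUnit C ((a \<otimes>\<^sub>o b) \<otimes>\<^sub>o ?u) = ?r \<cdot> RUnit C ((a \<otimes>\<^sub>o b) \<otimes>\<^sub>o ?u)"
    using runit_nat[of "RUnit C (a \<otimes>\<^sub>o b)"] runit_nat[of ?r] a b by (simp add: marrs)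
  then show ?thesis
    by (rule iso_cancel_right[OF runit_arr(1), rotated -1]) (use a b in \<open>simp_all add: marrs\<close>)
qed

text \<open>
  For a right dual \<open>d\<close> of \<open>c\<close>, \<open>sharp\<close> and \<open>flat\<close> are the bijections \<open>Hom(a \<otimes> c, b) = Hom(a, b \<otimes> d)\<close>, and
  \<open>cu\<close> and \<open>uncu\<close> the bijections \<open>Hom(a \<otimes> c, 1) = Hom(a, d)\<close>.
\<close>

definition sharp where
  "sharp c d k a f = (f \<otimes>\<^sub>a Id C d) \<cdot> (inv_arr C (Assoc C a c d) \<cdot> ((Id C a \<otimes>\<^sub>a k) \<cdot> inv_arr C (RUnit C a)))"

definition flat where
  "flat c d e b g = (RUnit C b \<cdot> ((Id C b \<otimes>\<^sub>a e) \<cdot> Assoc C b d c)) \<cdot> (g \<otimes>\<^sub>a Id C c)"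

definition cu where "cu c d k a f = LUnit C d \<cdot> sharp c d k a f"

definition uncu where "uncu c e g = e \<cdot> (g \<otimes>\<^sub>a Id C c)"

section \<open>The adjunctions of a dual pair\<close>

context
  fixes c d e k
  assumes dual: "is_right_dual C c d e k"
begin

lemma dual_arrs:
  "c \<in> Obj C" "d \<in> Obj C" "e \<in> Arr C" "Dom C e = d \<otimes>\<^sub>o c" "Cod C e = Unit C"
  "k \<in> Arr C" "Dom C k = Unit C" "Cod C k = c \<otimes>\<^sub>o d"
  using dual by (simp_all add: is_right_dual_def hom_iff)

lemmas darrs = marrs dual_arrs

lemma snake1:
  "RUnit C c \<cdot> ((Id C c \<otimes>\<^sub>a e) \<cdot> (Assoc C c d c \<cdot> ((k \<otimes>\<^sub>a Id C c) \<cdot> inv_arr C (LUnit C c)))) = Id C c"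
proof -
  have "RUnit C c \<cdot> ((Id C c \<otimes>\<^sub>a e) \<cdot> (Assoc C c d c \<cdot> ((k \<otimes>\<^sub>a Id C c) \<cdot> inv_arr C (LUnit C c)))) =
    (RUnit C c \<cdot> (Id C c \<otimes>\<^sub>a e) \<cdot> Assoc C c d c \<cdot> (k \<otimes>\<^sub>a Id C c)) \<cdot> inv_arr C (LUnit C c)"
    by (simp add: darrs comp_assoc_arr)
  also have "\<dots> = LUnit C c \<cdot> inv_arr C (LUnit C c)"
    using dual by (simp add: is_right_dual_def)
  also have "\<dots> = Id C c"
    using inv_arr[OF lunit_arr(1)[OF dual_arrs(1)]] by (simp add: darrs)
  finally show ?thesis .
qed

lemma snake2:
  "LUnit C d \<cdot> ((e \<otimes>\<^sub>a Id C d) \<cdot> (inv_arr C (Assoc C d c d) \<cdot> ((Id C d \<otimes>\<^sub>a k) \<cdot> inv_arr C (RUnit C d)))) = Id C d"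
proof -
  have "LUnit C d \<cdot> ((e \<otimes>\<^sub>a Id C d) \<cdot> (inv_arr C (Assoc C d c d) \<cdot> ((Id C d \<otimes>\<^sub>a k) \<cdot> inv_arr C (RUnit C d)))) =
    (LUnit C d \<cdot> (e \<otimes>\<^sub>a Id C d) \<cdot> inv_arr C (Assoc C d c d) \<cdot> (Id C d \<otimes>\<^sub>a k)) \<cdot> inv_arr C (RUnit C d)"
    by (simp add: darrs comp_assoc_arr)
  also have "\<dots> = RUnit C d \<cdot> inv_arr C (RUnit C d)"
    using dual by (simp add: is_right_dual_def)
  also have "\<dots> = Id C d"
    using inv_arr[OF runit_arr(1)[OF dual_arrs(2)]] by (simp add: darrs)
  finally show ?thesis .
qed

lemma sharp_in: "f \<in> hom (a \<otimes>\<^sub>o c) b \<Longrightarrow> a \<in> Obj C \<Longrightarrow> sharp c d k a f \<in> hom a (b \<otimes>\<^sub>o d)"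
  using hom_obj[of f] by (simp add: sharp_def hom_iff darrs)

lemma flat_in: "g \<in> hom a (b \<otimes>\<^sub>o d) \<Longrightarrow> b \<in> Obj C \<Longrightarrow> flat c d e b g \<in> hom (a \<otimes>\<^sub>o c) b"
  using hom_obj[of g] by (simp add: flat_def hom_iff darrs)

lemma sharp_post:
  assumes "f \<in> hom (a \<otimes>\<^sub>o c) b" "v \<in> hom b b'" "a \<in> Obj C"
  shows "sharp c d k a (v \<cdot> f) = (v \<otimes>\<^sub>a Id C d) \<cdot> sharp c d k a f"
  using assms by (simp add: sharp_def hom_iff darrs whisker_right comp_assoc_arr)

lemma flat_pre:
  assumes "g \<in> hom a (b \<otimes>\<^sub>o d)" "u \<in> hom a' a" "b \<in> Obj C"
  shows "flat c d e b (g \<cdot> u) = flat c d e b g \<cdot> (u \<otimes>\<^sub>a Id C c)"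
  using assms by (simp add: flat_def hom_iff darrs whisker_right comp_assoc_arr)

lemma sharp_pre:
  assumes "f \<in> hom (a \<otimes>\<^sub>o c) b" "u \<in> hom a' a"
  shows "sharp c d k a' (f \<cdot> (u \<otimes>\<^sub>a Id C c)) = sharp c d k a f \<cdot> u"
proof -
  have [simp]: "f \<in> Arr C" "Dom C f = a \<otimes>\<^sub>o c" "Cod C f = b" "u \<in> Arr C" "Dom C u = a'" "Cod C u = a"
    "a \<in> Obj C" "a' \<in> Obj C" "b \<in> Obj C"
    using assms hom_obj by (auto simp: hom_iff)
  have 1: "((u \<otimes>\<^sub>a Id C c) \<otimes>\<^sub>a Id C d) \<cdot> inv_arr C (Assoc C a' c d) =
      inv_arr C (Assoc C a c d) \<cdot> (u \<otimes>\<^sub>a Id C (c \<otimes>\<^sub>o d))"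
    using assoc_inv_nat[of u "Id C c" "Id C d"] by (simp add: darrs)
  have 2: "(u \<otimes>\<^sub>a Id C (c \<otimes>\<^sub>o d)) \<cdot> (Id C a' \<otimes>\<^sub>a k) = (Id C a \<otimes>\<^sub>a k) \<cdot> (u \<otimes>\<^sub>a Id C (Unit C))"
    using whisker_exchange[of u k] by (simp add: darrs)
  have 3: "(u \<otimes>\<^sub>a Id C (Unit C)) \<cdot> inv_arr C (RUnit C a') = inv_arr C (RUnit C a) \<cdot> u"
    using runit_inv_nat[of u] by simp
  have "sharp c d k a' (f \<cdot> (u \<otimes>\<^sub>a Id C c)) =
      (f \<otimes>\<^sub>a Id C d) \<cdot> (((u \<otimes>\<^sub>a Id C c) \<otimes>\<^sub>a Id C d) \<cdot> inv_arr C (Assoc C a' c d) \<cdot>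
        ((Id C a' \<otimes>\<^sub>a k) \<cdot> inv_arr C (RUnit C a')))"
    by (simp add: sharp_def darrs whisker_right comp_assoc_arr)
  also have "\<dots> = (f \<otimes>\<^sub>a Id C d) \<cdot> (inv_arr C (Assoc C a c d) \<cdot>
        (((u \<otimes>\<^sub>a Id C (c \<otimes>\<^sub>o d)) \<cdot> (Id C a' \<otimes>\<^sub>a k)) \<cdot> inv_arr C (RUnit C a')))"
    unfolding 1 by (simp add: darrs comp_assoc_arr)
  also have "\<dots> = (f \<otimes>\<^sub>a Id C d) \<cdot> (inv_arr C (Assoc C a c d) \<cdot>
        ((Id C a \<otimes>\<^sub>a k) \<cdot> ((u \<otimes>\<^sub>a Id C (Unit C)) \<cdot> inv_arr C (RUnit C a'))))"
    unfolding 2 by (simp add: darrs comp_assoc_arr)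
  also have "\<dots> = sharp c d k a f \<cdot> u"
    unfolding 3 by (simp add: sharp_def darrs comp_assoc_arr)
  finally show ?thesis .
qed

lemma flat_post:
  assumes "g \<in> hom a (b \<otimes>\<^sub>o d)" "v \<in> hom b b'"
  shows "flat c d e b' ((v \<otimes>\<^sub>a Id C d) \<cdot> g) = v \<cdot> flat c d e b g"
proof -
  have [simp]: "g \<in> Arr C" "Cod C g = b \<otimes>\<^sub>o d" "Dom C g = a" "v \<in> Arr C" "Dom C v = b" "Cod C v = b'"
    "a \<in> Obj C" "b' \<in> Obj C" "b \<in> Obj C"
    using assms hom_obj by (auto simp: hom_iff)
  have 1: "Assoc C b' d c \<cdot> ((v \<otimes>\<^sub>a Id C d) \<otimes>\<^sub>a Id C c) = (v \<otimes>\<^sub>a Id C (d \<otimes>\<^sub>o c)) \<cdot> Assoc C b d c"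
    using assoc_nat[of v "Id C d" "Id C c"] by (simp add: darrs)
  have 2: "(Id C b' \<otimes>\<^sub>a e) \<cdot> (v \<otimes>\<^sub>a Id C (d \<otimes>\<^sub>o c)) = (v \<otimes>\<^sub>a Id C (Unit C)) \<cdot> (Id C b \<otimes>\<^sub>a e)"
    using whisker_exchange[of v e] by (simp add: darrs)
  have 3: "RUnit C b' \<cdot> (v \<otimes>\<^sub>a Id C (Unit C)) = v \<cdot> RUnit C b"
    using runit_nat[of v] by simp
  have "flat c d e b' ((v \<otimes>\<^sub>a Id C d) \<cdot> g) =
      RUnit C b' \<cdot> ((Id C b' \<otimes>\<^sub>a e) \<cdot> ((Assoc C b' d c \<cdot> ((v \<otimes>\<^sub>a Id C d) \<otimes>\<^sub>a Id C c)) \<cdot> (g \<otimes>\<^sub>a Id C c)))"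
    by (simp add: flat_def darrs whisker_right comp_assoc_arr)
  also have "\<dots> = RUnit C b' \<cdot> (((Id C b' \<otimes>\<^sub>a e) \<cdot> (v \<otimes>\<^sub>a Id C (d \<otimes>\<^sub>o c))) \<cdot> (Assoc C b d c \<cdot> (g \<otimes>\<^sub>a Id C c)))"
    unfolding 1 by (simp add: darrs comp_assoc_arr)
  also have "\<dots> = (RUnit C b' \<cdot> (v \<otimes>\<^sub>a Id C (Unit C))) \<cdot> ((Id C b \<otimes>\<^sub>a e) \<cdot> (Assoc C b d c \<cdot> (g \<otimes>\<^sub>a Id C c)))"
    unfolding 2 by (simp add: darrs comp_assoc_arr)
  also have "\<dots> = v \<cdot> flat c d e b g"
    unfolding 3 by (simp add: flat_def darrs comp_assoc_arr)
  finally show ?thesis .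
qed

text \<open>A triangle identity of the adjunction between tensoring with c and tensoring with d.
  Pentagon, triangle and naturality move every constraint under tensoring with a on the left, where
  the first snake identity remains.\<close>

lemma flat_sharp_id:
  assumes a: "a \<in> Obj C"
  shows "flat c d e (a \<otimes>\<^sub>o c) (sharp c d k a (Id C (a \<otimes>\<^sub>o c))) = Id C (a \<otimes>\<^sub>o c)"
proof -
  note [simp] = a
  let ?iA = "\<lambda>a b c. inv_arr C (Assoc C a b c)"
  have "Assoc C a c (d \<otimes>\<^sub>o c) \<cdot> Assoc C (a \<otimes>\<^sub>o c) d c =
      ((Id C a \<otimes>\<^sub>a Assoc C c d c) \<cdot> Assoc C a (c \<otimes>\<^sub>o d) c) \<cdot> (Assoc C a c d \<otimes>\<^sub>a Id C c)"
    using pentagon[of a c d c] by (simp add: darrs)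
  then have "Assoc C (a \<otimes>\<^sub>o c) d c \<cdot> inv_arr C (Assoc C a c d \<otimes>\<^sub>a Id C c) =
      ?iA a c (d \<otimes>\<^sub>o c) \<cdot> ((Id C a \<otimes>\<^sub>a Assoc C c d c) \<cdot> Assoc C a (c \<otimes>\<^sub>o d) c)"
    by (intro iso_swap) (simp_all add: darrs iso_tensor(1) iso_id)
  then have 1: "Assoc C (a \<otimes>\<^sub>o c) d c \<cdot> (?iA a c d \<otimes>\<^sub>a Id C c) =
      ?iA a c (d \<otimes>\<^sub>o c) \<cdot> ((Id C a \<otimes>\<^sub>a Assoc C c d c) \<cdot> Assoc C a (c \<otimes>\<^sub>o d) c)"
    by (simp add: darrs iso_tensor(2) iso_id)
  have 2: "Assoc C a (c \<otimes>\<^sub>o d) c \<cdot> ((Id C a \<otimes>\<^sub>a k) \<otimes>\<^sub>a Id C c) =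
      (Id C a \<otimes>\<^sub>a k \<otimes>\<^sub>a Id C c) \<cdot> Assoc C a (Unit C) c"
    using assoc_nat[of "Id C a" k "Id C c"] by (simp add: darrs)
  have "(Id C a \<otimes>\<^sub>a LUnit C c) \<cdot> Assoc C a (Unit C) c = Id C (a \<otimes>\<^sub>o c) \<cdot> (RUnit C a \<otimes>\<^sub>a Id C c)"
    using triangle[of a c] by (simp add: darrs)
  then have "Assoc C a (Unit C) c \<cdot> inv_arr C (RUnit C a \<otimes>\<^sub>a Id C c) =
      inv_arr C (Id C a \<otimes>\<^sub>a LUnit C c) \<cdot> Id C (a \<otimes>\<^sub>o c)"
    by (intro iso_swap) (simp_all add: darrs iso_tensor(1) iso_id)
  then have 3: "Assoc C a (Unit C) c \<cdot> (inv_arr C (RUnit C a) \<otimes>\<^sub>a Id C c) = Id C a \<otimes>\<^sub>a inv_arr C (LUnit C c)"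
    by (simp add: darrs iso_tensor(2) iso_id)
  have 4: "(Id C (a \<otimes>\<^sub>o c) \<otimes>\<^sub>a e) \<cdot> ?iA a c (d \<otimes>\<^sub>o c) = ?iA a c (Unit C) \<cdot> (Id C a \<otimes>\<^sub>a Id C c \<otimes>\<^sub>a e)"
    using assoc_inv_nat[of "Id C a" "Id C c" e] by (simp add: darrs)
  have 5: "RUnit C (a \<otimes>\<^sub>o c) \<cdot> ?iA a c (Unit C) = Id C a \<otimes>\<^sub>a RUnit C c"
    unfolding runit_tensor[OF a dual_arrs(1)]
    using inv_arr[OF assoc_arr(1)[OF a dual_arrs(1) unit_obj]] by (simp add: darrs comp_assoc_arr)
  have "flat c d e (a \<otimes>\<^sub>o c) (sharp c d k a (Id C (a \<otimes>\<^sub>o c))) =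
      RUnit C (a \<otimes>\<^sub>o c) \<cdot> ((Id C (a \<otimes>\<^sub>o c) \<otimes>\<^sub>a e) \<cdot> ((Assoc C (a \<otimes>\<^sub>o c) d c \<cdot> (?iA a c d \<otimes>\<^sub>a Id C c)) \<cdot>
        (((Id C a \<otimes>\<^sub>a k) \<otimes>\<^sub>a Id C c) \<cdot> (inv_arr C (RUnit C a) \<otimes>\<^sub>a Id C c))))"
    by (simp add: flat_def sharp_def darrs whisker_right comp_assoc_arr)
  also have "\<dots> = RUnit C (a \<otimes>\<^sub>o c) \<cdot> (((Id C (a \<otimes>\<^sub>o c) \<otimes>\<^sub>a e) \<cdot> ?iA a c (d \<otimes>\<^sub>o c)) \<cdot>
      ((Id C a \<otimes>\<^sub>a Assoc C c d c) \<cdot> ((Assoc C a (c \<otimes>\<^sub>o d) c \<cdot>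
        ((Id C a \<otimes>\<^sub>a k) \<otimes>\<^sub>a Id C c)) \<cdot> (inv_arr C (RUnit C a) \<otimes>\<^sub>a Id C c))))"
    unfolding 1 by (simp add: darrs comp_assoc_arr)
  also have "\<dots> = (RUnit C (a \<otimes>\<^sub>o c) \<cdot> ?iA a c (Unit C)) \<cdot> ((Id C a \<otimes>\<^sub>a Id C c \<otimes>\<^sub>a e) \<cdot>
      ((Id C a \<otimes>\<^sub>a Assoc C c d c) \<cdot> ((Id C a \<otimes>\<^sub>a k \<otimes>\<^sub>a Id C c) \<cdot>
        (Assoc C a (Unit C) c \<cdot> (inv_arr C (RUnit C a) \<otimes>\<^sub>a Id C c)))))"
    unfolding 2 4 by (simp add: darrs comp_assoc_arr)
  also have "\<dots> = Id C a \<otimes>\<^sub>a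
      (RUnit C c \<cdot> ((Id C c \<otimes>\<^sub>a e) \<cdot> (Assoc C c d c \<cdot> ((k \<otimes>\<^sub>a Id C c) \<cdot> inv_arr C (LUnit C c)))))"
    unfolding 3 5 by (simp add: darrs comp_assoc_arr whisker_left)
  also have "\<dots> = Id C (a \<otimes>\<^sub>o c)"
    unfolding snake1 by (simp add: darrs)
  finally show ?thesis .
qed

text \<open>The other triangle identity, reduced in the same way to the second snake identity
  tensored with b on the left.\<close>

lemma sharp_flat_id:
  assumes b: "b \<in> Obj C"
  shows "sharp c d k (b \<otimes>\<^sub>o d) (flat c d e b (Id C (b \<otimes>\<^sub>o d))) = Id C (b \<otimes>\<^sub>o d)"
proof -
  note [simp] = b
  let ?iA = "\<lambda>a b c. inv_arr C (Assoc C a b c)"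
  have "(Id C b \<otimes>\<^sub>a Assoc C d c d) \<cdot> (Assoc C b (d \<otimes>\<^sub>o c) d \<cdot> (Assoc C b d c \<otimes>\<^sub>a Id C d)) =
      Assoc C b d (c \<otimes>\<^sub>o d) \<cdot> Assoc C (b \<otimes>\<^sub>o d) c d"
    using pentagon[of b d c d] by (simp add: darrs comp_assoc_arr)
  then have "(Assoc C b (d \<otimes>\<^sub>o c) d \<cdot> (Assoc C b d c \<otimes>\<^sub>a Id C d)) \<cdot> ?iA (b \<otimes>\<^sub>o d) c d =
      inv_arr C (Id C b \<otimes>\<^sub>a Assoc C d c d) \<cdot> Assoc C b d (c \<otimes>\<^sub>o d)"
    by (intro iso_swap) (simp_all add: darrs iso_tensor(1) iso_id)
  then have p: "Assoc C b (d \<otimes>\<^sub>o c) d \<cdot> ((Assoc C b d c \<otimes>\<^sub>a Id C d) \<cdot> ?iA (b \<otimes>\<^sub>o d) c d) =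
      (Id C b \<otimes>\<^sub>a ?iA d c d) \<cdot> Assoc C b d (c \<otimes>\<^sub>o d)"
    by (simp add: darrs iso_tensor(2) iso_id comp_assoc_arr)
  \<comment> \<open>The pentagon in the shape needed: p still carries an associator in front, which
    is cancelled as an isomorphism.\<close>
  have 1: "(Assoc C b d c \<otimes>\<^sub>a Id C d) \<cdot> ?iA (b \<otimes>\<^sub>o d) c d =
      ?iA b (d \<otimes>\<^sub>o c) d \<cdot> ((Id C b \<otimes>\<^sub>a ?iA d c d) \<cdot> Assoc C b d (c \<otimes>\<^sub>o d))"
  proof (rule iso_cancel_left[OF assoc_arr(1)[OF b tensor_obj[OF dual_arrs(2,1)] dual_arrs(2)]])
    show "Assoc C b (d \<otimes>\<^sub>o c) d \<cdot> ((Assoc C b d c \<otimes>\<^sub>a Id C d) \<cdot> ?iA (b \<otimes>\<^sub>o d) c d) =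
        Assoc C b (d \<otimes>\<^sub>o c) d \<cdot> (?iA b (d \<otimes>\<^sub>o c) d \<cdot> ((Id C b \<otimes>\<^sub>a ?iA d c d) \<cdot> Assoc C b d (c \<otimes>\<^sub>o d)))"
      unfolding p
      using comp_extend[OF inv_arr(6)[OF assoc_arr(1)[OF b tensor_obj[OF dual_arrs(2,1)] dual_arrs(2)]],
          of "(Id C b \<otimes>\<^sub>a ?iA d c d) \<cdot> Assoc C b d (c \<otimes>\<^sub>o d)"]
      by (simp add: darrs)
  qed (simp_all add: darrs)
  have 2: "Assoc C b d (c \<otimes>\<^sub>o d) \<cdot> (Id C (b \<otimes>\<^sub>o d) \<otimes>\<^sub>a k) = (Id C b \<otimes>\<^sub>a Id C d \<otimes>\<^sub>a k) \<cdot> Assoc C b d (Unit C)"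
    using assoc_nat[of "Id C b" "Id C d" k] by (simp add: darrs)
  have "(Id C b \<otimes>\<^sub>a RUnit C d) \<cdot> Assoc C b d (Unit C) = Id C (b \<otimes>\<^sub>o d) \<cdot> RUnit C (b \<otimes>\<^sub>o d)"
    using runit_tensor[of b d] by (simp add: darrs)
  then have "Assoc C b d (Unit C) \<cdot> inv_arr C (RUnit C (b \<otimes>\<^sub>o d)) =
      inv_arr C (Id C b \<otimes>\<^sub>a RUnit C d) \<cdot> Id C (b \<otimes>\<^sub>o d)"
    by (intro iso_swap) (simp_all add: darrs iso_tensor(1) iso_id)
  then have 3: "Assoc C b d (Unit C) \<cdot> inv_arr C (RUnit C (b \<otimes>\<^sub>o d)) = Id C b \<otimes>\<^sub>a inv_arr C (RUnit C d)"
    by (simp add: darrs iso_tensor(2) iso_id)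
  have 4: "((Id C b \<otimes>\<^sub>a e) \<otimes>\<^sub>a Id C d) \<cdot> ?iA b (d \<otimes>\<^sub>o c) d = ?iA b (Unit C) d \<cdot> (Id C b \<otimes>\<^sub>a e \<otimes>\<^sub>a Id C d)"
    using assoc_inv_nat[of "Id C b" e "Id C d"] by (simp add: darrs)
  have 5: "(RUnit C b \<otimes>\<^sub>a Id C d) \<cdot> ?iA b (Unit C) d = Id C b \<otimes>\<^sub>a LUnit C d"
    unfolding triangle[OF b dual_arrs(2), symmetric]
    using inv_arr[OF assoc_arr(1)[OF b unit_obj dual_arrs(2)]] by (simp add: darrs comp_assoc_arr)
  have "sharp c d k (b \<otimes>\<^sub>o d) (flat c d e b (Id C (b \<otimes>\<^sub>o d))) =
      (RUnit C b \<otimes>\<^sub>a Id C d) \<cdot> (((Id C b \<otimes>\<^sub>a e) \<otimes>\<^sub>a Id C d) \<cdot> (((Assoc C b d c \<otimes>\<^sub>a Id C d) \<cdot>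
        ?iA (b \<otimes>\<^sub>o d) c d) \<cdot> ((Id C (b \<otimes>\<^sub>o d) \<otimes>\<^sub>a k) \<cdot> inv_arr C (RUnit C (b \<otimes>\<^sub>o d)))))"
    by (simp add: flat_def sharp_def darrs whisker_right comp_assoc_arr)
  also have "\<dots> = (RUnit C b \<otimes>\<^sub>a Id C d) \<cdot> ((((Id C b \<otimes>\<^sub>a e) \<otimes>\<^sub>a Id C d) \<cdot> ?iA b (d \<otimes>\<^sub>o c) d) \<cdot>
      ((Id C b \<otimes>\<^sub>a ?iA d c d) \<cdot> ((Assoc C b d (c \<otimes>\<^sub>o d) \<cdot> (Id C (b \<otimes>\<^sub>o d) \<otimes>\<^sub>a k)) \<cdot>
        inv_arr C (RUnit C (b \<otimes>\<^sub>o d)))))"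
    unfolding 1 by (simp add: darrs comp_assoc_arr)
  also have "\<dots> = ((RUnit C b \<otimes>\<^sub>a Id C d) \<cdot> ?iA b (Unit C) d) \<cdot> ((Id C b \<otimes>\<^sub>a e \<otimes>\<^sub>a Id C d) \<cdot>
      ((Id C b \<otimes>\<^sub>a ?iA d c d) \<cdot> ((Id C b \<otimes>\<^sub>a Id C d \<otimes>\<^sub>a k) \<cdot>
        (Assoc C b d (Unit C) \<cdot> inv_arr C (RUnit C (b \<otimes>\<^sub>o d))))))"
    unfolding 2 4 by (simp add: darrs comp_assoc_arr)
  also have "\<dots> = Id C b \<otimes>\<^sub>a (LUnit C d \<cdot>
      ((e \<otimes>\<^sub>a Id C d) \<cdot> (?iA d c d \<cdot> ((Id C d \<otimes>\<^sub>a k) \<cdot> inv_arr C (RUnit C d)))))"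
    unfolding 3 5 by (simp add: darrs comp_assoc_arr whisker_left)
  also have "\<dots> = Id C (b \<otimes>\<^sub>o d)"
    unfolding snake2 by (simp add: darrs)
  finally show ?thesis .
qed

text \<open>Naturality reduces a general arrow to an identity, as in the Yoneda lemma; likewise in
  \<open>sharp_flat\<close>.\<close>

lemma flat_sharp:
  assumes f: "f \<in> hom (a \<otimes>\<^sub>o c) b" and a: "a \<in> Obj C"
  shows "flat c d e b (sharp c d k a f) = f"
proof -
  have i: "Id C (a \<otimes>\<^sub>o c) \<in> hom (a \<otimes>\<^sub>o c) (a \<otimes>\<^sub>o c)"
    by (rule id_in_hom[OF hom_obj(1)[OF f]])
  have "sharp c d k a f = (f \<otimes>\<^sub>a Id C d) \<cdot> sharp c d k a (Id C (a \<otimes>\<^sub>o c))"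
    using sharp_post[OF i f a] comp_id_right[OF f] by simp
  then show ?thesis
    using flat_post[OF sharp_in[OF i a] f] flat_sharp_id[OF a] comp_id_right[OF f] by simp
qed

lemma sharp_flat:
  assumes g: "g \<in> hom a (b \<otimes>\<^sub>o d)" and b: "b \<in> Obj C"
  shows "sharp c d k a (flat c d e b g) = g"
proof -
  have i: "Id C (b \<otimes>\<^sub>o d) \<in> hom (b \<otimes>\<^sub>o d) (b \<otimes>\<^sub>o d)"
    by (rule id_in_hom[OF hom_obj(2)[OF g]])
  have "flat c d e b g = flat c d e b (Id C (b \<otimes>\<^sub>o d)) \<cdot> (g \<otimes>\<^sub>a Id C c)"
    using flat_pre[OF i g b] comp_id_left[OF g] by simp
  then show ?thesis
    using sharp_pre[OF flat_in[OF i b] g] sharp_flat_id[OF b] comp_id_left[OF g] by simp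
qed

lemma cu_in: "f \<in> hom (a \<otimes>\<^sub>o c) (Unit C) \<Longrightarrow> a \<in> Obj C \<Longrightarrow> cu c d k a f \<in> hom a d"
  unfolding cu_def using sharp_in[of f a "Unit C"] by (simp add: hom_iff darrs)

lemma uncu_in: "g \<in> hom a d \<Longrightarrow> uncu c e g \<in> hom (a \<otimes>\<^sub>o c) (Unit C)"
  by (simp add: uncu_def hom_iff darrs)

lemma cu_pre:
  assumes "f \<in> hom (a \<otimes>\<^sub>o c) (Unit C)" "u \<in> hom a' a"
  shows "cu c d k a' (f \<cdot> (u \<otimes>\<^sub>a Id C c)) = cu c d k a f \<cdot> u"
proof -
  have "a \<in> Obj C" using assms(2) hom_obj by blast
  then show ?thesis
    unfolding cu_def sharp_pre[OF assms] using sharp_in[OF assms(1)] assms(2)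
    by (simp add: hom_iff darrs comp_assoc_arr)
qed

lemma uncu_pre: "g \<in> hom a d \<Longrightarrow> u \<in> hom a' a \<Longrightarrow> uncu c e (g \<cdot> u) = uncu c e g \<cdot> (u \<otimes>\<^sub>a Id C c)"
  by (simp add: uncu_def hom_iff darrs comp_assoc_arr whisker_right)

lemma cu_uncu:
  assumes g: "g \<in> hom a d"
  shows "cu c d k a (uncu c e g) = g"
proof -
  have "cu c d k d e = Id C d"
    unfolding cu_def sharp_def using snake2 .
  moreover have "e \<in> hom (d \<otimes>\<^sub>o c) (Unit C)"
    by (simp add: hom_iff darrs)
  ultimately show ?thesis
    using cu_pre[of e d g a] g comp_id_left[OF g] by (simp add: uncu_def)
qed

text \<open>\<open>cu\<close> is injective, being \<open>sharp\<close>, which \<open>flat\<close>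
  undoes, followed by an isomorphism. So the one-sided inverse from \<open>cu_uncu\<close> is
  two-sided.\<close>

lemma uncu_cu:
  assumes f: "f \<in> hom (a \<otimes>\<^sub>o c) (Unit C)" and a: "a \<in> Obj C"
  shows "uncu c e (cu c d k a f) = f"
proof -
  let ?f = "uncu c e (cu c d k a f)"
  have f': "?f \<in> hom (a \<otimes>\<^sub>o c) (Unit C)"
    by (rule uncu_in[OF cu_in[OF f a]])
  have "LUnit C d \<cdot> sharp c d k a ?f = LUnit C d \<cdot> sharp c d k a f"
    using cu_uncu[OF cu_in[OF f a]] by (simp add: cu_def)
  then have "sharp c d k a ?f = sharp c d k a f"
    by (rule iso_cancel_left[OF lunit_arr(1)[OF dual_arrs(2)], rotated -1])
      (use sharp_in[OF f a] sharp_in[OF f' a] in \<open>simp_all add: hom_iff darrs\<close>)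
  then have "flat c d e (Unit C) (sharp c d k a ?f) = flat c d e (Unit C) (sharp c d k a f)"
    by simp
  then show ?thesis
    using flat_sharp[OF f a] flat_sharp[OF f' a] by simp
qed

lemma sharp_add:
  assumes "f \<in> hom (a \<otimes>\<^sub>o c) b" "g \<in> hom (a \<otimes>\<^sub>o c) b" "a \<in> Obj C"
  shows "sharp c d k a (f \<boxplus> g) = sharp c d k a f \<boxplus> sharp c d k a g"
proof -
  have "(f \<boxplus> g) \<otimes>\<^sub>a Id C d = (f \<otimes>\<^sub>a Id C d) \<boxplus> (g \<otimes>\<^sub>a Id C d)"
    using tensor_linear_left[of "a \<otimes>\<^sub>o c" b "Id C d" d d] assms hom_obj[OF assms(1)] id_in_hom dual_arrs
    by (simp add: linear_map_iff)
  moreover have "((f \<otimes>\<^sub>a Id C d) \<boxplus> (g \<otimes>\<^sub>a Id C d)) \<cdot> r = ((f \<otimes>\<^sub>a Id C d) \<cdot> r) \<boxplus> ((g \<otimes>\<^sub>a Id C d) \<cdot> r)"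
    if "r \<in> hom a ((a \<otimes>\<^sub>o c) \<otimes>\<^sub>o d)" for r
    by (rule comp_add_left[OF that]) (use assms tensor_arr id_in_hom dual_arrs in blast)+
  ultimately show ?thesis
    unfolding sharp_def using assms(3) by (simp add: hom_iff darrs)
qed

lemma sharp_scale:
  assumes "f \<in> hom (a \<otimes>\<^sub>o c) b" "a \<in> Obj C"
  shows "sharp c d k a (r \<star> f) = r \<star> sharp c d k a f"
proof -
  have "(r \<star> f) \<otimes>\<^sub>a Id C d = r \<star> (f \<otimes>\<^sub>a Id C d)"
    using tensor_linear_left[of "a \<otimes>\<^sub>o c" b "Id C d" d d] assms hom_obj[OF assms(1)] id_in_hom dual_arrs
    by (simp add: linear_map_iff)
  moreover have "(r \<star> (f \<otimes>\<^sub>a Id C d)) \<cdot> s = r \<star> ((f \<otimes>\<^sub>a Id C d) \<cdot> s)"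
    if "s \<in> hom a ((a \<otimes>\<^sub>o c) \<otimes>\<^sub>o d)" for s
    by (rule comp_scale_left[OF that]) (use assms tensor_arr id_in_hom dual_arrs in blast)
  ultimately show ?thesis
    unfolding sharp_def using assms(2) by (simp add: hom_iff darrs)
qed

lemma whisker_right_add:
  assumes "f \<in> hom a b" "g \<in> hom a b"
  shows "(f \<boxplus> g) \<otimes>\<^sub>a Id C c = (f \<otimes>\<^sub>a Id C c) \<boxplus> (g \<otimes>\<^sub>a Id C c)"
  using tensor_linear_left[of a b "Id C c" c c] assms hom_obj[OF assms(1)] id_in_hom[OF dual_arrs(1)]
  by (simp add: linear_map_iff)

lemma whisker_right_scale:
  assumes "f \<in> hom a b"
  shows "(r \<star> f) \<otimes>\<^sub>a Id C c = r \<star> (f \<otimes>\<^sub>a Id C c)"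
  using tensor_linear_left[of a b "Id C c" c c] assms hom_obj[OF assms(1)] id_in_hom[OF dual_arrs(1)]
  by (simp add: linear_map_iff)

lemma whisker_in: "f \<in> hom a b \<Longrightarrow> f \<otimes>\<^sub>a Id C c \<in> hom (a \<otimes>\<^sub>o c) (b \<otimes>\<^sub>o c)"
  by (rule tensor_arr[OF _ id_in_hom[OF dual_arrs(1)]])

lemma flat_add:
  assumes "f \<in> hom a (b \<otimes>\<^sub>o d)" "g \<in> hom a (b \<otimes>\<^sub>o d)" "b \<in> Obj C"
  shows "flat c d e b (f \<boxplus> g) = flat c d e b f \<boxplus> flat c d e b g"
proof -
  have "RUnit C b \<cdot> ((Id C b \<otimes>\<^sub>a e) \<cdot> Assoc C b d c) \<in> hom ((b \<otimes>\<^sub>o d) \<otimes>\<^sub>o c) b"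
    using assms(3) by (simp add: hom_iff darrs)
  from comp_add_right[OF whisker_in[OF assms(1)] whisker_in[OF assms(2)] this]
  show ?thesis
    unfolding flat_def whisker_right_add[OF assms(1,2)] .
qed

lemma cu_add:
  assumes "f \<in> hom (a \<otimes>\<^sub>o c) (Unit C)" "g \<in> hom (a \<otimes>\<^sub>o c) (Unit C)" "a \<in> Obj C"
  shows "cu c d k a (f \<boxplus> g) = cu c d k a f \<boxplus> cu c d k a g"
  unfolding cu_def sharp_add[OF assms]
  using comp_add_right[OF sharp_in[OF assms(1,3)] sharp_in[OF assms(2,3)]] lunit_iso[OF dual_arrs(2)] by blast

lemma cu_scale:
  assumes "f \<in> hom (a \<otimes>\<^sub>o c) (Unit C)" "a \<in> Obj C"
  shows "cu c d k a (r \<star> f) = r \<star> cu c d k a f"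
  unfolding cu_def sharp_scale[OF assms]
  using comp_scale_right[OF sharp_in[OF assms]] lunit_iso[OF dual_arrs(2)] by blast

lemma uncu_add:
  assumes "f \<in> hom a d" "g \<in> hom a d"
  shows "uncu c e (f \<boxplus> g) = uncu c e f \<boxplus> uncu c e g"
proof -
  have "e \<in> hom (d \<otimes>\<^sub>o c) (Unit C)" by (simp add: hom_iff darrs)
  then show ?thesis
    unfolding uncu_def whisker_right_add[OF assms]
    by (rule comp_add_right[OF whisker_in[OF assms(1)] whisker_in[OF assms(2)]])
qed

lemma uncu_scale:
  assumes "f \<in> hom a d"
  shows "uncu c e (r \<star> f) = r \<star> uncu c e f"
proof -
  have "e \<in> hom (d \<otimes>\<^sub>o c) (Unit C)" by (simp add: hom_iff darrs)
  then show ?thesis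
    unfolding uncu_def whisker_right_scale[OF assms]
    by (rule comp_scale_right[OF whisker_in[OF assms(1)]])
qed

end

text \<open>The long composite defining a dual arrow is a transpose under \<open>cu\<close>. Dual
  arrows are handled through this bijection from here on, and the composite is not unfolded
  again.\<close>

lemma dual_arr_cu:
  assumes R: "right_duality C R" and f: "f \<in> hom c d"
  shows "dual_arr C R f = cu c (Dual R c) (Coev R c) (Dual R d) (Ev R d \<cdot> (Id C (Dual R d) \<otimes>\<^sub>a f))"
proof -
  have [simp]: "f \<in> Arr C" "Dom C f = c" "Cod C f = d" and o: "c \<in> Obj C" "d \<in> Obj C"
    using f hom_obj[OF f] by (simp_all add: hom_iff)
  note c = dual_arrs[OF R[unfolded right_duality_def, rule_format, OF o(1)]]
    and d = dual_arrs[OF R[unfolded right_duality_def, rule_format, OF o(2)]]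
  have 1: "((Id C (Dual R d) \<otimes>\<^sub>a f) \<otimes>\<^sub>a Id C (Dual R c)) \<cdot> inv_arr C (Assoc C (Dual R d) c (Dual R c)) =
      inv_arr C (Assoc C (Dual R d) d (Dual R c)) \<cdot> (Id C (Dual R d) \<otimes>\<^sub>a f \<otimes>\<^sub>a Id C (Dual R c))"
    using assoc_inv_nat[of "Id C (Dual R d)" f "Id C (Dual R c)"] c d by (simp add: marrs)
  have "dual_arr C R f = LUnit C (Dual R c) \<cdot> ((Ev R d \<otimes>\<^sub>a Id C (Dual R c)) \<cdot>
      ((inv_arr C (Assoc C (Dual R d) d (Dual R c)) \<cdot> (Id C (Dual R d) \<otimes>\<^sub>a f \<otimes>\<^sub>a Id C (Dual R c))) \<cdot>
        ((Id C (Dual R d) \<otimes>\<^sub>a Coev R c) \<cdot> inv_arr C (RUnit C (Dual R d)))))"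
    unfolding dual_arr_def Let_def using c d by (simp add: marrs comp_assoc_arr)
  also have "\<dots> = cu c (Dual R c) (Coev R c) (Dual R d) (Ev R d \<cdot> (Id C (Dual R d) \<otimes>\<^sub>a f))"
    unfolding 1[symmetric] cu_def sharp_def using c d by (simp add: marrs comp_assoc_arr whisker_right)
  finally show ?thesis .
qed

end

section \<open>Tensoring a universal family with an object\<close>

context finite_multitensor_category
begin

context
  fixes R :: "('o, 'm) duality" and \<Phi>
  assumes R: "right_duality C R" and \<Phi>: "univ (Unit C) (Unit C) \<Phi>"
begin

abbreviation rd where "rd z \<equiv> Dual R z"
abbreviation flatR where "flatR z \<equiv> flat z (rd z) (Ev R z)"
abbreviation sharpR where "sharpR z \<equiv> sharp z (rd z) (Coev R z)"
abbreviation cuR where "cuR z \<equiv> cu z (rd z) (Coev R z)"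
abbreviation uncuR where "uncuR z \<equiv> uncu z (Ev R z)"

text \<open>
  The composite \<open>Hom(c, z\<^sup>\<or>\<^sup>\<or>)\<^sup>* = Hom(c \<otimes> z\<^sup>\<or>, 1)\<^sup>* \<rightarrow> Hom(1, c \<otimes> z\<^sup>\<or>) = Hom(1 \<otimes> z, c) = Hom(z, c)\<close>.
\<close>

definition psi where
  "psi z c \<phi> = flatR z c (\<Phi> (c \<otimes>\<^sub>o rd z) (\<lambda>f. \<phi> (cuR (rd z) c f))) \<cdot> inv_arr C (LUnit C z)"

lemma dualR: "z \<in> Obj C \<Longrightarrow> is_right_dual C z (rd z) (Ev R z) (Coev R z)"
  using R by (simp add: right_duality_def)

lemma rd_obj: "z \<in> Obj C \<Longrightarrow> rd z \<in> Obj C"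
  using dual_arrs(2)[OF dualR] .

lemma Phi_natfam: "natfam (Unit C) (Unit C) \<Phi>"
  by (rule univ_natfam[OF \<Phi>])

lemma Fn_cu:
  assumes z: "z \<in> Obj C" and c: "c \<in> Obj C" and \<phi>: "\<phi> \<in> Fn c (rd (rd z))"
  shows "(\<lambda>f. \<phi> (cuR (rd z) c f)) \<in> Fn (c \<otimes>\<^sub>o rd z) (Unit C)"
  using \<phi> cu_add[OF dualR[OF rd_obj[OF z]] _ _ c] cu_scale[OF dualR[OF rd_obj[OF z]] _ c]
    cu_in[OF dualR[OF rd_obj[OF z]] _ c] by (simp add: functional_hom_iff)

lemma Phi_cu_in:
  assumes z: "z \<in> Obj C" and c: "c \<in> Obj C" and \<phi>: "\<phi> \<in> Fn c (rd (rd z))"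
  shows "\<Phi> (c \<otimes>\<^sub>o rd z) (\<lambda>f. \<phi> (cuR (rd z) c f)) \<in> hom (Unit C) (c \<otimes>\<^sub>o rd z)"
  by (rule natfam_in[OF Phi_natfam tensor_obj[OF c rd_obj[OF z]] Fn_cu[OF assms]])

lemma lunit_inv_in: "z \<in> Obj C \<Longrightarrow> inv_arr C (LUnit C z) \<in> hom z (Unit C \<otimes>\<^sub>o z)"
  using lunit_inv_arr[of z] by (simp add: hom_iff)

lemma lunit_in: "z \<in> Obj C \<Longrightarrow> LUnit C z \<in> hom (Unit C \<otimes>\<^sub>o z) z"
  using lunit_iso by blast

lemma psi_lunit:
  assumes z: "z \<in> Obj C" and c: "c \<in> Obj C" and \<phi>: "\<phi> \<in> Fn c (rd (rd z))"
  shows "psi z c \<phi> \<cdot> LUnit C z = flatR z c (\<Phi> (c \<otimes>\<^sub>o rd z) (\<lambda>f. \<phi> (cuR (rd z) c f)))"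
proof -
  let ?F = "flatR z c (\<Phi> (c \<otimes>\<^sub>o rd z) (\<lambda>f. \<phi> (cuR (rd z) c f)))"
  have F: "?F \<in> hom (Unit C \<otimes>\<^sub>o z) c"
    by (rule flat_in[OF dualR[OF z] Phi_cu_in[OF assms] c])
  have "psi z c \<phi> \<cdot> LUnit C z = ?F \<cdot> (inv_arr C (LUnit C z) \<cdot> LUnit C z)"
    unfolding psi_def by (rule comp_assoc[OF lunit_in[OF z] lunit_inv_in[OF z] F])
  also have "\<dots> = ?F"
    using inv_arr(5)[OF lunit_arr(1)[OF z]] lunit_arr(3)[OF z] comp_id_right[OF F] by simp
  finally show ?thesis .
qed

text \<open>Each map of the composite is natural in c: naturality at u becomes that of \<Phi> at u
  \<otimes> id, carried across by \<open>flat_post\<close> on arrows and by \<open>cu_pre\<close> on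
  functionals.\<close>

lemma psi_natfam:
  assumes z: "z \<in> Obj C"
  shows "natfam (rd (rd z)) z (psi z)"
proof (rule natfamI)
  show "rd (rd z) \<in> Obj C" "z \<in> Obj C"
    using z rd_obj by blast+
  note dz = dualR[OF z] and il = lunit_inv_in[OF z]
  have F: "flatR z c (\<Phi> (c \<otimes>\<^sub>o rd z) (\<lambda>f. \<phi> (cuR (rd z) c f))) \<in> hom (Unit C \<otimes>\<^sub>o z) c"
    if "c \<in> Obj C" "\<phi> \<in> Fn c (rd (rd z))" for c \<phi>
    by (rule flat_in[OF dz Phi_cu_in[OF z that] that(1)])
  show "psi z c \<phi> \<in> hom z c" if "c \<in> Obj C" "\<phi> \<in> Fn c (rd (rd z))" for c \<phi>
    unfolding psi_def by (rule comp_in_hom[OF il F[OF that]])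
  show "psi z c (\<lambda>f. \<phi> f + \<psi> f) = psi z c \<phi> \<boxplus> psi z c \<psi>"
    if c: "c \<in> Obj C" and f: "\<phi> \<in> Fn c (rd (rd z))" "\<psi> \<in> Fn c (rd (rd z))" for c \<phi> \<psi>
    unfolding psi_def
    by (simp only: natfam_add[OF Phi_natfam tensor_obj[OF c rd_obj[OF z]] Fn_cu[OF z c f(1)] Fn_cu[OF z c f(2)]]
        flat_add[OF dz Phi_cu_in[OF z c f(1)] Phi_cu_in[OF z c f(2)] c]
        comp_add_left[OF il F[OF c f(1)] F[OF c f(2)]])
  show "psi z c \<phi> = psi z c \<psi>"
    if c: "c \<in> Obj C" and f: "\<phi> \<in> Fn c (rd (rd z))" "\<psi> \<in> Fn c (rd (rd z))"
      and eq: "\<And>g. g \<in> hom c (rd (rd z)) \<Longrightarrow> \<phi> g = \<psi> g" for c \<phi> \<psi>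
  proof -
    have "\<Phi> (c \<otimes>\<^sub>o rd z) (\<lambda>f. \<phi> (cuR (rd z) c f)) = \<Phi> (c \<otimes>\<^sub>o rd z) (\<lambda>f. \<psi> (cuR (rd z) c f))"
      by (rule natfam_cong[OF Phi_natfam tensor_obj[OF c rd_obj[OF z]] Fn_cu[OF z c f(1)] Fn_cu[OF z c f(2)]])
        (rule eq[OF cu_in[OF dualR[OF rd_obj[OF z]] _ c]])
    then show ?thesis unfolding psi_def by (simp only:)
  qed
  show "u \<cdot> psi z c \<phi> = psi z d (\<lambda>f. \<phi> (f \<cdot> u))"
    if u: "u \<in> hom c d" and f: "\<phi> \<in> Fn c (rd (rd z))" for c d u \<phi>
  proof -
    note c = hom_obj(1)[OF u] and d = hom_obj(2)[OF u]
    let ?u = "u \<otimes>\<^sub>a Id C (rd z)"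
    have u': "?u \<in> hom (c \<otimes>\<^sub>o rd z) (d \<otimes>\<^sub>o rd z)"
      by (rule tensor_arr[OF u id_in_hom[OF rd_obj[OF z]]])
    note f' = Fn_precomp[OF f u]
    have "u \<cdot> psi z c \<phi> = (u \<cdot> flatR z c (\<Phi> (c \<otimes>\<^sub>o rd z) (\<lambda>f. \<phi> (cuR (rd z) c f)))) \<cdot> inv_arr C (LUnit C z)"
      unfolding psi_def by (rule comp_assoc[OF il F[OF c f] u, symmetric])
    also have "u \<cdot> flatR z c (\<Phi> (c \<otimes>\<^sub>o rd z) (\<lambda>f. \<phi> (cuR (rd z) c f))) =
        flatR z d (?u \<cdot> \<Phi> (c \<otimes>\<^sub>o rd z) (\<lambda>f. \<phi> (cuR (rd z) c f)))"
      by (rule flat_post[OF dz Phi_cu_in[OF z c f] u, symmetric])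
    also have "?u \<cdot> \<Phi> (c \<otimes>\<^sub>o rd z) (\<lambda>f. \<phi> (cuR (rd z) c f)) =
        \<Phi> (d \<otimes>\<^sub>o rd z) (\<lambda>f. \<phi> (cuR (rd z) c (f \<cdot> ?u)))"
      by (rule natfam_nat[OF Phi_natfam u' Fn_cu[OF z c f]])
    also have "\<dots> = \<Phi> (d \<otimes>\<^sub>o rd z) (\<lambda>f. \<phi> (cuR (rd z) d f \<cdot> u))"
    proof (rule natfam_cong[OF Phi_natfam tensor_obj[OF d rd_obj[OF z]]
          Fn_precomp[OF Fn_cu[OF z c f] u'] Fn_cu[OF z d f']])
      fix g assume g: "g \<in> hom (d \<otimes>\<^sub>o rd z) (Unit C)"
      show "\<phi> (cuR (rd z) c (g \<cdot> ?u)) = \<phi> (cuR (rd z) d g \<cdot> u)"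
        by (simp only: cu_pre[OF dualR[OF rd_obj[OF z]] g u])
    qed
    finally show ?thesis unfolding psi_def .
  qed
qed

text \<open>This equation characterises the dual arrow; it lets w slide from one factor of an
  evaluation to the other.\<close>

lemma ev_dual_arr:
  assumes w: "w \<in> hom z y"
  shows "Ev R z \<cdot> (dual_arr C R w \<otimes>\<^sub>a Id C z) = Ev R y \<cdot> (Id C (rd y) \<otimes>\<^sub>a w)"
proof -
  note z = hom_obj(1)[OF w] and y = hom_obj(2)[OF w]
  have "Ev R y \<cdot> (Id C (rd y) \<otimes>\<^sub>a w) \<in> hom (rd y \<otimes>\<^sub>o z) (Unit C)"
    using w dual_arrs[OF dualR[OF y]] by (simp add: hom_iff marrs)
  from uncu_cu[OF dualR[OF z] this rd_obj[OF y]]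
  show ?thesis
    unfolding dual_arr_cu[OF R w] uncu_def .
qed

lemma dual_arr_in: "w \<in> hom z y \<Longrightarrow> dual_arr C R w \<in> hom (rd y) (rd z)"
proof -
  assume w: "w \<in> hom z y"
  note z = hom_obj(1)[OF w] and y = hom_obj(2)[OF w]
  have "Ev R y \<cdot> (Id C (rd y) \<otimes>\<^sub>a w) \<in> hom (rd y \<otimes>\<^sub>o z) (Unit C)"
    using w dual_arrs[OF dualR[OF y]] by (simp add: hom_iff marrs)
  from cu_in[OF dualR[OF z] this rd_obj[OF y]] show ?thesis
    unfolding dual_arr_cu[OF R w] .
qed

text \<open>The arrow w and its dual are mates: sliding by \<open>ev_dual_arr\<close> inside
  \<open>flat\<close> turns the dual of w on the second factor of the target of g into w on the
  second factor of the source of the transpose.\<close>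

lemma flat_dual:
  assumes w: "w \<in> hom z y" and g: "g \<in> hom a (c \<otimes>\<^sub>o rd y)" and c: "c \<in> Obj C"
  shows "flatR z c ((Id C c \<otimes>\<^sub>a dual_arr C R w) \<cdot> g) = flatR y c g \<cdot> (Id C a \<otimes>\<^sub>a w)"
proof -
  note z = hom_obj(1)[OF w] and y = hom_obj(2)[OF w] and a = hom_obj(1)[OF g]
  note [simp] = z y a c rd_obj[OF z] rd_obj[OF y]
  let ?w = "dual_arr C R w"
  have [simp]: "w \<in> Arr C" "Dom C w = z" "Cod C w = y" "?w \<in> Arr C" "Dom C ?w = rd y" "Cod C ?w = rd z"
    "g \<in> Arr C" "Dom C g = a" "Cod C g = c \<otimes>\<^sub>o rd y"
    using w g dual_arr_in[OF w] by (simp_all add: hom_iff)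
  note ar = dual_arrs[OF dualR[OF z]] dual_arrs[OF dualR[OF y]] marrs
  have 1: "Assoc C c (rd z) z \<cdot> ((Id C c \<otimes>\<^sub>a ?w) \<otimes>\<^sub>a Id C z) = (Id C c \<otimes>\<^sub>a ?w \<otimes>\<^sub>a Id C z) \<cdot> Assoc C c (rd y) z"
    using assoc_nat[of "Id C c" ?w "Id C z"] by (simp add: ar)
  have 2: "(Id C c \<otimes>\<^sub>a Id C (rd y) \<otimes>\<^sub>a w) \<cdot> Assoc C c (rd y) z = Assoc C c (rd y) y \<cdot> (Id C (c \<otimes>\<^sub>o rd y) \<otimes>\<^sub>a w)"
    using assoc_nat[of "Id C c" "Id C (rd y)" w] by (simp add: ar)
  have 3: "(Id C (c \<otimes>\<^sub>o rd y) \<otimes>\<^sub>a w) \<cdot> (g \<otimes>\<^sub>a Id C z) = (g \<otimes>\<^sub>a Id C y) \<cdot> (Id C a \<otimes>\<^sub>a w)"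
    using whisker_exchange[of g w] by simp
  have "flatR z c ((Id C c \<otimes>\<^sub>a ?w) \<cdot> g) = RUnit C c \<cdot> ((Id C c \<otimes>\<^sub>a Ev R z) \<cdot>
      ((Assoc C c (rd z) z \<cdot> ((Id C c \<otimes>\<^sub>a ?w) \<otimes>\<^sub>a Id C z)) \<cdot> (g \<otimes>\<^sub>a Id C z)))"
    by (simp add: flat_def ar whisker_right comp_assoc_arr)
  also have "\<dots> = RUnit C c \<cdot> ((Id C c \<otimes>\<^sub>a (Ev R z \<cdot> (?w \<otimes>\<^sub>a Id C z))) \<cdot> (Assoc C c (rd y) z \<cdot> (g \<otimes>\<^sub>a Id C z)))"
    unfolding 1 by (simp add: ar whisker_left comp_assoc_arr)
  also have "\<dots> = RUnit C c \<cdot> ((Id C c \<otimes>\<^sub>a Ev R y) \<cdot>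
      (((Id C c \<otimes>\<^sub>a Id C (rd y) \<otimes>\<^sub>a w) \<cdot> Assoc C c (rd y) z) \<cdot> (g \<otimes>\<^sub>a Id C z)))"
    unfolding ev_dual_arr[OF w] by (simp add: ar whisker_left comp_assoc_arr)
  also have "\<dots> = RUnit C c \<cdot> ((Id C c \<otimes>\<^sub>a Ev R y) \<cdot>
      (Assoc C c (rd y) y \<cdot> ((Id C (c \<otimes>\<^sub>o rd y) \<otimes>\<^sub>a w) \<cdot> (g \<otimes>\<^sub>a Id C z))))"
    unfolding 2 by (simp add: ar comp_assoc_arr)
  also have "\<dots> = flatR y c g \<cdot> (Id C a \<otimes>\<^sub>a w)"
    unfolding 3 by (simp add: flat_def ar comp_assoc_arr)
  finally show ?thesis .
qed

text \<open>The same sliding one dual higher: \<open>cu\<close> for the dual of z ends in the double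
  dual of z, so the dual of w turns into its double dual.\<close>

lemma cu_dual:
  assumes w: "w \<in> hom z y" and f: "f \<in> hom (c \<otimes>\<^sub>o rd z) (Unit C)" and c: "c \<in> Obj C"
  shows "cuR (rd y) c (f \<cdot> (Id C c \<otimes>\<^sub>a dual_arr C R w)) = dual_arr C R (dual_arr C R w) \<cdot> cuR (rd z) c f"
proof -
  note z = hom_obj(1)[OF w] and y = hom_obj(2)[OF w]
  note z' = rd_obj[OF z] and y' = rd_obj[OF y]
  note dz' = dualR[OF z'] and dy' = dualR[OF y']
  let ?w = "dual_arr C R w"
  note w' = dual_arr_in[OF w]
  have wa: "?w \<in> Arr C" "Dom C ?w = rd y" "Cod C ?w = rd z"
    using w' by (simp_all add: hom_iff)
  note A = cu_in[OF dz' f c]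
  have Aa: "cuR (rd z) c f \<in> Arr C" "Dom C (cuR (rd z) c f) = c" "Cod C (cuR (rd z) c f) = rd (rd z)"
    using A by (simp_all add: hom_iff)
  have E: "Ev R (rd z) \<cdot> (Id C (rd (rd z)) \<otimes>\<^sub>a ?w) \<in> hom (rd (rd z) \<otimes>\<^sub>o rd y) (Unit C)"
    using wa dual_arrs[OF dz'] rd_obj[OF z'] by (simp add: hom_iff marrs)
  have "dual_arr C R ?w \<cdot> cuR (rd z) c f =
      cuR (rd y) c ((Ev R (rd z) \<cdot> (Id C (rd (rd z)) \<otimes>\<^sub>a ?w)) \<cdot> (cuR (rd z) c f \<otimes>\<^sub>a Id C (rd y)))"
    unfolding dual_arr_cu[OF R w'] by (rule cu_pre[OF dy' E A, symmetric])
  also have "(Ev R (rd z) \<cdot> (Id C (rd (rd z)) \<otimes>\<^sub>a ?w)) \<cdot> (cuR (rd z) c f \<otimes>\<^sub>a Id C (rd y)) =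
      Ev R (rd z) \<cdot> ((Id C (rd (rd z)) \<otimes>\<^sub>a ?w) \<cdot> (cuR (rd z) c f \<otimes>\<^sub>a Id C (rd y)))"
    using wa Aa dual_arrs[OF dz'] rd_obj[OF z'] y' by (simp add: marrs comp_assoc_arr)
  also have "(Id C (rd (rd z)) \<otimes>\<^sub>a ?w) \<cdot> (cuR (rd z) c f \<otimes>\<^sub>a Id C (rd y)) =
      (cuR (rd z) c f \<otimes>\<^sub>a Id C (rd z)) \<cdot> (Id C c \<otimes>\<^sub>a ?w)"
    using whisker_exchange[OF Aa(1) wa(1)] wa Aa by simp
  also have "Ev R (rd z) \<cdot> \<dots> = uncuR (rd z) (cuR (rd z) c f) \<cdot> (Id C c \<otimes>\<^sub>a ?w)"
    unfolding uncu_def using wa Aa dual_arrs[OF dz'] z' c by (simp add: marrs comp_assoc_arr)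
  also have "uncuR (rd z) (cuR (rd z) c f) = f"
    by (rule uncu_cu[OF dz' f c])
  finally show ?thesis by (rule sym)
qed

text \<open>\<Phi> is natural at id \<otimes> the dual of w. On functionals \<open>cu_dual\<close>
  reads this as postcomposition with the double dual of w, and on arrows \<open>flat_dual\<close>
  reads it as precomposition with w.\<close>

lemma psi_natural:
  assumes w: "w \<in> hom z y" and c: "c \<in> Obj C" and \<phi>: "\<phi> \<in> Fn c (rd (rd y))"
  shows "psi z c (\<lambda>g. \<phi> (dual_arr C R (dual_arr C R w) \<cdot> g)) = psi y c \<phi> \<cdot> w"
proof -
  note z = hom_obj(1)[OF w] and y = hom_obj(2)[OF w]
  note z' = rd_obj[OF z] and y' = rd_obj[OF y]
  let ?w = "dual_arr C R w"
  note w' = dual_arr_in[OF w] and w'' = dual_arr_in[OF dual_arr_in[OF w]]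
  have u: "Id C c \<otimes>\<^sub>a ?w \<in> hom (c \<otimes>\<^sub>o rd y) (c \<otimes>\<^sub>o rd z)"
    by (rule tensor_arr[OF id_in_hom[OF c] w'])
  note \<phi>w = Fn_postcomp[OF \<phi> w'']
  note F = Fn_cu[OF y c \<phi>] and P = Phi_cu_in[OF y c \<phi>]
  have wa: "w \<in> Arr C" "Dom C w = z" "Cod C w = y"
    using w by (simp_all add: hom_iff)
  have "\<Phi> (c \<otimes>\<^sub>o rd z) (\<lambda>f. \<phi> (dual_arr C R ?w \<cdot> cuR (rd z) c f)) =
      \<Phi> (c \<otimes>\<^sub>o rd z) (\<lambda>f. \<phi> (cuR (rd y) c (f \<cdot> (Id C c \<otimes>\<^sub>a ?w))))"
    by (rule natfam_cong[OF Phi_natfam tensor_obj[OF c z'] Fn_cu[OF z c \<phi>w] Fn_precomp[OF F u]])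
      (simp only: cu_dual[OF w _ c])
  also have "\<dots> = (Id C c \<otimes>\<^sub>a ?w) \<cdot> \<Phi> (c \<otimes>\<^sub>o rd y) (\<lambda>f. \<phi> (cuR (rd y) c f))"
    by (rule natfam_nat[OF Phi_natfam u F, symmetric])
  finally have 1: "psi z c (\<lambda>g. \<phi> (dual_arr C R ?w \<cdot> g)) =
      flatR z c ((Id C c \<otimes>\<^sub>a ?w) \<cdot> \<Phi> (c \<otimes>\<^sub>o rd y) (\<lambda>f. \<phi> (cuR (rd y) c f))) \<cdot> inv_arr C (LUnit C z)"
    unfolding psi_def by (simp only:)
  have 2: "(Id C (Unit C) \<otimes>\<^sub>a w) \<cdot> inv_arr C (LUnit C z) = inv_arr C (LUnit C y) \<cdot> w"
    using lunit_inv_nat[OF wa(1)] wa by simp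
  have wu: "Id C (Unit C) \<otimes>\<^sub>a w \<in> hom (Unit C \<otimes>\<^sub>o z) (Unit C \<otimes>\<^sub>o y)"
    by (rule tensor_arr[OF id_in_hom[OF unit_obj] w])
  have F: "flatR y c (\<Phi> (c \<otimes>\<^sub>o rd y) (\<lambda>f. \<phi> (cuR (rd y) c f))) \<in> hom (Unit C \<otimes>\<^sub>o y) c"
    by (rule flat_in[OF dualR[OF y] P c])
  show ?thesis
    unfolding 1 unfolding flat_dual[OF w P c] psi_def comp_assoc[OF lunit_inv_in[OF z] wu F] 2
    by (rule comp_assoc[OF w lunit_inv_in[OF y] F, symmetric])
qed

section \<open>Universality of \<open>psi\<close>\<close>

lemma Fn_uncu:
  assumes z: "z \<in> Obj C" and d: "d \<in> Obj C" and \<mu>: "\<mu> \<in> Fn d (Unit C)"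
  shows "(\<lambda>f. \<mu> (uncuR (rd z) f \<cdot> sharpR z d (Id C (d \<otimes>\<^sub>o z)))) \<in> Fn (d \<otimes>\<^sub>o z) (rd (rd z))"
proof -
  have s: "sharpR z d (Id C (d \<otimes>\<^sub>o z)) \<in> hom d ((d \<otimes>\<^sub>o z) \<otimes>\<^sub>o rd z)"
    by (rule sharp_in[OF dualR[OF z] id_in_hom[OF tensor_obj[OF d z]] d])
  note dz = dualR[OF rd_obj[OF z]]
  have "(\<lambda>f. \<mu> (f \<cdot> sharpR z d (Id C (d \<otimes>\<^sub>o z)))) \<in> Fn ((d \<otimes>\<^sub>o z) \<otimes>\<^sub>o rd z) (Unit C)"
    by (rule Fn_precomp[OF \<mu> s])
  then show ?thesis
    using uncu_add[OF dz] uncu_scale[OF dz] uncu_in[OF dz] by (simp add: functional_hom_iff)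
qed

text \<open>\<open>psi\<close> at d \<otimes> z knows all of \<Phi> at d: transport \<mu> along the
  unit d \<rightarrow> (d \<otimes> z) \<otimes> z^\<or> of the adjunction, apply naturality of
  \<Phi> at that unit, and cancel the unit by a triangle identity.\<close>

lemma Phi_whisker:
  assumes z: "z \<in> Obj C" and d: "d \<in> Obj C" and \<mu>: "\<mu> \<in> Fn d (Unit C)"
  shows "\<Phi> d \<mu> \<otimes>\<^sub>a Id C z =
    psi z (d \<otimes>\<^sub>o z) (\<lambda>f. \<mu> (uncuR (rd z) f \<cdot> sharpR z d (Id C (d \<otimes>\<^sub>o z)))) \<cdot> LUnit C z"
proof -
  let ?s = "sharpR z d (Id C (d \<otimes>\<^sub>o z))"
  note dz = tensor_obj[OF d z]
  have s: "?s \<in> hom d ((d \<otimes>\<^sub>o z) \<otimes>\<^sub>o rd z)"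
    by (rule sharp_in[OF dualR[OF z] id_in_hom[OF dz] d])
  note m = Fn_uncu[OF assms]
  note P = natfam_in[OF Phi_natfam d \<mu>]
  have "\<Phi> ((d \<otimes>\<^sub>o z) \<otimes>\<^sub>o rd z) (\<lambda>f. \<mu> (uncuR (rd z) (cuR (rd z) (d \<otimes>\<^sub>o z) f) \<cdot> ?s)) =
      \<Phi> ((d \<otimes>\<^sub>o z) \<otimes>\<^sub>o rd z) (\<lambda>f. \<mu> (f \<cdot> ?s))"
    by (rule natfam_cong[OF Phi_natfam tensor_obj[OF dz rd_obj[OF z]] Fn_cu[OF z dz m] Fn_precomp[OF \<mu> s]])
      (simp only: uncu_cu[OF dualR[OF rd_obj[OF z]] _ dz])
  also have "\<dots> = ?s \<cdot> \<Phi> d \<mu>"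
    by (rule natfam_nat[OF Phi_natfam s \<mu>, symmetric])
  finally have "psi z (d \<otimes>\<^sub>o z) (\<lambda>f. \<mu> (uncuR (rd z) f \<cdot> ?s)) \<cdot> LUnit C z = flatR z (d \<otimes>\<^sub>o z) (?s \<cdot> \<Phi> d \<mu>)"
    unfolding psi_lunit[OF z dz m] by (simp only:)
  also have "\<dots> = flatR z (d \<otimes>\<^sub>o z) ?s \<cdot> (\<Phi> d \<mu> \<otimes>\<^sub>a Id C z)"
    by (rule flat_pre[OF dualR[OF z] s P dz])
  also have "\<dots> = \<Phi> d \<mu> \<otimes>\<^sub>a Id C z"
    unfolding flat_sharp_id[OF dualR[OF z] d]
    by (rule comp_id_left[OF tensor_arr[OF P id_in_hom[OF z]]])
  finally show ?thesis by (rule sym)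
qed

text \<open>Left duals are used here: with z a right dual of l, Hom(X, z) = Hom(X \<otimes> l, 1),
  and for arrows into 1 the uniqueness of \<Phi> is available. \<open>Phi_whisker\<close> translates
  composites with \<Phi> into composites with \<open>psi\<close>.\<close>

lemma psi_unique:
  assumes z: "z \<in> Obj C" and h: "h1 \<in> hom X z" "h2 \<in> hom X z"
    and eq: "\<And>c \<phi>. c \<in> Obj C \<Longrightarrow> \<phi> \<in> Fn c (rd (rd z)) \<Longrightarrow> psi z c \<phi> \<cdot> h1 = psi z c \<phi> \<cdot> h2"
  shows "h1 = h2"
proof -
  obtain l e' k' where l: "is_right_dual C l z e' k'"
    using has_left_duals[OF z] by blast
  note X = hom_obj(1)[OF h(1)]
  have 1: "sharp l z k' X (\<Phi> d \<mu> \<cdot> uncu l e' h) =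
      psi z (d \<otimes>\<^sub>o z) (\<lambda>f. \<mu> (uncuR (rd z) f \<cdot> sharpR z d (Id C (d \<otimes>\<^sub>o z)))) \<cdot> h"
    if h: "h \<in> hom X z" and d: "d \<in> Obj C" and \<mu>: "\<mu> \<in> Fn d (Unit C)" for h d \<mu>
  proof -
    let ?p = "psi z (d \<otimes>\<^sub>o z) (\<lambda>f. \<mu> (uncuR (rd z) f \<cdot> sharpR z d (Id C (d \<otimes>\<^sub>o z))))"
    note P = natfam_in[OF Phi_natfam d \<mu>] and h' = uncu_in[OF l h]
    have p: "?p \<in> hom z (d \<otimes>\<^sub>o z)"
      by (rule natfam_in[OF psi_natfam[OF z] tensor_obj[OF d z] Fn_uncu[OF z d \<mu>]])
    have "sharp l z k' X (\<Phi> d \<mu> \<cdot> uncu l e' h) = (?p \<cdot> LUnit C z) \<cdot> sharp l z k' X (uncu l e' h)"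
      unfolding sharp_post[OF l h' P X] Phi_whisker[OF z d \<mu>] ..
    also have "\<dots> = ?p \<cdot> cu l z k' X (uncu l e' h)"
      unfolding cu_def by (rule comp_assoc[OF sharp_in[OF l h' X] lunit_in[OF z] p])
    also have "cu l z k' X (uncu l e' h) = h"
      by (rule cu_uncu[OF l h])
    finally show ?thesis .
  qed
  have "uncu l e' h1 = uncu l e' h2"
  proof (rule univ_unique[OF \<Phi> uncu_in[OF l h(1)] uncu_in[OF l h(2)]])
    fix d \<mu> assume d: "d \<in> Obj C" and \<mu>: "\<mu> \<in> Fn d (Unit C)"
    note P = natfam_in[OF Phi_natfam d \<mu>]
    have "sharp l z k' X (\<Phi> d \<mu> \<cdot> uncu l e' h1) = sharp l z k' X (\<Phi> d \<mu> \<cdot> uncu l e' h2)"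
      unfolding 1[OF h(1) d \<mu>] 1[OF h(2) d \<mu>] by (rule eq[OF tensor_obj[OF d z] Fn_uncu[OF z d \<mu>]])
    then have "flat l z e' d (sharp l z k' X (\<Phi> d \<mu> \<cdot> uncu l e' h1)) =
        flat l z e' d (sharp l z k' X (\<Phi> d \<mu> \<cdot> uncu l e' h2))"
      by (simp only:)
    then show "\<Phi> d \<mu> \<cdot> uncu l e' h1 = \<Phi> d \<mu> \<cdot> uncu l e' h2"
      unfolding flat_sharp[OF l comp_in_hom[OF uncu_in[OF l h(1)] P] X]
        flat_sharp[OF l comp_in_hom[OF uncu_in[OF l h(2)] P] X] .
  qed
  then have "cu l z k' X (uncu l e' h1) = cu l z k' X (uncu l e' h2)"
    by (simp only:)
  then show ?thesis
    unfolding cu_uncu[OF l h(1)] cu_uncu[OF l h(2)] .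
qed

text \<open>By the computation in \<open>psi_unique\<close>, the transpose X \<otimes> l
  \<rightarrow> 1 of the wanted arrow must compose with \<Phi> d \<mu> to \<gamma> d \<mu> below. So
  \<gamma> is shown to be a natural family, factored through \<Phi>, and the factor is transposed
  back.\<close>

lemma psi_factor:
  assumes z: "z \<in> Obj C" and \<beta>: "natfam (rd (rd z)) X \<beta>"
  shows "\<exists>h \<in> hom X z. \<forall>c \<in> Obj C. \<forall>\<phi> \<in> Fn c (rd (rd z)). psi z c \<phi> \<cdot> h = \<beta> c \<phi>"
proof -
  obtain l e' k' where l: "is_right_dual C l z e' k'"
    using has_left_duals[OF z] by blast
  have X: "X \<in> Obj C"
    using natfam_obj(2)[OF \<beta>] .
  note z' = rd_obj[OF z]
  note dz = dualR[OF z] and dz' = dualR[OF z']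
  let ?s = "\<lambda>d. sharpR z d (Id C (d \<otimes>\<^sub>o z))"
  define mt where "mt d \<mu> = (\<lambda>f. \<mu> (uncuR (rd z) f \<cdot> ?s d))" for d and \<mu> :: "'m \<Rightarrow> 'k"
  have mt: "mt d \<mu> \<in> Fn (d \<otimes>\<^sub>o z) (rd (rd z))" if "d \<in> Obj C" "\<mu> \<in> Fn d (Unit C)" for d \<mu>
    unfolding mt_def by (rule Fn_uncu[OF z that])
  have s: "?s d \<in> hom d ((d \<otimes>\<^sub>o z) \<otimes>\<^sub>o rd z)" if "d \<in> Obj C" for d
    by (rule sharp_in[OF dz id_in_hom[OF tensor_obj[OF that z]] that])
  define \<gamma> where "\<gamma> d \<mu> = flat l z e' d (\<beta> (d \<otimes>\<^sub>o z) (mt d \<mu>))" for d \<mu>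
  have B: "\<beta> (d \<otimes>\<^sub>o z) (mt d \<mu>) \<in> hom X (d \<otimes>\<^sub>o z)" if "d \<in> Obj C" "\<mu> \<in> Fn d (Unit C)" for d \<mu>
    by (rule natfam_in[OF \<beta> tensor_obj[OF that(1) z] mt[OF that]])
  have "natfam (Unit C) (X \<otimes>\<^sub>o l) \<gamma>"
  proof (rule natfamI)
    show "Unit C \<in> Obj C" "X \<otimes>\<^sub>o l \<in> Obj C"
      using unit_obj tensor_obj[OF X dual_arrs(1)[OF l]] .
    show "\<gamma> d \<mu> \<in> hom (X \<otimes>\<^sub>o l) d" if "d \<in> Obj C" "\<mu> \<in> Fn d (Unit C)" for d \<mu>
      unfolding \<gamma>_def by (rule flat_in[OF l B[OF that] that(1)])
    show "\<gamma> d (\<lambda>f. \<mu> f + \<nu> f) = \<gamma> d \<mu> \<boxplus> \<gamma> d \<nu>"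
      if d: "d \<in> Obj C" and m: "\<mu> \<in> Fn d (Unit C)" "\<nu> \<in> Fn d (Unit C)" for d \<mu> \<nu>
    proof -
      have "mt d (\<lambda>f. \<mu> f + \<nu> f) = (\<lambda>f. mt d \<mu> f + mt d \<nu> f)"
        by (simp add: mt_def)
      then show ?thesis
        unfolding \<gamma>_def
        by (simp only: natfam_add[OF \<beta> tensor_obj[OF d z] mt[OF d m(1)] mt[OF d m(2)]]
            flat_add[OF l B[OF d m(1)] B[OF d m(2)] d])
    qed
    show "\<gamma> d \<mu> = \<gamma> d \<nu>"
      if d: "d \<in> Obj C" and m: "\<mu> \<in> Fn d (Unit C)" "\<nu> \<in> Fn d (Unit C)"
        and eq: "\<And>f. f \<in> hom d (Unit C) \<Longrightarrow> \<mu> f = \<nu> f" for d \<mu> \<nu>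
    proof -
      have "\<beta> (d \<otimes>\<^sub>o z) (mt d \<mu>) = \<beta> (d \<otimes>\<^sub>o z) (mt d \<nu>)"
        by (rule natfam_cong[OF \<beta> tensor_obj[OF d z] mt[OF d m(1)] mt[OF d m(2)]])
          (unfold mt_def, rule eq[OF comp_in_hom[OF s[OF d] uncu_in[OF dz']]])
      then show ?thesis
        unfolding \<gamma>_def by (simp only:)
    qed
    show "u \<cdot> \<gamma> d \<mu> = \<gamma> d' (\<lambda>f. \<mu> (f \<cdot> u))"
      if u: "u \<in> hom d d'" and m: "\<mu> \<in> Fn d (Unit C)" for d d' u \<mu>
    proof -
      note d = hom_obj(1)[OF u] and d' = hom_obj(2)[OF u]
      let ?u = "u \<otimes>\<^sub>a Id C z"
      have u': "?u \<in> hom (d \<otimes>\<^sub>o z) (d' \<otimes>\<^sub>o z)"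
        by (rule tensor_arr[OF u id_in_hom[OF z]])
      note mu = Fn_precomp[OF m u]
      \<comment> \<open>Naturality of the unit of the adjunction in d: both sides are the transpose
        of u \<otimes> id.\<close>
      have su: "(?u \<otimes>\<^sub>a Id C (rd z)) \<cdot> ?s d = ?s d' \<cdot> u"
        unfolding sharp_post[OF dz id_in_hom[OF tensor_obj[OF d z]] u' d, symmetric]
          comp_id_right[OF u'] sharp_pre[OF dz id_in_hom[OF tensor_obj[OF d' z]] u, symmetric]
          comp_id_left[OF u'] ..
      have "u \<cdot> \<gamma> d \<mu> = flat l z e' d' (?u \<cdot> \<beta> (d \<otimes>\<^sub>o z) (mt d \<mu>))"
        unfolding \<gamma>_def by (rule flat_post[OF l B[OF d m] u, symmetric])
      also have "?u \<cdot> \<beta> (d \<otimes>\<^sub>o z) (mt d \<mu>) = \<beta> (d' \<otimes>\<^sub>o z) (\<lambda>f. mt d \<mu> (f \<cdot> ?u))"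
        by (rule natfam_nat[OF \<beta> u' mt[OF d m]])
      also have "\<dots> = \<beta> (d' \<otimes>\<^sub>o z) (mt d' (\<lambda>f. \<mu> (f \<cdot> u)))"
      proof (rule natfam_cong[OF \<beta> tensor_obj[OF d' z] Fn_precomp[OF mt[OF d m] u'] mt[OF d' mu]])
        fix f assume f: "f \<in> hom (d' \<otimes>\<^sub>o z) (rd (rd z))"
        have "uncuR (rd z) (f \<cdot> ?u) \<cdot> ?s d = (uncuR (rd z) f \<cdot> (?u \<otimes>\<^sub>a Id C (rd z))) \<cdot> ?s d"
          unfolding uncu_pre[OF dz' f u'] ..
        also have "\<dots> = uncuR (rd z) f \<cdot> ((?u \<otimes>\<^sub>a Id C (rd z)) \<cdot> ?s d)"
          by (rule comp_assoc[OF s[OF d] tensor_arr[OF u' id_in_hom[OF z']] uncu_in[OF dz' f]])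
        also have "\<dots> = (uncuR (rd z) f \<cdot> ?s d') \<cdot> u"
          unfolding su by (rule comp_assoc[OF u s[OF d'] uncu_in[OF dz' f], symmetric])
        finally show "mt d \<mu> (f \<cdot> ?u) = mt d' (\<lambda>f. \<mu> (f \<cdot> u)) f"
          unfolding mt_def by (simp only:)
      qed
      finally show ?thesis
        unfolding \<gamma>_def .
    qed
  qed
  then obtain h' where h': "h' \<in> hom (X \<otimes>\<^sub>o l) (Unit C)"
    and h'\<gamma>: "\<And>d \<mu>. d \<in> Obj C \<Longrightarrow> \<mu> \<in> Fn d (Unit C) \<Longrightarrow> \<Phi> d \<mu> \<cdot> h' = \<gamma> d \<mu>"
    using univ_ex[OF \<Phi>] by blast
  let ?h = "cu l z k' X h'"
  have "psi z c \<phi> \<cdot> ?h = \<beta> c \<phi>" if c: "c \<in> Obj C" and \<phi>: "\<phi> \<in> Fn c (rd (rd z))" for c \<phi>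
  proof -
    let ?c = "c \<otimes>\<^sub>o rd z" and ?\<mu> = "\<lambda>f. \<phi> (cuR (rd z) c f)"
    note cz = tensor_obj[OF c z'] and F = Fn_cu[OF z c \<phi>] and P = Phi_cu_in[OF z c \<phi>]
    note p = natfam_in[OF psi_natfam[OF z] c \<phi>]
    have i: "Id C ?c \<in> hom ?c ?c"
      by (rule id_in_hom[OF cz])
    note fi = flat_in[OF dz i c]
    have "psi z c \<phi> \<cdot> ?h = (psi z c \<phi> \<cdot> LUnit C z) \<cdot> sharp l z k' X h'"
      unfolding cu_def by (rule comp_assoc[OF sharp_in[OF l h' X] lunit_in[OF z] p, symmetric])
    also have "\<dots> = flatR z c (\<Phi> ?c ?\<mu>) \<cdot> sharp l z k' X h'"
      unfolding psi_lunit[OF z c \<phi>] ..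
    also have "flatR z c (\<Phi> ?c ?\<mu>) = flatR z c (Id C ?c) \<cdot> (\<Phi> ?c ?\<mu> \<otimes>\<^sub>a Id C z)"
      using flat_pre[OF dz i P c] comp_id_left[OF P] by simp
    also have "flatR z c (Id C ?c) \<cdot> (\<Phi> ?c ?\<mu> \<otimes>\<^sub>a Id C z) \<cdot> sharp l z k' X h' =
        flatR z c (Id C ?c) \<cdot> ((\<Phi> ?c ?\<mu> \<otimes>\<^sub>a Id C z) \<cdot> sharp l z k' X h')"
      by (rule comp_assoc[OF sharp_in[OF l h' X] tensor_arr[OF P id_in_hom[OF z]] fi])
    also have "(\<Phi> ?c ?\<mu> \<otimes>\<^sub>a Id C z) \<cdot> sharp l z k' X h' = sharp l z k' X (\<gamma> ?c ?\<mu>)"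
      unfolding sharp_post[OF l h' P X, symmetric] h'\<gamma>[OF cz F] ..
    also have "\<dots> = \<beta> (?c \<otimes>\<^sub>o z) (mt ?c ?\<mu>)"
      unfolding \<gamma>_def by (rule sharp_flat[OF l B[OF cz F] cz])
    also have "flatR z c (Id C ?c) \<cdot> \<dots> = \<beta> c (\<lambda>f. mt ?c ?\<mu> (f \<cdot> flatR z c (Id C ?c)))"
      by (rule natfam_nat[OF \<beta> fi mt[OF cz F]])
    also have "\<dots> = \<beta> c \<phi>"
    proof (rule natfam_cong[OF \<beta> c Fn_precomp[OF mt[OF cz F] fi] \<phi>])
      fix f assume f: "f \<in> hom c (rd (rd z))"
      let ?F = "flatR z c (Id C ?c)"
      \<comment> \<open>A triangle identity: the counit at c cancels the unit at c \<otimes>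
        z^\<or>, so that \<phi> comes back unchanged.\<close>
      have 1: "(?F \<otimes>\<^sub>a Id C (rd z)) \<cdot> ?s ?c = Id C ?c"
        unfolding sharp_post[OF dz id_in_hom[OF tensor_obj[OF cz z]] fi cz, symmetric] comp_id_right[OF fi]
        by (rule sharp_flat_id[OF dz c])
      have "uncuR (rd z) (f \<cdot> ?F) \<cdot> ?s ?c = (uncuR (rd z) f \<cdot> (?F \<otimes>\<^sub>a Id C (rd z))) \<cdot> ?s ?c"
        unfolding uncu_pre[OF dz' f fi] ..
      also have "\<dots> = uncuR (rd z) f \<cdot> ((?F \<otimes>\<^sub>a Id C (rd z)) \<cdot> ?s ?c)"
        by (rule comp_assoc[OF s[OF cz] tensor_arr[OF fi id_in_hom[OF z']] uncu_in[OF dz' f]])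
      also have "\<dots> = uncuR (rd z) f"
        unfolding 1 by (rule comp_id_right[OF uncu_in[OF dz' f]])
      finally have "mt ?c ?\<mu> (f \<cdot> ?F) = \<phi> (cuR (rd z) c (uncuR (rd z) f))"
        unfolding mt_def by (simp only:)
      then show "mt ?c ?\<mu> (f \<cdot> ?F) = \<phi> f"
        unfolding cu_uncu[OF dz' f] .
    qed
    finally show ?thesis .
  qed
  then show ?thesis
    using cu_in[OF l h' X] by blast
qed

lemma psi_univ:
  assumes z: "z \<in> Obj C"
  shows "univ (rd (rd z)) z (psi z)"
  unfolding univ_def
proof (intro conjI allI impI)
  show "natfam (rd (rd z)) z (psi z)"
    by (rule psi_natfam[OF z])
  fix X \<beta> assume "natfam (rd (rd z)) X \<beta>"
  from psi_factor[OF z this] obtain h where h: "h \<in> hom X z"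
    "\<And>c \<phi>. c \<in> Obj C \<Longrightarrow> \<phi> \<in> Fn c (rd (rd z)) \<Longrightarrow> psi z c \<phi> \<cdot> h = \<beta> c \<phi>"
    by blast
  show "\<exists>!h. h \<in> hom X z \<and> (\<forall>c \<in> Obj C. \<forall>\<phi> \<in> Fn c (rd (rd z)). psi z c \<phi> \<cdot> h = \<beta> c \<phi>)"
  proof (rule ex1I[of _ h])
    fix h' assume h': "h' \<in> hom X z \<and> (\<forall>c \<in> Obj C. \<forall>\<phi> \<in> Fn c (rd (rd z)). psi z c \<phi> \<cdot> h' = \<beta> c \<phi>)"
    show "h' = h"
      by (rule psi_unique[OF z _ h(1)]) (use h' h(2) in simp_all)
  qed (use h in blast)
qed

end

end

section \<open>Pairings and traces\<close>

context linear_category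
begin

text \<open>With finite-dimensional hom-spaces this says that I represents the functor sending c to
  the dual of Hom(P, c). The model is P = A, I = A^* and \<epsilon> evaluating the image of 1 at 1.
  The case I = P with symmetric \<epsilon> is a nondegenerate trace.\<close>

definition nondegenerate_pairing where
  "nondegenerate_pairing P I \<epsilon> \<longleftrightarrow> P \<in> Obj C \<and> I \<in> Obj C \<and> \<epsilon> \<in> Fn P I \<and>
     (\<forall>c \<in> Obj C. \<forall>f \<in> hom P c. (\<forall>g \<in> hom c I. \<epsilon> (g \<cdot> f) = 0) \<longrightarrow> f = ZeroArr C P c) \<and>
     (\<forall>c \<in> Obj C. \<forall>g \<in> hom c I. (\<forall>f \<in> hom P c. \<epsilon> (g \<cdot> f) = 0) \<longrightarrow> g = ZeroArr C c I)"

definition hom_finite where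
  "hom_finite \<longleftrightarrow> (\<forall>a \<in> Obj C. \<forall>b \<in> Obj C. \<exists>n v \<phi>. dual_basis (hom_space C a b) n v \<phi>)"

lemma hom_finiteD: "hom_finite \<Longrightarrow> a \<in> Obj C \<Longrightarrow> b \<in> Obj C \<Longrightarrow> \<exists>n v \<phi>. dual_basis (hom_space C a b) n v \<phi>"
  by (simp add: hom_finite_def)

definition generator where
  "generator P \<longleftrightarrow> P \<in> Obj C \<and>
     (\<forall>c \<in> Obj C. \<forall>x \<in> Obj C. \<forall>f \<in> hom c x. (\<forall>p \<in> hom P c. f \<cdot> p = ZeroArr C P x) \<longrightarrow> f = ZeroArr C c x)"

text \<open>Fullness of \<open>Hom(P, -)\<close> as a functor to modules over \<open>End(P)\<close>.\<close>

definition dense_obj where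
  "dense_obj P \<longleftrightarrow> P \<in> Obj C \<and>
     (\<forall>X \<in> Obj C. \<forall>x \<in> Obj C. \<forall>p.
        (\<forall>q \<in> hom P X. p q \<in> hom P x) \<and>
        (\<forall>q \<in> hom P X. \<forall>q' \<in> hom P X. p (q \<boxplus> q') = p q \<boxplus> p q') \<and>
        (\<forall>q \<in> hom P X. \<forall>s \<in> hom P P. p (q \<cdot> s) = p q \<cdot> s) \<longrightarrow>
        (\<exists>h \<in> hom X x. \<forall>q \<in> hom P X. h \<cdot> q = p q))"

lemma scale_one: "f \<in> hom a b \<Longrightarrow> 1 \<star> f = f"
  using kspace.one_smult[OF hom_kspace, of a b f] hom_obj by simp

lemma self_minus:
  assumes f: "f \<in> hom a b"
  shows "f \<boxplus> ((-1) \<star> f) = ZeroArr C a b"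
proof -
  have "(1 + -1) \<star> f = (1 \<star> f) \<boxplus> ((-1) \<star> f)"
    using kspace.add_smult[OF hom_kspace[OF hom_obj[OF f]], of f 1 "-1"] f by simp
  then show ?thesis
    using scale_one[OF f] scale_zero[OF f] by simp
qed

lemma eq_if_diff:
  assumes "f \<in> hom a b" "g \<in> hom a b" "f \<boxplus> ((-1) \<star> g) = ZeroArr C a b"
  shows "f = g"
proof -
  interpret kspace "hom_space C a b" using hom_kspace hom_obj assms by blast
  show ?thesis using eq_if_diff_zero[of f g] assms by simp
qed

lemma diff_in: "f \<in> hom a b \<Longrightarrow> g \<in> hom a b \<Longrightarrow> f \<boxplus> ((-1) \<star> g) \<in> hom a b"
  by (rule add_in[OF _ scale_in])

lemma Fn_diff: "\<phi> \<in> Fn a b \<Longrightarrow> f \<in> hom a b \<Longrightarrow> g \<in> hom a b \<Longrightarrow> \<phi> (f \<boxplus> ((-1) \<star> g)) = \<phi> f - \<phi> g"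
  using scale_in[of g a b "-1"] by (simp add: functional_hom_iff)

section \<open>From a universal family to a trace\<close>

context
  fixes P I \<epsilon>
  assumes nd: "nondegenerate_pairing P I \<epsilon>"
    and fin: hom_finite
begin

lemma nd_obj: "P \<in> Obj C" "I \<in> Obj C" and nd_Fn: "\<epsilon> \<in> Fn P I"
  using nd by (simp_all add: nondegenerate_pairing_def)

lemma nd_left_eq:
  assumes f: "f \<in> hom P c" "f' \<in> hom P c" and eq: "\<And>g. g \<in> hom c I \<Longrightarrow> \<epsilon> (g \<cdot> f) = \<epsilon> (g \<cdot> f')"
  shows "f = f'"
proof (rule eq_if_diff[OF f])
  have "\<epsilon> (g \<cdot> (f \<boxplus> ((-1) \<star> f'))) = 0" if g: "g \<in> hom c I" for g
    using Fn_diff[OF Fn_postcomp[OF nd_Fn g] f] eq[OF g] by simp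
  then show "f \<boxplus> ((-1) \<star> f') = ZeroArr C P c"
    using nd diff_in[OF f] hom_obj(2)[OF f(1)] by (simp add: nondegenerate_pairing_def)
qed

lemma nd_right_eq:
  assumes g: "g \<in> hom c I" "g' \<in> hom c I" and eq: "\<And>f. f \<in> hom P c \<Longrightarrow> \<epsilon> (g \<cdot> f) = \<epsilon> (g' \<cdot> f)"
  shows "g = g'"
proof (rule eq_if_diff[OF g])
  have "\<epsilon> ((g \<boxplus> ((-1) \<star> g')) \<cdot> f) = 0" if f: "f \<in> hom P c" for f
    using Fn_diff[OF Fn_precomp[OF nd_Fn f] g] eq[OF f] by simp
  then show "g \<boxplus> ((-1) \<star> g') = ZeroArr C c I"
    using nd diff_in[OF g] hom_obj(1)[OF g(1)] by (simp add: nondegenerate_pairing_def)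
qed

lemma nd_represent_left:
  assumes c: "c \<in> Obj C" and \<phi>: "\<phi> \<in> Fn c I"
  shows "\<exists>q \<in> hom P c. \<forall>g \<in> hom c I. \<epsilon> (g \<cdot> q) = \<phi> g"
proof -
  interpret V: kspace "hom_space C c I" by (rule hom_kspace[OF c nd_obj(2)])
  obtain n v \<psi> where db: "dual_basis (hom_space C c I) n v \<psi>"
    using hom_finiteD[OF fin c nd_obj(2)] by blast
  have "\<exists>q \<in> carrier (hom_space C P c). \<forall>g \<in> carrier (hom_space C c I). \<epsilon> (g \<cdot> q) = \<phi> g"
  proof (rule V.pairing_represents[OF db hom_kspace[OF nd_obj(1) c]])
    show "functional (hom_space C c I) (\<lambda>g. \<epsilon> (g \<cdot> q))" if "q \<in> carrier (hom_space C P c)" for q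
      using Fn_precomp[OF nd_Fn] that by simp
    show "functional (hom_space C P c) (\<lambda>q. \<epsilon> (g \<cdot> q))" if "g \<in> carrier (hom_space C c I)" for g
      using Fn_postcomp[OF nd_Fn] that by simp
  qed (use nd c \<phi> in \<open>simp_all add: nondegenerate_pairing_def\<close>)
  then show ?thesis
    by simp
qed

lemma nd_represent_right:
  assumes c: "c \<in> Obj C" and \<phi>: "\<phi> \<in> Fn P c"
  shows "\<exists>g \<in> hom c I. \<forall>f \<in> hom P c. \<epsilon> (g \<cdot> f) = \<phi> f"
proof -
  interpret V: kspace "hom_space C P c" by (rule hom_kspace[OF nd_obj(1) c])
  obtain n v \<psi> where db: "dual_basis (hom_space C P c) n v \<psi>"
    using hom_finiteD[OF fin nd_obj(1) c] by blast
  have "\<exists>g \<in> carrier (hom_space C c I). \<forall>f \<in> carrier (hom_space C P c). \<epsilon> (g \<cdot> f) = \<phi> f"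
  proof (rule V.pairing_represents[OF db hom_kspace[OF c nd_obj(2)]])
    show "functional (hom_space C P c) (\<lambda>f. \<epsilon> (g \<cdot> f))" if "g \<in> carrier (hom_space C c I)" for g
      using Fn_postcomp[OF nd_Fn] that by simp
    show "functional (hom_space C c I) (\<lambda>g. \<epsilon> (g \<cdot> f))" if "f \<in> carrier (hom_space C P c)" for f
      using Fn_precomp[OF nd_Fn] that by simp
  qed (use nd c \<phi> in \<open>simp_all add: nondegenerate_pairing_def\<close>)
  then show ?thesis
    by simp
qed

text \<open>
  The isomorphism \<open>Hom(c, I)\<^sup>* \<rightarrow> Hom(P, c)\<close> is a natural family, so it factors through a universal
  one by some \<open>h : P \<rightarrow> I\<close>.  Since \<open>h\<close> is split, naturality at endomorphisms of \<open>I\<close> restricts to \<open>P\<close>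
  and says that \<open>f \<mapsto> \<epsilon> (h f)\<close> is symmetric.
\<close>

lemma trace_exists:
  assumes U: "univ I I \<Phi>"
    and nat: "\<And>c u \<phi>. c \<in> Obj C \<Longrightarrow> u \<in> hom I I \<Longrightarrow> \<phi> \<in> Fn c I \<Longrightarrow> \<Phi> c (\<lambda>g. \<phi> (u \<cdot> g)) = \<Phi> c \<phi> \<cdot> u"
  shows "\<exists>t \<in> Fn P P. (\<forall>f \<in> hom P P. \<forall>g \<in> hom P P. t (f \<cdot> g) = t (g \<cdot> f)) \<and>
           (\<forall>f \<in> hom P P. (\<forall>g \<in> hom P P. t (f \<cdot> g) = 0) \<longrightarrow> f = ZeroArr C P P)"
proof -
  define \<alpha> where "\<alpha> c \<phi> = (SOME q. q \<in> hom P c \<and> (\<forall>g \<in> hom c I. \<epsilon> (g \<cdot> q) = \<phi> g))" for c \<phi>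
  have a: "\<alpha> c \<phi> \<in> hom P c \<and> (\<forall>g \<in> hom c I. \<epsilon> (g \<cdot> \<alpha> c \<phi>) = \<phi> g)"
    if "c \<in> Obj C" "\<phi> \<in> Fn c I" for c \<phi>
  proof -
    have "\<exists>q. q \<in> hom P c \<and> (\<forall>g \<in> hom c I. \<epsilon> (g \<cdot> q) = \<phi> g)"
      using nd_represent_left[OF that] by blast
    from someI_ex[OF this] show ?thesis
      unfolding \<alpha>_def .
  qed
  have \<alpha>: "\<alpha> c \<phi> \<in> hom P c" and \<alpha>\<epsilon>: "g \<in> hom c I \<Longrightarrow> \<epsilon> (g \<cdot> \<alpha> c \<phi>) = \<phi> g"
    if "c \<in> Obj C" "\<phi> \<in> Fn c I" for c \<phi> g
    using a[OF that] by blast+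
  have \<alpha>_eq: "\<alpha> c \<phi> = q" if "c \<in> Obj C" "\<phi> \<in> Fn c I" "q \<in> hom P c" "\<And>g. g \<in> hom c I \<Longrightarrow> \<phi> g = \<epsilon> (g \<cdot> q)"
    for c \<phi> q
    by (rule nd_left_eq[OF \<alpha>[OF that(1,2)] that(3)]) (simp only: \<alpha>\<epsilon>[OF that(1,2)] that(4))
  have "natfam I P \<alpha>"
  proof (rule natfamI)
    show "I \<in> Obj C" "P \<in> Obj C"
      by (rule nd_obj)+
    show "\<alpha> c \<phi> \<in> hom P c" if "c \<in> Obj C" "\<phi> \<in> Fn c I" for c \<phi>
      by (rule \<alpha>[OF that])
    show "\<alpha> c (\<lambda>f. \<phi> f + \<psi> f) = \<alpha> c \<phi> \<boxplus> \<alpha> c \<psi>"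
      if c: "c \<in> Obj C" and f: "\<phi> \<in> Fn c I" "\<psi> \<in> Fn c I" for c \<phi> \<psi>
    proof (rule \<alpha>_eq[OF c Fn_add[OF f] add_in[OF \<alpha>[OF c f(1)] \<alpha>[OF c f(2)]]])
      fix g assume g: "g \<in> hom c I"
      show "\<phi> g + \<psi> g = \<epsilon> (g \<cdot> (\<alpha> c \<phi> \<boxplus> \<alpha> c \<psi>))"
        using Fn_postcomp[OF nd_Fn g] \<alpha>[OF c f(1)] \<alpha>[OF c f(2)] \<alpha>\<epsilon>[OF c f(1) g] \<alpha>\<epsilon>[OF c f(2) g]
        by (simp add: functional_hom_iff)
    qed
    show "\<alpha> c \<phi> = \<alpha> c \<psi>"
      if c: "c \<in> Obj C" and f: "\<phi> \<in> Fn c I" "\<psi> \<in> Fn c I" and eq: "\<And>g. g \<in> hom c I \<Longrightarrow> \<phi> g = \<psi> g" for c \<phi> \<psi>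
      by (rule \<alpha>_eq[OF c f(1) \<alpha>[OF c f(2)]]) (simp only: \<alpha>\<epsilon>[OF c f(2)] eq)
    show "u \<cdot> \<alpha> c \<phi> = \<alpha> d (\<lambda>f. \<phi> (f \<cdot> u))" if u: "u \<in> hom c d" and f: "\<phi> \<in> Fn c I" for c d u \<phi>
    proof (rule \<alpha>_eq[OF hom_obj(2)[OF u] Fn_precomp[OF f u] comp_in_hom[OF \<alpha>[OF hom_obj(1)[OF u] f] u], symmetric])
      fix g assume g: "g \<in> hom d I"
      show "\<phi> (g \<cdot> u) = \<epsilon> (g \<cdot> (u \<cdot> \<alpha> c \<phi>))"
        unfolding comp_assoc[OF \<alpha>[OF hom_obj(1)[OF u] f] u g, symmetric]
        by (rule \<alpha>\<epsilon>[OF hom_obj(1)[OF u] f comp_in_hom[OF u g], symmetric])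
    qed
  qed
  then obtain h where h: "h \<in> hom P I" and h\<alpha>: "\<And>c \<phi>. c \<in> Obj C \<Longrightarrow> \<phi> \<in> Fn c I \<Longrightarrow> \<Phi> c \<phi> \<cdot> h = \<alpha> c \<phi>"
    using univ_ex[OF U] by blast
  note Pn = univ_natfam[OF U]
  \<comment> \<open>Under \<alpha> the functional \<epsilon> belongs to the identity of P, so the
    component of \<Phi> at \<epsilon> is a left inverse of h.\<close>
  define r where "r = \<Phi> P \<epsilon>"
  have r: "r \<in> hom I P"
    unfolding r_def by (rule natfam_in[OF Pn nd_obj(1) nd_Fn])
  have rh: "r \<cdot> h = Id C P"
    unfolding r_def h\<alpha>[OF nd_obj(1) nd_Fn]
    by (rule \<alpha>_eq[OF nd_obj(1) nd_Fn id_in_hom[OF nd_obj(1)]]) (simp only: comp_id_right)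
  define t where "t f = \<epsilon> (h \<cdot> f)" for f
  have "t \<in> Fn P P"
    unfolding t_def by (rule Fn_postcomp[OF nd_Fn h])
  moreover have "t (v \<cdot> f) = t (f \<cdot> v)" if f: "f \<in> hom P P" and v: "v \<in> hom P P" for f v
  proof -
    \<comment> \<open>The endomorphism u of I extends v along h, as u h = h v. Computing \<alpha> at
      the functional ?l twisted by u through \<Phi> then yields f v, while evaluating that
      functional at h yields the trace of v f.\<close>
    define u where "u = (h \<cdot> v) \<cdot> r"
    note hv = comp_in_hom[OF v h]
    have u: "u \<in> hom I I"
      unfolding u_def by (rule comp_in_hom[OF r hv])
    have uh: "u \<cdot> h = h \<cdot> v"
      unfolding u_def comp_assoc[OF h r hv] rh by (rule comp_id_right[OF hv])
    let ?l = "\<lambda>g. \<epsilon> (g \<cdot> f)"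
    have l: "?l \<in> Fn P I"
      by (rule Fn_precomp[OF nd_Fn f])
    have al: "\<alpha> P ?l = f"
      by (rule \<alpha>_eq[OF nd_obj(1) l f]) (rule refl)
    have ul: "(\<lambda>g. ?l (u \<cdot> g)) \<in> Fn P I"
      by (rule Fn_postcomp[OF l u])
    note \<Phi>l = natfam_in[OF Pn nd_obj(1) l]
    have "\<alpha> P (\<lambda>g. ?l (u \<cdot> g)) = (\<Phi> P ?l \<cdot> u) \<cdot> h"
      unfolding h\<alpha>[OF nd_obj(1) ul, symmetric] nat[OF nd_obj(1) u l] ..
    also have "\<dots> = (\<Phi> P ?l \<cdot> h) \<cdot> v"
      unfolding comp_assoc[OF h u \<Phi>l] uh by (rule comp_assoc[OF v h \<Phi>l, symmetric])
    also have "\<dots> = f \<cdot> v"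
      unfolding h\<alpha>[OF nd_obj(1) l] al ..
    finally have fv: "\<alpha> P (\<lambda>g. ?l (u \<cdot> g)) = f \<cdot> v" .
    have "\<epsilon> (h \<cdot> (f \<cdot> v)) = ?l (u \<cdot> h)"
      using \<alpha>\<epsilon>[OF nd_obj(1) ul h] unfolding fv .
    also have "\<dots> = \<epsilon> (h \<cdot> (v \<cdot> f))"
      unfolding uh comp_assoc[OF f v h] ..
    finally show ?thesis
      unfolding t_def by (rule sym)
  qed
  moreover have "f = ZeroArr C P P" if f: "f \<in> hom P P" and z: "\<And>g. g \<in> hom P P \<Longrightarrow> t (f \<cdot> g) = 0" for f
  proof -
    have "h \<cdot> f = ZeroArr C P I"
    proof -
      have "\<epsilon> ((h \<cdot> f) \<cdot> g) = 0" if g: "g \<in> hom P P" for g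
        using z[OF g] comp_assoc[OF g f h] by (simp add: t_def)
      then show ?thesis
        using nd comp_in_hom[OF f h] nd_obj unfolding nondegenerate_pairing_def by blast
    qed
    then have "r \<cdot> (h \<cdot> f) = ZeroArr C P P"
      using comp_zero_right[OF r nd_obj(1)] by simp
    then show ?thesis
      unfolding comp_assoc[OF f h r, symmetric] rh comp_id_left[OF f] .
  qed
  ultimately show ?thesis
    by blast
qed

end

text \<open>The family sending the functional \<open>f \<mapsto> t (g f p)\<close> on \<open>Hom(c, x)\<close> to \<open>p g : x \<rightarrow> c\<close>.\<close>

definition casimir where
  "casimir P t x c \<phi> = (THE m. m \<in> hom x c \<and> (\<forall>q \<in> hom P x. \<forall>r \<in> hom c P. t (r \<cdot> (m \<cdot> q)) = \<phi> (q \<cdot> r)))"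

section \<open>From a trace to universal families\<close>

context
  fixes P t
  assumes nd: "nondegenerate_pairing P P t"
    and fin: hom_finite
    and gen: "generator P"
    and dense: "dense_obj P"
    and sym: "\<And>f g. f \<in> hom P P \<Longrightarrow> g \<in> hom P P \<Longrightarrow> t (f \<cdot> g) = t (g \<cdot> f)"
begin

lemmas P_obj = nd_obj(1)[OF nd fin] and t_Fn = nd_Fn[OF nd fin]

lemma gen_eq:
  assumes m: "m \<in> hom x c" "m' \<in> hom x c" and eq: "\<And>q. q \<in> hom P x \<Longrightarrow> m \<cdot> q = m' \<cdot> q"
  shows "m = m'"
proof (rule eq_if_diff[OF m])
  have "(m \<boxplus> ((-1) \<star> m')) \<cdot> q = ZeroArr C P c" if q: "q \<in> hom P x" for q
  proof -
    note mq = comp_in_hom[OF q m(2)]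
    have "(m \<boxplus> ((-1) \<star> m')) \<cdot> q = (m' \<cdot> q) \<boxplus> ((-1) \<star> (m' \<cdot> q))"
      using comp_add_left[OF q m(1) scale_in[OF m(2)]] comp_scale_left[OF q m(2)] eq[OF q] by simp
    also have "\<dots> = ZeroArr C P c"
      by (rule self_minus[OF mq])
    finally show ?thesis .
  qed
  then show "m \<boxplus> ((-1) \<star> m') = ZeroArr C x c"
    using gen diff_in[OF m] hom_obj[OF m(1)] unfolding generator_def by blast
qed

text \<open>A nondegenerate form makes the generator P a cogenerator as well: arrows that agree
  after every r have the same traces against all q and r.\<close>

lemma cogen_eq:
  assumes m: "m \<in> hom x c" "m' \<in> hom x c" and eq: "\<And>r. r \<in> hom c P \<Longrightarrow> r \<cdot> m = r \<cdot> m'"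
  shows "m = m'"
proof (rule gen_eq[OF m])
  fix q assume q: "q \<in> hom P x"
  show "m \<cdot> q = m' \<cdot> q"
  proof (rule nd_left_eq[OF nd fin comp_in_hom[OF q m(1)] comp_in_hom[OF q m(2)]])
    fix r assume r: "r \<in> hom c P"
    show "t (r \<cdot> (m \<cdot> q)) = t (r \<cdot> (m' \<cdot> q))"
      unfolding comp_assoc[OF q m(1) r, symmetric] comp_assoc[OF q m(2) r, symmetric] eq[OF r] ..
  qed
qed

lemma trace_eq:
  assumes m: "m \<in> hom x c" "m' \<in> hom x c"
    and eq: "\<And>q r. q \<in> hom P x \<Longrightarrow> r \<in> hom c P \<Longrightarrow> t (r \<cdot> (m \<cdot> q)) = t (r \<cdot> (m' \<cdot> q))"
  shows "m = m'"
  by (rule gen_eq[OF m], rule nd_left_eq[OF nd fin comp_in_hom[OF _ m(1)] comp_in_hom[OF _ m(2)]], assumption+)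
    (rule eq)

text \<open>The functionals for which such an m exists form a subspace. It contains f \<mapsto> t (g
  f p), with m = p g, and these separate, since P is a generator and t is nondegenerate; so it is
  everything. That m is unique is the separate matter of \<open>trace_eq\<close>.\<close>

lemma casimir_ex:
  assumes x: "x \<in> Obj C" and c: "c \<in> Obj C" and \<phi>: "\<phi> \<in> Fn c x"
  shows "\<exists>m \<in> hom x c. \<forall>q \<in> hom P x. \<forall>r \<in> hom c P. t (r \<cdot> (m \<cdot> q)) = \<phi> (q \<cdot> r)"
proof -
  interpret V: kspace "hom_space C c x" by (rule hom_kspace[OF c x])
  let ?T = "{\<tau> \<in> Fn c x. \<exists>m \<in> hom x c. \<forall>q \<in> hom P x. \<forall>r \<in> hom c P. t (r \<cdot> (m \<cdot> q)) = \<tau> (q \<cdot> r)}"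
  obtain n v \<psi> where db: "dual_basis (hom_space C c x) n v \<psi>"
    using hom_finiteD[OF fin c x] by blast
  \<comment> \<open>Cyclicity of t turns t (r p g q) into t (g q r p).\<close>
  have mem: "(\<lambda>f. t (g \<cdot> (f \<cdot> p))) \<in> ?T" if p: "p \<in> hom P c" and g: "g \<in> hom x P" for p g
  proof -
    have "t (r \<cdot> ((p \<cdot> g) \<cdot> q)) = t (g \<cdot> ((q \<cdot> r) \<cdot> p))" if q: "q \<in> hom P x" and r: "r \<in> hom c P" for q r
    proof -
      have "r \<cdot> ((p \<cdot> g) \<cdot> q) = (r \<cdot> p) \<cdot> (g \<cdot> q)"
        unfolding comp_assoc[OF q g p] comp_assoc[OF comp_in_hom[OF q g] p r] ..
      moreover have "g \<cdot> ((q \<cdot> r) \<cdot> p) = (g \<cdot> q) \<cdot> (r \<cdot> p)"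
        unfolding comp_assoc[OF p r q] comp_assoc[OF comp_in_hom[OF p r] q g] ..
      ultimately show ?thesis
        using sym[OF comp_in_hom[OF p r] comp_in_hom[OF q g]] by simp
    qed
    then show ?thesis
      using comp_in_hom[OF g p] Fn_precomp[OF Fn_postcomp[OF t_Fn g] p] by blast
  qed
  have "\<exists>\<tau> \<in> ?T. \<forall>f \<in> carrier (hom_space C c x). \<tau> f = \<phi> f"
  proof (rule V.separating_subspace_spans[OF db])
    show "separating (hom_space C c x) ?T"
      unfolding separating_def
    proof (intro conjI ballI impI)
      show "functional (hom_space C c x) \<tau>" if "\<tau> \<in> ?T" for \<tau>
        using that by blast
      fix f assume f: "f \<in> carrier (hom_space C c x)" and z: "\<forall>\<tau> \<in> ?T. \<tau> f = 0"
      have "f \<cdot> p = ZeroArr C P x" if p: "p \<in> hom P c" for p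
      proof -
        have "t (g \<cdot> (f \<cdot> p)) = 0" if "g \<in> hom x P" for g
          using bspec[OF z mem[OF p that]] .
        then show ?thesis
          using nd comp_in_hom[OF p] f x unfolding nondegenerate_pairing_def by simp
      qed
      then show "f = \<zero>\<^bsub>hom_space C c x\<^esub>"
        using gen f c x by (simp add: generator_def)
    qed
    have "t (r \<cdot> (ZeroArr C x c \<cdot> q)) = 0" if "q \<in> hom P x" "r \<in> hom c P" for q r
      using comp_zero_left[OF that(1) c] comp_zero_right[OF that(2) P_obj] Fn_zero_arr[OF t_Fn P_obj P_obj] by simp
    then show "(\<lambda>x. 0) \<in> ?T"
      using Fn_zero zero_in[OF x c] by (intro CollectI conjI bexI[of _ "ZeroArr C x c"]) simp_all
    show "(\<lambda>x. s x + s' x) \<in> ?T" if st: "s \<in> ?T" "s' \<in> ?T" for s s'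
    proof -
      obtain m m' where m: "m \<in> hom x c" "\<forall>q \<in> hom P x. \<forall>r \<in> hom c P. t (r \<cdot> (m \<cdot> q)) = s (q \<cdot> r)"
        and m': "m' \<in> hom x c" "\<forall>q \<in> hom P x. \<forall>r \<in> hom c P. t (r \<cdot> (m' \<cdot> q)) = s' (q \<cdot> r)"
        using st by blast
      have "t (r \<cdot> ((m \<boxplus> m') \<cdot> q)) = s (q \<cdot> r) + s' (q \<cdot> r)" if q: "q \<in> hom P x" and r: "r \<in> hom c P" for q r
        using Fn_precomp[OF Fn_postcomp[OF t_Fn r] q] m m' q r by (simp add: functional_hom_iff)
      then show ?thesis
        using add_in[OF m(1) m'(1)] Fn_add st by blast
    qed
    show "(\<lambda>x. k * s x) \<in> ?T" if st: "s \<in> ?T" for k s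
    proof -
      obtain m where m: "m \<in> hom x c" "\<forall>q \<in> hom P x. \<forall>r \<in> hom c P. t (r \<cdot> (m \<cdot> q)) = s (q \<cdot> r)"
        using st by blast
      have "t (r \<cdot> ((k \<star> m) \<cdot> q)) = k * s (q \<cdot> r)" if q: "q \<in> hom P x" and r: "r \<in> hom c P" for q r
        using Fn_precomp[OF Fn_postcomp[OF t_Fn r] q] m q r by (simp add: functional_hom_iff)
      then show ?thesis
        using scale_in[OF m(1)] Fn_scale st by blast
    qed
    show "functional (hom_space C c x) \<phi>"
      using \<phi> by simp
  qed
  then obtain \<tau> m where \<tau>: "\<forall>f \<in> hom c x. \<tau> f = \<phi> f" and m: "m \<in> hom x c"
    and mt: "\<forall>q \<in> hom P x. \<forall>r \<in> hom c P. t (r \<cdot> (m \<cdot> q)) = \<tau> (q \<cdot> r)"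
    by auto
  have "t (r \<cdot> (m \<cdot> q)) = \<phi> (q \<cdot> r)" if "q \<in> hom P x" "r \<in> hom c P" for q r
    using mt \<tau> comp_in_hom[OF that(2,1)] that by simp
  then show ?thesis
    using m by blast
qed

lemma casimir:
  assumes "x \<in> Obj C" "c \<in> Obj C" "\<phi> \<in> Fn c x"
  shows casimir_in: "casimir P t x c \<phi> \<in> hom x c"
    and casimir_trace: "q \<in> hom P x \<Longrightarrow> r \<in> hom c P \<Longrightarrow> t (r \<cdot> (casimir P t x c \<phi> \<cdot> q)) = \<phi> (q \<cdot> r)"
proof -
  have "\<exists>!m. m \<in> hom x c \<and> (\<forall>q \<in> hom P x. \<forall>r \<in> hom c P. t (r \<cdot> (m \<cdot> q)) = \<phi> (q \<cdot> r))"
    using casimir_ex[OF assms] trace_eq[of _ x c] by metis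
  from theI'[OF this]
  show "casimir P t x c \<phi> \<in> hom x c"
    and "q \<in> hom P x \<Longrightarrow> r \<in> hom c P \<Longrightarrow> t (r \<cdot> (casimir P t x c \<phi> \<cdot> q)) = \<phi> (q \<cdot> r)"
    unfolding casimir_def by blast+
qed

lemma casimir_eq:
  assumes "x \<in> Obj C" "c \<in> Obj C" "\<phi> \<in> Fn c x" "m \<in> hom x c"
    and "\<And>q r. q \<in> hom P x \<Longrightarrow> r \<in> hom c P \<Longrightarrow> t (r \<cdot> (m \<cdot> q)) = \<phi> (q \<cdot> r)"
  shows "casimir P t x c \<phi> = m"
  by (rule trace_eq[OF casimir_in[OF assms(1-3)] assms(4)]) (simp only: casimir_trace[OF assms(1-3)] assms(5))

text \<open>Each equation to be shown is between arrows that are determined by their traces against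
  q and r, and on these traces it follows from the defining property of the family.\<close>

lemma casimir_natfam:
  assumes x: "x \<in> Obj C"
  shows "natfam x x (casimir P t x)"
proof (rule natfamI[OF x x])
  note in' = casimir_in[OF x] and tr = casimir_trace[OF x]
  show "casimir P t x c \<phi> \<in> hom x c" if "c \<in> Obj C" "\<phi> \<in> Fn c x" for c \<phi>
    by (rule in'[OF that])
  show "casimir P t x c (\<lambda>f. \<phi> f + \<psi> f) = casimir P t x c \<phi> \<boxplus> casimir P t x c \<psi>"
    if c: "c \<in> Obj C" and f: "\<phi> \<in> Fn c x" "\<psi> \<in> Fn c x" for c \<phi> \<psi>
  proof (rule casimir_eq[OF x c Fn_add[OF f] add_in[OF in'[OF c f(1)] in'[OF c f(2)]]])
    fix q r assume q: "q \<in> hom P x" and r: "r \<in> hom c P"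
    show "t (r \<cdot> ((casimir P t x c \<phi> \<boxplus> casimir P t x c \<psi>) \<cdot> q)) = \<phi> (q \<cdot> r) + \<psi> (q \<cdot> r)"
      using Fn_precomp[OF Fn_postcomp[OF t_Fn r] q] in'[OF c f(1)] in'[OF c f(2)] tr[OF c f(1) q r] tr[OF c f(2) q r]
      by (simp add: functional_hom_iff)
  qed
  show "casimir P t x c \<phi> = casimir P t x c \<psi>"
    if c: "c \<in> Obj C" and f: "\<phi> \<in> Fn c x" "\<psi> \<in> Fn c x" and eq: "\<And>f. f \<in> hom c x \<Longrightarrow> \<phi> f = \<psi> f" for c \<phi> \<psi>
  proof (rule casimir_eq[OF x c f(1) in'[OF c f(2)]])
    fix q r assume q: "q \<in> hom P x" and r: "r \<in> hom c P"
    show "t (r \<cdot> (casimir P t x c \<psi> \<cdot> q)) = \<phi> (q \<cdot> r)"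
      unfolding tr[OF c f(2) q r] by (rule eq[OF comp_in_hom[OF r q], symmetric])
  qed
  show "u \<cdot> casimir P t x c \<phi> = casimir P t x d (\<lambda>f. \<phi> (f \<cdot> u))"
    if u: "u \<in> hom c d" and f: "\<phi> \<in> Fn c x" for c d u \<phi>
  proof -
    note c = hom_obj(1)[OF u] and d = hom_obj(2)[OF u]
    note m = in'[OF c f]
    have "casimir P t x d (\<lambda>f. \<phi> (f \<cdot> u)) = u \<cdot> casimir P t x c \<phi>"
    proof (rule casimir_eq[OF x d Fn_precomp[OF f u] comp_in_hom[OF m u]])
      fix q r assume q: "q \<in> hom P x" and r: "r \<in> hom d P"
      have "r \<cdot> ((u \<cdot> casimir P t x c \<phi>) \<cdot> q) = (r \<cdot> u) \<cdot> (casimir P t x c \<phi> \<cdot> q)"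
        unfolding comp_assoc[OF q m u] comp_assoc[OF comp_in_hom[OF q m] u r] ..
      then show "t (r \<cdot> ((u \<cdot> casimir P t x c \<phi>) \<cdot> q)) = \<phi> ((q \<cdot> r) \<cdot> u)"
        using tr[OF c f q comp_in_hom[OF u r]] comp_assoc[OF u r q] by simp
    qed
    then show ?thesis by (rule HOL.sym)
  qed
qed

lemma casimir_natural:
  assumes w: "w \<in> hom x y" and c: "c \<in> Obj C" and \<phi>: "\<phi> \<in> Fn c y"
  shows "casimir P t x c (\<lambda>g. \<phi> (w \<cdot> g)) = casimir P t y c \<phi> \<cdot> w"
proof -
  note x = hom_obj(1)[OF w] and y = hom_obj(2)[OF w]
  note m = casimir_in[OF y c \<phi>]
  show ?thesis
  proof (rule casimir_eq[OF x c Fn_postcomp[OF \<phi> w] comp_in_hom[OF w m]])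
    fix q r assume q: "q \<in> hom P x" and r: "r \<in> hom c P"
    show "t (r \<cdot> ((casimir P t y c \<phi> \<cdot> w) \<cdot> q)) = \<phi> (w \<cdot> (q \<cdot> r))"
      unfolding comp_assoc[OF q w m] casimir_trace[OF y c \<phi> comp_in_hom[OF q w] r] comp_assoc[OF r q w] ..
  qed
qed

text \<open>On a trace functional at c = P the family returns g itself. Universality rests on this:
  it determines g h for a factorisation h and every g, and P is a cogenerator.\<close>

lemma casimir_trace_functional:
  assumes g: "g \<in> hom x P"
  shows "casimir P t x P (\<lambda>f. t (g \<cdot> f)) = g"
proof (rule casimir_eq[OF hom_obj(1)[OF g] P_obj Fn_postcomp[OF t_Fn g] g])
  fix q r assume q: "q \<in> hom P x" and r: "r \<in> hom P P"
  show "t (r \<cdot> (g \<cdot> q)) = t (g \<cdot> (q \<cdot> r))"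
    using sym[OF r comp_in_hom[OF q g]] comp_assoc[OF r q g] by simp
qed

text \<open>A factorisation h must satisfy g h = \<alpha> P (?f g) for every g : x \<rightarrow> P,
  with ?f g the trace functional of g. Traced against q : P \<rightarrow> X this prescribes h q for
  every q, and density of P assembles the prescribed values into an arrow.\<close>

lemma casimir_univ:
  assumes x: "x \<in> Obj C"
  shows "univ x x (casimir P t x)"
  unfolding univ_def
proof (intro conjI allI impI)
  show "natfam x x (casimir P t x)"
    by (rule casimir_natfam[OF x])
  fix X \<alpha> assume a: "natfam x X \<alpha>"
  have X: "X \<in> Obj C"
    using natfam_obj[OF a] by simp
  let ?f = "\<lambda>g f. t (g \<cdot> f)"
  have fF: "?f g \<in> Fn P x" if "g \<in> hom x P" for g
    by (rule Fn_postcomp[OF t_Fn that])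
  note \<alpha>in = natfam_in[OF a P_obj]
  \<comment> \<open>The arrow that will become h q, found by representing a functional of g as a
    trace.\<close>
  have "\<exists>p \<in> hom P x. \<forall>g \<in> hom x P. t (g \<cdot> p) = t (\<alpha> P (?f g) \<cdot> q)" if q: "q \<in> hom P X" for q
  proof (rule nd_represent_left[OF nd fin x])
    have tq: "(\<lambda>f. t (f \<cdot> q)) \<in> Fn X P"
      by (rule Fn_precomp[OF t_Fn q])
    have "t (\<alpha> P (?f (g \<boxplus> g')) \<cdot> q) = t (\<alpha> P (?f g) \<cdot> q) + t (\<alpha> P (?f g') \<cdot> q)"
      if g: "g \<in> hom x P" "g' \<in> hom x P" for g g'
    proof -
      have "\<alpha> P (?f (g \<boxplus> g')) = \<alpha> P (\<lambda>f. ?f g f + ?f g' f)"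
      proof (rule natfam_cong[OF a P_obj fF[OF add_in[OF g]] Fn_add[OF fF[OF g(1)] fF[OF g(2)]]])
        fix f assume f: "f \<in> hom P x"
        show "t ((g \<boxplus> g') \<cdot> f) = t (g \<cdot> f) + t (g' \<cdot> f)"
          using Fn_precomp[OF t_Fn f] g by (simp add: functional_hom_iff)
      qed
      also have "\<dots> = \<alpha> P (?f g) \<boxplus> \<alpha> P (?f g')"
        by (rule natfam_add[OF a P_obj fF[OF g(1)] fF[OF g(2)]])
      finally show ?thesis
        using tq \<alpha>in[OF fF[OF g(1)]] \<alpha>in[OF fF[OF g(2)]] by (simp add: functional_hom_iff)
    qed
    moreover have "t (\<alpha> P (?f (k \<star> g)) \<cdot> q) = k * t (\<alpha> P (?f g) \<cdot> q)" if g: "g \<in> hom x P" for g k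
    proof -
      have "\<alpha> P (?f (k \<star> g)) = \<alpha> P (\<lambda>f. k * ?f g f)"
      proof (rule natfam_cong[OF a P_obj fF[OF scale_in[OF g]] Fn_scale[OF fF[OF g]]])
        fix f assume f: "f \<in> hom P x"
        show "t ((k \<star> g) \<cdot> f) = k * t (g \<cdot> f)"
          using Fn_precomp[OF t_Fn f] g by (simp add: functional_hom_iff)
      qed
      also have "\<dots> = k \<star> \<alpha> P (?f g)"
        by (rule natfam_scale[OF a P_obj fF[OF g]])
      finally show ?thesis
        using tq \<alpha>in[OF fF[OF g]] by (simp add: functional_hom_iff)
    qed
    ultimately show "(\<lambda>g. t (\<alpha> P (?f g) \<cdot> q)) \<in> Fn x P"
      by (simp add: functional_hom_iff)
  qed
  then obtain p where p: "\<And>q. q \<in> hom P X \<Longrightarrow> p q \<in> hom P x"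
    and pt: "\<And>q g. q \<in> hom P X \<Longrightarrow> g \<in> hom x P \<Longrightarrow> t (g \<cdot> p q) = t (\<alpha> P (?f g) \<cdot> q)"
    by metis
  have padd: "p (q \<boxplus> q') = p q \<boxplus> p q'" if q: "q \<in> hom P X" "q' \<in> hom P X" for q q'
  proof (rule nd_left_eq[OF nd fin p[OF add_in[OF q]] add_in[OF p[OF q(1)] p[OF q(2)]]])
    fix g assume g: "g \<in> hom x P"
    show "t (g \<cdot> p (q \<boxplus> q')) = t (g \<cdot> (p q \<boxplus> p q'))"
      using pt[OF add_in[OF q] g] pt[OF q(1) g] pt[OF q(2) g] Fn_postcomp[OF t_Fn g]
        Fn_postcomp[OF t_Fn \<alpha>in[OF fF[OF g]]] p q by (simp add: functional_hom_iff)
  qed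
  \<comment> \<open>The linearity over End(P) that density asks for. It is naturality of \<alpha> at
    s, with cyclicity of t to bring s around.\<close>
  have pcomp: "p (q \<cdot> s) = p q \<cdot> s" if q: "q \<in> hom P X" and s: "s \<in> hom P P" for q s
  proof (rule nd_left_eq[OF nd fin p[OF comp_in_hom[OF s q]] comp_in_hom[OF s p[OF q]]])
    fix g assume g: "g \<in> hom x P"
    note ag = \<alpha>in[OF fF[OF g]] and sg = comp_in_hom[OF g s]
    have "\<alpha> P (?f (s \<cdot> g)) = \<alpha> P (\<lambda>f. ?f g (f \<cdot> s))"
    proof (rule natfam_cong[OF a P_obj fF[OF sg] Fn_precomp[OF fF[OF g] s]])
      fix f assume f: "f \<in> hom P x"
      show "t ((s \<cdot> g) \<cdot> f) = t (g \<cdot> (f \<cdot> s))"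
        using sym[OF s comp_in_hom[OF f g]] comp_assoc[OF f g s] comp_assoc[OF s f g] by simp
    qed
    also have "\<dots> = s \<cdot> \<alpha> P (?f g)"
      by (rule natfam_nat[OF a s fF[OF g], symmetric])
    finally have asg: "\<alpha> P (?f (s \<cdot> g)) = s \<cdot> \<alpha> P (?f g)" .
    have "t (g \<cdot> p (q \<cdot> s)) = t ((\<alpha> P (?f g) \<cdot> q) \<cdot> s)"
      unfolding pt[OF comp_in_hom[OF s q] g] comp_assoc[OF s q ag] ..
    also have "\<dots> = t (s \<cdot> (\<alpha> P (?f g) \<cdot> q))"
      by (rule sym[OF comp_in_hom[OF q ag] s])
    also have "\<dots> = t ((s \<cdot> g) \<cdot> p q)"
      unfolding pt[OF q sg] asg comp_assoc[OF q ag s] ..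
    also have "\<dots> = t (g \<cdot> (p q \<cdot> s))"
      unfolding comp_assoc[OF p[OF q] g s] sym[OF s comp_in_hom[OF p[OF q] g]] comp_assoc[OF s p[OF q] g] ..
    finally show "t (g \<cdot> p (q \<cdot> s)) = t (g \<cdot> (p q \<cdot> s))" .
  qed
  have "\<exists>h \<in> hom X x. \<forall>q \<in> hom P X. h \<cdot> q = p q"
    using dense p padd pcomp X x unfolding dense_obj_def by blast
  then obtain h where h: "h \<in> hom X x" and hp: "\<And>q. q \<in> hom P X \<Longrightarrow> h \<cdot> q = p q"
    by blast
  have gh: "g \<cdot> h = \<alpha> P (?f g)" if g: "g \<in> hom x P" for g
  proof (rule nd_right_eq[OF nd fin comp_in_hom[OF h g] \<alpha>in[OF fF[OF g]]])
    fix q assume q: "q \<in> hom P X"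
    show "t ((g \<cdot> h) \<cdot> q) = t (\<alpha> P (?f g) \<cdot> q)"
      unfolding comp_assoc[OF q h g] hp[OF q] by (rule pt[OF q g])
  qed
  have main: "casimir P t x c \<phi> \<cdot> h = \<alpha> c \<phi>" if c: "c \<in> Obj C" and \<phi>: "\<phi> \<in> Fn c x" for c \<phi>
  proof (rule cogen_eq[OF comp_in_hom[OF h casimir_in[OF x c \<phi>]] natfam_in[OF a c \<phi>]])
    fix r assume r: "r \<in> hom c P"
    note \<phi>r = Fn_precomp[OF \<phi> r]
    \<comment> \<open>Testing against r : c \<rightarrow> P moves the functional to Hom(P, x), where
      it is the trace functional of some g. This reduces the claim to the components at P, where h
      is known.\<close>
    obtain g where g: "g \<in> hom x P" and g\<phi>: "\<And>f. f \<in> hom P x \<Longrightarrow> t (g \<cdot> f) = \<phi> (f \<cdot> r)"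
      using nd_represent_right[OF nd fin x \<phi>r] by blast
    have "casimir P t x P (\<lambda>f. \<phi> (f \<cdot> r)) = casimir P t x P (?f g)"
      by (rule natfam_cong[OF casimir_natfam[OF x] P_obj \<phi>r fF[OF g]]) (simp only: g\<phi>)
    then have 1: "r \<cdot> casimir P t x c \<phi> = g"
      unfolding natfam_nat[OF casimir_natfam[OF x] r \<phi>] casimir_trace_functional[OF g] .
    have "\<alpha> P (\<lambda>f. \<phi> (f \<cdot> r)) = \<alpha> P (?f g)"
      by (rule natfam_cong[OF a P_obj \<phi>r fF[OF g]]) (simp only: g\<phi>)
    then have 2: "r \<cdot> \<alpha> c \<phi> = \<alpha> P (?f g)"
      unfolding natfam_nat[OF a r \<phi>] .
    show "r \<cdot> (casimir P t x c \<phi> \<cdot> h) = r \<cdot> \<alpha> c \<phi>"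
      unfolding 2 comp_assoc[OF h casimir_in[OF x c \<phi>] r, symmetric] 1 by (rule gh[OF g])
  qed
  show "\<exists>!h. h \<in> hom X x \<and> (\<forall>c \<in> Obj C. \<forall>\<phi> \<in> Fn c x. casimir P t x c \<phi> \<cdot> h = \<alpha> c \<phi>)"
  proof (rule ex1I[of _ h])
    show "h \<in> hom X x \<and> (\<forall>c \<in> Obj C. \<forall>\<phi> \<in> Fn c x. casimir P t x c \<phi> \<cdot> h = \<alpha> c \<phi>)"
      using h main by blast
    fix h' assume h': "h' \<in> hom X x \<and> (\<forall>c \<in> Obj C. \<forall>\<phi> \<in> Fn c x. casimir P t x c \<phi> \<cdot> h' = \<alpha> c \<phi>)"
    show "h' = h"
    proof (rule cogen_eq[OF _ h])
      show "h' \<in> hom X x" using h' by blast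
      fix g assume g: "g \<in> hom x P"
      have "casimir P t x P (?f g) \<cdot> h' = \<alpha> P (?f g)"
        using h' P_obj fF[OF g] by blast
      then show "g \<cdot> h' = g \<cdot> h"
        unfolding casimir_trace_functional[OF g] gh[OF g] .
    qed
  qed
qed

end

end

section \<open>Modules over a finite-dimensional algebra\<close>

lemma underlying_simps [simp]:
  "carrier (underlying_space A M) = carrier M" "zero (underlying_space A M) = zero M"
  "add (underlying_space A M) = add M"
  "smult (underlying_space A M) c x = (c \<odot>\<^bsub>A\<^esub> \<one>\<^bsub>A\<^esub>) \<odot>\<^bsub>M\<^esub> x"
  by (simp_all add: underlying_space_def)

lemma fd_algebraD:
  assumes "fd_algebra A"
  shows "ring A" "kspace A" "vectorspace.fin_dim (class_ring :: 'k::field ring) A"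
    "\<And>c x y. x \<in> carrier A \<Longrightarrow> y \<in> carrier A \<Longrightarrow> (c \<odot>\<^bsub>A\<^esub> x) \<otimes>\<^bsub>A\<^esub> y = c \<odot>\<^bsub>A\<^esub> (x \<otimes>\<^bsub>A\<^esub> y)"
    "\<And>c x y. x \<in> carrier A \<Longrightarrow> y \<in> carrier A \<Longrightarrow> x \<otimes>\<^bsub>A\<^esub> (c \<odot>\<^bsub>A\<^esub> y) = c \<odot>\<^bsub>A\<^esub> (x \<otimes>\<^bsub>A\<^esub> y)"
  using assms by (simp_all add: fd_algebra_def kspace_def)

lemma abelian_group_cong:
  fixes M :: "('a, 'm) ring_scheme" and N :: "('a, 'n) ring_scheme"
  assumes "carrier N = carrier M" "zero N = zero M" "add N = add M" "abelian_group M"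
  shows "abelian_group N"
proof -
  interpret M: abelian_group M by (rule assms(4))
  show ?thesis
  proof (rule abelian_groupI)
    fix x assume "x \<in> carrier N"
    then show "\<exists>y \<in> carrier N. y \<oplus>\<^bsub>N\<^esub> x = \<zero>\<^bsub>N\<^esub>"
      by (intro bexI[of _ "\<ominus>\<^bsub>M\<^esub> x"]) (simp_all add: assms(1-3) M.l_neg)
  next
    fix x y assume "x \<in> carrier N" "y \<in> carrier N"
    then show "x \<oplus>\<^bsub>N\<^esub> y = y \<oplus>\<^bsub>N\<^esub> x"
      by (simp add: assms(1-3) M.a_comm)
  qed (simp_all add: assms(1-3) M.a_assoc)
qed

lemma underlying_kspace:
  fixes A :: "('k::field, 'a) module" and M :: "('a, 'v) module"
  assumes A: "fd_algebra A" and M: "left_module A M"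
  shows "kspace (underlying_space A M)"
proof -
  interpret A: kspace A by (rule fd_algebraD(2)[OF A])
  interpret left_module A M by (rule M)
  note [simp] = fd_algebraD(4,5)[OF A] A.smult_smult
  have c: "c \<odot>\<^bsub>A\<^esub> \<one>\<^bsub>A\<^esub> \<in> carrier A" for c
    by simp
  have "module (class_ring :: 'k ring) (underlying_space A M)"
  proof (rule Module.moduleI)
    show "cring (class_ring :: 'k ring)"
      by (rule Module.module.axioms(1)[OF vectorspace.axioms(1)[OF A.vectorspace_axioms]])
    show "abelian_group (underlying_space A M)"
      by (rule abelian_group_cong[where M = M]) (simp_all add: M.abelian_group_axioms)
    show "(a \<oplus>\<^bsub>class_ring\<^esub> b) \<odot>\<^bsub>underlying_space A M\<^esub> x =
        a \<odot>\<^bsub>underlying_space A M\<^esub> x \<oplus>\<^bsub>underlying_space A M\<^esub> b \<odot>\<^bsub>underlying_space A M\<^esub> x"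
      if "x \<in> carrier (underlying_space A M)" for a b and x
      using that c by (simp add: A.add_smult smult_l_distr)
    show "(a \<otimes>\<^bsub>class_ring\<^esub> b) \<odot>\<^bsub>underlying_space A M\<^esub> x =
        a \<odot>\<^bsub>underlying_space A M\<^esub> (b \<odot>\<^bsub>underlying_space A M\<^esub> x)"
      if "x \<in> carrier (underlying_space A M)" for a b and x
      using that c by (simp add: smult_assoc[symmetric] mult.commute)
    show "\<one>\<^bsub>class_ring\<^esub> \<odot>\<^bsub>underlying_space A M\<^esub> x = x"
      if "x \<in> carrier (underlying_space A M)" for x
      using that smult_one by simp
  qed (use smult_closed smult_r_distr c in simp_all)
  then show ?thesis
    using A.vectorspace_axioms by (simp add: kspace_def vectorspace_def)
qed

abbreviation ufun where "ufun A M \<equiv> functional (underlying_space A M)"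

text \<open>Multiplication by a is linear over the field because the multiples of the unit of A are
  central.\<close>

lemma ufun_smult:
  assumes A: "fd_algebra A" and M: "left_module A M" and \<phi>: "ufun A M \<phi>" and "a \<in> carrier A"
  shows "ufun A M (\<lambda>x. \<phi> (a \<odot>\<^bsub>M\<^esub> x))"
proof -
  interpret A: kspace A by (rule fd_algebraD(2)[OF A])
  interpret left_module A M by (rule M)
  note [simp] = fd_algebraD(4,5)[OF A] smult_closed
  have "a \<odot>\<^bsub>M\<^esub> ((c \<odot>\<^bsub>A\<^esub> \<one>\<^bsub>A\<^esub>) \<odot>\<^bsub>M\<^esub> x) = (c \<odot>\<^bsub>A\<^esub> \<one>\<^bsub>A\<^esub>) \<odot>\<^bsub>M\<^esub> (a \<odot>\<^bsub>M\<^esub> x)" if "x \<in> carrier M" for c x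
    using assms(4) that by (simp add: smult_assoc[symmetric])
  then show ?thesis
    using \<phi> assms(4) by (simp add: functional_def smult_r_distr)
qed

lemma ufun_orbit:
  assumes A: "fd_algebra A" and M: "left_module A M" and \<phi>: "ufun A M \<phi>" and x: "x \<in> carrier M"
  shows "functional A (\<lambda>a. \<phi> (a \<odot>\<^bsub>M\<^esub> x))"
proof -
  interpret A: kspace A by (rule fd_algebraD(2)[OF A])
  interpret left_module A M by (rule M)
  note [simp] = fd_algebraD(4,5)[OF A] smult_closed
  have "(c \<odot>\<^bsub>A\<^esub> a) \<odot>\<^bsub>M\<^esub> x = (c \<odot>\<^bsub>A\<^esub> \<one>\<^bsub>A\<^esub>) \<odot>\<^bsub>M\<^esub> (a \<odot>\<^bsub>M\<^esub> x)" if "a \<in> carrier A" for c a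
    using x that by (simp add: smult_assoc[symmetric])
  then show ?thesis
    using \<phi> x by (simp add: functional_def smult_l_distr)
qed

text \<open>
  Coordinates embed a finite-dimensional module into the universe \<open>'k vec\<close>; the module structure is
  transported along this injection.
\<close>

lemma module_copy:
  fixes A :: "('k::field, 'a) module" and M :: "('a, 'v) module"
  assumes A: "fd_algebra A" and M: "left_module A M"
    and \<Xi>: "finite \<Xi>" "separating (underlying_space A M) \<Xi>"
  shows "\<exists>(N :: ('a, 'k vec) module) \<theta> \<theta>'. left_module A N \<and>
      vectorspace.fin_dim (class_ring :: 'k ring) (underlying_space A N) \<and>
      \<theta> \<in> LinearCombinations.module_hom A M N \<and> \<theta>' \<in> LinearCombinations.module_hom A N M \<and>
      (\<forall>x \<in> carrier M. \<theta>' (\<theta> x) = x) \<and> (\<forall>y \<in> carrier N. \<theta> (\<theta>' y) = y)"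
proof -
  interpret A: kspace A by (rule fd_algebraD(2)[OF A])
  interpret M: left_module A M by (rule M)
  interpret U: kspace "underlying_space A M" by (rule underlying_kspace[OF A M])
  obtain xs where xs: "set xs = \<Xi>"
    using finite_list[OF \<Xi>(1)] by blast
  \<comment> \<open>\<Xi> is separating but perhaps redundant, so \<theta> is injective without
    necessarily reaching all vectors of this length; the copy N lives on its image.\<close>
  define \<theta> where "\<theta> x = vec (length xs) (\<lambda>i. (xs ! i) x)" for x
  have inj: "inj_on \<theta> (carrier M)"
  proof (rule inj_onI)
    fix x y assume xy: "x \<in> carrier M" "y \<in> carrier M" "\<theta> x = \<theta> y"
    show "x = y"
    proof (rule U.separating_eq[OF \<Xi>(2)])
      fix \<phi> assume "\<phi> \<in> \<Xi>"
      then obtain i where i: "i < length xs" "xs ! i = \<phi>"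
        using xs by (metis in_set_conv_nth)
      have "\<theta> x $ i = \<theta> y $ i"
        using xy by simp
      then show "\<phi> x = \<phi> y"
        using i by (simp add: \<theta>_def)
    qed (use xy in simp_all)
  qed
  define \<theta>' where "\<theta>' = inv_into (carrier M) \<theta>"
  have l: "\<theta>' (\<theta> x) = x" if "x \<in> carrier M" for x
    unfolding \<theta>'_def by (rule inv_into_f_f[OF inj that])
  define N :: "('a, 'k vec) module" where "N = \<lparr>carrier = \<theta> ` carrier M, mult = undefined, one = undefined,
     zero = \<theta> \<zero>\<^bsub>M\<^esub>, add = (\<lambda>x y. \<theta> (\<theta>' x \<oplus>\<^bsub>M\<^esub> \<theta>' y)), smult = (\<lambda>a x. \<theta> (a \<odot>\<^bsub>M\<^esub> \<theta>' x))\<rparr>"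
  have N: "carrier N = \<theta> ` carrier M" "\<zero>\<^bsub>N\<^esub> = \<theta> \<zero>\<^bsub>M\<^esub>" "\<And>x y. x \<oplus>\<^bsub>N\<^esub> y = \<theta> (\<theta>' x \<oplus>\<^bsub>M\<^esub> \<theta>' y)"
    "\<And>a x. a \<odot>\<^bsub>N\<^esub> x = \<theta> (a \<odot>\<^bsub>M\<^esub> \<theta>' x)"
    by (simp_all add: N_def)
  note [simp] = l M.smult_closed
  have agN: "abelian_group N"
  proof (rule abelian_groupI)
    fix x assume "x \<in> carrier N"
    then obtain u where u: "u \<in> carrier M" "x = \<theta> u" by (auto simp: N)
    then show "\<exists>y \<in> carrier N. y \<oplus>\<^bsub>N\<^esub> x = \<zero>\<^bsub>N\<^esub>"
      by (intro bexI[of _ "\<theta> (\<ominus>\<^bsub>M\<^esub> u)"]) (auto simp: N M.M.l_neg)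
  next
    fix x y assume "x \<in> carrier N" "y \<in> carrier N"
    then show "x \<oplus>\<^bsub>N\<^esub> y = y \<oplus>\<^bsub>N\<^esub> x"
      by (auto simp: N M.M.a_comm)
  qed (auto simp: N M.M.a_assoc)
  have lmN: "left_module A N"
  proof (intro left_module.intro left_module_axioms.intro)
    show "ring A" by (rule fd_algebraD(1)[OF A])
    show "abelian_group N" by (rule agN)
  qed (auto simp: N M.smult_l_distr M.smult_r_distr M.smult_assoc M.smult_one)
  interpret UN: kspace "underlying_space A N" by (rule underlying_kspace[OF A lmN])
  have "separating (underlying_space A N) ((\<lambda>\<phi>. \<phi> \<circ> \<theta>') ` \<Xi>)"
    unfolding separating_def
  proof (intro conjI ballI impI)
    fix \<psi> assume "\<psi> \<in> (\<lambda>\<phi>. \<phi> \<circ> \<theta>') ` \<Xi>"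
    then obtain \<phi> where \<phi>: "\<phi> \<in> \<Xi>" "\<psi> = \<phi> \<circ> \<theta>'" by blast
    have "ufun A M \<phi>" using \<Xi>(2) \<phi> by (simp add: separating_def)
    then show "ufun A N \<psi>"
      unfolding \<phi>(2) functional_def by (auto simp: N)
  next
    fix x assume x: "x \<in> carrier (underlying_space A N)" "\<forall>\<phi> \<in> (\<lambda>\<phi>. \<phi> \<circ> \<theta>') ` \<Xi>. \<phi> x = 0"
    then obtain u where u: "u \<in> carrier M" "x = \<theta> u" by (auto simp: N)
    have "u = \<zero>\<^bsub>M\<^esub>"
      using \<Xi>(2) x(2) u by (simp add: separating_def)
    then show "x = \<zero>\<^bsub>underlying_space A N\<^esub>"
      using u by (simp add: N)
  qed
  then have "vectorspace.fin_dim (class_ring :: 'k ring) (underlying_space A N)"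
    using UN.fin_dim_if_separating \<Xi>(1) by blast
  moreover have "\<theta> \<in> LinearCombinations.module_hom A M N" "\<theta>' \<in> LinearCombinations.module_hom A N M"
    "\<forall>x \<in> carrier M. \<theta>' (\<theta> x) = x" "\<forall>y \<in> carrier N. \<theta> (\<theta>' y) = y"
    by (auto simp: LinearCombinations.module_hom_def N)
  ultimately show ?thesis
    using lmN by blast
qed

section \<open>Regular, dual and power modules\<close>

definition regular_module :: "('k, 'a) module \<Rightarrow> ('a, 'a) module" where
  "regular_module A = \<lparr>carrier = carrier A, mult = mult A, one = one A, zero = zero A, add = add A, smult = mult A\<rparr>"

lemma regular_module:
  assumes A: "fd_algebra A"
  shows "left_module A (regular_module A)"
    and "\<exists>\<Xi>. finite \<Xi> \<and> separating (underlying_space A (regular_module A)) \<Xi>"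
proof -
  interpret A: kspace A by (rule fd_algebraD(2)[OF A])
  interpret R: ring A by (rule fd_algebraD(1)[OF A])
  show "left_module A (regular_module A)"
  proof (intro left_module.intro left_module_axioms.intro)
    show "abelian_group (regular_module A)"
      by (rule abelian_group_cong[OF _ _ _ R.is_abelian_group]) (simp_all add: regular_module_def)
  qed (simp_all add: regular_module_def R.ring_axioms R.l_distr R.r_distr R.m_assoc)
  obtain \<Xi> where \<Xi>: "finite \<Xi>" "separating A \<Xi>"
    using A.separating_if_fin_dim fd_algebraD(3)[OF A] by blast
  have "functional (underlying_space A (regular_module A)) \<phi>" if "functional A \<phi>" for \<phi>
    using that fd_algebraD(4)[OF A] by (simp add: functional_def regular_module_def)
  then show "\<exists>\<Xi>. finite \<Xi> \<and> separating (underlying_space A (regular_module A)) \<Xi>"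
    using \<Xi> by (intro exI[of _ \<Xi>]) (simp add: separating_def regular_module_def)
qed

text \<open>A^* becomes a left module through right multiplication in the argument. Functionals are
  made \<open>undefined\<close> off the carrier so that those agreeing on A are equal.\<close>

definition dual_module :: "('k::field, 'a) module \<Rightarrow> ('a, 'a \<Rightarrow> 'k) module" where
  "dual_module A = \<lparr>carrier = {\<psi>. functional A \<psi> \<and> \<psi> \<in> extensional (carrier A)}, mult = undefined, one = undefined,
     zero = (\<lambda>x \<in> carrier A. 0), add = (\<lambda>\<psi> \<psi>'. \<lambda>x \<in> carrier A. \<psi> x + \<psi>' x),
     smult = (\<lambda>a \<psi>. \<lambda>x \<in> carrier A. \<psi> (x \<otimes>\<^bsub>A\<^esub> a))\<rparr>"

lemma dual_module:
  assumes A: "fd_algebra A"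
  shows "left_module A (dual_module A)"
    and "\<exists>\<Xi>. finite \<Xi> \<and> separating (underlying_space A (dual_module A)) \<Xi>"
proof -
  interpret A: kspace A by (rule fd_algebraD(2)[OF A])
  interpret R: ring A by (rule fd_algebraD(1)[OF A])
  note D = dual_module_def
  have ag: "abelian_group (dual_module A)"
  proof (rule abelian_groupI)
    fix \<psi> assume "\<psi> \<in> carrier (dual_module A)"
    then show "\<exists>\<chi> \<in> carrier (dual_module A). \<chi> \<oplus>\<^bsub>dual_module A\<^esub> \<psi> = \<zero>\<^bsub>dual_module A\<^esub>"
      by (intro bexI[of _ "\<lambda>x \<in> carrier A. - \<psi> x"]) (auto simp: D functional_def)
  next
    fix \<psi> assume "\<psi> \<in> carrier (dual_module A)"
    then show "\<zero>\<^bsub>dual_module A\<^esub> \<oplus>\<^bsub>dual_module A\<^esub> \<psi> = \<psi>"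
      by (auto simp: D extensional_def)
  qed (auto simp: D functional_def algebra_simps)
  show lm: "left_module A (dual_module A)"
  proof (intro left_module.intro left_module_axioms.intro)
    show "ring A" "abelian_group (dual_module A)"
      using R.ring_axioms ag by simp_all
    fix a \<psi> assume a: "a \<in> carrier A" and \<psi>: "\<psi> \<in> carrier (dual_module A)"
    show "a \<odot>\<^bsub>dual_module A\<^esub> \<psi> \<in> carrier (dual_module A)"
      using a \<psi> fd_algebraD(4)[OF A] by (auto simp: D functional_def R.l_distr)
  next
    fix \<psi> assume "\<psi> \<in> carrier (dual_module A)"
    then show "\<one>\<^bsub>A\<^esub> \<odot>\<^bsub>dual_module A\<^esub> \<psi> = \<psi>"
      by (auto simp: D extensional_def)
  qed (auto simp: D functional_def R.r_distr R.m_assoc intro!: restrict_ext)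
  obtain \<Xi> where "finite \<Xi>" "separating A \<Xi>"
    using A.separating_if_fin_dim fd_algebraD(3)[OF A] by blast
  then obtain n v \<phi> where db: "dual_basis A n v \<phi>"
    using A.dual_basis_exists by blast
  have v: "v i \<in> carrier A" if "i < n" for i
    using db that by (simp add: dual_basis_def)
  have "separating (underlying_space A (dual_module A)) ((\<lambda>i \<psi>. \<psi> (v i)) ` {..<n})"
    unfolding separating_def
  proof (intro conjI ballI impI)
    fix \<xi> :: "('a \<Rightarrow> 'b) \<Rightarrow> 'b" assume "\<xi> \<in> (\<lambda>i \<psi>. \<psi> (v i)) ` {..<n}"
    then show "ufun A (dual_module A) \<xi>"
      using v fd_algebraD(5)[OF A] by (auto simp: functional_def D)
  next
    fix \<psi> assume \<psi>: "\<psi> \<in> carrier (underlying_space A (dual_module A))"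
      and z: "\<forall>\<xi> \<in> (\<lambda>i \<psi>. \<psi> (v i)) ` {..<n}. \<xi> \<psi> = 0"
    have "\<psi> x = 0" if "x \<in> carrier A" for x
      using A.functional_expand[OF db _ that, of \<psi>] \<psi> z by (simp add: D)
    then show "\<psi> = \<zero>\<^bsub>underlying_space A (dual_module A)\<^esub>"
      using \<psi> by (auto simp: D extensional_def)
  qed
  then show "\<exists>\<Xi>. finite \<Xi> \<and> separating (underlying_space A (dual_module A)) \<Xi>"
    by blast
qed

text \<open>The direct sum of n copies of M, from which V \<otimes> d is built. Families are
  \<open>undefined\<close> from n on, so that agreement in the n components is equality.\<close>

definition power_module :: "('a, 'v) module \<Rightarrow> nat \<Rightarrow> ('a, nat \<Rightarrow> 'v) module" where
  "power_module M n = \<lparr>carrier = {x. (\<forall>i<n. x i \<in> carrier M) \<and> (\<forall>i\<ge>n. x i = undefined)},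
     mult = undefined, one = undefined,
     zero = (\<lambda>i. if i < n then \<zero>\<^bsub>M\<^esub> else undefined),
     add = (\<lambda>x y i. if i < n then x i \<oplus>\<^bsub>M\<^esub> y i else undefined),
     smult = (\<lambda>a x i. if i < n then a \<odot>\<^bsub>M\<^esub> x i else undefined)\<rparr>"

lemma power_module:
  fixes A :: "('k::field, 'a) module" and M :: "('a, 'v) module"
  assumes A: "fd_algebra A" and M: "left_module A M"
    and \<Xi>: "finite \<Xi>" "separating (underlying_space A M) \<Xi>"
  shows "left_module A (power_module M n)"
    and "\<exists>\<Xi>. finite \<Xi> \<and> separating (underlying_space A (power_module M n)) \<Xi>"
proof -
  interpret M: left_module A M by (rule M)
  note D = power_module_def
  have ag: "abelian_group (power_module M n)"
  proof (rule abelian_groupI)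
    fix x assume "x \<in> carrier (power_module M n)"
    then show "\<exists>y \<in> carrier (power_module M n). y \<oplus>\<^bsub>power_module M n\<^esub> x = \<zero>\<^bsub>power_module M n\<^esub>"
      by (intro bexI[of _ "\<lambda>i. if i < n then \<ominus>\<^bsub>M\<^esub> x i else undefined"]) (simp_all add: D M.M.l_neg fun_eq_iff)
  next
    fix x y assume "x \<in> carrier (power_module M n)" "y \<in> carrier (power_module M n)"
    then show "x \<oplus>\<^bsub>power_module M n\<^esub> y = y \<oplus>\<^bsub>power_module M n\<^esub> x"
      by (simp add: D M.M.a_comm fun_eq_iff)
  qed (simp_all add: D M.M.a_assoc fun_eq_iff)
  show "left_module A (power_module M n)"
  proof (intro left_module.intro left_module_axioms.intro)
    show "ring A" "abelian_group (power_module M n)"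
      using M.R.ring_axioms ag by simp_all
  qed (simp_all add: D fun_eq_iff M.smult_closed M.smult_l_distr M.smult_r_distr M.smult_assoc M.smult_one)
  let ?X = "(\<lambda>(i, \<phi>) x. \<phi> (x i)) ` ({..<n} \<times> \<Xi>)"
  have "separating (underlying_space A (power_module M n)) ?X"
    unfolding separating_def
  proof (intro conjI ballI impI)
    fix \<xi> assume "\<xi> \<in> ?X"
    then obtain i \<phi> where i: "i < n" "\<phi> \<in> \<Xi>" "\<xi> = (\<lambda>x. \<phi> (x i))" by auto
    have "ufun A M \<phi>" using \<Xi>(2) i by (simp add: separating_def)
    then show "ufun A (power_module M n) \<xi>"
      unfolding i(3) functional_def using i(1) by (simp add: D)
  next
    fix x assume x: "x \<in> carrier (underlying_space A (power_module M n))" and z: "\<forall>\<xi> \<in> ?X. \<xi> x = 0"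
    have "x i = \<zero>\<^bsub>M\<^esub>" if i: "i < n" for i
    proof -
      have "\<forall>\<phi> \<in> \<Xi>. \<phi> (x i) = 0"
        using z i by auto
      moreover have "x i \<in> carrier M"
        using x i by (simp add: D)
      ultimately show ?thesis
        using \<Xi>(2) by (simp add: separating_def)
    qed
    then show "x = \<zero>\<^bsub>underlying_space A (power_module M n)\<^esub>"
      using x by (simp add: D fun_eq_iff)
  qed
  moreover have "finite ?X"
    using \<Xi>(1) by simp
  ultimately show "\<exists>\<Xi>. finite \<Xi> \<and> separating (underlying_space A (power_module M n)) \<Xi>"
    by blast
qed

section \<open>Categories equivalent to module categories\<close>

lemma module_hom_iff:
  "f \<in> LinearCombinations.module_hom R M N \<longleftrightarrow>
     (\<forall>x \<in> carrier M. f x \<in> carrier N) \<and>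
     (\<forall>x \<in> carrier M. \<forall>y \<in> carrier M. f (x \<oplus>\<^bsub>M\<^esub> y) = f x \<oplus>\<^bsub>N\<^esub> f y) \<and>
     (\<forall>r \<in> carrier R. \<forall>x \<in> carrier M. f (r \<odot>\<^bsub>M\<^esub> x) = r \<odot>\<^bsub>N\<^esub> f x)"
  unfolding LinearCombinations.module_hom_def by (simp add: Pi_iff) blast

lemma module_hom_functional:
  assumes "fd_algebra A" "f \<in> LinearCombinations.module_hom A M N" "ufun A N \<phi>"
  shows "ufun A M (\<lambda>x. \<phi> (f x))"
proof -
  interpret A: kspace A by (rule fd_algebraD(2)[OF assms(1)])
  interpret R: ring A by (rule fd_algebraD(1)[OF assms(1)])
  show ?thesis
    using assms(2,3) by (simp add: module_hom_iff functional_def)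
qed

text \<open>
  An equivalence of \<open>C\<close> with finite-dimensional \<open>A\<close>-modules, in terms of the module \<open>U c\<close> of each object
  and the map \<open>act f\<close> of each arrow.
\<close>

locale module_fibre = linear_category C
  for C :: "('k::field, 'o, 'm, 'x) linear_cat_scheme" (structure) +
  fixes A :: "('k, 'a) module" and U :: "'o \<Rightarrow> ('a, 'k vec) module" and act :: "'m \<Rightarrow> 'k vec \<Rightarrow> 'k vec"
  assumes alg: "fd_algebra A"
    and U_module: "c \<in> Obj C \<Longrightarrow> left_module A (U c)"
    and U_sep: "c \<in> Obj C \<Longrightarrow> \<exists>\<Xi>. finite \<Xi> \<and> separating (underlying_space A (U c)) \<Xi>"
    and act_hom: "f \<in> hom a b \<Longrightarrow> act f \<in> LinearCombinations.module_hom A (U a) (U b)"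
    and act_id: "a \<in> Obj C \<Longrightarrow> x \<in> carrier (U a) \<Longrightarrow> act (Id C a) x = x"
    and act_comp: "f \<in> hom a b \<Longrightarrow> g \<in> hom b c \<Longrightarrow> x \<in> carrier (U a) \<Longrightarrow> act (g \<cdot> f) x = act g (act f x)"
    and act_add: "f \<in> hom a b \<Longrightarrow> g \<in> hom a b \<Longrightarrow> x \<in> carrier (U a) \<Longrightarrow>
      act (f \<boxplus> g) x = act f x \<oplus>\<^bsub>U b\<^esub> act g x"
    and act_scale: "f \<in> hom a b \<Longrightarrow> x \<in> carrier (U a) \<Longrightarrow>
      act (k \<star> f) x = (k \<odot>\<^bsub>A\<^esub> \<one>\<^bsub>A\<^esub>) \<odot>\<^bsub>U b\<^esub> act f x"
    and act_inj: "f \<in> hom a b \<Longrightarrow> g \<in> hom a b \<Longrightarrow> (\<And>x. x \<in> carrier (U a) \<Longrightarrow> act f x = act g x) \<Longrightarrow> f = g"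
    and act_full: "a \<in> Obj C \<Longrightarrow> b \<in> Obj C \<Longrightarrow> h \<in> LinearCombinations.module_hom A (U a) (U b) \<Longrightarrow>
      \<exists>f \<in> hom a b. \<forall>x \<in> carrier (U a). act f x = h x"
    and U_surj: "left_module A (M :: ('a, 'k vec) module) \<Longrightarrow> vectorspace.fin_dim (class_ring :: 'k ring) (underlying_space A M) \<Longrightarrow>
      \<exists>c \<in> Obj C. \<exists>\<theta> \<in> LinearCombinations.module_hom A M (U c). \<exists>\<theta>' \<in> LinearCombinations.module_hom A (U c) M.
        (\<forall>x \<in> carrier M. \<theta>' (\<theta> x) = x) \<and> (\<forall>y \<in> carrier (U c). \<theta> (\<theta>' y) = y)"
begin

lemma A_kspace: "kspace A" and A_ring: "ring A"
  using fd_algebraD[OF alg] by simp_all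

lemma U_kspace: "c \<in> Obj C \<Longrightarrow> kspace (underlying_space A (U c))"
  by (rule underlying_kspace[OF alg U_module])

lemma act_in: "f \<in> hom a b \<Longrightarrow> x \<in> carrier (U a) \<Longrightarrow> act f x \<in> carrier (U b)"
  and act_smult: "f \<in> hom a b \<Longrightarrow> r \<in> carrier A \<Longrightarrow> x \<in> carrier (U a) \<Longrightarrow>
    act f (r \<odot>\<^bsub>U a\<^esub> x) = r \<odot>\<^bsub>U b\<^esub> act f x"
  using act_hom[of f a b] by (simp_all add: module_hom_iff)

lemma act_zero:
  assumes "a \<in> Obj C" "b \<in> Obj C" "x \<in> carrier (U a)"
  shows "act (ZeroArr C a b) x = \<zero>\<^bsub>U b\<^esub>"
proof -
  note z = zero_in[OF assms(1,2)]
  have "act (ZeroArr C a b) x = (0 \<odot>\<^bsub>A\<^esub> \<one>\<^bsub>A\<^esub>) \<odot>\<^bsub>U b\<^esub> act (ZeroArr C a b) x"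
    using act_scale[OF z assms(3), of 0] scale_zero[OF z] by simp
  also have "\<dots> = \<zero>\<^bsub>U b\<^esub>"
    using kspace.zero_smult[OF U_kspace[OF assms(2)], of "act (ZeroArr C a b) x"] act_in[OF z assms(3)] by simp
  finally show ?thesis .
qed

lemma Fn_act:
  assumes "ufun A (U b) \<phi>" "x \<in> carrier (U a)"
  shows "(\<lambda>f. \<phi> (act f x)) \<in> Fn a b"
  using assms act_add[of _ a b _ x] act_scale[of _ a b x] act_in[of _ a b x]
  by (simp add: functional_hom_iff functional_def)

lemma U_dual_basis: "c \<in> Obj C \<Longrightarrow> \<exists>n v \<phi>. dual_basis (underlying_space A (U c)) n v \<phi>"
  using U_sep kspace.dual_basis_exists[OF U_kspace] by metis

lemma U_zero_if:
  assumes c: "c \<in> Obj C" and x: "x \<in> carrier (U c)" and z: "\<And>\<phi>. ufun A (U c) \<phi> \<Longrightarrow> \<phi> x = 0"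
  shows "x = \<zero>\<^bsub>U c\<^esub>"
proof -
  obtain \<Xi> where "separating (underlying_space A (U c)) \<Xi>"
    using U_sep[OF c] by blast
  then show ?thesis
    using x z by (simp add: separating_def)
qed

text \<open>An arrow is determined by its values on a basis of U a, and these are tested by finitely
  many functionals on U b. So the pairs of a basis vector and such a functional separate Hom(a,
  b).\<close>

lemma hom_finite: "hom_finite"
  unfolding hom_finite_def
proof (intro ballI)
  fix a b assume a: "a \<in> Obj C" and b: "b \<in> Obj C"
  interpret H: kspace "hom_space C a b" by (rule hom_kspace[OF a b])
  interpret Ua: kspace "underlying_space A (U a)" by (rule U_kspace[OF a])
  obtain n v \<phi> where db: "dual_basis (underlying_space A (U a)) n v \<phi>"
    using U_dual_basis[OF a] by blast
  obtain \<Xi> where \<Xi>: "finite \<Xi>" "separating (underlying_space A (U b)) \<Xi>"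
    using U_sep[OF b] by blast
  have v: "v i \<in> carrier (U a)" if "i < n" for i
    using db that by (simp add: dual_basis_def)
  let ?X = "(\<lambda>(i, \<xi>) f. \<xi> (act f (v i))) ` ({..<n} \<times> \<Xi>)"
  have "separating (hom_space C a b) ?X"
    unfolding separating_def
  proof (intro conjI ballI impI)
    fix \<tau> assume "\<tau> \<in> ?X"
    then obtain i \<xi> where i: "i < n" "\<xi> \<in> \<Xi>" "\<tau> = (\<lambda>f. \<xi> (act f (v i)))"
      by auto
    have "ufun A (U b) \<xi>"
      using \<Xi>(2) i(2) by (simp add: separating_def)
    then show "functional (hom_space C a b) \<tau>"
      using Fn_act[OF _ v[OF i(1)]] i(3) by simp
  next
    fix f assume "f \<in> carrier (hom_space C a b)" and z: "\<forall>\<tau> \<in> ?X. \<tau> f = 0"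
    then have f: "f \<in> hom a b" by simp
    have vz: "act f (v i) = \<zero>\<^bsub>U b\<^esub>" if i: "i < n" for i
    proof -
      have "\<xi> (act f (v i)) = 0" if "\<xi> \<in> \<Xi>" for \<xi>
        using z i that by auto
      then show ?thesis
        using \<Xi>(2) act_in[OF f v[OF i]] by (simp add: separating_def)
    qed
    show "f = \<zero>\<^bsub>hom_space C a b\<^esub>"
      unfolding hom_space_simps
    proof (rule act_inj[OF f zero_in[OF a b]])
      fix x assume x: "x \<in> carrier (U a)"
      have "act f x = \<zero>\<^bsub>U b\<^esub>"
      proof (rule U_zero_if[OF b act_in[OF f x]])
        fix \<psi> assume \<psi>: "ufun A (U b) \<psi>"
        have "\<psi> (act f x) = (\<Sum>i<n. \<psi> (act f (v i)) * \<phi> i x)"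
          by (rule Ua.functional_expand[OF db module_hom_functional[OF alg act_hom[OF f] \<psi>]]) (simp add: x)
        also have "\<dots> = 0"
          using vz kspace.functional_zero[OF U_kspace[OF b] \<psi>] by simp
        finally show "\<psi> (act f x) = 0" .
      qed
      then show "act f x = act (ZeroArr C a b) x"
        using act_zero[OF a b x] by simp
    qed
  qed
  then show "\<exists>n v \<phi>. dual_basis (hom_space C a b) n v \<phi>"
    by (rule H.dual_basis_exists[rotated]) (simp add: \<Xi>(1))
qed

text \<open>\<open>U_surj\<close> speaks of modules inside the universe \<open>'k vec\<close>.
  Composing with the copy from \<open>module_copy\<close> makes it apply to modules of functionals
  or of families, whose elements have other types.\<close>

lemma U_surj_sep:
  fixes M :: "('a, 'v) module"
  assumes M: "left_module A M" and \<Xi>: "\<exists>\<Xi>. finite \<Xi> \<and> separating (underlying_space A M) \<Xi>"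
  shows "\<exists>c \<in> Obj C. \<exists>\<theta> \<in> LinearCombinations.module_hom A M (U c). \<exists>\<theta>' \<in> LinearCombinations.module_hom A (U c) M.
        (\<forall>x \<in> carrier M. \<theta>' (\<theta> x) = x) \<and> (\<forall>y \<in> carrier (U c). \<theta> (\<theta>' y) = y)"
proof -
  obtain \<Xi> where \<Xi>: "finite \<Xi>" "separating (underlying_space A M) \<Xi>"
    using assms(2) by blast
  obtain N :: "('a, 'k vec) module" and \<theta> \<theta>' where N: "left_module A N"
    "vectorspace.fin_dim (class_ring :: 'k ring) (underlying_space A N)"
    and \<theta>: "\<theta> \<in> LinearCombinations.module_hom A M N" "\<theta>' \<in> LinearCombinations.module_hom A N M"
      "\<forall>x \<in> carrier M. \<theta>' (\<theta> x) = x" "\<forall>y \<in> carrier N. \<theta> (\<theta>' y) = y"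
    using module_copy[OF alg M \<Xi>] by blast
  obtain c \<eta> \<eta>' where c: "c \<in> Obj C" and \<eta>: "\<eta> \<in> LinearCombinations.module_hom A N (U c)"
    "\<eta>' \<in> LinearCombinations.module_hom A (U c) N"
    "\<forall>x \<in> carrier N. \<eta>' (\<eta> x) = x" "\<forall>y \<in> carrier (U c). \<eta> (\<eta>' y) = y"
    using U_surj[OF N] by blast
  show ?thesis
  proof (intro bexI[OF _ c] bexI conjI ballI)
    show "\<eta> \<circ> \<theta> \<in> LinearCombinations.module_hom A M (U c)" "\<theta>' \<circ> \<eta>' \<in> LinearCombinations.module_hom A (U c) M"
      using \<theta>(1,2) \<eta>(1,2) by (simp_all add: module_hom_iff)
    show "(\<theta>' \<circ> \<eta>') ((\<eta> \<circ> \<theta>) x) = x" if "x \<in> carrier M" for x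
      using that \<theta> \<eta> by (simp add: module_hom_iff)
    show "(\<eta> \<circ> \<theta>) ((\<theta>' \<circ> \<eta>') y) = y" if "y \<in> carrier (U c)" for y
      using that \<theta> \<eta> by (simp add: module_hom_iff)
  qed
qed

text \<open>The regular module itself need not be of the form U c, so freeness is expressed by the
  element e that corresponds to 1.\<close>

definition free_at where
  "free_at P e \<longleftrightarrow> P \<in> Obj C \<and> e \<in> carrier (U P) \<and>
     (\<forall>x \<in> carrier (U P). \<exists>!a. a \<in> carrier A \<and> a \<odot>\<^bsub>U P\<^esub> e = x)"

text \<open>The pair of I and \<epsilon> represents the functor sending c to the dual of U c: the
  third clause is existence of g, and the last makes g unique. The model is A^* with evaluation at
  1.\<close>

definition cofree_at where
  "cofree_at I \<epsilon> \<longleftrightarrow> I \<in> Obj C \<and> ufun A (U I) \<epsilon> \<and>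
     (\<forall>c \<in> Obj C. \<forall>\<phi>. ufun A (U c) \<phi> \<longrightarrow> (\<exists>g \<in> hom c I. \<forall>x \<in> carrier (U c). \<epsilon> (act g x) = \<phi> x)) \<and>
     (\<forall>x \<in> carrier (U I). (\<forall>a \<in> carrier A. \<epsilon> (a \<odot>\<^bsub>U I\<^esub> x) = 0) \<longrightarrow> x = \<zero>\<^bsub>U I\<^esub>)"

lemma free_exists: "\<exists>P e. free_at P e"
proof -
  interpret R: ring A by (rule A_ring)
  obtain c \<theta> \<theta>' where c: "c \<in> Obj C" and \<theta>: "\<theta> \<in> LinearCombinations.module_hom A (regular_module A) (U c)"
    "\<theta>' \<in> LinearCombinations.module_hom A (U c) (regular_module A)"
    "\<forall>x \<in> carrier (regular_module A). \<theta>' (\<theta> x) = x" "\<forall>y \<in> carrier (U c). \<theta> (\<theta>' y) = y"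
    using U_surj_sep[OF regular_module[OF alg]] by blast
  have s: "a \<odot>\<^bsub>U c\<^esub> \<theta> \<one>\<^bsub>A\<^esub> = \<theta> a" if "a \<in> carrier A" for a
    using \<theta>(1) that by (simp add: module_hom_iff regular_module_def) (metis R.one_closed R.r_one)
  have "free_at c (\<theta> \<one>\<^bsub>A\<^esub>)"
    unfolding free_at_def
  proof (intro conjI ballI c)
    show "\<theta> \<one>\<^bsub>A\<^esub> \<in> carrier (U c)"
      using \<theta>(1) by (simp add: module_hom_iff regular_module_def)
    fix x assume x: "x \<in> carrier (U c)"
    show "\<exists>!a. a \<in> carrier A \<and> a \<odot>\<^bsub>U c\<^esub> \<theta> \<one>\<^bsub>A\<^esub> = x"
    proof (rule ex1I[of _ "\<theta>' x"])
      have "\<theta>' x \<in> carrier A"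
        using \<theta>(2) x by (simp add: module_hom_iff regular_module_def)
      then show "\<theta>' x \<in> carrier A \<and> \<theta>' x \<odot>\<^bsub>U c\<^esub> \<theta> \<one>\<^bsub>A\<^esub> = x"
        using s \<theta>(4) x by simp
      fix a assume "a \<in> carrier A \<and> a \<odot>\<^bsub>U c\<^esub> \<theta> \<one>\<^bsub>A\<^esub> = x"
      then show "a = \<theta>' x"
        using s \<theta>(3) by (auto simp: regular_module_def)
    qed
  qed
  then show ?thesis by blast
qed

text \<open>A functional \<phi> on U c gives the A-linear map x \<mapsto> (a \<mapsto> \<phi> (a x))
  into A^*, from which evaluation at 1 recovers \<phi>.\<close>

lemma cofree_exists: "\<exists>I \<epsilon>. cofree_at I \<epsilon>"
proof -
  interpret R: ring A by (rule A_ring)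
  interpret A: kspace A by (rule A_kspace)
  let ?D = "dual_module A"
  obtain I \<theta> \<theta>' where I: "I \<in> Obj C" and \<theta>: "\<theta> \<in> LinearCombinations.module_hom A ?D (U I)"
    "\<theta>' \<in> LinearCombinations.module_hom A (U I) ?D"
    "\<forall>x \<in> carrier ?D. \<theta>' (\<theta> x) = x" "\<forall>y \<in> carrier (U I). \<theta> (\<theta>' y) = y"
    using U_surj_sep[OF dual_module[OF alg]] by blast
  define \<epsilon> where "\<epsilon> x = \<theta>' x \<one>\<^bsub>A\<^esub>" for x
  have D: "\<psi> \<in> carrier ?D \<longleftrightarrow> functional A \<psi> \<and> \<psi> \<in> extensional (carrier A)" for \<psi>
    by (simp add: dual_module_def)
  have "ufun A ?D (\<lambda>\<psi>. \<psi> \<one>\<^bsub>A\<^esub>)"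
    using fd_algebraD(4,5)[OF alg] by (simp add: functional_def dual_module_def)
  then have \<epsilon>: "ufun A (U I) \<epsilon>"
    unfolding \<epsilon>_def by (rule module_hom_functional[OF alg \<theta>(2)])
  have \<epsilon>a: "\<epsilon> (a \<odot>\<^bsub>U I\<^esub> x) = \<theta>' x a" if "a \<in> carrier A" "x \<in> carrier (U I)" for a x
    using \<theta>(2) that by (simp add: \<epsilon>_def module_hom_iff) (simp add: dual_module_def)
  have "\<exists>g \<in> hom c I. \<forall>x \<in> carrier (U c). \<epsilon> (act g x) = \<phi> x" if c: "c \<in> Obj C" and \<phi>: "ufun A (U c) \<phi>" for c \<phi>
  proof -
    interpret N: left_module A "U c" by (rule U_module[OF c])
    define h where "h x = (\<lambda>a \<in> carrier A. \<phi> (a \<odot>\<^bsub>U c\<^esub> x))" for x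
    have h: "h x \<in> carrier ?D" if "x \<in> carrier (U c)" for x
      using ufun_orbit[OF alg U_module[OF c] \<phi> that] by (simp add: D h_def functional_def)
    have "h \<in> LinearCombinations.module_hom A (U c) ?D"
      unfolding module_hom_iff
    proof (intro conjI ballI h)
      show "h (x \<oplus>\<^bsub>U c\<^esub> y) = h x \<oplus>\<^bsub>?D\<^esub> h y" if "x \<in> carrier (U c)" "y \<in> carrier (U c)" for x y
        using that \<phi> by (simp add: h_def dual_module_def fun_eq_iff N.smult_r_distr N.smult_closed functional_def)
      show "h (r \<odot>\<^bsub>U c\<^esub> x) = r \<odot>\<^bsub>?D\<^esub> h x" if "r \<in> carrier A" "x \<in> carrier (U c)" for r x
        using that by (simp add: h_def dual_module_def fun_eq_iff N.smult_assoc)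
    qed
    then have "\<theta> \<circ> h \<in> LinearCombinations.module_hom A (U c) (U I)"
      using \<theta>(1) by (simp add: module_hom_iff)
    then obtain g where g: "g \<in> hom c I" "\<forall>x \<in> carrier (U c). act g x = \<theta> (h x)"
      using act_full[OF c I] by fastforce
    have "\<epsilon> (act g x) = \<phi> x" if "x \<in> carrier (U c)" for x
      using that g(2) \<theta>(3) h[OF that] N.smult_one by (simp add: \<epsilon>_def h_def)
    then show ?thesis
      using g(1) by blast
  qed
  moreover have "x = \<zero>\<^bsub>U I\<^esub>" if x: "x \<in> carrier (U I)" and z: "\<forall>a \<in> carrier A. \<epsilon> (a \<odot>\<^bsub>U I\<^esub> x) = 0" for x
  proof -
    interpret N: left_module A "U I" by (rule U_module[OF I])
    have *: "\<theta>' y = (\<lambda>x \<in> carrier A. 0)" if "y \<in> carrier (U I)" "\<forall>a \<in> carrier A. \<epsilon> (a \<odot>\<^bsub>U I\<^esub> y) = 0" for y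
    proof -
      have "\<theta>' y \<in> extensional (carrier A)"
        using \<theta>(2) that(1) by (simp add: module_hom_iff D)
      then show ?thesis
        using that \<epsilon>a by (intro ext) (auto simp: extensional_def)
    qed
    have "\<epsilon> (a \<odot>\<^bsub>U I\<^esub> \<zero>\<^bsub>U I\<^esub>) = 0" if a: "a \<in> carrier A" for a
      using kspace.functional_zero[OF U_kspace[OF I] ufun_smult[OF alg U_module[OF I] \<epsilon> a]] by simp
    then have "\<theta>' x = \<theta>' \<zero>\<^bsub>U I\<^esub>"
      using *[OF x z] *[OF N.M.zero_closed] by simp
    then show ?thesis
      using \<theta>(4) x N.M.zero_closed by metis
  qed
  ultimately have "cofree_at I \<epsilon>"
    unfolding cofree_at_def using I \<epsilon> by blast
  then show ?thesis by blast
qed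

section \<open>The free module of rank one\<close>

context
  fixes P e
  assumes P: "free_at P e"
begin

lemma free_obj: "P \<in> Obj C" and free_el: "e \<in> carrier (U P)"
  using P by (simp_all add: free_at_def)

lemma free_coeff:
  assumes "x \<in> carrier (U P)"
  obtains a where "a \<in> carrier A" "a \<odot>\<^bsub>U P\<^esub> e = x"
  using P assms unfolding free_at_def by blast

lemma free_coeff_unique:
  assumes "a \<in> carrier A" "b \<in> carrier A" "a \<odot>\<^bsub>U P\<^esub> e = b \<odot>\<^bsub>U P\<^esub> e"
  shows "a = b"
proof -
  interpret left_module A "U P" by (rule U_module[OF free_obj])
  have "b \<odot>\<^bsub>U P\<^esub> e \<in> carrier (U P)"
    using smult_closed[OF assms(2) free_el] .
  then show ?thesis
    using P assms unfolding free_at_def by blast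
qed

lemma free_eq:
  assumes f: "f \<in> hom P c" "g \<in> hom P c" and eq: "act f e = act g e"
  shows "f = g"
proof (rule act_inj[OF f])
  fix x assume "x \<in> carrier (U P)"
  then obtain a where a: "a \<in> carrier A" "a \<odot>\<^bsub>U P\<^esub> e = x"
    by (rule free_coeff)
  then show "act f x = act g x"
    using act_smult[OF f(1) a(1) free_el] act_smult[OF f(2) a(1) free_el] eq by simp
qed

lemma free_arr:
  assumes c: "c \<in> Obj C" and x: "x \<in> carrier (U c)"
  shows "\<exists>f \<in> hom P c. act f e = x"
proof -
  interpret R: ring A by (rule A_ring)
  interpret UP: left_module A "U P" by (rule U_module[OF free_obj])
  interpret Uc: left_module A "U c" by (rule U_module[OF c])
  define co where "co y = (THE a. a \<in> carrier A \<and> a \<odot>\<^bsub>U P\<^esub> e = y)" for y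
  have co: "co y \<in> carrier A \<and> co y \<odot>\<^bsub>U P\<^esub> e = y" if "y \<in> carrier (U P)" for y
    unfolding co_def by (rule theI') (use P that in \<open>simp add: free_at_def\<close>)
  have co_eq: "co (a \<odot>\<^bsub>U P\<^esub> e) = a" if "a \<in> carrier A" for a
    using free_coeff_unique[of "co (a \<odot>\<^bsub>U P\<^esub> e)" a] co[OF UP.smult_closed[OF that free_el]] that by simp
  have "(\<lambda>y. co y \<odot>\<^bsub>U c\<^esub> x) \<in> LinearCombinations.module_hom A (U P) (U c)"
    unfolding module_hom_iff
  proof (intro conjI ballI)
    show "co y \<odot>\<^bsub>U c\<^esub> x \<in> carrier (U c)" if "y \<in> carrier (U P)" for y
      using co[OF that] x Uc.smult_closed by simp
    show "co (y \<oplus>\<^bsub>U P\<^esub> z) \<odot>\<^bsub>U c\<^esub> x = co y \<odot>\<^bsub>U c\<^esub> x \<oplus>\<^bsub>U c\<^esub> co z \<odot>\<^bsub>U c\<^esub> x"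
      if y: "y \<in> carrier (U P)" and z: "z \<in> carrier (U P)" for y z
    proof -
      have "(co y \<oplus>\<^bsub>A\<^esub> co z) \<odot>\<^bsub>U P\<^esub> e = y \<oplus>\<^bsub>U P\<^esub> z"
        using UP.smult_l_distr[OF _ _ free_el, of "co y" "co z"] co[OF y] co[OF z] by simp
      then have "co (y \<oplus>\<^bsub>U P\<^esub> z) = co y \<oplus>\<^bsub>A\<^esub> co z"
        using co_eq[of "co y \<oplus>\<^bsub>A\<^esub> co z"] co[OF y] co[OF z] by simp
      then show ?thesis
        using Uc.smult_l_distr[OF _ _ x, of "co y" "co z"] co[OF y] co[OF z] by simp
    qed
    show "co (r \<odot>\<^bsub>U P\<^esub> y) \<odot>\<^bsub>U c\<^esub> x = r \<odot>\<^bsub>U c\<^esub> (co y \<odot>\<^bsub>U c\<^esub> x)"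
      if r: "r \<in> carrier A" and y: "y \<in> carrier (U P)" for r y
    proof -
      have "(r \<otimes>\<^bsub>A\<^esub> co y) \<odot>\<^bsub>U P\<^esub> e = r \<odot>\<^bsub>U P\<^esub> y"
        using UP.smult_assoc[OF r _ free_el, of "co y"] co[OF y] by simp
      then have "co (r \<odot>\<^bsub>U P\<^esub> y) = r \<otimes>\<^bsub>A\<^esub> co y"
        using co_eq[of "r \<otimes>\<^bsub>A\<^esub> co y"] co[OF y] r by simp
      then show ?thesis
        using Uc.smult_assoc[OF r _ x, of "co y"] co[OF y] by simp
    qed
  qed
  then obtain f where f: "f \<in> hom P c" "\<forall>y \<in> carrier (U P). act f y = co y \<odot>\<^bsub>U c\<^esub> x"
    using act_full[OF free_obj c] by blast
  have "co e = \<one>\<^bsub>A\<^esub>"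
    using co_eq[OF R.one_closed] UP.smult_one[OF free_el] by simp
  then show ?thesis
    using f free_el Uc.smult_one[OF x] by (intro bexI[of _ f]) simp_all
qed

lemma free_generator: "generator P"
  unfolding generator_def
proof (intro conjI ballI impI free_obj)
  fix c x f assume c: "c \<in> Obj C" and x: "x \<in> Obj C" and f: "f \<in> hom c x"
    and z: "\<forall>p \<in> hom P c. f \<cdot> p = ZeroArr C P x"
  show "f = ZeroArr C c x"
  proof (rule act_inj[OF f zero_in[OF c x]])
    fix y assume y: "y \<in> carrier (U c)"
    obtain p where p: "p \<in> hom P c" "act p e = y"
      using free_arr[OF c y] by blast
    have "act f y = act (ZeroArr C P x) e"
      using act_comp[OF p(1) f free_el] z p by simp
    then show "act f y = act (ZeroArr C c x) y"
      using act_zero[OF free_obj x free_el] act_zero[OF c x y] by simp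
  qed
qed

text \<open>Evaluation at e identifies Hom(P, X) with U X, and precomposition with the endomorphism
  taking e to r e becomes multiplication by r. An additive map respecting such precompositions is
  therefore A-linear, and A-linear maps come from arrows.\<close>

lemma free_dense: "dense_obj P"
  unfolding dense_obj_def
proof (intro conjI ballI allI impI free_obj)
  fix X x p assume X: "X \<in> Obj C" and x: "x \<in> Obj C"
    and "(\<forall>q \<in> hom P X. p q \<in> hom P x) \<and>
      (\<forall>q \<in> hom P X. \<forall>q' \<in> hom P X. p (q \<boxplus> q') = p q \<boxplus> p q') \<and>
      (\<forall>q \<in> hom P X. \<forall>s \<in> hom P P. p (q \<cdot> s) = p q \<cdot> s)"
  then have p: "\<And>q. q \<in> hom P X \<Longrightarrow> p q \<in> hom P x"
    and padd: "\<And>q q'. q \<in> hom P X \<Longrightarrow> q' \<in> hom P X \<Longrightarrow> p (q \<boxplus> q') = p q \<boxplus> p q'"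
    and pcomp: "\<And>q s. q \<in> hom P X \<Longrightarrow> s \<in> hom P P \<Longrightarrow> p (q \<cdot> s) = p q \<cdot> s"
    by blast+
  interpret UX: left_module A "U X" by (rule U_module[OF X])
  interpret UP: left_module A "U P" by (rule U_module[OF free_obj])
  define q where "q y = (SOME f. f \<in> hom P X \<and> act f e = y)" for y
  have q: "q y \<in> hom P X" "act (q y) e = y" if "y \<in> carrier (U X)" for y
  proof -
    have "\<exists>f. f \<in> hom P X \<and> act f e = y"
      using free_arr[OF X that] by blast
    from someI_ex[OF this] show "q y \<in> hom P X" "act (q y) e = y"
      unfolding q_def by blast+
  qed
  have q_eq: "q (act f e) = f" if f: "f \<in> hom P X" for f
    by (rule free_eq[OF q(1)[OF act_in[OF f free_el]] f q(2)[OF act_in[OF f free_el]]])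
  have "(\<lambda>y. act (p (q y)) e) \<in> LinearCombinations.module_hom A (U X) (U x)"
    unfolding module_hom_iff
  proof (intro conjI ballI)
    show "act (p (q y)) e \<in> carrier (U x)" if "y \<in> carrier (U X)" for y
      by (rule act_in[OF p[OF q(1)[OF that]] free_el])
    show "act (p (q (y \<oplus>\<^bsub>U X\<^esub> z))) e = act (p (q y)) e \<oplus>\<^bsub>U x\<^esub> act (p (q z)) e"
      if y: "y \<in> carrier (U X)" and z: "z \<in> carrier (U X)" for y z
    proof -
      note qy = q[OF y] and qz = q[OF z]
      have "q (y \<oplus>\<^bsub>U X\<^esub> z) = q y \<boxplus> q z"
        using q_eq[OF add_in[OF qy(1) qz(1)]] act_add[OF qy(1) qz(1) free_el] qy qz by simp
      then show ?thesis
        using padd[OF qy(1) qz(1)] act_add[OF p[OF qy(1)] p[OF qz(1)] free_el] by simp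
    qed
    show "act (p (q (r \<odot>\<^bsub>U X\<^esub> y))) e = r \<odot>\<^bsub>U x\<^esub> act (p (q y)) e"
      if r: "r \<in> carrier A" and y: "y \<in> carrier (U X)" for r y
    proof -
      note qy = q[OF y]
      obtain s where s: "s \<in> hom P P" "act s e = r \<odot>\<^bsub>U P\<^esub> e"
        using free_arr[OF free_obj UP.smult_closed[OF r free_el]] by blast
      have "act (q y \<cdot> s) e = r \<odot>\<^bsub>U X\<^esub> y"
        using act_comp[OF s(1) qy(1) free_el] s(2) act_smult[OF qy(1) r free_el] qy(2) by simp
      then have "q (r \<odot>\<^bsub>U X\<^esub> y) = q y \<cdot> s"
        using q_eq[OF comp_in_hom[OF s(1) qy(1)]] by simp
      then show ?thesis
        using pcomp[OF qy(1) s(1)] act_comp[OF s(1) p[OF qy(1)] free_el] s(2)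
          act_smult[OF p[OF qy(1)] r free_el] by simp
    qed
  qed
  then obtain h where h: "h \<in> hom X x" "\<forall>y \<in> carrier (U X). act h y = act (p (q y)) e"
    using act_full[OF X x] by blast
  have "h \<cdot> f = p f" if f: "f \<in> hom P X" for f
    by (rule free_eq[OF comp_in_hom[OF f h(1)] p[OF f]])
      (use act_comp[OF f h(1) free_el] h(2) act_in[OF f free_el] q_eq[OF f] in simp)
  then show "\<exists>h \<in> hom X x. \<forall>q \<in> hom P X. h \<cdot> q = p q"
    using h(1) by blast
qed

text \<open>Evaluation at e turns Hom(P, c) into U c, and \<epsilon> turns Hom(c, I) into the dual
  of U c, so the pairing becomes evaluation of functionals at vectors.\<close>

lemma free_cofree_pairing:
  assumes I: "cofree_at I \<epsilon>"
  shows "nondegenerate_pairing P I (\<lambda>g. \<epsilon> (act g e))"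
  unfolding nondegenerate_pairing_def
proof (intro conjI ballI impI free_obj)
  have Io: "I \<in> Obj C" and \<epsilon>: "ufun A (U I) \<epsilon>"
    and rep: "\<And>c \<phi>. c \<in> Obj C \<Longrightarrow> ufun A (U c) \<phi> \<Longrightarrow> \<exists>g \<in> hom c I. \<forall>x \<in> carrier (U c). \<epsilon> (act g x) = \<phi> x"
    and uniq: "\<And>x. x \<in> carrier (U I) \<Longrightarrow> (\<forall>a \<in> carrier A. \<epsilon> (a \<odot>\<^bsub>U I\<^esub> x) = 0) \<Longrightarrow> x = \<zero>\<^bsub>U I\<^esub>"
    using I by (simp_all add: cofree_at_def)
  show "I \<in> Obj C" "(\<lambda>g. \<epsilon> (act g e)) \<in> Fn P I"
    by (rule Io, rule Fn_act[OF \<epsilon> free_el])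
  show "f = ZeroArr C P c" if c: "c \<in> Obj C" and f: "f \<in> hom P c" and z: "\<forall>g \<in> hom c I. \<epsilon> (act (g \<cdot> f) e) = 0" for c f
  proof (rule free_eq[OF f zero_in[OF free_obj c]])
    note fe = act_in[OF f free_el]
    have "act f e = \<zero>\<^bsub>U c\<^esub>"
    proof (rule U_zero_if[OF c fe])
      fix \<phi> assume "ufun A (U c) \<phi>"
      then obtain g where g: "g \<in> hom c I" "\<forall>x \<in> carrier (U c). \<epsilon> (act g x) = \<phi> x"
        using rep[OF c] by blast
      have "\<phi> (act f e) = \<epsilon> (act g (act f e))"
        using bspec[OF g(2) fe] by simp
      also have "\<dots> = \<epsilon> (act (g \<cdot> f) e)"
        by (simp only: act_comp[OF f g(1) free_el])
      also have "\<dots> = 0"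
        by (rule bspec[OF z g(1)])
      finally show "\<phi> (act f e) = 0" .
    qed
    then show "act f e = act (ZeroArr C P c) e"
      using act_zero[OF free_obj c free_el] by simp
  qed
  show "g = ZeroArr C c I" if c: "c \<in> Obj C" and g: "g \<in> hom c I" and z: "\<forall>f \<in> hom P c. \<epsilon> (act (g \<cdot> f) e) = 0" for c g
  proof (rule act_inj[OF g zero_in[OF c Io]])
    interpret Uc: left_module A "U c" by (rule U_module[OF c])
    fix x assume x: "x \<in> carrier (U c)"
    have "act g x = \<zero>\<^bsub>U I\<^esub>"
    proof (rule uniq[OF act_in[OF g x]], intro ballI)
      fix a assume a: "a \<in> carrier A"
      obtain f where f: "f \<in> hom P c" "act f e = a \<odot>\<^bsub>U c\<^esub> x"
        using free_arr[OF c Uc.smult_closed[OF a x]] by blast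
      show "\<epsilon> (a \<odot>\<^bsub>U I\<^esub> act g x) = 0"
        using bspec[OF z f(1)] unfolding act_comp[OF f(1) g free_el] f(2) act_smult[OF g a x] .
    qed
    then show "act g x = act (ZeroArr C c I) x"
      using act_zero[OF c Io x] by simp
  qed
qed

text \<open>\<open>A\<close> is opposite to \<open>End(P)\<close>: \<open>a\<close> corresponds to the arrow sending \<open>e\<close> to \<open>a e\<close>.\<close>

lemma symmetric_if_trace:
  assumes t: "t \<in> Fn P P" and sym: "\<forall>f \<in> hom P P. \<forall>g \<in> hom P P. t (f \<cdot> g) = t (g \<cdot> f)"
    and nd: "\<forall>f \<in> hom P P. (\<forall>g \<in> hom P P. t (f \<cdot> g) = 0) \<longrightarrow> f = ZeroArr C P P"
  shows "symmetric_frobenius_algebra A"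
proof -
  interpret R: ring A by (rule A_ring)
  interpret A: kspace A by (rule A_kspace)
  interpret UP: left_module A "U P" by (rule U_module[OF free_obj])
  define s where "s a = (SOME f. f \<in> hom P P \<and> act f e = a \<odot>\<^bsub>U P\<^esub> e)" for a
  have s: "s a \<in> hom P P" "act (s a) e = a \<odot>\<^bsub>U P\<^esub> e" if "a \<in> carrier A" for a
  proof -
    have "\<exists>f. f \<in> hom P P \<and> act f e = a \<odot>\<^bsub>U P\<^esub> e"
      using free_arr[OF free_obj UP.smult_closed[OF that free_el]] by blast
    from someI_ex[OF this] show "s a \<in> hom P P" "act (s a) e = a \<odot>\<^bsub>U P\<^esub> e"
      unfolding s_def by blast+
  qed
  have s_eq: "s a = f" if "a \<in> carrier A" "f \<in> hom P P" "act f e = a \<odot>\<^bsub>U P\<^esub> e" for a f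
    by (rule free_eq[OF s(1)[OF that(1)] that(2)]) (simp add: s(2)[OF that(1)] that(3))
  have smul: "s (x \<otimes>\<^bsub>A\<^esub> y) = s y \<cdot> s x" if x: "x \<in> carrier A" and y: "y \<in> carrier A" for x y
    by (rule s_eq[OF _ comp_in_hom[OF s(1)[OF x] s(1)[OF y]]])
      (use x y act_comp[OF s(1)[OF x] s(1)[OF y] free_el] s act_smult[OF s(1)[OF y] x free_el]
        UP.smult_assoc[OF x y free_el] in simp_all)
  have "s (x \<oplus>\<^bsub>A\<^esub> y) = s x \<boxplus> s y" if x: "x \<in> carrier A" and y: "y \<in> carrier A" for x y
    by (rule s_eq[OF _ add_in[OF s(1)[OF x] s(1)[OF y]]])
      (use x y act_add[OF s(1)[OF x] s(1)[OF y] free_el] s UP.smult_l_distr[OF x y free_el] in simp_all)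
  then have 1: "\<forall>x \<in> carrier A. \<forall>y \<in> carrier A. t (s (x \<oplus>\<^bsub>A\<^esub> y)) = t (s x) + t (s y)"
    using t s by (simp add: functional_hom_iff)
  have "s (k \<odot>\<^bsub>A\<^esub> x) = k \<star> s x" if x: "x \<in> carrier A" for k x
  proof (rule s_eq[OF _ scale_in[OF s(1)[OF x]]])
    have "(k \<odot>\<^bsub>A\<^esub> \<one>\<^bsub>A\<^esub>) \<otimes>\<^bsub>A\<^esub> x = k \<odot>\<^bsub>A\<^esub> x"
      using x fd_algebraD(4)[OF alg, of "\<one>\<^bsub>A\<^esub>" x k] by simp
    then show "act (k \<star> s x) e = (k \<odot>\<^bsub>A\<^esub> x) \<odot>\<^bsub>U P\<^esub> e"
      using act_scale[OF s(1)[OF x] free_el, of k] s(2)[OF x] UP.smult_assoc[OF _ x free_el, of "k \<odot>\<^bsub>A\<^esub> \<one>\<^bsub>A\<^esub>"]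
      by simp
  qed (use x in simp)
  then have 2: "\<forall>k. \<forall>x \<in> carrier A. t (s (k \<odot>\<^bsub>A\<^esub> x)) = k * t (s x)"
    using t s by (simp add: functional_hom_iff)
  have 3: "\<forall>x \<in> carrier A. \<forall>y \<in> carrier A. t (s (x \<otimes>\<^bsub>A\<^esub> y)) = t (s (y \<otimes>\<^bsub>A\<^esub> x))"
    using smul sym s by simp
  have 4: "x = \<zero>\<^bsub>A\<^esub>" if x: "x \<in> carrier A" and z: "\<forall>y \<in> carrier A. t (s (x \<otimes>\<^bsub>A\<^esub> y)) = 0" for x
  proof -
    have "t (s x \<cdot> g) = 0" if g: "g \<in> hom P P" for g
    proof -
      obtain y where y: "y \<in> carrier A" "y \<odot>\<^bsub>U P\<^esub> e = act g e"
        using free_coeff[OF act_in[OF g free_el]] by blast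
      have "s y = g"
        using s_eq[OF y(1) g] y(2) by simp
      \<comment> \<open>Since s reverses products, the hypothesis concerns s x applied before g.
        Symmetry of t brings it into the order in which nondegeneracy is assumed.\<close>
      have "t (s x \<cdot> g) = t (g \<cdot> s x)"
        using sym s(1)[OF x] g by blast
      also have "\<dots> = 0"
        using bspec[OF z y(1)] unfolding smul[OF x y(1)] \<open>s y = g\<close> .
      finally show ?thesis .
    qed
    then have "s x = ZeroArr C P P"
      using nd s(1)[OF x] by blast
    then have "x \<odot>\<^bsub>U P\<^esub> e = \<zero>\<^bsub>U P\<^esub>"
      using s(2)[OF x] act_zero[OF free_obj free_obj free_el] by simp
    moreover have "\<zero>\<^bsub>A\<^esub> \<odot>\<^bsub>U P\<^esub> e = \<zero>\<^bsub>U P\<^esub>"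
    proof -
      have "\<zero>\<^bsub>A\<^esub> = 0 \<odot>\<^bsub>A\<^esub> \<one>\<^bsub>A\<^esub>" by simp
      then show ?thesis
        using kspace.zero_smult[OF U_kspace[OF free_obj], of e] free_el by simp
    qed
    ultimately show ?thesis
      using free_coeff_unique[OF x R.zero_closed] by simp
  qed
  show ?thesis
    unfolding symmetric_frobenius_algebra_def using alg 1 2 3 4 by (intro conjI exI[of _ "\<lambda>x. t (s x)"]) blast+
qed

text \<open>The form identifies A with A^* as a left module, so the free module P is also cofree, by
  \<epsilon> (a e) = t a. Symmetry of t becomes symmetry of \<epsilon> on composites of
  endomorphisms of P.\<close>

lemma trace_if_symmetric:
  assumes "symmetric_frobenius_algebra A"
  shows "\<exists>\<epsilon>. cofree_at P \<epsilon> \<and>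
    (\<forall>f \<in> hom P P. \<forall>g \<in> hom P P. \<epsilon> (act (f \<cdot> g) e) = \<epsilon> (act (g \<cdot> f) e))"
proof -
  interpret R: ring A by (rule A_ring)
  interpret A: kspace A by (rule A_kspace)
  interpret UP: left_module A "U P" by (rule U_module[OF free_obj])
  obtain t :: "'a \<Rightarrow> 'k" where t: "functional A t"
    and sym: "\<And>x y. x \<in> carrier A \<Longrightarrow> y \<in> carrier A \<Longrightarrow> t (x \<otimes>\<^bsub>A\<^esub> y) = t (y \<otimes>\<^bsub>A\<^esub> x)"
    and nd: "\<And>x. x \<in> carrier A \<Longrightarrow> (\<forall>y \<in> carrier A. t (x \<otimes>\<^bsub>A\<^esub> y) = 0) \<Longrightarrow> x = \<zero>\<^bsub>A\<^esub>"
    using assms unfolding symmetric_frobenius_algebra_def functional_def by auto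
  obtain \<Xi> where "finite \<Xi>" "separating A \<Xi>"
    using A.separating_if_fin_dim fd_algebraD(3)[OF alg] by blast
  then obtain n v \<phi> where db: "dual_basis A n v \<phi>"
    using A.dual_basis_exists by blast
  have tb: "functional A (\<lambda>a. t (a \<otimes>\<^bsub>A\<^esub> b))" if "b \<in> carrier A" for b
    using t that fd_algebraD(4)[OF alg] by (simp add: functional_def R.l_distr)
  have rep: "\<exists>b \<in> carrier A. \<forall>a \<in> carrier A. t (a \<otimes>\<^bsub>A\<^esub> b) = \<psi> a" if "functional A \<psi>" for \<psi>
  proof (rule A.pairing_represents[OF db A_kspace tb _ _ that])
    show "functional A (\<lambda>b. t (a \<otimes>\<^bsub>A\<^esub> b))" if "a \<in> carrier A" for a
      using t that fd_algebraD(5)[OF alg] by (simp add: functional_def R.r_distr)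
  next
    show "a = \<zero>\<^bsub>A\<^esub>" if "a \<in> carrier A" and "\<And>b. b \<in> carrier A \<Longrightarrow> t (a \<otimes>\<^bsub>A\<^esub> b) = 0" for a
      by (rule nd) (simp_all add: that)
  qed
  \<comment> \<open>Nondegeneracy is given in the left argument of the form; symmetry moves it to
    the right argument, where the coefficients b x below occur.\<close>
  have t_inj: "a = b" if a: "a \<in> carrier A" and b: "b \<in> carrier A"
    and eq: "\<And>c. c \<in> carrier A \<Longrightarrow> t (c \<otimes>\<^bsub>A\<^esub> a) = t (c \<otimes>\<^bsub>A\<^esub> b)" for a b
  proof (rule A.eq_if_diff_zero[OF a b], rule nd)
    show "a \<oplus>\<^bsub>A\<^esub> (-1) \<odot>\<^bsub>A\<^esub> b \<in> carrier A"
      using a b by simp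
    have "t ((a \<oplus>\<^bsub>A\<^esub> (-1) \<odot>\<^bsub>A\<^esub> b) \<otimes>\<^bsub>A\<^esub> c) = 0" if c: "c \<in> carrier A" for c
    proof -
      have "t ((a \<oplus>\<^bsub>A\<^esub> (-1) \<odot>\<^bsub>A\<^esub> b) \<otimes>\<^bsub>A\<^esub> c) = t (a \<otimes>\<^bsub>A\<^esub> c) + (-1) * t (b \<otimes>\<^bsub>A\<^esub> c)"
        using a b c functional_add[OF tb[OF c], of a "(-1) \<odot>\<^bsub>A\<^esub> b"] functional_smult[OF tb[OF c], of b "-1"] by simp
      also have "\<dots> = 0"
        using sym[OF a c] sym[OF b c] eq[OF c] by simp
      finally show ?thesis .
    qed
    then show "\<forall>y \<in> carrier A. t ((a \<oplus>\<^bsub>A\<^esub> (-1) \<odot>\<^bsub>A\<^esub> b) \<otimes>\<^bsub>A\<^esub> y) = 0" by blast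
  qed
  define co where "co y = (THE a. a \<in> carrier A \<and> a \<odot>\<^bsub>U P\<^esub> e = y)" for y
  have co_eq: "co (a \<odot>\<^bsub>U P\<^esub> e) = a" if "a \<in> carrier A" for a
    unfolding co_def by (rule the_equality) (use that free_coeff_unique in blast)+
  define \<epsilon> where "\<epsilon> y = t (co y)" for y
  have \<epsilon>: "\<epsilon> (a \<odot>\<^bsub>U P\<^esub> e) = t a" if "a \<in> carrier A" for a
    using co_eq[OF that] by (simp add: \<epsilon>_def)
  have \<epsilon>f: "ufun A (U P) \<epsilon>"
    unfolding functional_def underlying_simps
  proof (intro conjI ballI allI)
    fix x y assume "x \<in> carrier (U P)" "y \<in> carrier (U P)"
    then obtain a b where ab: "a \<in> carrier A" "b \<in> carrier A" "a \<odot>\<^bsub>U P\<^esub> e = x" "b \<odot>\<^bsub>U P\<^esub> e = y"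
      by (metis free_coeff)
    have "x \<oplus>\<^bsub>U P\<^esub> y = (a \<oplus>\<^bsub>A\<^esub> b) \<odot>\<^bsub>U P\<^esub> e"
      using ab UP.smult_l_distr[OF ab(1,2) free_el] by simp
    then have "\<epsilon> (x \<oplus>\<^bsub>U P\<^esub> y) = t (a \<oplus>\<^bsub>A\<^esub> b)"
      using \<epsilon>[OF R.a_closed[OF ab(1,2)]] by simp
    also have "\<dots> = \<epsilon> x + \<epsilon> y"
      using functional_add[OF t ab(1,2)] \<epsilon>[OF ab(1)] \<epsilon>[OF ab(2)] ab(3,4) by simp
    finally show "\<epsilon> (x \<oplus>\<^bsub>U P\<^esub> y) = \<epsilon> x + \<epsilon> y" .
  next
    fix k x assume "x \<in> carrier (U P)"
    then obtain a where a: "a \<in> carrier A" "a \<odot>\<^bsub>U P\<^esub> e = x"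
      by (metis free_coeff)
    have "(k \<odot>\<^bsub>A\<^esub> \<one>\<^bsub>A\<^esub>) \<otimes>\<^bsub>A\<^esub> a = k \<odot>\<^bsub>A\<^esub> a"
      using a fd_algebraD(4)[OF alg, of "\<one>\<^bsub>A\<^esub>" a k] by simp
    then have "(k \<odot>\<^bsub>A\<^esub> \<one>\<^bsub>A\<^esub>) \<odot>\<^bsub>U P\<^esub> x = (k \<odot>\<^bsub>A\<^esub> a) \<odot>\<^bsub>U P\<^esub> e"
      using UP.smult_assoc[OF _ a(1) free_el, of "k \<odot>\<^bsub>A\<^esub> \<one>\<^bsub>A\<^esub>"] a by simp
    then have "\<epsilon> ((k \<odot>\<^bsub>A\<^esub> \<one>\<^bsub>A\<^esub>) \<odot>\<^bsub>U P\<^esub> x) = t (k \<odot>\<^bsub>A\<^esub> a)"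
      using \<epsilon>[OF A.smult_in[OF a(1)]] by simp
    also have "\<dots> = k * \<epsilon> x"
      using functional_smult[OF t a(1)] \<epsilon>[OF a(1)] a(2) by simp
    finally show "\<epsilon> ((k \<odot>\<^bsub>A\<^esub> \<one>\<^bsub>A\<^esub>) \<odot>\<^bsub>U P\<^esub> x) = k * \<epsilon> x" .
  qed
  have \<epsilon>b: "\<epsilon> (a \<odot>\<^bsub>U P\<^esub> (b \<odot>\<^bsub>U P\<^esub> e)) = t (a \<otimes>\<^bsub>A\<^esub> b)" if "a \<in> carrier A" "b \<in> carrier A" for a b
    using \<epsilon>[OF R.m_closed[OF that]] UP.smult_assoc[OF that free_el] by simp
  have "\<exists>g \<in> hom c P. \<forall>x \<in> carrier (U c). \<epsilon> (act g x) = \<phi> x" if c: "c \<in> Obj C" and \<phi>: "ufun A (U c) \<phi>" for c \<phi>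
  proof -
    interpret Uc: left_module A "U c" by (rule U_module[OF c])
    \<comment> \<open>b x is to be the coefficient at e of the image of x under the arrow g sought:
      \<epsilon> (a (g x)) is then t (a (b x)) and has to equal \<phi> (a x).\<close>
    have "\<exists>b \<in> carrier A. \<forall>a \<in> carrier A. t (a \<otimes>\<^bsub>A\<^esub> b) = \<phi> (a \<odot>\<^bsub>U c\<^esub> x)" if "x \<in> carrier (U c)" for x
      by (rule rep[OF ufun_orbit[OF alg U_module[OF c] \<phi> that]])
    then obtain b where b: "\<And>x. x \<in> carrier (U c) \<Longrightarrow> b x \<in> carrier A"
      and bt: "\<And>x a. x \<in> carrier (U c) \<Longrightarrow> a \<in> carrier A \<Longrightarrow> t (a \<otimes>\<^bsub>A\<^esub> b x) = \<phi> (a \<odot>\<^bsub>U c\<^esub> x)"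
      by metis
    have badd: "b (x \<oplus>\<^bsub>U c\<^esub> y) = b x \<oplus>\<^bsub>A\<^esub> b y" if x: "x \<in> carrier (U c)" and y: "y \<in> carrier (U c)" for x y
    proof (rule t_inj[OF b R.a_closed[OF b[OF x] b[OF y]]])
      show "x \<oplus>\<^bsub>U c\<^esub> y \<in> carrier (U c)" using x y by simp
      fix a assume a: "a \<in> carrier A"
      show "t (a \<otimes>\<^bsub>A\<^esub> b (x \<oplus>\<^bsub>U c\<^esub> y)) = t (a \<otimes>\<^bsub>A\<^esub> (b x \<oplus>\<^bsub>A\<^esub> b y))"
        using x y a b bt \<phi> t by (simp add: R.r_distr Uc.smult_r_distr Uc.smult_closed functional_def)
    qed
    have bmul: "b (r \<odot>\<^bsub>U c\<^esub> x) = r \<otimes>\<^bsub>A\<^esub> b x" if r: "r \<in> carrier A" and x: "x \<in> carrier (U c)" for r x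
    proof (rule t_inj[OF b[OF Uc.smult_closed[OF r x]] R.m_closed[OF r b[OF x]]])
      fix a assume a: "a \<in> carrier A"
      have "t (a \<otimes>\<^bsub>A\<^esub> b (r \<odot>\<^bsub>U c\<^esub> x)) = t ((a \<otimes>\<^bsub>A\<^esub> r) \<otimes>\<^bsub>A\<^esub> b x)"
        using bt[OF Uc.smult_closed[OF r x] a] bt[OF x R.m_closed[OF a r]] Uc.smult_assoc[OF a r x] by simp
      then show "t (a \<otimes>\<^bsub>A\<^esub> b (r \<odot>\<^bsub>U c\<^esub> x)) = t (a \<otimes>\<^bsub>A\<^esub> (r \<otimes>\<^bsub>A\<^esub> b x))"
        using R.m_assoc[OF a r b[OF x]] by simp
    qed
    have "(\<lambda>x. b x \<odot>\<^bsub>U P\<^esub> e) \<in> LinearCombinations.module_hom A (U c) (U P)"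
      unfolding module_hom_iff
      using b badd bmul UP.smult_closed free_el UP.smult_l_distr UP.smult_assoc by simp
    then obtain g where g: "g \<in> hom c P" "\<forall>x \<in> carrier (U c). act g x = b x \<odot>\<^bsub>U P\<^esub> e"
      using act_full[OF c free_obj] by blast
    have "\<epsilon> (act g x) = \<phi> x" if x: "x \<in> carrier (U c)" for x
      using g(2) x \<epsilon>[OF b[OF x]] bt[OF x R.one_closed] b[OF x] Uc.smult_one[OF x] by simp
    then show ?thesis
      using g(1) by blast
  qed
  moreover have "x = \<zero>\<^bsub>U P\<^esub>" if x: "x \<in> carrier (U P)" and z: "\<forall>a \<in> carrier A. \<epsilon> (a \<odot>\<^bsub>U P\<^esub> x) = 0" for x
  proof -
    obtain b where b: "b \<in> carrier A" "b \<odot>\<^bsub>U P\<^esub> e = x"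
      using free_coeff[OF x] by blast
    have "t (b \<otimes>\<^bsub>A\<^esub> a) = 0" if a: "a \<in> carrier A" for a
      using bspec[OF z a] unfolding b(2)[symmetric] \<epsilon>b[OF a b(1)] sym[OF b(1) a] .
    then have "b = \<zero>\<^bsub>A\<^esub>"
      using nd b(1) by blast
    moreover have "\<zero>\<^bsub>A\<^esub> \<odot>\<^bsub>U P\<^esub> e = \<zero>\<^bsub>U P\<^esub>"
    proof -
      have "\<zero>\<^bsub>A\<^esub> = 0 \<odot>\<^bsub>A\<^esub> \<one>\<^bsub>A\<^esub>" by simp
      then show ?thesis
        using kspace.zero_smult[OF U_kspace[OF free_obj], of e] free_el by simp
    qed
    ultimately show ?thesis
      using b(2) by simp
  qed
  ultimately have cf: "cofree_at P \<epsilon>"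
    unfolding cofree_at_def using free_obj \<epsilon>f by blast
  have comp: "\<epsilon> (act (f \<cdot> g) e) = t (b \<otimes>\<^bsub>A\<^esub> a)"
    if f: "f \<in> hom P P" and g: "g \<in> hom P P" and a: "a \<in> carrier A" "a \<odot>\<^bsub>U P\<^esub> e = act f e"
      and b: "b \<in> carrier A" "b \<odot>\<^bsub>U P\<^esub> e = act g e" for f g a b
    using act_comp[OF g f free_el] act_smult[OF f b(1) free_el] \<epsilon>b[OF b(1) a(1)] a(2) b(2)[symmetric] by simp
  have "\<epsilon> (act (f \<cdot> g) e) = \<epsilon> (act (g \<cdot> f) e)" if f: "f \<in> hom P P" and g: "g \<in> hom P P" for f g
  proof -
    obtain a where a: "a \<in> carrier A" "a \<odot>\<^bsub>U P\<^esub> e = act f e"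
      using free_coeff[OF act_in[OF f free_el]] by blast
    obtain b where b: "b \<in> carrier A" "b \<odot>\<^bsub>U P\<^esub> e = act g e"
      using free_coeff[OF act_in[OF g free_el]] by blast
    show ?thesis
      using comp[OF f g a b] comp[OF g f b a] sym[OF a(1) b(1)] by simp
  qed
  then show ?thesis
    using cf by blast
qed

end

text \<open>The n-th power of U d, with n the dimension of V, is the module of some object P by
  essential surjectivity. Fullness lifts its projections and injections to arrows p and i, and the
  biproduct equations extend every linear map from V to Hom(d, x) uniquely along \<iota>, where
  \<iota> w has the coordinates of w as coefficients of the i j.\<close>

lemma vect_tensor_exists:
  fixes V :: "('k, 'v) module"
  assumes V: "kspace V" and db: "dual_basis V n v \<phi>" and d: "d \<in> Obj C"
  shows "\<exists>P \<iota>. is_vect_tensor C V d P \<iota>"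
proof -
  interpret V: kspace V by (rule V)
  let ?M = "power_module (U d) n"
  interpret Ud: left_module A "U d" by (rule U_module[OF d])
  obtain \<Xi> where \<Xi>: "finite \<Xi>" "separating (underlying_space A (U d)) \<Xi>"
    using U_sep[OF d] by blast
  obtain P \<theta> \<theta>' where P: "P \<in> Obj C" and \<theta>: "\<theta> \<in> LinearCombinations.module_hom A ?M (U P)"
    "\<theta>' \<in> LinearCombinations.module_hom A (U P) ?M"
    "\<forall>x \<in> carrier ?M. \<theta>' (\<theta> x) = x" "\<forall>y \<in> carrier (U P). \<theta> (\<theta>' y) = y"
    using U_surj_sep[OF power_module[OF alg U_module[OF d] \<Xi>, of n]] by blast
  have \<theta>'c: "\<theta>' y \<in> carrier ?M" if "y \<in> carrier (U P)" for y
    using \<theta>(2) that by (simp add: module_hom_iff)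
  have "\<exists>p \<in> hom P d. \<forall>y \<in> carrier (U P). act p y = \<theta>' y j" if j: "j < n" for j
  proof (rule act_full[OF P d])
    have "(\<lambda>x. x j) \<in> LinearCombinations.module_hom A ?M (U d)"
      using j by (simp add: module_hom_iff power_module_def)
    then show "(\<lambda>y. \<theta>' y j) \<in> LinearCombinations.module_hom A (U P) (U d)"
      using \<theta>(2) by (simp add: module_hom_iff)
  qed
  then obtain p where p: "\<And>j. j < n \<Longrightarrow> p j \<in> hom P d"
    and pa: "\<And>j y. j < n \<Longrightarrow> y \<in> carrier (U P) \<Longrightarrow> act (p j) y = \<theta>' y j"
    by metis
  have z: "a \<odot>\<^bsub>U d\<^esub> \<zero>\<^bsub>U d\<^esub> = \<zero>\<^bsub>U d\<^esub>" if a: "a \<in> carrier A" for a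
  proof -
    have "a \<odot>\<^bsub>U d\<^esub> \<zero>\<^bsub>U d\<^esub> \<oplus>\<^bsub>U d\<^esub> a \<odot>\<^bsub>U d\<^esub> \<zero>\<^bsub>U d\<^esub> = \<zero>\<^bsub>U d\<^esub> \<oplus>\<^bsub>U d\<^esub> a \<odot>\<^bsub>U d\<^esub> \<zero>\<^bsub>U d\<^esub>"
      using Ud.smult_r_distr[OF a Ud.M.zero_closed Ud.M.zero_closed] Ud.smult_closed[OF a Ud.M.zero_closed] by simp
    then show ?thesis
      using Ud.M.add.right_cancel[OF Ud.smult_closed[OF a Ud.M.zero_closed] Ud.smult_closed[OF a Ud.M.zero_closed]
          Ud.M.zero_closed] by blast
  qed
  define inc where "inc j x = (\<lambda>k. if k < n then if k = j then x else \<zero>\<^bsub>U d\<^esub> else undefined)" for j x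
  have "\<exists>i \<in> hom d P. \<forall>x \<in> carrier (U d). act i x = \<theta> (inc j x)" if j: "j < n" for j
  proof (rule act_full[OF d P])
    have "inc j \<in> LinearCombinations.module_hom A (U d) ?M"
      using j z by (simp add: inc_def module_hom_iff power_module_def fun_eq_iff)
    then show "(\<lambda>x. \<theta> (inc j x)) \<in> LinearCombinations.module_hom A (U d) (U P)"
      using \<theta>(1) by (simp add: module_hom_iff)
  qed
  then obtain i where i: "\<And>j. j < n \<Longrightarrow> i j \<in> hom d P"
    and ia: "\<And>j x. j < n \<Longrightarrow> x \<in> carrier (U d) \<Longrightarrow> act (i j) x = \<theta> (inc j x)"
    by metis
  have pi_act: "act (p k \<cdot> i j) x = (if k = j then x else \<zero>\<^bsub>U d\<^esub>)"
    if jk: "j < n" "k < n" and x: "x \<in> carrier (U d)" for j k x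
  proof -
    have "inc j x \<in> carrier ?M"
      using x by (simp add: inc_def power_module_def)
    then have "\<theta>' (\<theta> (inc j x)) = inc j x"
      using \<theta>(3) by blast
    then have "act (p k \<cdot> i j) x = inc j x k"
      using act_comp[OF i[OF jk(1)] p[OF jk(2)] x] pa[OF jk(2) act_in[OF i[OF jk(1)] x]] ia[OF jk(1) x] by simp
    then show ?thesis
      using jk by (simp add: inc_def)
  qed
  have pi1: "p j \<cdot> i j = Id C d" if j: "j < n" for j
    by (rule act_inj[OF comp_in_hom[OF i[OF j] p[OF j]] id_in_hom[OF d]]) (simp add: pi_act[OF j j] act_id[OF d])
  have pi0: "p k \<cdot> i j = ZeroArr C d d" if "j < n" "k < n" "k \<noteq> j" for j k
    by (rule act_inj[OF comp_in_hom[OF i[OF that(1)] p[OF that(2)]] zero_in[OF d d]])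
      (simp add: pi_act[OF that(1,2)] act_zero[OF d d] that(3))
  \<comment> \<open>Arrows into P are tested by the projections, because \<theta>' is injective on U
    P.\<close>
  have mono: "f = g" if f: "f \<in> hom x P" "g \<in> hom x P" and eq: "\<And>k. k < n \<Longrightarrow> p k \<cdot> f = p k \<cdot> g" for f g x
  proof (rule act_inj[OF f])
    fix y assume y: "y \<in> carrier (U x)"
    note fy = act_in[OF f(1) y] and gy = act_in[OF f(2) y]
    have "\<theta>' (act f y) k = \<theta>' (act g y) k" if "k < n" for k
      using pa[OF that fy] pa[OF that gy] act_comp[OF f(1) p[OF that] y] act_comp[OF f(2) p[OF that] y] eq[OF that]
      by simp
    then have "\<theta>' (act f y) = \<theta>' (act g y)"
      using \<theta>'c[OF fy] \<theta>'c[OF gy] by (simp add: power_module_def fun_eq_iff) (metis not_le)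
    then show "act f y = act g y"
      using \<theta>(4) fy gy by metis
  qed
  have id_sum: "hsum P P (\<lambda>j. i j \<cdot> p j) n = Id C P"
  proof (rule mono[OF hsum_in[OF P P] id_in_hom[OF P]])
    show ip: "i j \<cdot> p j \<in> hom P P" if "j < n" for j
      by (rule comp_in_hom[OF p[OF that] i[OF that]])
    fix k assume k: "k < n"
    have t: "p k \<cdot> (i j \<cdot> p j) = (p k \<cdot> i j) \<cdot> p j" if "j < n" for j
      by (rule comp_assoc[OF p[OF that] i[OF that] p[OF k], symmetric])
    have "p k \<cdot> hsum P P (\<lambda>j. i j \<cdot> p j) n = hsum P d (\<lambda>j. p k \<cdot> (i j \<cdot> p j)) n"
      by (rule comp_hsum[OF p[OF k] P ip])
    also have "\<dots> = p k \<cdot> (i k \<cdot> p k)"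
    proof (rule hsum_delta[OF P d k])
      show "p k \<cdot> (i j \<cdot> p j) \<in> hom P d" if "j < n" for j
        by (rule comp_in_hom[OF ip[OF that] p[OF k]])
      show "p k \<cdot> (i j \<cdot> p j) = ZeroArr C P d" if "j < n" "j \<noteq> k" for j
        unfolding t[OF that(1)] pi0[OF that(1) k that(2)[symmetric]] by (rule comp_zero_left[OF p[OF that(1)] d])
    qed
    also have "\<dots> = p k"
      unfolding t[OF k] pi1[OF k] by (rule comp_id_left[OF p[OF k]])
    finally show "p k \<cdot> hsum P P (\<lambda>j. i j \<cdot> p j) n = p k \<cdot> Id C P"
      unfolding comp_id_right[OF p[OF k]] .
  qed
  define \<iota> where "\<iota> w = hsum d P (\<lambda>j. \<phi> j w \<star> i j) n" for w
  have \<phi>: "functional V (\<phi> j)" and v: "v j \<in> carrier V" if "j < n" for j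
    using db that by (simp_all add: dual_basis_def)
  have \<iota>: "\<iota> w \<in> hom d P" for w
    unfolding \<iota>_def by (rule hsum_in[OF d P scale_in[OF i]])
  interpret D: kspace "hom_space C d d" by (rule hom_kspace[OF d d])
  have p\<iota>: "p k \<cdot> \<iota> w = \<phi> k w \<star> Id C d" if k: "k < n" for k w
  proof -
    have t: "p k \<cdot> (\<phi> j w \<star> i j) = \<phi> j w \<star> (p k \<cdot> i j)" if "j < n" for j
      by (rule comp_scale_right[OF i[OF that] p[OF k]])
    have "p k \<cdot> \<iota> w = hsum d d (\<lambda>j. p k \<cdot> (\<phi> j w \<star> i j)) n"
      unfolding \<iota>_def by (rule comp_hsum[OF p[OF k] d scale_in[OF i]])
    also have "\<dots> = p k \<cdot> (\<phi> k w \<star> i k)"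
    proof (rule hsum_delta[OF d d k])
      show "p k \<cdot> (\<phi> j w \<star> i j) \<in> hom d d" if "j < n" for j
        by (rule comp_in_hom[OF scale_in[OF i[OF that]] p[OF k]])
      show "p k \<cdot> (\<phi> j w \<star> i j) = ZeroArr C d d" if "j < n" "j \<noteq> k" for j
        unfolding t[OF that(1)] pi0[OF that(1) k that(2)[symmetric]] using D.smult_zero by simp
    qed
    finally show ?thesis
      unfolding t[OF k] pi1[OF k] .
  qed
  have "linear_map (class_ring :: 'k ring) V (hom_space C d P) \<iota>"
    unfolding linear_map_iff
  proof (intro conjI ballI allI)
    show "vectorspace (class_ring :: 'k ring) V" "vectorspace (class_ring :: 'k ring) (hom_space C d P)"
      using V.vectorspace_axioms hom_vectorspace[OF d P] by simp_all
    show "\<iota> w \<in> carrier (hom_space C d P)" for w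
      using \<iota> by simp
    fix w w' assume w: "w \<in> carrier V" "w' \<in> carrier V"
    show "\<iota> (w \<oplus>\<^bsub>V\<^esub> w') = \<iota> w \<oplus>\<^bsub>hom_space C d P\<^esub> \<iota> w'"
      unfolding hom_space_simps
    proof (rule mono[OF \<iota> add_in[OF \<iota> \<iota>]])
      fix k assume k: "k < n"
      show "p k \<cdot> \<iota> (w \<oplus>\<^bsub>V\<^esub> w') = p k \<cdot> (\<iota> w \<boxplus> \<iota> w')"
        using comp_add_right[OF \<iota> \<iota> p[OF k]] p\<iota>[OF k] functional_add[OF \<phi>[OF k] w]
          D.add_smult[of "Id C d"] id_in_hom[OF d] by simp
    qed
  next
    fix r w assume w: "w \<in> carrier V"
    show "\<iota> (r \<odot>\<^bsub>V\<^esub> w) = r \<odot>\<^bsub>hom_space C d P\<^esub> \<iota> w"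
      unfolding hom_space_simps
    proof (rule mono[OF \<iota> scale_in[OF \<iota>]])
      fix k assume k: "k < n"
      show "p k \<cdot> \<iota> (r \<odot>\<^bsub>V\<^esub> w) = p k \<cdot> (r \<star> \<iota> w)"
        using comp_scale_right[OF \<iota> p[OF k]] p\<iota>[OF k] functional_smult[OF \<phi>[OF k] w]
          D.smult_smult[of "Id C d"] id_in_hom[OF d] by simp
    qed
  qed
  moreover have "\<exists>!h. h \<in> hom P x \<and> (\<forall>w \<in> carrier V. h \<cdot> \<iota> w = g w)"
    if x: "x \<in> Obj C" and "linear_map (class_ring :: 'k ring) V (hom_space C d x) g" for x g
  proof (rule ex1I)
    have g: "\<And>w. w \<in> carrier V \<Longrightarrow> g w \<in> hom d x"
      and gadd: "\<And>w w'. w \<in> carrier V \<Longrightarrow> w' \<in> carrier V \<Longrightarrow> g (w \<oplus>\<^bsub>V\<^esub> w') = g w \<boxplus> g w'"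
      and gscale: "\<And>r w. w \<in> carrier V \<Longrightarrow> g (r \<odot>\<^bsub>V\<^esub> w) = r \<star> g w"
      using that(2) by (simp_all add: linear_map_iff)
    have gz: "g \<zero>\<^bsub>V\<^esub> = ZeroArr C d x"
      using gscale[of "\<zero>\<^bsub>V\<^esub>" 0] scale_zero[OF g, of "\<zero>\<^bsub>V\<^esub>"] by simp
    have gsum: "g (vsum V f m) = hsum d x (\<lambda>j. g (f j)) m" if "\<And>j. j < m \<Longrightarrow> f j \<in> carrier V" for f and m
      using that by (induction m) (simp_all add: gz gadd)
    let ?h = "hsum P x (\<lambda>j. g (v j) \<cdot> p j) n"
    have gp: "g (v j) \<cdot> p j \<in> hom P x" if "j < n" for j
      by (rule comp_in_hom[OF p[OF that] g[OF v[OF that]]])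
    have "?h \<cdot> \<iota> w = g w" if w: "w \<in> carrier V" for w
    proof -
      have "?h \<cdot> \<iota> w = hsum d x (\<lambda>j. (g (v j) \<cdot> p j) \<cdot> \<iota> w) n"
        by (rule hsum_comp[OF \<iota> x gp])
      also have "\<dots> = hsum d x (\<lambda>j. g (\<phi> j w \<odot>\<^bsub>V\<^esub> v j)) n"
      proof (rule hsum_cong)
        fix j assume j: "j < n"
        have "(g (v j) \<cdot> p j) \<cdot> \<iota> w = g (v j) \<cdot> (\<phi> j w \<star> Id C d)"
          unfolding comp_assoc[OF \<iota> p[OF j] g[OF v[OF j]]] p\<iota>[OF j] ..
        also have "\<dots> = g (\<phi> j w \<odot>\<^bsub>V\<^esub> v j)"
          using comp_scale_right[OF id_in_hom[OF d] g[OF v[OF j]]] comp_id_right[OF g[OF v[OF j]]] gscale[OF v[OF j]]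
          by simp
        finally show "(g (v j) \<cdot> p j) \<cdot> \<iota> w = g (\<phi> j w \<odot>\<^bsub>V\<^esub> v j)" .
      qed
      also have "\<dots> = g (vsum V (\<lambda>j. \<phi> j w \<odot>\<^bsub>V\<^esub> v j) n)"
        by (rule gsum[symmetric]) (simp add: v)
      also have "\<dots> = g w"
        using db w by (simp add: dual_basis_def)
      finally show ?thesis .
    qed
    then show "?h \<in> hom P x \<and> (\<forall>w \<in> carrier V. ?h \<cdot> \<iota> w = g w)"
      by (intro conjI ballI hsum_in[OF P x gp])
    fix h assume h: "h \<in> hom P x \<and> (\<forall>w \<in> carrier V. h \<cdot> \<iota> w = g w)"
    then have h1: "h \<in> hom P x" by blast
    have hi: "h \<cdot> i j = g (v j)" if j: "j < n" for j
    proof -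
      \<comment> \<open>At a basis vector \<iota> is an injection of the biproduct, so the
        composites of h with the injections, and with them h, are forced.\<close>
      have "\<iota> (v j) = i j"
      proof (rule mono[OF \<iota> i[OF j]])
        fix k assume k: "k < n"
        have "\<phi> k (v j) = (if k = j then 1 else 0)"
          using db j k by (simp add: dual_basis_def)
        then show "p k \<cdot> \<iota> (v j) = p k \<cdot> i j"
          using p\<iota>[OF k, of "v j"] pi1[OF j] pi0[OF j k] scale_one[OF id_in_hom[OF d]]
            scale_zero[OF id_in_hom[OF d]] by (cases "k = j") simp_all
      qed
      moreover have "h \<cdot> \<iota> (v j) = g (v j)"
        using h v[OF j] by blast
      ultimately show ?thesis
        by (simp only:)
    qed
    have "h = h \<cdot> hsum P P (\<lambda>j. i j \<cdot> p j) n"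
      unfolding id_sum comp_id_right[OF h1] ..
    also have "\<dots> = hsum P x (\<lambda>j. h \<cdot> (i j \<cdot> p j)) n"
      by (rule comp_hsum[OF h1 P comp_in_hom[OF p i]])
    also have "\<dots> = ?h"
    proof (rule hsum_cong)
      fix j assume j: "j < n"
      show "h \<cdot> (i j \<cdot> p j) = g (v j) \<cdot> p j"
        unfolding comp_assoc[OF p[OF j] i[OF j] h1, symmetric] hi[OF j] ..
    qed
    finally show "h = ?h" .
  qed
  ultimately have "is_vect_tensor C V d P \<iota>"
    unfolding is_vect_tensor_def using P by blast
  then show ?thesis by blast
qed

end

section \<open>Symmetric Frobenius multitensor categories\<close>

context linear_category
begin

lemma natfam_postcomp:
  assumes a: "natfam y X \<alpha>" and w: "w \<in> hom y x"
  shows "natfam x X (\<lambda>c \<phi>. \<alpha> c (\<lambda>g. \<phi> (w \<cdot> g)))"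
proof (rule natfamI)
  show "x \<in> Obj C" "X \<in> Obj C"
    by (rule hom_obj(2)[OF w], rule natfam_obj(2)[OF a])
  note F = Fn_postcomp[OF _ w]
  show "\<alpha> c (\<lambda>g. \<phi> (w \<cdot> g)) \<in> hom X c" if "c \<in> Obj C" "\<phi> \<in> Fn c x" for c \<phi>
    by (rule natfam_in[OF a that(1) F[OF that(2)]])
  show "\<alpha> c (\<lambda>g. \<phi> (w \<cdot> g) + \<psi> (w \<cdot> g)) = \<alpha> c (\<lambda>g. \<phi> (w \<cdot> g)) \<boxplus> \<alpha> c (\<lambda>g. \<psi> (w \<cdot> g))"
    if "c \<in> Obj C" "\<phi> \<in> Fn c x" "\<psi> \<in> Fn c x" for c \<phi> \<psi>
    by (rule natfam_add[OF a that(1) F[OF that(2)] F[OF that(3)]])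
  show "\<alpha> c (\<lambda>g. \<phi> (w \<cdot> g)) = \<alpha> c (\<lambda>g. \<psi> (w \<cdot> g))"
    if "c \<in> Obj C" "\<phi> \<in> Fn c x" "\<psi> \<in> Fn c x" "\<And>f. f \<in> hom c x \<Longrightarrow> \<phi> f = \<psi> f" for c \<phi> \<psi>
    by (rule natfam_cong[OF a that(1) F[OF that(2)] F[OF that(3)]]) (rule that(4)[OF comp_in_hom[OF _ w]])
  show "u \<cdot> \<alpha> c (\<lambda>g. \<phi> (w \<cdot> g)) = \<alpha> d (\<lambda>g. \<phi> ((w \<cdot> g) \<cdot> u))" if u: "u \<in> hom c d" and \<phi>: "\<phi> \<in> Fn c x" for c d u \<phi>
    unfolding natfam_nat[OF a u F[OF \<phi>]]
    by (rule natfam_cong[OF a hom_obj(2)[OF u] Fn_precomp[OF F[OF \<phi>] u] F[OF Fn_precomp[OF \<phi> u]]])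
      (simp only: comp_assoc[OF u _ w])
qed

lemma iso_inverse:
  assumes "f \<in> hom a b" "iso_arr C f"
  obtains g where "g \<in> hom b a" "g \<cdot> f = Id C a" "f \<cdot> g = Id C b"
  using inv_arr[OF assms(2)] assms(1) by (metis hom_iff)

lemma isoI:
  assumes "f \<in> hom a b" "g \<in> hom b a" "g \<cdot> f = Id C a" "f \<cdot> g = Id C b"
  shows "iso_arr C f"
  unfolding iso_arr_def inverse_arrows_def using assms by (auto simp: hom_iff)

text \<open>Besides the isomorphism its compatibility with the two families is kept, since
  naturality of the isomorphism to the double dual is deduced from it.\<close>

lemma univ_iso:
  assumes U: "univ x N \<Phi>" and U': "univ x N' \<Phi>'"
  shows "\<exists>h \<in> hom N N'. iso_arr C h \<and> (\<forall>c \<in> Obj C. \<forall>\<phi> \<in> Fn c x. \<Phi>' c \<phi> \<cdot> h = \<Phi> c \<phi>)"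
proof -
  note n = univ_natfam[OF U] and n' = univ_natfam[OF U']
  obtain h where h: "h \<in> hom N N'" "\<And>c \<phi>. c \<in> Obj C \<Longrightarrow> \<phi> \<in> Fn c x \<Longrightarrow> \<Phi>' c \<phi> \<cdot> h = \<Phi> c \<phi>"
    using univ_ex[OF U' n] by blast
  obtain k where k: "k \<in> hom N' N" "\<And>c \<phi>. c \<in> Obj C \<Longrightarrow> \<phi> \<in> Fn c x \<Longrightarrow> \<Phi> c \<phi> \<cdot> k = \<Phi>' c \<phi>"
    using univ_ex[OF U n'] by blast
  have "k \<cdot> h = Id C N"
  proof (rule univ_unique[OF U comp_in_hom[OF h(1) k(1)] id_in_hom[OF natfam_obj(2)[OF n]]])
    fix c \<phi> assume c: "c \<in> Obj C" "\<phi> \<in> Fn c x"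
    note p = natfam_in[OF n c]
    show "\<Phi> c \<phi> \<cdot> (k \<cdot> h) = \<Phi> c \<phi> \<cdot> Id C N"
      unfolding comp_assoc[OF h(1) k(1) p, symmetric] k(2)[OF c] h(2)[OF c] comp_id_right[OF p] ..
  qed
  moreover have "h \<cdot> k = Id C N'"
  proof (rule univ_unique[OF U' comp_in_hom[OF k(1) h(1)] id_in_hom[OF natfam_obj(2)[OF n']]])
    fix c \<phi> assume c: "c \<in> Obj C" "\<phi> \<in> Fn c x"
    note p = natfam_in[OF n' c]
    show "\<Phi>' c \<phi> \<cdot> (h \<cdot> k) = \<Phi>' c \<phi> \<cdot> Id C N'"
      unfolding comp_assoc[OF k(1) h(1) p, symmetric] h(2)[OF c] k(2)[OF c] comp_id_right[OF p] ..
  qed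
  ultimately have "iso_arr C h"
    by (rule isoI[OF h(1) k(1)])
  then show ?thesis
    using h by blast
qed

text \<open>Serves to move the universal family from the distinguished object to the unit when the
  two are isomorphic.\<close>

lemma univ_transport:
  assumes U: "univ x N \<Phi>" and j: "j \<in> hom N' N" "iso_arr C j"
  shows "univ x N' (\<lambda>c \<phi>. \<Phi> c \<phi> \<cdot> j)"
  unfolding univ_def
proof (intro conjI allI impI)
  note n = univ_natfam[OF U]
  obtain j' where j': "j' \<in> hom N N'" "j' \<cdot> j = Id C N'" "j \<cdot> j' = Id C N"
    by (rule iso_inverse[OF j])
  show "natfam x N' (\<lambda>c \<phi>. \<Phi> c \<phi> \<cdot> j)"
    by (rule natfam_comp[OF n j(1)])
  fix X \<alpha> assume "natfam x X \<alpha>"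
  then obtain h where h: "h \<in> hom X N" "\<And>c \<phi>. c \<in> Obj C \<Longrightarrow> \<phi> \<in> Fn c x \<Longrightarrow> \<Phi> c \<phi> \<cdot> h = \<alpha> c \<phi>"
    using univ_ex[OF U] by blast
  have s: "(\<Phi> c \<phi> \<cdot> j) \<cdot> g = \<Phi> c \<phi> \<cdot> (j \<cdot> g)" if "c \<in> Obj C" "\<phi> \<in> Fn c x" "g \<in> hom X N'" for c \<phi> g
    by (rule comp_assoc[OF that(3) j(1) natfam_in[OF n that(1,2)]])
  have jh: "j \<cdot> (j' \<cdot> h) = h"
    unfolding comp_assoc[OF h(1) j'(1) j(1), symmetric] j'(3) by (rule comp_id_left[OF h(1)])
  show "\<exists>!g. g \<in> hom X N' \<and> (\<forall>c \<in> Obj C. \<forall>\<phi> \<in> Fn c x. (\<Phi> c \<phi> \<cdot> j) \<cdot> g = \<alpha> c \<phi>)"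
  proof (rule ex1I[of _ "j' \<cdot> h"])
    note jh' = comp_in_hom[OF h(1) j'(1)]
    show "j' \<cdot> h \<in> hom X N' \<and> (\<forall>c \<in> Obj C. \<forall>\<phi> \<in> Fn c x. (\<Phi> c \<phi> \<cdot> j) \<cdot> (j' \<cdot> h) = \<alpha> c \<phi>)"
      using jh' s[OF _ _ jh'] jh h(2) by simp
    fix g assume g: "g \<in> hom X N' \<and> (\<forall>c \<in> Obj C. \<forall>\<phi> \<in> Fn c x. (\<Phi> c \<phi> \<cdot> j) \<cdot> g = \<alpha> c \<phi>)"
    then have g1: "g \<in> hom X N'" by blast
    have "j \<cdot> g = h"
    proof (rule univ_unique[OF U comp_in_hom[OF g1 j(1)] h(1)])
      fix c \<phi> assume c: "c \<in> Obj C" "\<phi> \<in> Fn c x"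
      show "\<Phi> c \<phi> \<cdot> (j \<cdot> g) = \<Phi> c \<phi> \<cdot> h"
        unfolding s[OF c g1, symmetric] h(2)[OF c] using g c by blast
    qed
    then have "j' \<cdot> (j \<cdot> g) = j' \<cdot> h"
      by simp
    then show "g = j' \<cdot> h"
      unfolding comp_assoc[OF g1 j(1) j'(1), symmetric] j'(2) comp_id_left[OF g1] .
  qed
qed

text \<open>Serves to turn the universal family for a double dual into one for the object itself.
  The inverse of e translates natural families for x into families for y, to which universality
  applies.\<close>

lemma univ_transport_left:
  assumes U: "univ y N \<Psi>" and e: "e \<in> hom y x" "iso_arr C e"
  shows "univ x N (\<lambda>c \<phi>. \<Psi> c (\<lambda>g. \<phi> (e \<cdot> g)))"
  unfolding univ_def
proof (intro conjI allI impI)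
  note n = univ_natfam[OF U]
  obtain e' where e': "e' \<in> hom x y" "e' \<cdot> e = Id C y" "e \<cdot> e' = Id C x"
    by (rule iso_inverse[OF e])
  show "natfam x N (\<lambda>c \<phi>. \<Psi> c (\<lambda>g. \<phi> (e \<cdot> g)))"
    by (rule natfam_postcomp[OF n e(1)])
  fix X \<alpha> assume a: "natfam x X \<alpha>"
  have ee: "e \<cdot> (e' \<cdot> g) = g" if "g \<in> hom c x" for c g
    unfolding comp_assoc[OF that e'(1) e(1), symmetric] e'(3) by (rule comp_id_left[OF that])
  have ee': "e' \<cdot> (e \<cdot> g) = g" if "g \<in> hom c y" for c g
    unfolding comp_assoc[OF that e(1) e'(1), symmetric] e'(2) by (rule comp_id_left[OF that])
  obtain h where h: "h \<in> hom X N"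
    and h\<alpha>: "\<And>c \<psi>. c \<in> Obj C \<Longrightarrow> \<psi> \<in> Fn c y \<Longrightarrow> \<Psi> c \<psi> \<cdot> h = \<alpha> c (\<lambda>g. \<psi> (e' \<cdot> g))"
    using univ_ex[OF U natfam_postcomp[OF a e'(1)]] by blast
  show "\<exists>!h. h \<in> hom X N \<and> (\<forall>c \<in> Obj C. \<forall>\<phi> \<in> Fn c x. \<Psi> c (\<lambda>g. \<phi> (e \<cdot> g)) \<cdot> h = \<alpha> c \<phi>)"
  proof (rule ex1I[of _ h], intro conjI ballI h)
    fix c \<phi> assume c: "c \<in> Obj C" and \<phi>: "\<phi> \<in> Fn c x"
    note f = Fn_postcomp[OF \<phi> e(1)]
    show "\<Psi> c (\<lambda>g. \<phi> (e \<cdot> g)) \<cdot> h = \<alpha> c \<phi>"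
      unfolding h\<alpha>[OF c f]
      by (rule natfam_cong[OF a c Fn_postcomp[OF f e'(1)] \<phi>]) (simp only: ee)
  next
    fix h' assume h': "h' \<in> hom X N \<and> (\<forall>c \<in> Obj C. \<forall>\<phi> \<in> Fn c x. \<Psi> c (\<lambda>g. \<phi> (e \<cdot> g)) \<cdot> h' = \<alpha> c \<phi>)"
    show "h' = h"
    proof (rule univ_unique[OF U _ h])
      show "h' \<in> hom X N" using h' by blast
      fix c \<psi> assume c: "c \<in> Obj C" and \<psi>: "\<psi> \<in> Fn c y"
      note f = Fn_postcomp[OF \<psi> e'(1)]
      have "\<Psi> c \<psi> = \<Psi> c (\<lambda>g. \<psi> (e' \<cdot> (e \<cdot> g)))"
        by (rule natfam_cong[OF n c \<psi> Fn_postcomp[OF f e(1)]]) (simp only: ee')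
      moreover have "\<Psi> c (\<lambda>g. \<psi> (e' \<cdot> (e \<cdot> g))) \<cdot> h' = \<alpha> c (\<lambda>g. \<psi> (e' \<cdot> g))"
        by (rule bspec[OF bspec[OF conjunct2[OF h'] c] f])
      ultimately show "\<Psi> c \<psi> \<cdot> h' = \<Psi> c \<psi> \<cdot> h"
        unfolding h\<alpha>[OF c \<psi>] by (simp only:)
    qed
  qed
qed

end

section \<open>Equivalences with module categories\<close>

lemma natural_iso_id:
  assumes "naturally_isomorphic C C (comp_functor G F) id_functor"
  shows "\<exists>\<eta>. \<forall>a \<in> Obj C. \<eta> a \<in> Hom C (FObj G (FObj F a)) a \<and> iso_arr C (\<eta> a) \<and>
    (\<forall>b \<in> Obj C. \<forall>f \<in> Hom C a b. f \<cdot>\<^bsub>C\<^esub> \<eta> a = \<eta> b \<cdot>\<^bsub>C\<^esub> FArr G (FArr F f))"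
proof -
  obtain \<eta> where "(\<forall>a \<in> Obj C. \<eta> a \<in> Hom C (FObj G (FObj F a)) a \<and> iso_arr C (\<eta> a)) \<and>
    (\<forall>a \<in> Obj C. \<forall>b \<in> Obj C. \<forall>f \<in> Hom C a b. f \<cdot>\<^bsub>C\<^esub> \<eta> a = \<eta> b \<cdot>\<^bsub>C\<^esub> FArr G (FArr F f))"
    using assms unfolding naturally_isomorphic_def comp_functor_def id_functor_def by auto
  then show ?thesis
    by (intro exI[of _ \<eta>]) simp
qed

lemma linear_functor_in_hom:
  assumes "linear_functor C D F" "f \<in> Hom C a b"
  shows "FArr F f \<in> Hom D (FObj F a) (FObj F b)"
proof -
  interpret linear_functor C D F by (rule assms(1))
  show ?thesis
    using linear_on_homs[OF C.hom_obj[OF assms(2)]] assms(2) by (simp add: linear_map_iff)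
qed

lemma equivalence_faithful:
  assumes F: "linear_functor C D F" and n: "naturally_isomorphic C C (comp_functor G F) id_functor"
    and f: "f \<in> Hom C a b" "f' \<in> Hom C a b" and eq: "FArr F f = FArr F f'"
  shows "f = f'"
proof -
  interpret linear_functor C D F by (rule F)
  obtain \<eta> where *: "\<forall>a \<in> Obj C. \<eta> a \<in> Hom C (FObj G (FObj F a)) a \<and> iso_arr C (\<eta> a) \<and>
    (\<forall>b \<in> Obj C. \<forall>f \<in> Hom C a b. f \<cdot>\<^bsub>C\<^esub> \<eta> a = \<eta> b \<cdot>\<^bsub>C\<^esub> FArr G (FArr F f))"
    using natural_iso_id[OF n] by blast
  have \<eta>: "\<eta> a \<in> Hom C (FObj G (FObj F a)) a" "iso_arr C (\<eta> a)"
    "b \<in> Obj C \<Longrightarrow> f \<in> Hom C a b \<Longrightarrow> f \<cdot>\<^bsub>C\<^esub> \<eta> a = \<eta> b \<cdot>\<^bsub>C\<^esub> FArr G (FArr F f)"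
    if "a \<in> Obj C" for a b f
    using bspec[OF * that] by blast+
  note a = C.hom_obj(1)[OF f(1)] and b = C.hom_obj(2)[OF f(1)]
  show ?thesis
    by (rule C.iso_cancel_right[OF \<eta>(2)[OF a]])
      (use f \<eta>(1)[OF a] \<eta>(3)[OF a b f(1)] \<eta>(3)[OF a b f(2)] eq in \<open>simp_all add: C.hom_iff\<close>)
qed

text \<open>Conjugating G g by the isomorphisms at a and b gives an arrow f with G (F f) = G g, and
  G is faithful, being the other half of the equivalence.\<close>

lemma equivalence_full:
  assumes F: "linear_functor C D F" and G: "linear_functor D C G"
    and n: "naturally_isomorphic C C (comp_functor G F) id_functor"
    and n': "naturally_isomorphic D D (comp_functor F G) id_functor"
    and a: "a \<in> Obj C" and b: "b \<in> Obj C" and g: "g \<in> Hom D (FObj F a) (FObj F b)"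
  shows "\<exists>f \<in> Hom C a b. FArr F f = g"
proof -
  interpret F: linear_functor C D F by (rule F)
  obtain \<eta> where *: "\<forall>a \<in> Obj C. \<eta> a \<in> Hom C (FObj G (FObj F a)) a \<and> iso_arr C (\<eta> a) \<and>
    (\<forall>b \<in> Obj C. \<forall>f \<in> Hom C a b. f \<cdot>\<^bsub>C\<^esub> \<eta> a = \<eta> b \<cdot>\<^bsub>C\<^esub> FArr G (FArr F f))"
    using natural_iso_id[OF n] by blast
  have \<eta>: "\<eta> a \<in> Hom C (FObj G (FObj F a)) a" "iso_arr C (\<eta> a)"
    "b \<in> Obj C \<Longrightarrow> f \<in> Hom C a b \<Longrightarrow> f \<cdot>\<^bsub>C\<^esub> \<eta> a = \<eta> b \<cdot>\<^bsub>C\<^esub> FArr G (FArr F f)"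
    if "a \<in> Obj C" for a b f
    using bspec[OF * that] by blast+
  note \<eta>a = \<eta>(1)[OF a] and \<eta>b = \<eta>(1)[OF b]
  obtain r where r: "r \<in> Hom C a (FObj G (FObj F a))" "r \<cdot>\<^bsub>C\<^esub> \<eta> a = Id C (FObj G (FObj F a))" "\<eta> a \<cdot>\<^bsub>C\<^esub> r = Id C a"
    by (rule F.C.iso_inverse[OF \<eta>a \<eta>(2)[OF a]])
  have Gg: "FArr G g \<in> Hom C (FObj G (FObj F a)) (FObj G (FObj F b))"
    by (rule linear_functor_in_hom[OF G g])
  note bg = F.C.comp_in_hom[OF Gg \<eta>b]
  let ?f = "(\<eta> b \<cdot>\<^bsub>C\<^esub> FArr G g) \<cdot>\<^bsub>C\<^esub> r"
  have f: "?f \<in> Hom C a b"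
    by (rule F.C.comp_in_hom[OF r(1) bg])
  have "?f \<cdot>\<^bsub>C\<^esub> \<eta> a = \<eta> b \<cdot>\<^bsub>C\<^esub> FArr G g"
    unfolding F.C.comp_assoc[OF \<eta>a r(1) bg] r(2) by (rule F.C.comp_id_right[OF bg])
  then have e: "\<eta> b \<cdot>\<^bsub>C\<^esub> FArr G (FArr F ?f) = \<eta> b \<cdot>\<^bsub>C\<^esub> FArr G g"
    using \<eta>(3)[OF a b f] by simp
  note Ff = linear_functor_in_hom[OF F f]
  have "FArr G (FArr F ?f) = FArr G g"
    by (rule F.C.iso_cancel_left[OF \<eta>(2)[OF b] _ _ _ _ e])
      (use \<eta>b Gg linear_functor_in_hom[OF G Ff] in \<open>simp_all add: F.C.hom_iff\<close>)
  then have "FArr F ?f = g"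
    by (rule equivalence_faithful[OF G n' Ff g])
  then show ?thesis
    using f by blast
qed

lemma fd_module_cat_obj:
  fixes A :: "('k::field, 'a) module"
  shows "M \<in> Obj (fd_module_cat A) \<longleftrightarrow>
     left_module A M \<and> vectorspace.fin_dim (class_ring :: 'k ring) (underlying_space A M)"
  by (simp add: fd_module_cat_def Let_def)

lemma fd_module_cat_hom:
  "\<phi> \<in> Hom (fd_module_cat A) M N \<longleftrightarrow>
     M \<in> Obj (fd_module_cat A) \<and> N \<in> Obj (fd_module_cat A) \<and> \<phi> = (M, fst (snd \<phi>), N) \<and>
     fst (snd \<phi>) \<in> LinearCombinations.module_hom A M N \<and> fst (snd \<phi>) \<in> extensional (carrier M)"
  by (cases \<phi>) (auto simp: fd_module_cat_def Let_def Hom_def)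

lemma fd_module_cat_ops:
  "Comp (fd_module_cat A) (M', g, N) (L, f, M) = (L, compose (carrier L) g f, N)"
  "Id (fd_module_cat A) M = (M, \<lambda>x \<in> carrier M. x, M)"
  "AddArr (fd_module_cat A) (M, f, N) (M', g, N') = (M, \<lambda>x \<in> carrier M. f x \<oplus>\<^bsub>N\<^esub> g x, N)"
  "ScaleArr (fd_module_cat A) c (M, f, N) = (M, \<lambda>x \<in> carrier M. c \<odot>\<^bsub>underlying_space A N\<^esub> f x, N)"
  by (simp_all add: fd_module_cat_def Let_def)

text \<open>U is the object part of the equivalence and \<open>act\<close> extracts the map from the
  triple assigned to an arrow. Essential surjectivity is the isomorphism from F G to the identity at
  M, unpacked into two mutually inverse linear maps.\<close>

lemma equivalence_module_fibre:
  fixes C :: "('k::field, 'o, 'm, 'x) linear_cat_scheme" and A :: "('k, 'k vec) module"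
  assumes A: "fd_algebra A" and eqv: "linearly_equivalent C (fd_modules A)"
  shows "\<exists>U act. module_fibre C A U act"
proof -
  let ?D = "fd_modules A"
  obtain F G where F: "linear_functor C ?D F" and G: "linear_functor ?D C G"
    and n: "naturally_isomorphic C C (comp_functor G F) id_functor"
    and n': "naturally_isomorphic ?D ?D (comp_functor F G) id_functor"
    using eqv unfolding linearly_equivalent_def by blast
  interpret F: linear_functor C ?D F by (rule F)
  define act where "act f = fst (snd (FArr F f))" for f
  let ?U = "FObj F"
  have FA: "FArr F f = (?U a, act f, ?U b)" and ah: "act f \<in> LinearCombinations.module_hom A (?U a) (?U b)"
    and ae: "act f \<in> extensional (carrier (?U a))" if "f \<in> Hom C a b" for f a b
    using linear_functor_in_hom[OF F that] unfolding fd_module_cat_hom act_def by blast+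
  have Uo: "?U c \<in> Obj ?D" if "c \<in> Obj C" for c
    by (rule F.obj_closed[OF that])
  have "module_fibre C A ?U act"
  proof (intro module_fibre.intro module_fibre_axioms.intro)
    show "linear_category C" by (rule F.C.linear_category_axioms)
    show "fd_algebra A" by (rule A)
    show lm: "left_module A (?U c)" if "c \<in> Obj C" for c
      using Uo[OF that] unfolding fd_module_cat_obj by blast
    show "\<exists>\<Xi>. finite \<Xi> \<and> separating (underlying_space A (?U c)) \<Xi>" if "c \<in> Obj C" for c
      using kspace.separating_if_fin_dim[OF underlying_kspace[OF A lm[OF that]]] Uo[OF that]
      unfolding fd_module_cat_obj by blast
    show "act f \<in> LinearCombinations.module_hom A (?U a) (?U b)" if "f \<in> F.C.hom a b" for f a b
      by (rule ah[OF that])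
    show "act (Id C a) x = x" if "a \<in> Obj C" "x \<in> carrier (?U a)" for a x
      unfolding act_def F.preserves_id[OF that(1)] fd_module_cat_ops using that(2) by simp
    show "act (g \<cdot>\<^bsub>C\<^esub> f) x = act g (act f x)"
      if f: "f \<in> F.C.hom a b" and g: "g \<in> F.C.hom b c" and x: "x \<in> carrier (?U a)" for f g a b c x
      unfolding act_def[of "g \<cdot>\<^bsub>C\<^esub> f"] F.preserves_comp[OF f g] FA[OF f] FA[OF g] fd_module_cat_ops
      using x by (simp add: compose_def)
    show "act (AddArr C f g) x = act f x \<oplus>\<^bsub>?U b\<^esub> act g x"
      if f: "f \<in> F.C.hom a b" and g: "g \<in> F.C.hom a b" and x: "x \<in> carrier (?U a)" for f g a b x
    proof -
      have "FArr F (AddArr C f g) = AddArr ?D (FArr F f) (FArr F g)"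
        using F.linear_on_homs[OF F.C.hom_obj[OF f]] f g by (simp add: linear_map_iff)
      then show ?thesis
        unfolding act_def[of "AddArr C f g"] FA[OF f] FA[OF g] fd_module_cat_ops using x by simp
    qed
    show "act (ScaleArr C k f) x = (k \<odot>\<^bsub>A\<^esub> \<one>\<^bsub>A\<^esub>) \<odot>\<^bsub>?U b\<^esub> act f x"
      if f: "f \<in> F.C.hom a b" and x: "x \<in> carrier (?U a)" for f a b x k
    proof -
      have "FArr F (ScaleArr C k f) = ScaleArr ?D k (FArr F f)"
        using F.linear_on_homs[OF F.C.hom_obj[OF f]] f by (simp add: linear_map_iff)
      then show ?thesis
        unfolding act_def[of "ScaleArr C k f"] FA[OF f] fd_module_cat_ops using x by simp
    qed
    show "f = g" if f: "f \<in> F.C.hom a b" and g: "g \<in> F.C.hom a b"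
      and eq: "\<And>x. x \<in> carrier (?U a) \<Longrightarrow> act f x = act g x" for f g a b
    proof (rule equivalence_faithful[OF F n f g])
      \<comment> \<open>Maps in the module category are \<open>undefined\<close> outside their
        source, so agreement on the carrier is equality.\<close>
      have "act f = act g"
        by (rule extensionalityI[OF ae[OF f] ae[OF g] eq])
      then show "FArr F f = FArr F g"
        unfolding FA[OF f] FA[OF g] by simp
    qed
    show "\<exists>f \<in> F.C.hom a b. \<forall>x \<in> carrier (?U a). act f x = h x"
      if a: "a \<in> Obj C" and b: "b \<in> Obj C" and h: "h \<in> LinearCombinations.module_hom A (?U a) (?U b)" for a b h
    proof -
      interpret Ua: left_module A "?U a" by (rule lm[OF a])
      have "restrict h (carrier (?U a)) \<in> LinearCombinations.module_hom A (?U a) (?U b)"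
        using h Ua.smult_closed by (simp add: module_hom_iff)
      then have "(?U a, restrict h (carrier (?U a)), ?U b) \<in> Hom ?D (?U a) (?U b)"
        unfolding fd_module_cat_hom using Uo[OF a] Uo[OF b] by simp
      then obtain f where f: "f \<in> Hom C a b" "FArr F f = (?U a, restrict h (carrier (?U a)), ?U b)"
        using equivalence_full[OF F G n n' a b] by blast
      then show ?thesis
        by (intro bexI[of _ f]) (simp_all add: act_def)
    qed
    show "\<exists>c \<in> Obj C. \<exists>\<theta> \<in> LinearCombinations.module_hom A M (?U c). \<exists>\<theta>' \<in> LinearCombinations.module_hom A (?U c) M.
        (\<forall>x \<in> carrier M. \<theta>' (\<theta> x) = x) \<and> (\<forall>y \<in> carrier (?U c). \<theta> (\<theta>' y) = y)"
      if M: "left_module A M" "vectorspace.fin_dim (class_ring :: 'k ring) (underlying_space A M)"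
      for M :: "('k vec, 'k vec) module"
    proof -
      have Mo: "M \<in> Obj ?D"
        unfolding fd_module_cat_obj using M by blast
      let ?c = "FObj G M"
      have c: "?c \<in> Obj C"
        by (rule linear_functor.obj_closed[OF G Mo])
      obtain \<eta> where *: "\<forall>a \<in> Obj ?D. \<eta> a \<in> Hom ?D (FObj F (FObj G a)) a \<and> iso_arr ?D (\<eta> a) \<and>
          (\<forall>b \<in> Obj ?D. \<forall>f \<in> Hom ?D a b. Comp ?D f (\<eta> a) = Comp ?D (\<eta> b) (FArr F (FArr G f)))"
        using natural_iso_id[OF n'] by blast
      have \<eta>: "\<eta> M \<in> Hom ?D (FObj F (FObj G M)) M" "iso_arr ?D (\<eta> M)"
        using bspec[OF * Mo] by blast+
      obtain \<zeta> where \<zeta>: "\<zeta> \<in> Hom ?D M (?U ?c)" "Comp ?D \<zeta> (\<eta> M) = Id ?D (?U ?c)" "Comp ?D (\<eta> M) \<zeta> = Id ?D M"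
        by (rule F.D.iso_inverse[OF \<eta>])
      obtain p where p: "\<eta> M = (?U ?c, p, M)" "p \<in> LinearCombinations.module_hom A (?U ?c) M"
        using \<eta>(1) unfolding fd_module_cat_hom by metis
      obtain q where q: "\<zeta> = (M, q, ?U ?c)" "q \<in> LinearCombinations.module_hom A M (?U ?c)"
        using \<zeta>(1) unfolding fd_module_cat_hom by metis
      have e: "compose (carrier (?U ?c)) q p = (\<lambda>x \<in> carrier (?U ?c). x)"
        "compose (carrier M) p q = (\<lambda>x \<in> carrier M. x)"
        using \<zeta>(2,3) unfolding p(1) q(1) fd_module_cat_ops by simp_all
      have "q (p y) = y" if "y \<in> carrier (?U ?c)" for y
        using fun_cong[OF e(1), of y] that by (simp add: compose_def)
      moreover have "p (q x) = x" if "x \<in> carrier M" for x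
        using fun_cong[OF e(2), of x] that by (simp add: compose_def)
      ultimately have "\<forall>x \<in> carrier M. p (q x) = x" "\<forall>y \<in> carrier (?U ?c). q (p y) = y"
        by blast+
      then show ?thesis
        by (intro bexI[OF _ c] bexI[OF _ q(2)] bexI[OF _ p(2)] conjI)
    qed
  qed
  then show ?thesis by blast
qed

section \<open>The two implications\<close>

context finite_multitensor_category
begin

text \<open>Comparing K at the double dual of z with \<open>psi\<close> at z yields an isomorphism h
  z. Both families are natural in z, and arrows into b are determined by their composites with
  \<open>psi\<close> at b, so naturality of h is checked there.\<close>

lemma casimir_double_dual:
  assumes R: "right_duality C R"
    and \<Phi>: "univ (Unit C) (Unit C) \<Phi>"
    and U: "\<And>x. x \<in> Obj C \<Longrightarrow> univ x x (K x)"
    and nat: "\<And>w x y c \<phi>. w \<in> hom x y \<Longrightarrow> c \<in> Obj C \<Longrightarrow> \<phi> \<in> Fn c y \<Longrightarrow> K x c (\<lambda>g. \<phi> (w \<cdot> g)) = K y c \<phi> \<cdot> w"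
  shows "naturally_isomorphic C C (double_dual C R) id_functor"
proof -
  let ?dd = "\<lambda>z. Dual R (Dual R z)" and ?da = "\<lambda>f. dual_arr C R (dual_arr C R f)"
  note ddo = rd_obj[OF R \<Phi> rd_obj[OF R \<Phi>]]
  let ?\<Psi> = "psi R \<Phi>"
  have "\<exists>h \<in> hom (?dd z) z. iso_arr C h \<and> (\<forall>c \<in> Obj C. \<forall>\<phi> \<in> Fn c (?dd z). ?\<Psi> z c \<phi> \<cdot> h = K (?dd z) c \<phi>)"
    if z: "z \<in> Obj C" for z
    by (rule univ_iso[OF U[OF ddo[OF z]] psi_univ[OF R \<Phi> z]])
  then obtain h where h: "\<And>z. z \<in> Obj C \<Longrightarrow> h z \<in> hom (?dd z) z" "\<And>z. z \<in> Obj C \<Longrightarrow> iso_arr C (h z)"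
    and h\<Psi>: "\<And>z c \<phi>. z \<in> Obj C \<Longrightarrow> c \<in> Obj C \<Longrightarrow> \<phi> \<in> Fn c (?dd z) \<Longrightarrow> ?\<Psi> z c \<phi> \<cdot> h z = K (?dd z) c \<phi>"
    by metis
  have "f \<cdot> h a = h b \<cdot> ?da f" if f: "f \<in> hom a b" for a b f
  proof -
    note a = hom_obj(1)[OF f] and b = hom_obj(2)[OF f]
    have f'': "?da f \<in> hom (?dd a) (?dd b)"
      by (rule dual_arr_in[OF R \<Phi> dual_arr_in[OF R \<Phi> f]])
    show ?thesis
    proof (rule psi_unique[OF R \<Phi> b comp_in_hom[OF h(1)[OF a] f] comp_in_hom[OF f'' h(1)[OF b]]])
      fix c \<phi> assume c: "c \<in> Obj C" and \<phi>: "\<phi> \<in> Fn c (?dd b)"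
      note p = natfam_in[OF psi_natfam[OF R \<Phi> b] c \<phi>] and \<phi>f = Fn_postcomp[OF \<phi> f'']
      have "?\<Psi> b c \<phi> \<cdot> (f \<cdot> h a) = ?\<Psi> a c (\<lambda>g. \<phi> (?da f \<cdot> g)) \<cdot> h a"
        unfolding comp_assoc[OF h(1)[OF a] f p, symmetric] psi_natural[OF R \<Phi> f c \<phi>] ..
      also have "\<dots> = K (?dd b) c \<phi> \<cdot> ?da f"
        unfolding h\<Psi>[OF a c \<phi>f] by (rule nat[OF f'' c \<phi>])
      also have "\<dots> = ?\<Psi> b c \<phi> \<cdot> (h b \<cdot> ?da f)"
        unfolding h\<Psi>[OF b c \<phi>, symmetric] by (rule comp_assoc[OF f'' h(1)[OF b] p])
      finally show "?\<Psi> b c \<phi> \<cdot> (f \<cdot> h a) = ?\<Psi> b c \<phi> \<cdot> (h b \<cdot> ?da f)" .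
    qed
  qed
  then show ?thesis
    unfolding naturally_isomorphic_def double_dual_def id_functor_def using h by (intro exI[of _ h]) simp
qed

text \<open>K is \<open>psi\<close> at x carried along the component of \<eta> at x. An endomorphism
  u matches its double dual under \<open>psi\<close>, and naturality of \<eta> trades the double
  dual for u itself; the symmetry of the trace is derived from the resulting equation.\<close>

lemma double_dual_trivial_univ:
  assumes R: "right_duality C R" and \<Phi>: "univ (Unit C) (Unit C) \<Phi>"
    and n: "naturally_isomorphic C C (double_dual C R) id_functor" and x: "x \<in> Obj C"
  shows "\<exists>K. univ x x K \<and> (\<forall>c \<in> Obj C. \<forall>u \<in> hom x x. \<forall>\<phi> \<in> Fn c x. K c (\<lambda>g. \<phi> (u \<cdot> g)) = K c \<phi> \<cdot> u)"
proof -
  let ?dd = "\<lambda>z. Dual R (Dual R z)" and ?da = "\<lambda>f. dual_arr C R (dual_arr C R f)"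
  let ?\<Psi> = "psi R \<Phi>"
  obtain \<eta> where \<eta>: "\<eta> x \<in> hom (?dd x) x" "iso_arr C (\<eta> x)"
    and \<eta>n: "\<And>f. f \<in> hom x x \<Longrightarrow> f \<cdot> \<eta> x = \<eta> x \<cdot> ?da f"
    using n x unfolding naturally_isomorphic_def double_dual_def id_functor_def by auto
  let ?K = "\<lambda>c \<phi>. ?\<Psi> x c (\<lambda>g. \<phi> (\<eta> x \<cdot> g))"
  have "univ x x ?K"
    by (rule univ_transport_left[OF psi_univ[OF R \<Phi> x] \<eta>])
  moreover have "?K c (\<lambda>g. \<phi> (u \<cdot> g)) = ?K c \<phi> \<cdot> u"
    if c: "c \<in> Obj C" and u: "u \<in> hom x x" and \<phi>: "\<phi> \<in> Fn c x" for c u \<phi>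
  proof -
    have u'': "?da u \<in> hom (?dd x) (?dd x)"
      by (rule dual_arr_in[OF R \<Phi> dual_arr_in[OF R \<Phi> u]])
    note \<phi>' = Fn_postcomp[OF \<phi> \<eta>(1)]
    have "?K c (\<lambda>g. \<phi> (u \<cdot> g)) = ?\<Psi> x c (\<lambda>g. \<phi> (\<eta> x \<cdot> (?da u \<cdot> g)))"
    proof (rule natfam_cong[OF psi_natfam[OF R \<Phi> x] c Fn_postcomp[OF Fn_postcomp[OF \<phi> u] \<eta>(1)] Fn_postcomp[OF \<phi>' u'']])
      fix g assume g: "g \<in> hom c (?dd x)"
      show "\<phi> (u \<cdot> (\<eta> x \<cdot> g)) = \<phi> (\<eta> x \<cdot> (?da u \<cdot> g))"
        unfolding comp_assoc[OF g \<eta>(1) u, symmetric] \<eta>n[OF u] comp_assoc[OF g u'' \<eta>(1)] ..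
    qed
    also have "\<dots> = ?K c \<phi> \<cdot> u"
      by (rule psi_natural[OF R \<Phi> u c \<phi>'])
    finally show ?thesis .
  qed
  ultimately show ?thesis by blast
qed

lemma isomorphic_refl: "a \<in> Obj C \<Longrightarrow> isomorphic C a a"
  unfolding isomorphic_def using id_in_hom iso_id(1) by blast

end

theorem theorem4p14:
  fixes C :: "('k::alg_closed_field, 'o, 'm) monoidal_cat"
    and R :: "('o, 'm) duality"
  assumes "finite_multitensor_category C"
    and "right_duality C R"
  shows "symmetric_frobenius_category C \<longleftrightarrow>
         unimodular C \<and> naturally_isomorphic C C (double_dual C R) id_functor"
proof -
  interpret finite_multitensor_category C by (rule assms(1))
  note R = assms(2)
  show ?thesis
  proof (intro iffI conjI)
    assume "symmetric_frobenius_category C"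
    then obtain A where sA: "symmetric_frobenius_algebra A" and eqv: "linearly_equivalent C (fd_modules A)"
      unfolding symmetric_frobenius_category_def by blast
    have A: "fd_algebra A"
      using sA by (simp add: symmetric_frobenius_algebra_def)
    obtain U act where "module_fibre C A U act"
      using equivalence_module_fibre[OF A eqv] by blast
    then interpret M: module_fibre C A U act .
    obtain P e where P: "M.free_at P e"
      using M.free_exists by blast
    obtain \<epsilon> where \<epsilon>: "M.cofree_at P \<epsilon>"
      and sym: "\<forall>f \<in> hom P P. \<forall>g \<in> hom P P. \<epsilon> (act (f \<cdot>\<^bsub>C\<^esub> g) e) = \<epsilon> (act (g \<cdot>\<^bsub>C\<^esub> f) e)"
      using M.trace_if_symmetric[OF P sA] by blast
    define t where "t g = \<epsilon> (act g e)" for g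
    have nd: "nondegenerate_pairing P P t"
      unfolding t_def by (rule M.free_cofree_pairing[OF P \<epsilon>])
    have sym': "t (f \<cdot>\<^bsub>C\<^esub> g) = t (g \<cdot>\<^bsub>C\<^esub> f)" if "f \<in> hom P P" "g \<in> hom P P" for f g
      using sym that unfolding t_def by blast
    note U = casimir_univ[OF nd M.hom_finite M.free_generator[OF P] M.free_dense[OF P] sym']
    note nat = casimir_natural[OF nd M.hom_finite M.free_generator[OF P] M.free_dense[OF P] sym']
    have "is_distinguished_object C (Unit C)"
    proof (rule univ_distinguished[OF _ _ U[OF _ _ unit_obj]])
      show "\<exists>n v \<phi>. dual_basis (hom_space C c (Unit C)) n v \<phi>" if "c \<in> Obj C" for c
        by (rule hom_finiteD[OF M.hom_finite that unit_obj])
      then show "\<exists>P \<iota>. is_vect_tensor C (hom_space C c (Unit C)) d P \<iota>" if "c \<in> Obj C" "d \<in> Obj C" for c d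
        using M.vect_tensor_exists[OF hom_kspace[OF that(1) unit_obj] _ that(2)] that(1) by blast
    qed
    then show "unimodular C"
      unfolding unimodular_def using isomorphic_refl[OF unit_obj] by blast
    show "naturally_isomorphic C C (double_dual C R) id_functor"
      by (rule casimir_double_dual[OF R U[OF _ _ unit_obj] U nat])
  next
    assume "unimodular C \<and> naturally_isomorphic C C (double_dual C R) id_functor"
    then obtain D j where D: "is_distinguished_object C D" and j: "j \<in> hom D (Unit C)" "iso_arr C j"
      and n: "naturally_isomorphic C C (double_dual C R) id_functor"
      unfolding unimodular_def isomorphic_def by blast
    \<comment> \<open>Any presenting algebra will do: the trace found on End(P) shows this very A to
      be symmetric.\<close>
    obtain A where A: "fd_algebra A" and eqv: "linearly_equivalent C (fd_modules A)"
      using finite_linear unfolding finite_linear_category_def by blast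
    obtain U act where "module_fibre C A U act"
      using equivalence_module_fibre[OF A eqv] by blast
    then interpret M: module_fibre C A U act .
    obtain P e where P: "M.free_at P e"
      using M.free_exists by blast
    obtain I \<epsilon> where I: "M.cofree_at I \<epsilon>"
      using M.cofree_exists by blast
    note nd = M.free_cofree_pairing[OF P I]
    obtain \<Phi>0 where \<Phi>0: "univ (Unit C) D \<Phi>0"
      using distinguished_univ[OF hom_finiteD[OF M.hom_finite _ unit_obj] D] by blast
    obtain j' where j': "j' \<in> hom (Unit C) D" "j' \<cdot>\<^bsub>C\<^esub> j = Id C D" "j \<cdot>\<^bsub>C\<^esub> j' = Id C (Unit C)"
      by (rule iso_inverse[OF j])
    \<comment> \<open>The universal family on D is carried to the unit by composing with j', which
      goes from 1 to D; from here on the distinguished object is the unit itself.\<close>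
    note \<Phi> = univ_transport[OF \<Phi>0 j'(1) isoI[OF j'(1) j(1) j'(3,2)]]
    have Io: "I \<in> Obj C"
      using I by (simp add: M.cofree_at_def)
    obtain K where K: "univ I I K"
      and Kn: "\<And>c u \<phi>. c \<in> Obj C \<Longrightarrow> u \<in> hom I I \<Longrightarrow> \<phi> \<in> Fn c I \<Longrightarrow> K c (\<lambda>g. \<phi> (u \<cdot>\<^bsub>C\<^esub> g)) = K c \<phi> \<cdot>\<^bsub>C\<^esub> u"
      using double_dual_trivial_univ[OF R \<Phi> n Io] by blast
    obtain t where "t \<in> Fn P P" "\<forall>f \<in> hom P P. \<forall>g \<in> hom P P. t (f \<cdot>\<^bsub>C\<^esub> g) = t (g \<cdot>\<^bsub>C\<^esub> f)"
      "\<forall>f \<in> hom P P. (\<forall>g \<in> hom P P. t (f \<cdot>\<^bsub>C\<^esub> g) = 0) \<longrightarrow> f = ZeroArr C P P"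
      using trace_exists[OF nd M.hom_finite K Kn] by blast
    then have "symmetric_frobenius_algebra A"
      by (rule M.symmetric_if_trace[OF P])
    then show "symmetric_frobenius_category C"
      unfolding symmetric_frobenius_category_def using linear_category_axioms eqv by blast
  qed
qed

end
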